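(* Let $0<p\le1$ and let $\varphi:\mathbb D\to\mathbb D$ be analytic. Then the composition operator $C_\varphi:\mathcal Q_p\to\mathcal Q_p$, $C_\varphi f=f\circ\varphi$, is compact if and only if $C_\varphi:\mathcal Q_p\to\mathcal Q_p$ is bounded and $$\lim_{\rho\to1^-}\ \sup_{a\in\mathbb D}\ \sup_{\mathcal D}\ \big\|H_a^{\varphi,\rho}\big\|_{\mathcal B_p(\mathcal D)}=0,$$ where the second supremum is taken over all dyadic systems $\mathcal D$ on $\mathbb T$, and for $0<\rho<1$, $a\in\mathbb D$ and an arc $I\subseteq\mathbb T$ $$H_a^{\varphi,\rho}(I):=\frac{1}{|I|^{p+2}}\int_{Q_I^{\mathrm{up}}\cap\{\rho<|\zeta|<1\}}\mathcal N_{p,\varphi,a}(\zeta)\,dA(\zeta),\qquad \mathcal N_{p,\varphi,a}(\zeta):=\sum_{\varphi(z)=\zeta}g(z,a)^p .$$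
   Context: $\mathbb D$ is the open unit disc, $\mathbb T$ the unit circle, $dA$ is normalized area measure on $\mathbb D$, and $H(\mathbb D)$ is the space of holomorphic functions on $\mathbb D$. For $a\in\mathbb D$, $\sigma_a(z)=\frac{a-z}{1-\overline a z}$ and $g(z,a)=\log\frac{1}{|\sigma_a(z)|}$. $\mathcal Q_p$ is the space of $f\in H(\mathbb D)$ with $\|f\|_{\mathcal Q_p,*}^2:=\sup_{a\in\mathbb D}\int_{\mathbb D}|f'(z)|^2g(z,a)^p\,dA(z)<\infty$, normed by $\|f\|_{\mathcal Q_p}:=|f(0)|+\|f\|_{\mathcal Q_p,*}$. The sum defining $\mathcal N_{p,\varphi,a}(\zeta)$ runs over the preimages $z\in\mathbb D$ of $\zeta$ under $\varphi$, counted with multiplicity (it is $0$ if there are none). $|I|$ denotes arc length normalized so that $|\mathbb T|=1$; arcs include $\mathbb T$ itself. For an arc $I$, $Q_I^{\mathrm{up}}:=\{re^{it}: e^{it}\in I,\ 1-|I|\le r<1-\frac{|I|}{2}\}$. A dyadic system on $\mathbb T$ is a family $\mathcal D=\bigcup_{k\ge0}\mathcal D_k$ of half-open arcs where $\mathcal D_0=\{\mathbb T\}$, each $\mathcal D_k$ is a partition of $\mathbb T$ into $2^k$ arcs of length $2^{-k}$, and each arc of $\mathcal D_{k+1}$ is contained in an arc of $\mathcal D_k$. For a nonnegative sequence $h=\{h(I)\}_{I\in\mathcal D}$, the dyadic $p$-capacity gauge is $$\|h\|_{\mathcal B_p(\mathcal D)}:=\inf\Big\{\sum_{J\in\mathcal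 D}\lambda_J|J|^p:\ \lambda_J\ge0,\ \sum_{J\in\mathcal D,\,J\supseteq I}\lambda_J\ge h(I)\ \text{for all }I\in\mathcal D\Big\}\in[0,\infty],$$ with $\inf\emptyset=+\infty$; in $\|H_a^{\varphi,\rho}\|_{\mathcal B_p(\mathcal D)}$ the sequence is $\{H_a^{\varphi,\rho}(I)\}_{I\in\mathcal D}$. *)

theory Defs
  imports "HOL-Complex_Analysis.Complex_Analysis" "HOL-Library.Disjoint_Sets"
begin

abbreviation disc :: "complex set"
  where "disc \<equiv> ball 0 1"

abbreviation circle :: "complex set"
  where "circle \<equiv> sphere 0 1"

text \<open>Integrals against this measure are automatically restricted to the disc.\<close>

definition area :: "complex measure"
  where "area = uniform_measure lborel disc"

definition disc_involution :: "complex \<Rightarrow> complex \<Rightarrow> complex"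
  where "disc_involution a z = (a - z) / (1 - cnj a * z)"

text \<open>
  The power \<open>g(z,a)^p\<close> of the Green function, with the value \<open>\<infinity>\<close> at the pole \<open>z = a\<close>
  (the case distinction is needed because \<open>ln (1 / 0) = 0\<close> in HOL).
\<close>

definition green_powr :: "real \<Rightarrow> complex \<Rightarrow> complex \<Rightarrow> ennreal"
  where "green_powr p z a =
    (if z = a then \<infinity> else ennreal (ln (1 / cmod (disc_involution a z)) powr p))"


section \<open>The spaces \<open>Q\<^sub>p\<close>\<close>

definition Qp_energy :: "real \<Rightarrow> (complex \<Rightarrow> complex) \<Rightarrow> ennreal"
  where "Qp_energy p f =
    (SUP a\<in>disc. \<integral>\<^sup>+z. ennreal ((cmod (deriv f z))\<^sup>2) * green_powr p z a \<partial>area)"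

text \<open>
  A function on the disc is represented by its extension by zero to the whole plane, so that
  each function has exactly one representative.
\<close>

definition Qp :: "real \<Rightarrow> (complex \<Rightarrow> complex) set"
  where "Qp p = {f. f holomorphic_on disc \<and> (\<forall>z. z \<notin> disc \<longrightarrow> f z = 0) \<and> Qp_energy p f < \<infinity>}"

definition Qp_norm :: "real \<Rightarrow> (complex \<Rightarrow> complex) \<Rightarrow> real"
  where "Qp_norm p f = cmod (f 0) + sqrt (enn2real (Qp_energy p f))"

definition Qp_dist :: "real \<Rightarrow> (complex \<Rightarrow> complex) \<Rightarrow> (complex \<Rightarrow> complex) \<Rightarrow> real"
  where "Qp_dist p f h = Qp_norm p (\<lambda>z. f z - h z)"

definition Qp_bounded_operator ::
    "real \<Rightarrow> ((complex \<Rightarrow> complex) \<Rightarrow> (complex \<Rightarrow> complex)) \<Rightarrow> bool"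
  where "Qp_bounded_operator p T \<longleftrightarrow>
    T ` Qp p \<subseteq> Qp p \<and> (\<exists>C. \<forall>f\<in>Qp p. Qp_norm p (T f) \<le> C * Qp_norm p f)"

text \<open>
  An operator is compact if it maps bounded sets to relatively compact ones.
  That \<open>Qp_dist\<close> is a metric on \<open>Qp\<close> is shown in \<open>Metric_space_Qp\<close> below.
\<close>

definition Qp_compact_operator ::
    "real \<Rightarrow> ((complex \<Rightarrow> complex) \<Rightarrow> (complex \<Rightarrow> complex)) \<Rightarrow> bool"
  where "Qp_compact_operator p T \<longleftrightarrow>
    T ` Qp p \<subseteq> Qp p \<and>
    (\<forall>S\<subseteq>Qp p. Metric_space.mbounded (Qp p) (Qp_dist p) S \<longrightarrow>
      compactin (Metric_space.mtopology (Qp p) (Qp_dist p))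
        (Metric_space.mtopology (Qp p) (Qp_dist p) closure_of (T ` S)))"

definition comp_operator :: "(complex \<Rightarrow> complex) \<Rightarrow> (complex \<Rightarrow> complex) \<Rightarrow> (complex \<Rightarrow> complex)"
  where "comp_operator \<phi> f = (\<lambda>z. if z \<in> disc then f (\<phi> z) else 0)"


section \<open>The counting function\<close>

text \<open>If \<open>\<phi>\<close> is constant near \<open>z\<close>, the value is attained with infinite multiplicity.\<close>

definition value_multiplicity :: "(complex \<Rightarrow> complex) \<Rightarrow> complex \<Rightarrow> ennreal"
  where "value_multiplicity \<phi> z =
    (if \<forall>\<^sub>F w in at z. \<phi> w = \<phi> z then \<infinity> else of_nat (nat (zorder (\<lambda>w. \<phi> w - \<phi> z) z)))"

definition counting :: "real \<Rightarrow> (complex \<Rightarrow> complex) \<Rightarrow> complex \<Rightarrow> complex \<Rightarrow> ennreal"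
  where "counting p \<phi> a \<zeta> =
    (\<Sum>\<^sub>\<infinity>z\<in>{z\<in>disc. \<phi> z = \<zeta>}. value_multiplicity \<phi> z * green_powr p z a)"


section \<open>Arcs and dyadic systems\<close>

definition arc_len :: "complex set \<Rightarrow> real"
  where "arc_len I = measure lborel {t\<in>{0..<2 * pi}. cis t \<in> I} / (2 * pi)"

text \<open>Half-open arcs of either orientation are admitted; the full circle is the case
  \<open>\<beta> = \<alpha> + 2 * pi\<close>.\<close>

definition half_open_arc :: "complex set \<Rightarrow> bool"
  where "half_open_arc I \<longleftrightarrow>
    (\<exists>\<alpha> \<beta>. \<alpha> < \<beta> \<and> \<beta> \<le> \<alpha> + 2 * pi \<and> (I = cis ` {\<alpha>..<\<beta>} \<or> I = cis ` {\<alpha><..\<beta>}))"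

definition Q_up :: "complex set \<Rightarrow> complex set"
  where "Q_up I = {of_real r * w |r w. w \<in> I \<and> 1 - arc_len I \<le> r \<and> r < 1 - arc_len I / 2}"

definition dyadic_system :: "complex set set \<Rightarrow> bool"
  where "dyadic_system \<D> \<longleftrightarrow>
    (\<exists>D :: nat \<Rightarrow> complex set set.
      \<D> = (\<Union>k. D k) \<and> D 0 = {circle} \<and>
      (\<forall>k. partition_on circle (D k) \<and> card (D k) = 2 ^ k \<and>
        (\<forall>I\<in>D k. half_open_arc I \<and> arc_len I = 1 / 2 ^ k)) \<and>
      (\<forall>k. \<forall>I\<in>D (Suc k). \<exists>J\<in>D k. I \<subseteq> J))"

definition capacity_gauge :: "real \<Rightarrow> complex set set \<Rightarrow> (complex set \<Rightarrow> ennreal) \<Rightarrow> ennreal"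
  where "capacity_gauge p \<D> h =
    Inf {(\<Sum>\<^sub>\<infinity>J\<in>\<D>. ennreal (w J * arc_len J powr p)) |w :: complex set \<Rightarrow> real.
      (\<forall>J\<in>\<D>. 0 \<le> w J) \<and> (\<forall>I\<in>\<D>. h I \<le> (\<Sum>\<^sub>\<infinity>J\<in>{J\<in>\<D>. I \<subseteq> J}. ennreal (w J)))}"

definition H_avg :: "real \<Rightarrow> (complex \<Rightarrow> complex) \<Rightarrow> complex \<Rightarrow> real \<Rightarrow> complex set \<Rightarrow> ennreal"
  where "H_avg p \<phi> a \<rho> I =
    (\<integral>\<^sup>+\<zeta>\<in>Q_up I \<inter> {\<zeta>. \<rho> < cmod \<zeta> \<and> cmod \<zeta> < 1}. counting p \<phi> a \<zeta> \<partial>area)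
      / ennreal (arc_len I powr (p + 2))"


section \<open>The metric on \<open>Q\<^sub>p\<close>\<close>

lemma sets_area [simp, measurable_cong]: "sets area = sets borel"
  by (simp add: area_def)

lemma emeasure_disc: "emeasure lborel disc \<noteq> 0" "emeasure lborel disc < \<infinity>"
proof -
  have "\<not> negligible disc"
    by (intro open_not_negligible) auto
  then show "emeasure lborel disc \<noteq> 0"
    by (auto simp: negligible_iff_emeasure0)
  show "emeasure lborel disc < \<infinity>"
    using emeasure_bounded_finite[of disc] by simp
qed

lemma AE_area: "(AE z in area. P z) \<longleftrightarrow> (AE z in lborel. z \<in> disc \<longrightarrow> P z)"
  unfolding area_def using emeasure_disc by (subst AE_uniform_measure) auto

lemma green_powr_measurable [measurable]:
  "(\<lambda>z. green_powr p z a) \<in> borel_measurable borel"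
  unfolding green_powr_def disc_involution_def by measurable

lemma green_powr_pos:
  assumes "z \<in> disc"
  shows "green_powr p z 0 > 0"
  using assms by (auto simp: green_powr_def disc_involution_def powr_gt_zero)

lemma deriv_measurable_area:
  assumes "f holomorphic_on disc"
  shows "(\<lambda>z. ennreal ((cmod (deriv f z))\<^sup>2) * indicator disc z) \<in> borel_measurable borel"
proof -
  have "(\<lambda>z. (cmod (deriv f z))\<^sup>2 * indicator disc z) \<in> borel_measurable borel"
    using holomorphic_on_imp_continuous_on[OF holomorphic_deriv[OF assms open_ball]]
    by (subst mult.commute, subst real_scaleR_def[symmetric])
       (intro borel_measurable_continuous_on_indicator continuous_intros, auto)
  then have "(\<lambda>z. ennreal ((cmod (deriv f z))\<^sup>2 * indicator disc z)) \<in> borel_measurable borel"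
    by measurable
  then show ?thesis
    by (rule back_subst[of "\<lambda>x. x \<in> borel_measurable borel"]) (auto split: split_indicator)
qed

lemma Qp_energy_indicator:
  "Qp_energy p f =
    (SUP a\<in>disc. \<integral>\<^sup>+z. (ennreal ((cmod (deriv f z))\<^sup>2) * indicator disc z) * green_powr p z a \<partial>area)"
  unfolding Qp_energy_def
  by (intro SUP_cong refl nn_integral_cong_AE) (auto simp: AE_area)

lemma power2_add_le_weighted:
  fixes x y s :: real
  assumes "s > 0"
  shows "(x + y)\<^sup>2 \<le> (1 + s) * x\<^sup>2 + (1 + 1 / s) * y\<^sup>2"
proof -
  have "0 \<le> (s * x - y)\<^sup>2 / s"
    using assms by simp
  also have "\<dots> = (1 + s) * x\<^sup>2 + (1 + 1 / s) * y\<^sup>2 - (x + y)\<^sup>2"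
    using assms by (simp add: field_simps power2_eq_square)
  finally show ?thesis by simp
qed

lemma Qp_energy_add:
  assumes u: "u holomorphic_on disc" and v: "v holomorphic_on disc" and s: "s > 0"
  shows "Qp_energy p (\<lambda>z. u z + v z)
    \<le> ennreal (1 + s) * Qp_energy p u + ennreal (1 + 1 / s) * Qp_energy p v"
proof -
  let ?e = "\<lambda>f z. ennreal ((cmod (deriv f z))\<^sup>2) * indicator disc z :: ennreal"
  have [measurable]: "?e u \<in> borel_measurable borel" "?e v \<in> borel_measurable borel"
    using deriv_measurable_area u v by auto
  have pointwise: "?e (\<lambda>z. u z + v z) z \<le> ennreal (1 + s) * ?e u z + ennreal (1 + 1 / s) * ?e v z" for z
  proof (cases "z \<in> disc")
    case True
    then have "u field_differentiable at z" "v field_differentiable at z"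
      using u v holomorphic_on_imp_differentiable_at[OF _ open_ball] by blast+
    then have "deriv (\<lambda>z. u z + v z) z = deriv u z + deriv v z"
      by (rule deriv_add)
    then have "(cmod (deriv (\<lambda>z. u z + v z) z))\<^sup>2 \<le> (cmod (deriv u z) + cmod (deriv v z))\<^sup>2"
      by (simp add: norm_triangle_ineq power_mono)
    also have "\<dots> \<le> (1 + s) * (cmod (deriv u z))\<^sup>2 + (1 + 1 / s) * (cmod (deriv v z))\<^sup>2"
      by (rule power2_add_le_weighted[OF s])
    finally show ?thesis
      using True s by (simp flip: ennreal_mult ennreal_plus)
  qed auto
  show ?thesis
    unfolding Qp_energy_indicator[of p "\<lambda>z. u z + v z"]
  proof (rule SUP_least)
    fix a :: complex
    assume a: "a \<in> disc"
    have "(\<integral>\<^sup>+z. ?e (\<lambda>z. u z + v z) z * green_powr p z a \<partial>area)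
      \<le> (\<integral>\<^sup>+z. ennreal (1 + s) * (?e u z * green_powr p z a)
            + ennreal (1 + 1 / s) * (?e v z * green_powr p z a) \<partial>area)"
    proof (rule nn_integral_mono)
      fix z
      show "?e (\<lambda>z. u z + v z) z * green_powr p z a \<le> ennreal (1 + s) * (?e u z * green_powr p z a)
            + ennreal (1 + 1 / s) * (?e v z * green_powr p z a)"
        using mult_right_mono[OF pointwise[of z], of "green_powr p z a"]
        by (simp add: distrib_right mult.assoc)
    qed
    also have "\<dots> = ennreal (1 + s) * (\<integral>\<^sup>+z. ?e u z * green_powr p z a \<partial>area)
        + ennreal (1 + 1 / s) * (\<integral>\<^sup>+z. ?e v z * green_powr p z a \<partial>area)"
      by (simp add: nn_integral_add nn_integral_cmult)
    also have "\<dots> \<le> ennreal (1 + s) * Qp_energy p u + ennreal (1 + 1 / s) * Qp_energy p v"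
      unfolding Qp_energy_indicator[of p u] Qp_energy_indicator[of p v]
      by (intro add_mono mult_left_mono SUP_upper a) auto
    finally show "(\<integral>\<^sup>+z. ?e (\<lambda>z. u z + v z) z * green_powr p z a \<partial>area)
      \<le> ennreal (1 + s) * Qp_energy p u + ennreal (1 + 1 / s) * Qp_energy p v" .
  qed
qed

lemma Qp_energy_minus: "Qp_energy p (\<lambda>z. h z - f z) = Qp_energy p (\<lambda>z. f z - h z)"
proof -
  have "cmod (deriv (\<lambda>z. h z - f z) z) = cmod (deriv (\<lambda>z. f z - h z) z)"
    if "z \<in> disc" "(\<lambda>z. f z - h z) field_differentiable at z" for z
    using deriv_minus[OF that(2)] by (simp add: norm_minus_commute)
  moreover have "(\<lambda>z. f z - h z) field_differentiable at z \<longleftrightarrow> (\<lambda>z. h z - f z) field_differentiable at z" for z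
    using field_differentiable_minus[of "\<lambda>z. f z - h z" "at z"]
      field_differentiable_minus[of "\<lambda>z. h z - f z" "at z"] by auto
  moreover have "deriv k z = (SOME D. False)" if "\<not> k field_differentiable at z" for k :: "complex \<Rightarrow> complex" and z
    using that by (auto simp: deriv_def field_differentiable_def)
  ultimately have "cmod (deriv (\<lambda>z. h z - f z) z) = cmod (deriv (\<lambda>z. f z - h z) z)"
    if "z \<in> disc" for z
    using that by metis
  then show ?thesis
    unfolding Qp_energy_def
    by (intro SUP_cong refl nn_integral_cong_AE) (auto simp: AE_area)
qed

lemma Qp_norm_triangle:
  assumes u: "u holomorphic_on disc" "Qp_energy p u < \<infinity>"
    and v: "v holomorphic_on disc" "Qp_energy p v < \<infinity>"
  shows "Qp_energy p (\<lambda>z. u z + v z) < \<infinity>"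
    and "Qp_norm p (\<lambda>z. u z + v z) \<le> Qp_norm p u + Qp_norm p v"
proof -
  define A where "A = enn2real (Qp_energy p u)"
  define B where "B = enn2real (Qp_energy p v)"
  have A: "Qp_energy p u = ennreal A" "A \<ge> 0" and B: "Qp_energy p v = ennreal B" "B \<ge> 0"
    using u v by (auto simp: A_def B_def less_top)
  have E: "Qp_energy p (\<lambda>z. u z + v z) \<le> ennreal ((1 + s) * A + (1 + 1 / s) * B)" if "s > 0" for s
    using Qp_energy_add[OF u(1) v(1) that, of p] that A B
    by (simp add: ennreal_mult ennreal_plus)
  show fin: "Qp_energy p (\<lambda>z. u z + v z) < \<infinity>"
    using E[of 1] by (auto intro: le_less_trans)
  define C where "C = enn2real (Qp_energy p (\<lambda>z. u z + v z))"
  have "sqrt C \<le> sqrt A + sqrt B"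
  proof (rule field_le_epsilon)
    fix e :: real
    assume "e > 0"
    define \<alpha> where "\<alpha> = sqrt A + e / 2"
    define \<beta> where "\<beta> = sqrt B + e / 2"
    have pos: "\<alpha> > 0" "\<beta> > 0"
      using \<open>e > 0\<close> A B by (auto simp: \<alpha>_def \<beta>_def add_nonneg_pos)
    have "sqrt A \<le> \<alpha>" "sqrt B \<le> \<beta>"
      using \<open>e > 0\<close> by (auto simp: \<alpha>_def \<beta>_def)
    then have le: "A \<le> \<alpha>\<^sup>2" "B \<le> \<beta>\<^sup>2"
      by (auto intro: sqrt_le_D)
    have "C \<le> (1 + \<beta> / \<alpha>) * A + (1 + 1 / (\<beta> / \<alpha>)) * B"
      unfolding C_def using E[of "\<beta> / \<alpha>"] pos A B
      by (intro enn2real_leI) (auto intro!: add_nonneg_nonneg mult_nonneg_nonneg)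
    also have "\<dots> \<le> (1 + \<beta> / \<alpha>) * \<alpha>\<^sup>2 + (1 + 1 / (\<beta> / \<alpha>)) * \<beta>\<^sup>2"
      using pos le by (intro add_mono mult_left_mono) auto
    also have "\<dots> = (\<alpha> + \<beta>)\<^sup>2"
      using pos by (simp add: field_simps power2_eq_square)
    finally have "sqrt C \<le> \<alpha> + \<beta>"
      using pos by (intro real_le_lsqrt) auto
    then show "sqrt C \<le> sqrt A + sqrt B + e"
      by (simp add: \<alpha>_def \<beta>_def)
  qed
  then show "Qp_norm p (\<lambda>z. u z + v z) \<le> Qp_norm p u + Qp_norm p v"
    using norm_triangle_ineq[of "u 0" "v 0"]
    by (simp add: Qp_norm_def A_def B_def C_def)
qed

lemma Qp_norm_eq_0:
  assumes u: "u holomorphic_on disc" "Qp_energy p u < \<infinity>" and norm: "Qp_norm p u = 0"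
    and z: "z \<in> disc"
  shows "u z = 0"
proof -
  have "cmod (u 0) = 0 \<and> sqrt (enn2real (Qp_energy p u)) = 0"
    using norm unfolding Qp_norm_def by (subst (asm) add_nonneg_eq_0_iff) auto
  then have u0: "u 0 = 0" and "Qp_energy p u = 0"
    using u(2) by (auto simp: enn2real_eq_0_iff)
  then have "(\<integral>\<^sup>+z. (ennreal ((cmod (deriv u z))\<^sup>2) * indicator disc z) * green_powr p z 0 \<partial>area) = 0"
    using SUP_upper[of 0 disc "\<lambda>a. \<integral>\<^sup>+z. (ennreal ((cmod (deriv u z))\<^sup>2) * indicator disc z)
      * green_powr p z a \<partial>area"]
    by (simp add: Qp_energy_indicator)
  moreover note [measurable] = deriv_measurable_area[OF u(1)]
  ultimately have "AE z in area. (ennreal ((cmod (deriv u z))\<^sup>2) * indicator disc z) * green_powr p z 0 = 0"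
    by (subst (asm) nn_integral_0_iff_AE) auto
  then have ae: "AE z in lborel. z \<notin> {z\<in>disc. deriv u z \<noteq> 0}"
    unfolding AE_area
  proof (rule AE_mp, intro AE_I2 impI)
    fix z :: complex
    assume "z \<in> disc \<longrightarrow> ennreal ((cmod (deriv u z))\<^sup>2) * indicator disc z * green_powr p z 0 = 0"
    then show "z \<notin> {z\<in>disc. deriv u z \<noteq> 0}"
      using green_powr_pos[of z p] by (auto simp: ennreal_eq_0_iff)
  qed
  have open_S: "open {z\<in>disc. deriv u z \<noteq> 0}"
  proof -
    have "open (disc \<inter> deriv u -` (- {0}))"
      using holomorphic_on_imp_continuous_on[OF holomorphic_deriv[OF u(1) open_ball]]
      by (intro continuous_open_preimage) auto
    then show ?thesis
      by (rule back_subst[where P = "open"]) auto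
  qed
  have "{z\<in>disc. deriv u z \<noteq> 0} \<in> null_sets lborel"
    using ae AE_iff_null_sets[of "{z\<in>disc. deriv u z \<noteq> 0}" lborel] open_S by simp
  then have "negligible {z\<in>disc. deriv u z \<noteq> 0}"
    by (auto simp: negligible_iff_null_sets intro: null_sets_completionI)
  then have "deriv u z = 0" if "z \<in> disc" for z
    using open_not_negligible[OF open_S] that by blast
  then have "(u has_field_derivative 0) (at z within disc)" if "z \<in> disc" for z
    using that holomorphic_derivI[OF u(1) open_ball] by fastforce
  then have "\<exists>c. \<forall>z\<in>disc. u z = c"
    using has_field_derivative_zero_constant[of disc u] by blast
  then show ?thesis
    using u0 z by force
qed

lemma Qp_diff_energy:
  assumes "f \<in> Qp p" "h \<in> Qp p"
  shows "(\<lambda>z. f z - h z) holomorphic_on disc" "Qp_energy p (\<lambda>z. f z - h z) < \<infinity>"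
proof -
  show "(\<lambda>z. f z - h z) holomorphic_on disc"
    using assms by (auto simp: Qp_def intro!: holomorphic_intros)
  have "Qp_energy p (\<lambda>z. 0 - h z) < \<infinity>"
    using assms Qp_energy_minus[of p "\<lambda>_. 0" h] by (simp add: Qp_def)
  moreover have "(\<lambda>z. 0 - h z) holomorphic_on disc"
    using assms by (auto simp: Qp_def intro!: holomorphic_intros)
  ultimately show "Qp_energy p (\<lambda>z. f z - h z) < \<infinity>"
    using Qp_norm_triangle(1)[of f p "\<lambda>z. 0 - h z"] assms by (simp add: Qp_def)
qed

lemma Metric_space_Qp: "Metric_space (Qp p) (Qp_dist p)"
proof
  fix f h k :: "complex \<Rightarrow> complex"
  show "0 \<le> Qp_dist p f h"
    by (simp add: Qp_dist_def Qp_norm_def)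
  show "Qp_dist p f h = Qp_dist p h f"
    by (simp add: Qp_dist_def Qp_norm_def Qp_energy_minus[of p f h] norm_minus_commute)
  show "Qp_dist p f h = 0 \<longleftrightarrow> f = h" if "f \<in> Qp p" "h \<in> Qp p"
  proof
    assume "Qp_dist p f h = 0"
    then have "f z - h z = 0" if "z \<in> disc" for z
      using Qp_norm_eq_0[OF Qp_diff_energy[OF \<open>f \<in> Qp p\<close> \<open>h \<in> Qp p\<close>]] that
      by (simp add: Qp_dist_def)
    then show "f = h"
      using that by (fastforce simp: Qp_def)
  qed (simp add: Qp_dist_def Qp_norm_def Qp_energy_def zero_ennreal_def[symmetric])
  show "Qp_dist p f k \<le> Qp_dist p f h + Qp_dist p h k"
    if "f \<in> Qp p" "h \<in> Qp p" "k \<in> Qp p"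
    using Qp_norm_triangle(2)[OF Qp_diff_energy[OF that(1,2)] Qp_diff_energy[OF that(2,3)]]
    by (simp add: Qp_dist_def)
qed

end

theory Submission
  imports Defs
begin

text \<open>
  Write \<open>\<mu>\<^sub>a\<close> for the push-forward under \<open>\<phi>\<close> of the measure \<open>|\<phi>'|\<^sup>2 g(\<cdot>,a)^p dA\<close>. The area
  formula for holomorphic maps (\<open>nn_integral_counting\<close>) identifies \<open>\<mu>\<^sub>a\<close> with
  \<open>N\<^sub>a dA\<close>, where \<open>N\<^sub>a\<close> is the counting function, so that two things hold at once: the
  energy of \<open>f \<circ> \<phi>\<close> is the supremum over \<open>a\<close> of the integrals of \<open>|f'|\<^sup>2\<close> against
  \<open>\<mu>\<^sub>a\<close>, and \<open>H\<^sub>a(I)\<close> is \<open>|I|^(-p-2)\<close> times the mass that \<open>\<mu>\<^sub>a\<close> puts on the part of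
  \<open>Q_up I\<close> outside the disc of radius \<open>\<rho>\<close>. As in other spaces of holomorphic functions,
  compactness of the composition operator means that bounded sequences tending to zero locally
  uniformly are mapped to norm-null sequences; this rests on Montel's theorem and Fatou's lemma
  (\<open>Qp_normal_family\<close>, \<open>null_sequence_imp_compact\<close>, \<open>compact_imp_null_sequence\<close>).

  \<^bold>\<open>Small gauge implies compact.\<close> For a function \<open>g\<close> of bounded energy put
  \<open>S(I) = sup |g'|\<^sup>2\<close> over \<open>Q_up I\<close>. The values \<open>S(I) |I|^(p+2)\<close> satisfy a packing
  condition: their sum over the arcs inside \<open>J\<close> is at most a constant times \<open>|J|^p\<close> times the
  energy of \<open>g\<close> (\<open>carleson_embedding\<close>; submean value property plus the Green function with
  pole above \<open>J\<close>). If weights \<open>\<lambda>\<^sub>J\<close> are admissible for \<open>H\<^sub>a\<close>, then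
  the integral of \<open>|g'|\<^sup>2\<close> against \<open>\<mu>\<^sub>a\<close> over \<open>\<rho> < |\<zeta>|\<close> is at most the sum of
  \<open>S(I) |I|^(p+2) \<lambda>\<^sub>J\<close> over all pairs \<open>I \<subseteq> J\<close>, and summing over \<open>I\<close> first bounds it
  by a constant times the cost of \<open>\<lambda>\<close> times the energy (\<open>tail_estimate\<close>). The remaining part
  \<open>|\<zeta>| \<le> \<rho>\<close> is harmless for locally uniform null sequences, because boundedness of the
  operator, tested on the identity map, bounds the total mass of the \<open>\<mu>\<^sub>a\<close>.

  \<^bold>\<open>Compact implies small gauge.\<close> By linear programming duality on a laminar family, proved
  here by a greedy algorithm (\<open>laminar_duality\<close>, \<open>gauge_le_dual\<close>), the gauge of \<open>H\<^sub>a\<close> is at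
  most the supremum of the sums of \<open>H\<^sub>a(I) x\<^sub>I\<close> over finitely supported \<open>x \<ge> 0\<close> with the packing
  condition that the \<open>x\<^sub>I\<close> with \<open>I \<subseteq> J\<close> sum to at most \<open>|J|^p\<close>. Such an \<open>x\<close> yields test
  functions: with \<open>w\<^sub>I\<close> a point in the middle of \<open>Q_up I\<close>, the function
  \<open>\<Sum>\<^sub>I \<plusminus> x\<^sub>I^(1/2) |I|^(2-p/2) / (1 - w\<^sub>I\<^sup>* z)\<^sup>2\<close> has energy bounded by a constant that
  depends only on \<open>p\<close> (\<open>test_fun_energy\<close>), its \<open>I\<close>-th term has \<open>|derivative|\<^sup>2\<close> at least
  a constant times \<open>x\<^sub>I |I|^(-2-p)\<close> on \<open>Q_up I\<close>, and the signs can be chosen so that the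
  squares of the individual terms add up after integration (\<open>choose_signs\<close>). So a dual sum
  that stays large produces functions whose images have large norm. Since \<open>H\<^sub>a\<close> vanishes on
  the arcs of generation below \<open>n\<close> as soon as \<open>\<rho> \<ge> 1 - 2^(-n)\<close>, only arcs of generation at
  least \<open>n\<close> occur, and then the test functions tend to zero locally uniformly, which contradicts
  compactness.
\<close>

section \<open>The area formula for holomorphic maps\<close>

lemma borel_measurable_Complex_vec: "(\<lambda>v::real^2. Complex (v$1) (v$2)) \<in> borel_measurable borel"
  by (intro borel_measurable_continuous_onI) (auto simp: Complex_eq intro!: continuous_intros)

text \<open>
  The change of variables theorem for multiple integrals is formulated for \<open>real^'n\<close>; this
  and the next two lemmas transport it to the complex plane.
\<close>

lemma lborel_complex_eq_distr:
  "(lborel :: complex measure) = distr lborel borel (\<lambda>v::real^2. Complex (v$1) (v$2))"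
proof (rule lborel_eqI)
  fix l u :: complex
  assume le: "\<And>b. b \<in> Basis \<Longrightarrow> l \<bullet> b \<le> u \<bullet> b"
  have "(\<lambda>v::real^2. Complex (v$1) (v$2)) -` box l u = box (vector [Re l, Im l]) (vector [Re u, Im u])"
    by (auto simp: box_def Basis_complex_def inner_complex_def Basis_vec_def inner_axis forall_2 vector_2)
  then have "emeasure (distr lborel borel (\<lambda>v::real^2. Complex (v$1) (v$2))) (box l u)
      = emeasure lborel (box (vector [Re l, Im l] :: real^2) (vector [Re u, Im u]))"
    using borel_measurable_Complex_vec by (subst emeasure_distr) auto
  also have "\<dots> = ennreal ((Re u - Re l) * (Im u - Im l))"
  proof -
    have "Re l \<le> Re u" "Im l \<le> Im u"
      using le[of 1] le[of \<i>] by (auto simp: Basis_complex_def inner_complex_def)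
    then show ?thesis
      by (subst emeasure_lborel_box_eq)
        (auto simp: Basis_vec_def inner_axis vector_2 UNIV_2 axis_eq_axis forall_2)
  qed
  also have "\<dots> = (\<Prod>b\<in>Basis. (u - l) \<bullet> b)"
    by (auto simp: Basis_complex_def inner_complex_def)
  finally show "emeasure (distr lborel borel (\<lambda>v::real^2. Complex (v$1) (v$2))) (box l u)
      = (\<Prod>b\<in>Basis. (u - l) \<bullet> b)" .
qed auto

lemma emeasure_lborel_complex:
  assumes [measurable]: "A \<in> sets borel"
  shows "emeasure lborel (A :: complex set) = emeasure lborel {v::real^2. Complex (v$1) (v$2) \<in> A}"
  using borel_measurable_Complex_vec
  by (subst lborel_complex_eq_distr, subst emeasure_distr) (auto simp: vimage_def)

lemma nn_integral_lborel_complex: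
  fixes F :: "complex \<Rightarrow> ennreal"
  assumes [measurable]: "F \<in> borel_measurable borel"
  shows "(\<integral>\<^sup>+z. F z \<partial>lborel) = (\<integral>\<^sup>+v. F (Complex (v$1) (v$2)) \<partial>(lborel :: (real^2) measure))"
  using borel_measurable_Complex_vec by (subst lborel_complex_eq_distr, subst nn_integral_distr) auto

lemma inj_image_borel:
  fixes \<phi> :: "complex \<Rightarrow> complex"
  assumes "open U" "\<phi> holomorphic_on U" "inj_on \<phi> U" "A \<subseteq> U" "A \<in> sets borel"
  shows "\<phi> ` A \<in> sets borel"
proof -
  obtain \<psi> where \<psi>: "\<psi> holomorphic_on (\<phi> ` U)" "\<And>z. z \<in> U \<Longrightarrow> \<psi> (\<phi> z) = z"
    using holomorphic_has_inverse[OF assms(2,1,3)] by metis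
  have op: "open (\<phi> ` U)"
    by (rule open_mapping_thm3) (use assms in auto)
  have "\<psi> \<in> borel_measurable (restrict_space borel (\<phi> ` U))"
    by (intro borel_measurable_continuous_on_restrict holomorphic_on_imp_continuous_on \<psi>)
  from measurable_sets[OF this assms(5)]
  have "\<psi> -` A \<inter> \<phi> ` U \<in> sets (restrict_space borel (\<phi> ` U))"
    by (simp add: space_restrict_space)
  then have "\<psi> -` A \<inter> \<phi> ` U \<in> sets borel"
    using op by (auto simp: sets_restrict_space)
  moreover have "\<psi> -` A \<inter> \<phi> ` U = \<phi> ` A"
    using \<psi> assms(4) by force
  ultimately show ?thesis by simp
qed

text \<open>
  By the Cauchy-Riemann equations \<open>|f'|\<^sup>2\<close> is the Jacobian determinant of \<open>f\<close> as a map of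
  the real plane.
\<close>

abbreviation jac :: "(complex \<Rightarrow> complex) \<Rightarrow> complex \<Rightarrow> ennreal" where
  "jac f z \<equiv> ennreal ((cmod (deriv f z))\<^sup>2)"

text \<open>
  In real coordinates the derivative of \<open>\<phi>\<close> is multiplication by the complex number
  \<open>\<phi>'\<close>, whose determinant is \<open>|\<phi>'|\<^sup>2\<close>, so the real change of variables theorem applies.
\<close>

lemma emeasure_inj_holomorphic_image:
  fixes \<phi> :: "complex \<Rightarrow> complex"
  assumes U: "open U" and hol: "\<phi> holomorphic_on U" and inj: "inj_on \<phi> U"
    and A: "A \<subseteq> U" and [measurable]: "A \<in> sets borel"
    and fin: "(\<integral>\<^sup>+z. jac \<phi> z * indicator A z \<partial>lborel) < \<infinity>"
  shows "emeasure lborel (\<phi> ` A) = (\<integral>\<^sup>+z. jac \<phi> z * indicator A z \<partial>lborel)"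
proof -
  define T where "T = (\<lambda>v::real^2. Complex (v$1) (v$2))"
  define S where "S = (\<lambda>z. vector [Re z, Im z] :: real^2)"
  have TS [simp]: "T (S z) = z" "S (T v) = v" for z v
    by (auto simp: T_def S_def vec_eq_iff forall_2 vector_2)
  have linS: "bounded_linear S"
    by (intro linear_conv_bounded_linear[THEN iffD1] linearI)
      (auto simp: S_def vec_eq_iff forall_2 vector_2)
  have linT: "bounded_linear T"
    by (intro linear_conv_bounded_linear[THEN iffD1] linearI)
      (auto simp: T_def complex_eq_iff)
  have Tm [measurable]: "T \<in> borel_measurable borel"
    by (intro borel_measurable_continuous_onI linear_continuous_on linT)
  define B where "B = T -` A"
  have B [measurable]: "B \<in> sets borel"
    unfolding B_def using measurable_sets[OF Tm \<open>A \<in> sets borel\<close>] by simp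
  \<comment> \<open>\<open>g\<close> is \<open>\<phi>\<close> in real coordinates.\<close>
  define g where "g = S \<circ> \<phi> \<circ> T"
  define g' where "g' = (\<lambda>v h. S (deriv \<phi> (T v) * T h))"
  have der: "(g has_derivative g' v) (at v within B)" if "v \<in> B" for v
  proof -
    have "T v \<in> U" using that A by (auto simp: B_def)
    then have "(\<phi> has_derivative (\<lambda>h. deriv \<phi> (T v) * h)) (at (T v))"
      using holomorphic_derivI[OF hol U] by (simp add: has_field_derivative_def)
    from has_derivative_compose[OF bounded_linear_imp_has_derivative[OF linT] this]
    have "((\<lambda>v. \<phi> (T v)) has_derivative (\<lambda>h. deriv \<phi> (T v) * T h)) (at v)" .
    from has_derivative_compose[OF this bounded_linear_imp_has_derivative[OF linS]]
    have "(g has_derivative g' v) (at v)" by (simp add: g_def g'_def o_def)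
    then show ?thesis by (rule has_derivative_at_withinI)
  qed
  have det: "\<bar>det (matrix (g' v))\<bar> = (cmod (deriv \<phi> (T v)))\<^sup>2" for v
  proof -
    have T1: "T (axis 1 1) = 1" and T2: "T (axis 2 1) = \<i>"
      by (auto simp: T_def axis_def complex_eq_iff)
    show ?thesis
      by (simp add: det_2 matrix_def g'_def T1 T2 S_def vector_2 cmod_power2 flip: power2_eq_square)
  qed
  have injg: "inj_on g B"
  proof (rule inj_onI)
    fix x y assume xy: "x \<in> B" "y \<in> B" "g x = g y"
    then have "\<phi> (T x) = \<phi> (T y)" unfolding g_def by (metis TS(1) comp_apply)
    then have "T x = T y" using inj_onD[OF inj] xy A by (auto simp: B_def)
    then show "x = y" by (metis TS(2))
  qed
  have contd: "continuous_on U (\<lambda>z. (cmod (deriv \<phi> z))\<^sup>2)"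
    using holomorphic_on_imp_continuous_on[OF holomorphic_deriv[OF hol U]] by (intro continuous_intros)
  have m1: "(\<lambda>z. indicator U z *\<^sub>R (cmod (deriv \<phi> z))\<^sup>2) \<in> borel_measurable borel"
    by (intro borel_measurable_continuous_on_indicator contd) (use U in auto)
  have m2: "(\<lambda>z. (cmod (deriv \<phi> z))\<^sup>2 * indicator A z) \<in> borel_measurable borel"
  proof -
    have "(\<lambda>z. (indicator U z *\<^sub>R (cmod (deriv \<phi> z))\<^sup>2) * indicator A z) \<in> borel_measurable borel"
      using m1 by measurable
    then show ?thesis
      by (rule back_subst[of "\<lambda>x. x \<in> borel_measurable borel"]) (use A in \<open>auto simp: fun_eq_iff split:
          split_indicator\<close>)
  qed
  define f where "f = (\<lambda>v. (cmod (deriv \<phi> (T v)))\<^sup>2 * indicator B v)"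
  have fm: "f \<in> borel_measurable borel"
    unfolding f_def B_def using measurable_compose[OF Tm m2] by (simp add: indicator_def)
  have I: "(\<integral>\<^sup>+z. jac \<phi> z * indicator A z \<partial>lborel) = (\<integral>\<^sup>+v. ennreal (f v) \<partial>lborel)"
  proof -
    have "(\<integral>\<^sup>+z. jac \<phi> z * indicator A z \<partial>lborel)
       = (\<integral>\<^sup>+z. ennreal ((cmod (deriv \<phi> z))\<^sup>2 * indicator A z) \<partial>lborel)"
      by (intro nn_integral_cong) (auto split: split_indicator)
    also have "\<dots> = (\<integral>\<^sup>+v. ennreal (f v) \<partial>lborel)"
      using m2 by (subst nn_integral_lborel_complex) (auto simp: f_def T_def B_def indicator_def)
    finally show ?thesis .
  qed
  obtain r where r: "r \<ge> 0" "(\<integral>\<^sup>+v. ennreal (f v) \<partial>lborel) = ennreal r"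
    using fin I by (metis ennreal_cases infinity_ennreal_def less_irrefl)
  have "(f has_integral r) UNIV"
    by (rule nn_integral_has_integral[OF _ _ r(2)]) (use fm r in \<open>auto simp: f_def\<close>)
  then have "((\<lambda>v. \<bar>det (matrix (g' v))\<bar>) has_integral r) B"
    unfolding det f_def using has_integral_restrict_UNIV[of B "\<lambda>v. (cmod (deriv \<phi> (T v)))\<^sup>2" r]
    by (simp add: indicator_def of_bool_def if_distrib cong: if_cong)
  then have "g ` B \<in> lmeasurable \<and> measure lebesgue (g ` B) = r"
    using has_measure_differentiable_image[OF _ der injg, of r] B by auto
  then have "emeasure lebesgue (g ` B) = ennreal r"
    by (metis emeasure_eq_measure2 fmeasurable_def)
  moreover have "{v. T v \<in> \<phi> ` A} = g ` B"
  proof -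
    have "v \<in> g ` B" if "T v = \<phi> z" "z \<in> A" for v z
      using that by (intro image_eqI[of _ _ "S z"]) (auto simp: g_def B_def simp flip: that(1))
    then show ?thesis by (auto simp: g_def B_def)
  qed
  moreover have bor: "\<phi> ` A \<in> sets borel"
    by (rule inj_image_borel[OF U hol inj A]) simp
  moreover have "{v. T v \<in> \<phi> ` A} \<in> sets borel"
    using measurable_sets[OF Tm bor] by (simp add: vimage_def)
  ultimately show ?thesis
    using emeasure_lborel_complex[OF bor] I r by (simp add: T_def)
qed

lemma infsum_ennreal_eq_suminf:
  fixes f :: "nat \<Rightarrow> ennreal"
  shows "infsum f UNIV = (\<Sum>i. f i)"
proof -
  have "infsum f UNIV = (SUP F\<in>{F. finite F \<and> F \<subseteq> UNIV}. sum f F)"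
    by (rule nonneg_infsum_complete) auto
  also have "\<dots> = (SUP n. \<Sum>i<n. f i)"
  proof (rule antisym)
    show "(SUP F\<in>{F. finite F \<and> F \<subseteq> UNIV}. sum f F) \<le> (SUP n. \<Sum>i<n. f i)"
    proof (rule SUP_least)
      fix F :: "nat set" assume "F \<in> {F. finite F \<and> F \<subseteq> UNIV}"
      then obtain n where "F \<subseteq> {..<n}" using finite_nat_bounded by auto
      then have "sum f F \<le> (\<Sum>i<n. f i)" by (intro sum_mono2) auto
      also have "\<dots> \<le> (SUP n. \<Sum>i<n. f i)" by (rule SUP_upper) simp
      finally show "sum f F \<le> (SUP n. \<Sum>i<n. f i)" .
    qed
    show "(SUP n. \<Sum>i<n. f i) \<le> (SUP F\<in>{F. finite F \<and> F \<subseteq> UNIV}. sum f F)"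
      by (rule SUP_least, rule SUP_upper) auto
  qed
  finally show ?thesis by (simp add: suminf_eq_SUP)
qed

lemma nn_integral_area:
  assumes [measurable]: "F \<in> borel_measurable borel"
  shows "(\<integral>\<^sup>+z. F z \<partial>area) = (\<integral>\<^sup>+z. F z * indicator disc z \<partial>lborel) / emeasure lborel disc"
proof -
  have [simp]: "disc \<in> sets borel" by simp
  show ?thesis unfolding area_def
    by (subst nn_integral_uniform_measure) auto
qed

text \<open>
  The area formula for images of sets says that the push-forward of area on \<open>\<phi> ` U\<close> under the
  local inverse \<open>\<psi>\<close> has density \<open>|\<phi>'|\<^sup>2\<close> on \<open>U\<close>. Integrating an arbitrary \<open>G\<close>
  against this identity of measures gives the substitution rule.
\<close>

lemma inj_holomorphic_density:
  fixes \<phi> :: "complex \<Rightarrow> complex" and G :: "complex \<Rightarrow> ennreal"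
  assumes V: "open V" and hol: "\<phi> holomorphic_on V" and inj: "inj_on \<phi> V"
    and U: "U \<subseteq> V" and [measurable]: "U \<in> sets borel"
    and fin: "(\<integral>\<^sup>+z. jac \<phi> z * indicator V z \<partial>lborel) < \<infinity>"
    and \<psi>: "\<psi> holomorphic_on (\<phi> ` V)" "\<And>z. z \<in> V \<Longrightarrow> \<psi> (\<phi> z) = z"
    and [measurable]: "G \<in> borel_measurable borel"
  shows "(\<lambda>\<zeta>. indicator (\<phi> ` U) \<zeta> * G (\<psi> \<zeta>)) \<in> borel_measurable borel"
    and "(\<integral>\<^sup>+\<zeta>. indicator (\<phi> ` U) \<zeta> * G (\<psi> \<zeta>) \<partial>lborel)
      = (\<integral>\<^sup>+z. jac \<phi> z * indicator U z * G z \<partial>lborel)"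
proof -
  have im [measurable]: "\<phi> ` A \<in> sets borel" if "A \<subseteq> V" "A \<in> sets borel" for A
    using inj_image_borel[OF V hol inj that] .
  have op: "open (\<phi> ` V)"
    by (rule open_mapping_thm3) (use V hol inj in auto)
  \<comment> \<open>The inverse is only known to be continuous on \<open>\<phi> ` V\<close>; its extension by zero is Borel.\<close>
  define \<psi>' where "\<psi>' = (\<lambda>\<zeta>. indicator (\<phi> ` V) \<zeta> *\<^sub>R \<psi> \<zeta>)"
  have \<psi>'m [measurable]: "\<psi>' \<in> borel_measurable borel" unfolding \<psi>'_def
    by (intro borel_measurable_continuous_on_indicator holomorphic_on_imp_continuous_on \<psi>) (use op in auto)
  have [measurable]: "\<phi> ` U \<in> sets borel" using im U by auto
  have eq: "indicator (\<phi> ` U) \<zeta> * G (\<psi> \<zeta>) = indicator (\<phi> ` U) \<zeta> * G (\<psi>' \<zeta>)" for \<zeta>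
    using U by (auto simp: \<psi>'_def split: split_indicator)
  show "(\<lambda>\<zeta>. indicator (\<phi> ` U) \<zeta> * G (\<psi> \<zeta>)) \<in> borel_measurable borel"
    unfolding eq by measurable
  have m2: "(\<lambda>z. jac \<phi> z * indicator U z) \<in> borel_measurable borel"
  proof -
    have "(\<lambda>z. indicator V z *\<^sub>R (cmod (deriv \<phi> z))\<^sup>2) \<in> borel_measurable borel"
      using holomorphic_on_imp_continuous_on[OF holomorphic_deriv[OF hol V]]
      by (intro borel_measurable_continuous_on_indicator continuous_intros) (use V in auto)
    then have "(\<lambda>z. ennreal (indicator V z *\<^sub>R (cmod (deriv \<phi> z))\<^sup>2) * indicator U z) \<in> borel_measurable borel"
      by measurable
    then show ?thesis
      by (rule back_subst[of "\<lambda>x. x \<in> borel_measurable borel"]) (use U in \<open>auto simp: fun_eq_iff split: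
          split_indicator\<close>)
  qed
  have "distr (density lborel (indicator (\<phi> ` U))) borel \<psi>' =
      density lborel (\<lambda>z. jac \<phi> z * indicator U z)" (is "?M1 = ?M2")
  proof (rule measure_eqI)
    fix C assume "C \<in> sets ?M1"
    then have C [measurable]: "C \<in> sets borel" by simp
    have UC: "U \<inter> C \<subseteq> V" "U \<inter> C \<in> sets borel" using U by auto
    have mono: "(\<integral>\<^sup>+z. jac \<phi> z * indicator (U \<inter> C) z \<partial>lborel) < \<infinity>"
      by (rule le_less_trans[OF nn_integral_mono fin]) (use U in \<open>auto split: split_indicator\<close>)
    have [measurable]: "\<psi>' -` C \<in> sets borel"
      using measurable_sets[OF \<psi>'m C] by simp
    have "emeasure ?M1 C = emeasure (density lborel (indicator (\<phi> ` U))) (\<psi>' -` C)"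
      by (subst emeasure_distr) auto
    also have "\<dots> = (\<integral>\<^sup>+z. indicator (\<phi> ` U) z * indicator (\<psi>' -` C) z \<partial>lborel)"
      by (subst emeasure_density) auto
    also have "\<dots> = (\<integral>\<^sup>+z. indicator (\<phi> ` (U \<inter> C)) z \<partial>lborel)"
    proof (rule nn_integral_cong)
      fix \<zeta>
      show "indicator (\<phi> ` U) \<zeta> * indicator (\<psi>' -` C) \<zeta> = (indicator (\<phi> ` (U \<inter> C)) \<zeta> :: ennreal)"
      proof (cases "\<zeta> \<in> \<phi> ` U")
        case True
        then obtain z where z: "z \<in> U" "\<zeta> = \<phi> z" by auto
        then have "\<psi>' \<zeta> = z" using U \<psi> by (auto simp: \<psi>'_def)
        moreover have "\<zeta> \<in> \<phi> ` (U \<inter> C) \<longleftrightarrow> z \<in> C" using z U inj by (auto dest: inj_onD)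
        ultimately show ?thesis using True by (auto split: split_indicator)
      next
        case False
        then have "\<zeta> \<notin> \<phi> ` (U \<inter> C)" by auto
        then show ?thesis using False by simp
      qed
    qed
    also have "\<dots> = emeasure lborel (\<phi> ` (U \<inter> C))" using im[OF UC] by simp
    also have "\<dots> = (\<integral>\<^sup>+z. jac \<phi> z * indicator (U \<inter> C) z \<partial>lborel)"
      by (rule emeasure_inj_holomorphic_image[OF V hol inj UC mono])
    also have "\<dots> = emeasure ?M2 C"
      using m2 by (subst emeasure_density) (auto intro!: nn_integral_cong split: split_indicator)
    finally show "emeasure ?M1 C = emeasure ?M2 C" .
  qed simp
  then have "(\<integral>\<^sup>+z. G z \<partial>?M1) = (\<integral>\<^sup>+z. G z \<partial>?M2)" by simp
  moreover have "(\<integral>\<^sup>+z. G z \<partial>?M1) = (\<integral>\<^sup>+\<zeta>. indicator (\<phi> ` U) \<zeta> * G (\<psi> \<zeta>) \<partial>lborel)"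
    by (subst nn_integral_distr) (auto simp: nn_integral_density eq)
  moreover have "(\<integral>\<^sup>+z. G z \<partial>?M2) = (\<integral>\<^sup>+z. jac \<phi> z * indicator U z * G z \<partial>lborel)"
    using m2 by (subst nn_integral_density) auto
  ultimately show "(\<integral>\<^sup>+\<zeta>. indicator (\<phi> ` U) \<zeta> * G (\<psi> \<zeta>) \<partial>lborel)
      = (\<integral>\<^sup>+z. jac \<phi> z * indicator U z * G z \<partial>lborel)" by simp
qed

section \<open>Change of variables for the counting function\<close>

text \<open>
  The energy integrand, cut off outside the disc, where \<open>deriv f\<close> is arbitrary.
\<close>

definition dsq :: "(complex \<Rightarrow> complex) \<Rightarrow> complex \<Rightarrow> ennreal" where
  "dsq f z = jac f z * indicator disc z"

lemma dsq_measurable: "f holomorphic_on disc \<Longrightarrow> dsq f \<in> borel_measurable borel"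
  unfolding dsq_def[abs_def] by (rule deriv_measurable_area)

lemma value_multiplicity_simple:
  assumes hol: "\<phi> holomorphic_on S" "open S" and z: "z \<in> S" and nz: "deriv \<phi> z \<noteq> 0"
  shows "value_multiplicity \<phi> z = 1"
proof -
  obtain r where r: "r > 0" "ball z r \<subseteq> S" "inj_on \<phi> (ball z r)"
    using has_complex_derivative_locally_injective[OF hol(1) z hol(2) nz] .
  have nev: "\<not> (\<forall>\<^sub>F w in at z. \<phi> w = \<phi> z)"
  proof
    assume "\<forall>\<^sub>F w in at z. \<phi> w = \<phi> z"
    then obtain d where d: "d > 0" "\<And>w. w \<noteq> z \<Longrightarrow> dist w z < d \<Longrightarrow> \<phi> w = \<phi> z"
      unfolding eventually_at by auto
    define w where "w = z + of_real (min d r / 2)"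
    have "w \<noteq> z" "dist w z < d" "w \<in> ball z r"
      using d r by (auto simp: w_def dist_norm)
    then show False using d(2)[of w] inj_onD[OF r(3), of w z] r(1) by auto
  qed
  have dd: "(\<lambda>w. \<phi> w - \<phi> z) holomorphic_on S" using hol by (intro holomorphic_intros)
  have fd: "\<phi> field_differentiable at z"
    using hol z holomorphic_on_imp_differentiable_at by blast
  have "deriv (\<lambda>w. \<phi> w - \<phi> z) z = deriv \<phi> z"
    using fd by (subst deriv_diff) auto
  then have "zorder (\<lambda>w. \<phi> w - \<phi> z) z = 1"
    using nz by (intro zorder_zero_eqI[OF dd hol(2) z]) auto
  then show ?thesis using nev by (simp add: value_multiplicity_def)
qed

lemma borel_holomorphic_preimage:
  assumes "\<phi> holomorphic_on U" "open U" "B \<in> sets borel"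
  shows "{z\<in>U. \<phi> z \<in> B} \<in> sets borel"
proof -
  have "\<phi> \<in> borel_measurable (restrict_space borel U)"
    by (intro borel_measurable_continuous_on_restrict holomorphic_on_imp_continuous_on assms)
  from measurable_sets[OF this assms(3)]
  have "\<phi> -` B \<inter> U \<in> sets (restrict_space borel U)" by (simp add: space_restrict_space)
  then have "\<phi> -` B \<inter> U \<in> sets borel" using assms(2) by (auto simp: sets_restrict_space)
  moreover have "\<phi> -` B \<inter> U = {z\<in>U. \<phi> z \<in> B}" by auto
  ultimately show ?thesis by simp
qed

lemma AE_lborel_notin_countable:
  assumes "countable (A :: complex set)"
  shows "AE z in lborel. z \<notin> A"
proof -
  have "A \<in> null_sets lborel" by (rule countable_imp_null_set_lborel) fact
  then show ?thesis by (rule AE_not_in)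
qed

text \<open>
  A holomorphic function is injective near each point where its derivative does not vanish, and
  by the Lindelof property countably many of these neighbourhoods cover all such points. Balls
  with closure in the disc are used so that \<open>|\<phi>'|\<^sup>2\<close> is integrable on each piece.
\<close>

lemma injective_pieces:
  assumes hol: "\<phi> holomorphic_on disc"
  shows "\<exists>V :: nat \<Rightarrow> complex set. (\<forall>i. open (V i)) \<and> (\<forall>i. V i \<subseteq> disc) \<and> (\<forall>i. inj_on \<phi> (V i)) \<and>
    (\<forall>i. (\<integral>\<^sup>+z. jac \<phi> z * indicator (V i) z \<partial>lborel) < \<infinity>) \<and>
    (\<Union>i. V i) = {z\<in>disc. deriv \<phi> z \<noteq> 0}"
proof -
  define \<F> where "\<F> = {V. \<exists>z r. V = ball z r \<and> cball z r \<subseteq> disc \<and> inj_on \<phi> (ball z r)}"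
  have op: "open V" if "V \<in> \<F>" for V using that by (auto simp: \<F>_def)
  obtain \<F>' where F': "\<F>' \<subseteq> \<F>" "countable \<F>'" "\<Union>\<F>' = \<Union>\<F>"
    using Lindelof[of \<F>] op by metis
  have "{} \<in> \<F>" unfolding \<F>_def by (auto intro!: exI[of _ "0::complex"] exI[of _ "0::real"])
  define V where "V = from_nat_into (insert {} \<F>')"
  have rV: "range V = insert {} \<F>'"
    unfolding V_def using F'(2) by (intro range_from_nat_into) auto
  have VF: "V i \<in> \<F>" for i
  proof -
    have "V i \<in> insert {} \<F>'" unfolding rV[symmetric] by (rule rangeI)
    then show ?thesis using F'(1) \<open>{} \<in> \<F>\<close> by (metis insertE subsetD)
  qed
  show ?thesis
  proof (intro exI[of _ V] conjI allI)
    fix i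
    obtain z r where zr: "V i = ball z r" "cball z r \<subseteq> disc" "inj_on \<phi> (ball z r)"
      using VF[of i] by (auto simp: \<F>_def)
    show "open (V i)" "inj_on \<phi> (V i)" using zr by auto
    show "V i \<subseteq> disc" using zr ball_subset_cball by blast
    have "continuous_on disc (deriv \<phi>)"
      by (intro holomorphic_on_imp_continuous_on holomorphic_deriv hol) auto
    then have "compact (deriv \<phi> ` cball z r)"
      using zr(2) by (intro compact_continuous_image continuous_on_subset[OF _ zr(2)]) auto
    then obtain M where M: "\<And>w. w \<in> cball z r \<Longrightarrow> cmod (deriv \<phi> w) \<le> M"
      by (meson bounded_iff compact_imp_bounded image_eqI)
    have "(\<integral>\<^sup>+z. jac \<phi> z * indicator (V i) z \<partial>lborel)
       \<le> (\<integral>\<^sup>+w. ennreal (M\<^sup>2) * indicator (ball z r) w \<partial>lborel)"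
      using M zr by (intro nn_integral_mono) (auto split: split_indicator intro!: ennreal_leI power_mono)
    also have "\<dots> = ennreal (M\<^sup>2) * emeasure lborel (ball z r)"
      by (subst nn_integral_cmult_indicator) auto
    also have "\<dots> < \<infinity>" using emeasure_bounded_finite[of "ball z r"]
      by (simp add: ennreal_mult_less_top)
    finally show "(\<integral>\<^sup>+z. jac \<phi> z * indicator (V i) z \<partial>lborel) < \<infinity>" .
  next
    have "\<Union>\<F> = {z\<in>disc. deriv \<phi> z \<noteq> 0}"
    proof (intro equalityI subsetI)
      fix w assume "w \<in> \<Union>\<F>"
      then obtain z r where zr: "w \<in> ball z r" "cball z r \<subseteq> disc" "inj_on \<phi> (ball z r)"
        by (auto simp: \<F>_def)
      have sub: "ball z r \<subseteq> disc" using zr(2) ball_subset_cball by blast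
      have "deriv \<phi> w \<noteq> 0"
        using holomorphic_injective_imp_regular[OF holomorphic_on_subset[OF hol sub] open_ball zr(3) zr(1)] .
      then show "w \<in> {z\<in>disc. deriv \<phi> z \<noteq> 0}" using sub zr by auto
    next
      fix w assume w: "w \<in> {z\<in>disc. deriv \<phi> z \<noteq> 0}"
      then obtain r where r: "r > 0" "ball w r \<subseteq> disc" "inj_on \<phi> (ball w r)"
        using has_complex_derivative_locally_injective[OF hol _ open_ball] by blast
      have "cball w (r/2) \<subseteq> ball w r" using r by auto
      moreover have "ball w (r/2) \<subseteq> ball w r" using r by (intro subset_ball) auto
      ultimately have "ball w (r/2) \<in> \<F>" unfolding \<F>_def
        using r inj_on_subset[OF r(3), of "ball w (r/2)"] by (blast intro: order.trans)
      then show "w \<in> \<Union>\<F>" using r(1) by (intro UnionI[of "ball w (r/2)"]) auto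
    qed
    moreover have "(\<Union>i. V i) = \<Union>\<F>" using rV F' by auto
    ultimately show "(\<Union>i. V i) = {z\<in>disc. deriv \<phi> z \<noteq> 0}" by simp
  qed
qed

text \<open>
  The zeros of the nonzero function \<open>\<phi>'\<close> are isolated, and the disc is \<open>\<sigma>\<close>-compact.
\<close>

lemma nonconstant_countable_critical:
  assumes hol: "\<phi> holomorphic_on disc" and nc: "\<not> (\<forall>z\<in>disc. deriv \<phi> z = 0)"
  shows "countable {z\<in>disc. deriv \<phi> z = 0}"
proof (cases "deriv \<phi> constant_on disc")
  case True
  then have "{z\<in>disc. deriv \<phi> z = 0} = {}" using nc by (auto simp: constant_on_def)
  then show ?thesis by (metis countable_empty)
next
  case False
  have "disc = (\<Union>n::nat. cball 0 (1 - 1 / Suc n))"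
  proof (intro equalityI subsetI)
    fix z :: complex assume "z \<in> disc"
    then obtain n :: nat where "1 / Suc n < 1 - cmod z"
      using nat_approx_posE[of "1 - cmod z"] by auto
    then show "z \<in> (\<Union>n::nat. cball 0 (1 - 1 / Suc n))" by (intro UN_I[of n]) auto
  next
    fix z :: complex assume "z \<in> (\<Union>n::nat. cball 0 (1 - 1 / Suc n))"
    then obtain n :: nat where "cmod z \<le> 1 - 1 / Suc n" by auto
    moreover have "0 < 1 / real (Suc n)" by simp
    ultimately have "cmod z < 1" by linarith
    then show "z \<in> disc" by simp
  qed
  then have "fsigma disc"
    unfolding fsigma_Union_compact by (intro exI[of _ "\<lambda>n. cball 0 (1 - 1 / real (Suc n))"]) auto
  then show ?thesis
    using holomorphic_countable_zeros[OF holomorphic_deriv[OF hol open_ball] open_ball _ _ False] by simp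
qed

text \<open>
  The disc without the critical points of \<open>\<phi>\<close> is cut into countably many disjoint pieces
  \<open>U i\<close> on which \<open>\<phi>\<close> is injective. A value \<open>\<zeta>\<close> that is not critical has all its preimages
  in these pieces, at most one in each and all of multiplicity one, so the counting function is
  the sum over \<open>i\<close> of the functions \<open>g(\<psi>\<^sub>i(\<zeta>), a)^p\<close> on \<open>\<phi> ` U i\<close>, where \<open>\<psi>\<^sub>i\<close> is the
  inverse of \<open>\<phi>\<close> on \<open>U i\<close>. The critical points and values are countable, hence negligible.
  If \<open>\<phi>\<close> is constant, both sides vanish: the left one because the only value is a null set.
\<close>

lemma nn_integral_counting:
  fixes p :: real
  assumes hol: "\<phi> holomorphic_on disc" and maps: "\<phi> ` disc \<subseteq> disc" and B [measurable]: "B \<in> sets borel"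
  shows "(\<integral>\<^sup>+\<zeta>. counting p \<phi> a \<zeta> * indicator B \<zeta> \<partial>area) =
    (\<integral>\<^sup>+z. dsq \<phi> z *
       (green_powr p z a * indicator {z\<in>disc. \<phi> z \<in> B} z) \<partial>area)"
proof (cases "\<forall>z\<in>disc. deriv \<phi> z = 0")
  case True
  then have "(\<phi> has_field_derivative 0) (at z within disc)" if "z \<in> disc" for z
    using that holomorphic_derivI[OF hol open_ball that] by fastforce
  then obtain c where c: "\<forall>z\<in>disc. \<phi> z = c"
    using has_field_derivative_zero_constant[of disc \<phi>] by auto
  have "AE \<zeta> in lborel. \<zeta> \<notin> {c}" by (rule AE_lborel_notin_countable) simp
  then have "AE \<zeta> in area. counting p \<phi> a \<zeta> = 0"
    unfolding AE_area
  proof eventually_elim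
    case (elim \<zeta>)
    then have e: "{z\<in>disc. \<phi> z = \<zeta>} = {}" using c by auto
    show ?case unfolding counting_def e by simp
  qed
  then have "(\<integral>\<^sup>+\<zeta>. counting p \<phi> a \<zeta> * indicator B \<zeta> \<partial>area) = (\<integral>\<^sup>+\<zeta>. 0 \<partial>area)"
    by (intro nn_integral_cong_AE) auto
  moreover have "(\<integral>\<^sup>+z. dsq \<phi> z *
       (green_powr p z a * indicator {z\<in>disc. \<phi> z \<in> B} z) \<partial>area) = (\<integral>\<^sup>+\<zeta>. 0 \<partial>area)"
    using True by (intro nn_integral_cong) (auto simp: dsq_def split: split_indicator)
  ultimately show ?thesis by simp
next
  case False
  define G where "G = (\<lambda>z. green_powr p z a * indicator {z\<in>disc. \<phi> z \<in> B} z)"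
  have [measurable]: "{z\<in>disc. \<phi> z \<in> B} \<in> sets borel"
    by (rule borel_holomorphic_preimage[OF hol]) auto
  have G [measurable]: "G \<in> borel_measurable borel" unfolding G_def by measurable
  define Z where "Z = {z\<in>disc. deriv \<phi> z = 0}"
  have cZ: "countable Z" unfolding Z_def by (rule nonconstant_countable_critical[OF hol False])
  obtain V :: "nat \<Rightarrow> complex set" where V': "(\<forall>i. open (V i)) \<and> (\<forall>i. V i \<subseteq> disc) \<and> (\<forall>i. inj_on \<phi> (V i)) \<and>
    (\<forall>i. (\<integral>\<^sup>+z. jac \<phi> z * indicator (V i) z \<partial>lborel) < \<infinity>) \<and>
    (\<Union>i. V i) = {z\<in>disc. deriv \<phi> z \<noteq> 0}"
    using injective_pieces[OF hol] by (rule exE)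
  then have V: "open (V i)" "V i \<subseteq> disc" "inj_on \<phi> (V i)"
    "(\<integral>\<^sup>+z. jac \<phi> z * indicator (V i) z \<partial>lborel) < \<infinity>"
    "(\<Union>i. V i) = {z\<in>disc. deriv \<phi> z \<noteq> 0}" for i
    by simp_all
  define U where "U = disjointed V"
  have UV: "U i \<subseteq> V i" for i unfolding U_def by (rule disjointed_subset)
  have Um [measurable]: "U i \<in> sets borel" for i
  proof -
    have "range (disjointed V) \<subseteq> sets borel"
      by (rule sets.range_disjointed_sets) (use V(1) in auto)
    then show ?thesis by (auto simp: U_def)
  qed
  have Ud: "disjoint_family U" unfolding U_def by (rule disjoint_family_disjointed)
  have UU: "(\<Union>i. U i) = disc - Z"
    unfolding U_def UN_disjointed_eq V(5) Z_def by auto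
  have holV: "\<phi> holomorphic_on V i" for i using hol V(2) by (rule holomorphic_on_subset)
  have "\<exists>\<psi>. \<psi> holomorphic_on (\<phi> ` V i) \<and> (\<forall>z\<in>V i. \<psi> (\<phi> z) = z)" for i
    using holomorphic_has_inverse[OF holV V(1,3)] by metis
  then obtain \<psi> where \<psi>: "\<And>i. \<psi> i holomorphic_on (\<phi> ` V i)" "\<And>i z. z \<in> V i \<Longrightarrow> \<psi> i (\<phi> z) = z"
    by metis
  note dens = inj_holomorphic_density[OF V(1) holV V(3) UV Um V(4) \<psi> G]
  define K where "K = (\<lambda>\<zeta>. \<Sum>i. indicator (\<phi> ` U i) \<zeta> * G (\<psi> i \<zeta>))"
  have Km [measurable]: "K \<in> borel_measurable borel" unfolding K_def
    using dens(1) by measurable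
  \<comment> \<open>Off the critical values the counting function is the sum over the local inverses.\<close>
  have pt: "counting p \<phi> a \<zeta> * indicator B \<zeta> = K \<zeta>" if "\<zeta> \<notin> \<phi> ` Z" for \<zeta>
  proof -
    define P where "P = {z\<in>disc. \<phi> z = \<zeta>}"
    define I where "I = {i. \<zeta> \<in> \<phi> ` U i}"
    have PZ: "z \<notin> Z" if "z \<in> P" for z using that \<open>\<zeta> \<notin> \<phi> ` Z\<close> by (auto simp: P_def)
    have "counting p \<phi> a \<zeta> * indicator B \<zeta> = infsum G P"
    proof (cases "\<zeta> \<in> B")
      case True
      have "counting p \<phi> a \<zeta> = infsum G P" unfolding counting_def P_def[symmetric]
      proof (rule infsum_cong)
        fix z assume z: "z \<in> P"
        then have "value_multiplicity \<phi> z = 1"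
          using PZ[OF z] by (intro value_multiplicity_simple[OF hol open_ball]) (auto simp: Z_def P_def)
        then show "value_multiplicity \<phi> z * green_powr p z a = G z"
          using z True by (simp add: G_def P_def)
      qed
      then show ?thesis using True by simp
    next
      case False
      then have "infsum G P = infsum (\<lambda>_. 0) P" by (intro infsum_cong) (auto simp: G_def P_def)
      then show ?thesis using False by simp
    qed
    also have "\<dots> = infsum (\<lambda>i. G (\<psi> i \<zeta>)) I"
    proof (rule infsum_reindex_bij_betw[symmetric], rule bij_betwI')
      have *: "\<psi> i \<zeta> \<in> U i \<and> \<phi> (\<psi> i \<zeta>) = \<zeta>" if "i \<in> I" for i
      proof -
        from that obtain z where z: "z \<in> U i" "\<zeta> = \<phi> z" by (auto simp: I_def)
        then have "z \<in> V i" using UV by blast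
        then have "\<psi> i (\<phi> z) = z" by (rule \<psi>(2))
        then show ?thesis using z by simp
      qed
      show "(\<psi> i \<zeta> = \<psi> j \<zeta>) = (i = j)" if "i \<in> I" "j \<in> I" for i j
        using *[OF that(1)] *[OF that(2)] Ud unfolding disjoint_family_on_def
        by (metis IntI UNIV_I empty_iff)
      show "\<psi> i \<zeta> \<in> P" if "i \<in> I" for i
        using *[OF that] UV[of i] V(2)[of i] unfolding P_def by blast
      show "\<exists>i\<in>I. z = \<psi> i \<zeta>" if "z \<in> P" for z
      proof -
        have "z \<in> disc - Z" using that PZ[OF that] by (simp add: P_def)
        then have "z \<in> (\<Union>i. U i)" unfolding UU .
        then obtain i where i: "z \<in> U i" by blast
        then have e: "\<psi> i (\<phi> z) = z" using \<psi>(2) UV by blast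
        have "\<phi> z = \<zeta>" using that by (simp add: P_def)
        then have "z = \<psi> i \<zeta>" "i \<in> I" using e i by (auto simp: I_def)
        then show ?thesis by blast
      qed
    qed
    also have "\<dots> = infsum (\<lambda>i. indicator (\<phi> ` U i) \<zeta> * G (\<psi> i \<zeta>)) UNIV"
      by (rule infsum_cong_neutral) (auto simp: I_def)
    also have "\<dots> = K \<zeta>" by (simp add: infsum_ennreal_eq_suminf K_def)
    finally show ?thesis .
  qed
  have "(\<integral>\<^sup>+\<zeta>. counting p \<phi> a \<zeta> * indicator B \<zeta> \<partial>area) = (\<integral>\<^sup>+\<zeta>. K \<zeta> \<partial>area)"
  proof (rule nn_integral_cong_AE)
    have "AE \<zeta> in lborel. \<zeta> \<notin> \<phi> ` Z" by (rule AE_lborel_notin_countable) (use cZ in simp)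
    then show "AE \<zeta> in area. counting p \<phi> a \<zeta> * indicator B \<zeta> = K \<zeta>"
      unfolding AE_area by eventually_elim (use pt in auto)
  qed
  also have "\<dots> = (\<integral>\<^sup>+\<zeta>. K \<zeta> * indicator disc \<zeta> \<partial>lborel) / emeasure lborel disc"
    by (rule nn_integral_area) measurable
  also have "(\<integral>\<^sup>+\<zeta>. K \<zeta> * indicator disc \<zeta> \<partial>lborel) = (\<integral>\<^sup>+\<zeta>. K \<zeta> \<partial>lborel)"
  proof (rule nn_integral_cong)
    fix \<zeta>
    show "K \<zeta> * indicator disc \<zeta> = K \<zeta>"
    proof (cases "\<zeta> \<in> disc")
      case False
      then have "\<zeta> \<notin> \<phi> ` U i" for i using maps UV V(2) by blast
      then show ?thesis by (simp add: K_def)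
    qed simp
  qed
  also have "\<dots> = (\<Sum>i. \<integral>\<^sup>+\<zeta>. indicator (\<phi> ` U i) \<zeta> * G (\<psi> i \<zeta>) \<partial>lborel)"
    unfolding K_def using dens(1) by (subst nn_integral_suminf) auto
  also have "\<dots> = (\<Sum>i. \<integral>\<^sup>+z. jac \<phi> z * indicator (U i) z * G z \<partial>lborel)"
    by (simp add: dens(2))
  also have "\<dots> = (\<Sum>i. \<integral>\<^sup>+z. dsq \<phi> z * G z * indicator (U i) z \<partial>lborel)"
  proof (intro suminf_cong nn_integral_cong)
    fix i z
    have "U i \<subseteq> disc" using UV V(2) by blast
    then show "jac \<phi> z * indicator (U i) z * G z =
      dsq \<phi> z * G z * indicator (U i) z"
      by (cases "z \<in> U i") (auto simp: dsq_def)
  qed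
  also have "\<dots> = (\<integral>\<^sup>+z. (\<Sum>i. dsq \<phi> z * G z * indicator (U i) z) \<partial>lborel)"
    using dsq_measurable[OF hol] by (subst nn_integral_suminf) auto
  also have "\<dots> = (\<integral>\<^sup>+z. dsq \<phi> z * G z * indicator disc z \<partial>lborel)"
  proof (rule nn_integral_cong_AE)
    have "AE z in lborel. z \<notin> Z" by (rule AE_lborel_notin_countable) (use cZ in simp)
    then show "AE z in lborel. (\<Sum>i. dsq \<phi> z * G z * indicator (U i) z) =
        dsq \<phi> z * G z * indicator disc z"
    proof eventually_elim
      case (elim z)
      have "(\<Sum>i. indicator (U i) z) = (indicator (\<Union>i. U i) z :: ennreal)"
        by (rule suminf_indicator[OF Ud])
      then have "(\<Sum>i. indicator (U i) z) = (indicator disc z :: ennreal)"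
        using elim by (simp add: UU split: split_indicator)
      then show ?case by (simp add: ennreal_suminf_cmult)
    qed
  qed
  also have "\<dots> / emeasure lborel disc = (\<integral>\<^sup>+z. dsq \<phi> z * G z \<partial>area)"
    using dsq_measurable[OF hol] by (subst nn_integral_area) auto
  finally show ?thesis by (simp add: G_def)
qed

section \<open>Mean values over discs\<close>

text \<open>
  Boxes rotate to sets that are not boxes, but their measure is preserved because the inverse
  rotation is an injective holomorphic map with derivative of modulus one.
\<close>

lemma lborel_rotation:
  fixes z \<omega> :: complex
  assumes w: "cmod \<omega> = 1"
  shows "distr lborel borel (\<lambda>w. z + \<omega> * (w - z)) = lborel"
proof (rule lborel_eqI[symmetric])
  let ?T = "\<lambda>w. z + \<omega> * (w - z)"
  let ?S = "\<lambda>w. z + (w - z) / \<omega>"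
  fix l u :: complex
  assume le: "\<And>b. b \<in> Basis \<Longrightarrow> l \<bullet> b \<le> u \<bullet> b"
  have w0: "\<omega> \<noteq> 0" using w by auto
  have "?T -` box l u = ?S ` box l u"
  proof (intro equalityI subsetI)
    fix x assume "x \<in> ?T -` box l u"
    then show "x \<in> ?S ` box l u" using w0 by (intro image_eqI[of _ _ "?T x"]) auto
  qed (use w0 in auto)
  then have "emeasure (distr lborel borel ?T) (box l u) = emeasure lborel (?S ` box l u)"
    by (subst emeasure_distr) auto
  also have "\<dots> = (\<integral>\<^sup>+x. jac ?S x * indicator (box l u) x \<partial>lborel)"
  proof (rule emeasure_inj_holomorphic_image[of UNIV])
    have d: "deriv ?S x = 1 / \<omega>" for x
      by (rule DERIV_imp_deriv) (use w0 in \<open>auto intro!: derivative_eq_intros\<close>)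
    show "(\<integral>\<^sup>+x. jac ?S x * indicator (box l u) x \<partial>lborel) < \<infinity>"
      unfolding d using w by (simp add: norm_divide emeasure_lborel_box_eq)
  qed (use w0 in \<open>auto intro!: holomorphic_intros inj_onI\<close>)
  also have "\<dots> = (\<integral>\<^sup>+x. indicator (box l u) x \<partial>lborel)"
  proof -
    have d: "deriv ?S x = 1 / \<omega>" for x
      by (rule DERIV_imp_deriv) (use w0 in \<open>auto intro!: derivative_eq_intros\<close>)
    show ?thesis unfolding d using w by (simp add: norm_divide)
  qed
  also have "\<dots> = (\<Prod>b\<in>Basis. (u - l) \<bullet> b)" using le by simp
  finally show "emeasure (distr lborel borel ?T) (box l u) = (\<Prod>b\<in>Basis. (u - l) \<bullet> b)" .
qed simp

lemma integrable_bounded_ball: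
  fixes h :: "complex \<Rightarrow> complex"
  assumes "continuous_on (ball z r) h" "\<And>w. w \<in> ball z r \<Longrightarrow> cmod (h w) \<le> M"
  shows "integrable lborel (\<lambda>w. indicator (ball z r) w *\<^sub>R h w)"
proof (rule Bochner_Integration.integrable_bound)
  show "integrable lborel (\<lambda>w. indicator (ball z r) w * M :: real)"
    using emeasure_bounded_finite[of "ball z r"] by simp
  show "(\<lambda>w. indicator (ball z r) w *\<^sub>R h w) \<in> borel_measurable lborel"
    using borel_measurable_continuous_on_indicator[OF _ assms(1)] by simp
  show "AE w in lborel. norm (indicator (ball z r) w *\<^sub>R h w) \<le> norm (indicator (ball z r) w * M)"
  proof (rule AE_I2)
    fix w show "norm (indicator (ball z r) w *\<^sub>R h w) \<le> norm (indicator (ball z r) w * M)"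
      using assms(2)[of w] by (auto split: split_indicator)
  qed
qed

text \<open>
  Rotation about \<open>z\<close> by an angle with \<open>\<omega>^n = -1\<close> preserves the disc and changes the sign of
  the integrand.
\<close>

lemma integral_ball_power:
  assumes n: "n > 0" and r: "r > 0"
  shows "(\<integral>w. indicator (ball z r) w *\<^sub>R (w - z) ^ n \<partial>lborel) = (0::complex)"
proof -
  define \<omega> where "\<omega> = cis (pi / n)"
  have w: "cmod \<omega> = 1" by (simp add: \<omega>_def)
  have wn: "\<omega> ^ n = -1"
  proof -
    have "\<omega> ^ n = cis (real n * (pi / real n))" unfolding \<omega>_def by (rule Complex.DeMoivre)
    then show ?thesis using n by simp
  qed
  let ?I = "(\<integral>w. indicator (ball z r) w *\<^sub>R (w - z) ^ n \<partial>lborel)"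
  have m: "(\<lambda>w. indicator (ball z r) w *\<^sub>R (w - z) ^ n) \<in> borel_measurable borel"
    by (intro borel_measurable_continuous_on_indicator continuous_intros) auto
  have "?I = (\<integral>w. indicator (ball z r) w *\<^sub>R (w - z) ^ n \<partial>(distr lborel borel (\<lambda>w. z + \<omega> * (w - z))))"
    by (simp add: lborel_rotation[OF w])
  also have "\<dots> = (\<integral>w. indicator (ball z r) (z + \<omega> * (w - z)) *\<^sub>R (\<omega> * (w - z)) ^ n \<partial>lborel)"
    using m by (subst integral_distr) auto
  also have "\<dots> = (\<integral>w. \<omega> ^ n * (indicator (ball z r) w *\<^sub>R (w - z) ^ n) \<partial>lborel)"
  proof (rule Bochner_Integration.integral_cong)
    fix w
    have "z + \<omega> * (w - z) \<in> ball z r \<longleftrightarrow> w \<in> ball z r"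
      using w by (simp add: dist_norm norm_mult norm_minus_commute)
    then show "indicator (ball z r) (z + \<omega> * (w - z)) *\<^sub>R (\<omega> * (w - z)) ^ n =
       \<omega> ^ n * (indicator (ball z r) w *\<^sub>R (w - z) ^ n)"
      by (auto simp: power_mult_distrib split: split_indicator)
  qed simp
  also have "\<dots> = - ?I" by (simp add: wn)
  finally show ?thesis by simp
qed

text \<open>
  Integrate the power series at \<open>z\<close> term by term; only the constant term survives.
\<close>

lemma integral_ball_holomorphic:
  assumes hol: "f holomorphic_on ball z R" and r: "0 < r" "r < R"
  shows "(\<integral>w. indicator (ball z r) w *\<^sub>R f w \<partial>lborel) = of_real (measure lborel (ball z r)) * f z"
proof -
  define a where "a = (\<lambda>n. (deriv ^^ n) f z / fact n)"
  define F where "F = (\<lambda>n w. indicator (ball z r) w *\<^sub>R (a n * (w - z) ^ n))"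
  have sums: "(\<lambda>n. a n * (w - z) ^ n) sums f w" if "w \<in> ball z R" for w
    using holomorphic_power_series[OF hol that] by (simp add: a_def)
  have nrR: "cmod (of_real r + of_real R) = r + R" using norm_of_real[of "r + R"] r by simp
  have sm: "summable (\<lambda>n. norm (a n) * r ^ n)"
  proof -
    have "summable (\<lambda>n. a n * ((z + of_real ((r + R)/2)) - z) ^ n)"
      by (rule sums_summable[OF sums]) (use r nrR in \<open>auto simp: dist_norm norm_divide\<close>)
    then have "summable (\<lambda>n. a n * (of_real ((r + R)/2)) ^ n)" by simp
    then have "summable (\<lambda>n. norm (a n * (of_real r) ^ n))"
      by (rule powser_insidea) (use r nrR in \<open>auto simp: norm_divide\<close>)
    then show ?thesis using r by (simp add: norm_mult norm_power)
  qed
  have bd: "cmod (a n * (w - z) ^ n) \<le> norm (a n) * r ^ n" if "w \<in> ball z r" for n w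
    using that r by (auto simp: norm_mult norm_power dist_norm norm_minus_commute intro!: mult_left_mono
        power_mono)
  have int: "integrable lborel (F n)" for n unfolding F_def
    by (rule integrable_bounded_ball[OF _ bd]) (auto intro!: continuous_intros)
  have fin: "emeasure lborel (ball z r) < \<infinity>" using emeasure_bounded_finite[of "ball z r"] by simp
  have "(\<lambda>n. integral\<^sup>L lborel (F n)) sums (\<integral>w. (\<Sum>n. F n w) \<partial>lborel)"
  proof (rule sums_integral[OF int])
    show "AE w in lborel. summable (\<lambda>n. norm (F n w))"
    proof (rule AE_I2)
      fix w show "summable (\<lambda>n. norm (F n w))"
      proof (cases "w \<in> ball z r")
        case True
        then show ?thesis using bd[OF True]
          by (intro summable_comparison_test'[OF sm, of 0]) (auto simp: F_def)
      qed (simp add: F_def)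
    qed
    have "norm (integral\<^sup>L lborel (\<lambda>w. norm (F n w))) \<le> norm (a n) * r ^ n * measure lborel (ball z r)" for n
    proof -
      have "integral\<^sup>L lborel (\<lambda>w. norm (F n w)) \<le> (\<integral>w. indicator (ball z r) w * (norm (a n) * r ^ n) \<partial>lborel)"
      proof (rule integral_mono)
        show "integrable lborel (\<lambda>w. norm (F n w))" by (rule integrable_norm[OF int])
        show "integrable lborel (\<lambda>w. indicator (ball z r) w * (norm (a n) * r ^ n))" using fin by simp
        show "norm (F n w) \<le> indicator (ball z r) w * (norm (a n) * r ^ n)" for w
          using bd[of w n] by (auto simp: F_def split: split_indicator)
      qed
      also have "\<dots> = norm (a n) * r ^ n * measure lborel (ball z r)" using fin by (simp add: mult.commute)
      finally show ?thesis by (simp add: abs_of_nonneg integral_nonneg_AE)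
    qed
    then show "summable (\<lambda>n. integral\<^sup>L lborel (\<lambda>w. norm (F n w)))"
      by (intro summable_comparison_test'[OF summable_mult2[OF sm], of 0]) auto
  qed
  moreover have "(\<Sum>n. F n w) = indicator (ball z r) w *\<^sub>R f w" for w
  proof (cases "w \<in> ball z r")
    case True
    then have "w \<in> ball z R" using r by auto
    then show ?thesis using True sums_unique[OF sums] by (simp add: F_def)
  qed (simp add: F_def)
  moreover have "integral\<^sup>L lborel (F n) = (if n
      = 0 then of_real (measure lborel (ball z r)) * f z else 0)" for n
  proof (cases "n = 0")
    case True
    then show ?thesis using fin by (simp add: F_def a_def scaleR_conv_of_real)
  next
    case False
    have "integral\<^sup>L lborel (F n) = (\<integral>w. a n * (indicator (ball z r) w *\<^sub>R (w - z) ^ n) \<partial>lborel)"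
      by (simp add: F_def)
    also have "\<dots> = a n * (\<integral>w. indicator (ball z r) w *\<^sub>R (w - z) ^ n \<partial>lborel)"
      by (rule integral_mult_right_zero)
    also have "\<dots> = 0" using integral_ball_power[of n r z] False r by simp
    finally show ?thesis using False by simp
  qed
  ultimately have "(\<lambda>n. if n = 0 then of_real (measure lborel (ball z r)) * f z else 0) sums
      (\<integral>w. indicator (ball z r) w *\<^sub>R f w \<partial>lborel)" by simp
  moreover have "(\<lambda>n. if n = 0 then of_real (measure lborel (ball z r)) * f z else 0) sums
     (of_real (measure lborel (ball z r)) * f z)"
    by (rule sums_single)
  ultimately show ?thesis by (rule sums_unique2)
qed

lemma measure_ball_complex: "r \<ge> 0 \<Longrightarrow> measure lborel (ball (z::complex) r) = pi * r\<^sup>2"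
  by (simp add: content_ball unit_ball_vol_2 powr_numeral)

lemma emeasure_ball_complex: "r \<ge> 0 \<Longrightarrow> emeasure lborel (ball (z::complex) r) = ennreal (pi * r\<^sup>2)"
  using emeasure_bounded_finite[of "ball z r"] measure_ball_complex[of r z]
  by (simp add: emeasure_eq_ennreal_measure)

text \<open>
  The mean value property is applied to the holomorphic function \<open>f\<^sup>2\<close>.
\<close>

lemma submean_ball:
  assumes hol: "f holomorphic_on ball z R" and r: "0 < r" "r < R"
  shows "ennreal (pi * r\<^sup>2 * (cmod (f z))\<^sup>2) \<le> (\<integral>\<^sup>+w. ennreal ((cmod (f w))\<^sup>2) * indicator (ball z r) w \<partial>lborel)"
proof -
  have hol2: "(\<lambda>w. (f w)\<^sup>2) holomorphic_on ball z R" by (intro holomorphic_intros hol)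
  have "ennreal (pi * r\<^sup>2 * (cmod (f z))\<^sup>2) = ennreal (norm (of_real (measure lborel (ball z r)) * (f z)\<^sup>2))"
    using r by (simp add: measure_ball_complex norm_mult norm_power)
  also have "\<dots> = ennreal (norm (\<integral>w. indicator (ball z r) w *\<^sub>R (f w)\<^sup>2 \<partial>lborel))"
    by (simp add: integral_ball_holomorphic[OF hol2 r])
  also have "\<dots> \<le> (\<integral>\<^sup>+w. ennreal (norm (indicator (ball z r) w *\<^sub>R (f w)\<^sup>2)) \<partial>lborel)"
  proof (rule integral_norm_bound_ennreal)
    have "compact (f ` cball z r)"
      using r by (intro compact_continuous_image continuous_on_subset[OF holomorphic_on_imp_continuous_on[OF
          hol]]) auto
    then obtain M where M: "\<And>w. w \<in> cball z r \<Longrightarrow> cmod (f w) \<le> M"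
      by (meson bounded_iff compact_imp_bounded image_eqI)
    show "integrable lborel (\<lambda>w. indicator (ball z r) w *\<^sub>R (f w)\<^sup>2)"
    proof (rule integrable_bounded_ball)
      show "continuous_on (ball z r) (\<lambda>w. (f w)\<^sup>2)"
        using r by (intro continuous_intros continuous_on_subset[OF holomorphic_on_imp_continuous_on[OF hol]])
            auto
      show "cmod ((f w)\<^sup>2) \<le> M\<^sup>2" if "w \<in> ball z r" for w
        using M[of w] that by (auto simp: norm_power intro!: power_mono)
    qed
  qed
  also have "\<dots> = (\<integral>\<^sup>+w. ennreal ((cmod (f w))\<^sup>2) * indicator (ball z r) w \<partial>lborel)"
    by (intro nn_integral_cong) (auto simp: norm_power split: split_indicator)
  finally show ?thesis .
qed

lemma emeasure_area:
  assumes "A \<in> sets borel"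
  shows "emeasure area A = emeasure lborel (disc \<inter> A) / ennreal pi"
proof -
  have "emeasure lborel disc = ennreal pi" using emeasure_ball_complex[of 1 0] by simp
  then show ?thesis using assms unfolding area_def by (subst emeasure_uniform_measure) auto
qed

lemma space_area [simp]: "space area = UNIV" by (simp add: area_def)

lemma emeasure_area_ball_le:
  assumes "A \<in> sets borel" "A \<subseteq> cball b R" "0 \<le> R"
  shows "emeasure area A \<le> ennreal (R\<^sup>2)"
proof -
  have "emeasure lborel (disc \<inter> A) \<le> emeasure lborel (cball b R)"
    using assms by (intro emeasure_mono) auto
  also have "\<dots> = ennreal (pi * R\<^sup>2)"
    using assms by (simp add: emeasure_cball unit_ball_vol_2 powr_numeral)
  finally have "emeasure area A \<le> ennreal (pi * R\<^sup>2) / ennreal pi"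
    unfolding emeasure_area[OF assms(1)] by (rule divide_right_mono_ennreal)
  also have "\<dots> = ennreal (R\<^sup>2)" by (simp add: divide_ennreal)
  finally show ?thesis .
qed

lemma borel_measurable_disc_holomorphic:
  assumes "f holomorphic_on disc"
  shows "(\<lambda>z. ennreal ((cmod (f z))\<^sup>2) * indicator disc z) \<in> borel_measurable borel"
proof -
  have "(\<lambda>z. indicator disc z *\<^sub>R (cmod (f z))\<^sup>2) \<in> borel_measurable borel"
    using holomorphic_on_imp_continuous_on[OF assms]
    by (intro borel_measurable_continuous_on_indicator continuous_intros) auto
  then have "(\<lambda>z. ennreal (indicator disc z *\<^sub>R (cmod (f z))\<^sup>2)) \<in> borel_measurable borel" by measurable
  then show ?thesis
    by (rule back_subst[of "\<lambda>x. x \<in> borel_measurable borel"]) (auto simp: fun_eq_iff split: split_indicator)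
qed

lemma submean_area:
  assumes hol: "f holomorphic_on disc" and sub: "ball z R \<subseteq> disc" and r: "0 < r" "r < R"
  shows "ennreal (r\<^sup>2 * (cmod (f z))\<^sup>2) \<le> (\<integral>\<^sup>+w. (ennreal ((cmod (f w))\<^sup>2) * indicator disc w)
      * indicator (ball z r) w \<partial>area)"
proof -
  have "emeasure lborel disc = ennreal pi" using emeasure_ball_complex[of 1 0] by simp
  define F where "F = (\<lambda>w. ennreal ((cmod (f w))\<^sup>2) * indicator disc w)"
  have [measurable]: "F \<in> borel_measurable borel" unfolding F_def
      by (rule borel_measurable_disc_holomorphic[OF hol])
  have br: "ball z r \<subseteq> disc" using sub r by auto
  have "ennreal (pi * r\<^sup>2 * (cmod (f z))\<^sup>2) \<le> (\<integral>\<^sup>+w. ennreal ((cmod (f w))\<^sup>2) * indicator (ball z r) w \<partial>lborel)"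
    by (rule submean_ball[OF holomorphic_on_subset[OF hol sub] r])
  also have "\<dots> = (\<integral>\<^sup>+w. F w * indicator (ball z r) w * indicator disc w \<partial>lborel)"
    unfolding F_def by (intro nn_integral_cong) (use br in \<open>auto split: split_indicator\<close>)
  finally have "ennreal (pi * r\<^sup>2 * (cmod (f z))\<^sup>2) / ennreal pi \<le> \<dots> / ennreal pi"
    by (rule divide_right_mono_ennreal)
  also have "\<dots> = (\<integral>\<^sup>+w. F w * indicator (ball z r) w \<partial>area)"
  proof -
    have m: "(\<lambda>w. F w * indicator (ball z r) w) \<in> borel_measurable borel"
      by (intro borel_measurable_times_ennreal borel_measurable_indicator) auto
    show ?thesis unfolding nn_integral_area[OF m] \<open>emeasure lborel disc = ennreal pi\<close> ..
  qed
  also have "ennreal (pi * r\<^sup>2 * (cmod (f z))\<^sup>2) / ennreal pi = ennreal (r\<^sup>2 * (cmod (f z))\<^sup>2)"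
    by (simp add: divide_ennreal)
  finally show ?thesis by (simp add: F_def)
qed

section \<open>Integrals of powers under growth conditions\<close>

lemma dyadic_scale_above:
  fixes x \<delta> :: real
  assumes "0 < \<delta>" "\<delta> \<le> x"
  obtains j :: nat where "2 ^ j * \<delta> \<le> x" "x < 2 ^ Suc j * \<delta>"
proof -
  obtain n :: nat where "x / \<delta> < 2 ^ n" using real_arch_pow[of 2 "x / \<delta>"] by auto
  then have ex: "x < 2 ^ n * \<delta>" using assms by (simp add: field_simps)
  define m where "m = (LEAST n. x < 2 ^ n * \<delta>)"
  have m: "x < 2 ^ m * \<delta>" unfolding m_def using ex by (rule LeastI)
  have "m \<noteq> 0" using m assms by (cases m) auto
  then obtain j where j: "m = Suc j" by (cases m) auto
  have "\<not> x < 2 ^ j * \<delta>" using j not_less_Least[of j "\<lambda>n. x < 2 ^ n * \<delta>"] by (simp add: m_def)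
  then show thesis using that[of j] m j by auto
qed

lemma powr_power_two: "(2 ^ j * \<delta>) powr r = (2 powr r) ^ j * \<delta> powr r" if "\<delta> > 0" for \<delta> r :: real
  using that by (simp add: powr_mult powr_powr powr_realpow[symmetric] mult.commute)

text \<open>
  Cut the space into the shells \<open>2^j \<delta> \<le> D < 2^(j+1) \<delta>\<close>. The growth of the measure of the
  sublevel sets makes the contributions of the shells a geometric series of ratio
  \<open>2^(\<gamma>-r) < 1\<close>. The lemma is used both for weighted area and, with a point measure, for sums
  over arcs.
\<close>

lemma nn_integral_powr_growth_above:
  fixes D :: "'a \<Rightarrow> real"
  assumes D [measurable]: "D \<in> borel_measurable M" and \<delta>: "0 < \<delta>" "\<And>x. x \<in> space M \<Longrightarrow> \<delta> \<le> D x"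
    and r: "0 \<le> \<gamma>" "\<gamma> < r" and C: "0 \<le> C"
    and growth: "\<And>R. \<delta> \<le> R \<Longrightarrow> emeasure M {x\<in>space M. D x \<le> R} \<le> ennreal (C * R powr \<gamma>)"
  shows "(\<integral>\<^sup>+x. ennreal (D x powr (-r)) \<partial>M) \<le> ennreal (C * (2 powr \<gamma> / (1 - 2 powr (\<gamma> - r))) * \<delta> powr (\<gamma> - r))"
proof -
  let ?b = "\<lambda>j. (2 ^ j * \<delta>) powr (-r)"
  let ?S = "\<lambda>j. {x\<in>space M. D x \<le> 2 ^ Suc j * \<delta>}"
  let ?s = "\<lambda>j x. ennreal (?b j) * indicator (?S j) x"
  let ?K = "C * 2 powr \<gamma> * \<delta> powr (\<gamma> - r)"
  have "(\<integral>\<^sup>+x. ennreal (D x powr (-r)) \<partial>M) \<le> (\<integral>\<^sup>+x. (\<Sum>j. ?s j x) \<partial>M)"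
  proof (rule nn_integral_mono)
    fix x assume x: "x \<in> space M"
    obtain j where j: "2 ^ j * \<delta> \<le> D x" "D x < 2 ^ Suc j * \<delta>"
      using dyadic_scale_above[OF \<delta>(1) \<delta>(2)[OF x]] .
    have "D x powr (-r) \<le> ?b j"
      using j(1) \<delta> r by (intro powr_mono2') auto
    then have "ennreal (D x powr (-r)) \<le> (\<Sum>j\<in>{j}. ?s j x)"
      using j x by (simp add: ennreal_leI)
    also have "\<dots> \<le> (\<Sum>j. ?s j x)"
      by (rule sum_le_suminf) auto
    finally show "ennreal (D x powr (-r)) \<le> (\<Sum>j. ?s j x)" .
  qed
  also have "\<dots> = (\<Sum>j. ennreal (?b j) * emeasure M (?S j))"
    by (simp add: nn_integral_suminf nn_integral_cmult_indicator)
  also have "\<dots> \<le> (\<Sum>j. ennreal (?K * (2 powr (\<gamma> - r)) ^ j))"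
  proof (rule suminf_le)
    fix j
    have "emeasure M (?S j) \<le> ennreal (C * (2 ^ Suc j * \<delta>) powr \<gamma>)"
    proof (rule growth)
      have "1 * \<delta> \<le> 2 ^ Suc j * \<delta>" using \<delta> one_le_power[of "2::real" "Suc j"] by (intro mult_right_mono) auto
      then show "\<delta> \<le> 2 ^ Suc j * \<delta>" by simp
    qed
    then have "ennreal (?b j) * emeasure M (?S j) \<le> ennreal (?b j) * ennreal (C * (2 ^ Suc j * \<delta>) powr \<gamma>)"
      by (rule mult_left_mono) simp
    also have "\<dots> = ennreal (?b j * (C * (2 ^ Suc j * \<delta>) powr \<gamma>))"
      using C by (simp add: ennreal_mult)
    also have "?b j * (C * (2 ^ Suc j * \<delta>) powr \<gamma>) = ?K * (2 powr (\<gamma> - r)) ^ j"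
    proof -
      have k1: "(2 powr (-r)) ^ j * (2 powr \<gamma>) ^ j = (2 powr (\<gamma> - r)) ^ j"
        by (simp add: power_mult_distrib[symmetric] powr_add[symmetric])
      have k2: "\<delta> powr (-r) * \<delta> powr \<gamma> = \<delta> powr (\<gamma> - r)"
        by (simp add: powr_add[symmetric])
      have k3: "(2 ^ Suc j * \<delta>) powr \<gamma> = 2 powr \<gamma> * (2 powr \<gamma>) ^ j * \<delta> powr \<gamma>"
        unfolding powr_power_two[OF \<delta>(1)] by simp
      show ?thesis
        unfolding k3 powr_power_two[OF \<delta>(1)] k1[symmetric] k2[symmetric]
            by (simp only: power_Suc minus_minus mult_ac)
    qed
    finally show "ennreal (?b j) * emeasure M (?S j) \<le> ennreal (?K * (2 powr (\<gamma> - r)) ^ j)" .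
  qed auto
  also have "\<dots> = ennreal (?K * (1 / (1 - 2 powr (\<gamma> - r))))"
  proof (rule suminf_ennreal_eq)
    show "(\<lambda>j. ?K * (2 powr (\<gamma> - r)) ^ j) sums
       (?K * (1 / (1 - 2 powr (\<gamma> - r))))"
      using r by (intro sums_mult geometric_sums) (simp add: powr_less_one)
  qed (use C in simp)
  finally show ?thesis by (simp add: mult_ac)
qed

text \<open>
  The same argument with shells shrinking towards \<open>D = 0\<close>, which converges for exponents
  below the growth exponent. Points with \<open>D x = 0\<close> do no harm because \<open>0 powr (-t) = 0\<close>.
\<close>

lemma nn_integral_powr_growth_below:
  fixes D :: "'a \<Rightarrow> real"
  assumes D [measurable]: "D \<in> borel_measurable M" and R0: "0 < R0" "\<And>x. x \<in> space M \<Longrightarrow> 0 \<le> D x"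
    and t: "0 \<le> t" "t < \<gamma>" and C: "0 \<le> C"
    and growth: "\<And>R. 0 < R \<Longrightarrow> R \<le> R0 \<Longrightarrow> emeasure M {x\<in>space M. D x \<le> R} \<le> ennreal (C * R powr \<gamma>)"
  shows "(\<integral>\<^sup>+x. ennreal (D x powr (-t)) * indicator {x\<in>space M. D x \<le> R0} x \<partial>M)
    \<le> ennreal (C * (2 powr t / (1 - 2 powr (t - \<gamma>))) * R0 powr (\<gamma> - t))"
proof -
  let ?b = "\<lambda>j. (R0 / 2 ^ Suc j) powr (-t)"
  let ?S = "\<lambda>j. {x\<in>space M. D x \<le> R0 / 2 ^ j}"
  let ?s = "\<lambda>j x. ennreal (?b j) * indicator (?S j) x"
  let ?K = "C * 2 powr t * R0 powr (\<gamma> - t)"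
  have "(\<integral>\<^sup>+x. ennreal (D x powr (-t)) * indicator {x\<in>space M. D x \<le> R0} x \<partial>M)
     \<le> (\<integral>\<^sup>+x. (\<Sum>j. ?s j x) \<partial>M)"
  proof (rule nn_integral_mono)
    fix x assume x: "x \<in> space M"
    show "ennreal (D x powr (-t)) * indicator {x\<in>space M. D x \<le> R0} x \<le> (\<Sum>j. ?s j x)"
    proof (cases "0 < D x \<and> D x \<le> R0")
      case True
      obtain j where j: "2 ^ j * D x \<le> R0" "R0 < 2 ^ Suc j * D x"
        using dyadic_scale_above[of "D x" R0] True by auto
      have "D x powr (-t) \<le> ?b j"
        using j(2) R0 True t by (intro powr_mono2') (auto simp: field_simps)
      then have "ennreal (D x powr (-t)) * indicator {x\<in>space M. D x \<le> R0} x \<le> (\<Sum>j\<in>{j}. ?s j x)"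
        using j x True by (simp add: ennreal_leI field_simps)
      also have "\<dots> \<le> (\<Sum>j. ?s j x)"
        by (rule sum_le_suminf) auto
      finally show ?thesis .
    next
      case False
      then have "D x = 0 \<or> \<not> D x \<le> R0" using R0(2)[OF x] by auto
      then show ?thesis by auto
    qed
  qed
  also have "\<dots> = (\<Sum>j. ennreal (?b j) * emeasure M (?S j))"
    by (simp add: nn_integral_suminf nn_integral_cmult_indicator)
  also have "\<dots> \<le> (\<Sum>j. ennreal (?K * (2 powr (t - \<gamma>)) ^ j))"
  proof (rule suminf_le)
    fix j
    have "emeasure M (?S j) \<le> ennreal (C * (R0 / 2 ^ j) powr \<gamma>)"
    proof (rule growth)
      have "R0 / 2 ^ j \<le> R0 / 1" using R0 one_le_power[of "2::real" j] by (intro divide_left_mono) auto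
      then show "R0 / 2 ^ j \<le> R0" by simp
    qed (use R0 in auto)
    then have "ennreal (?b j) * emeasure M (?S j) \<le> ennreal (?b j) * ennreal (C * (R0 / 2 ^ j) powr \<gamma>)"
      by (rule mult_left_mono) simp
    also have "\<dots> = ennreal (?b j * (C * (R0 / 2 ^ j) powr \<gamma>))"
      using C by (simp add: ennreal_mult)
    also have "?b j * (C * (R0 / 2 ^ j) powr \<gamma>) = ?K * (2 powr (t - \<gamma>)) ^ j"
    proof -
      have e: "(R0 / 2 ^ i) powr q = R0 powr q * (2 powr (-q)) ^ i" for i q
        using R0 by (simp add: powr_divide powr_realpow[symmetric] powr_powr powr_minus field_simps)
      have k1: "(2 powr t) ^ j * (2 powr (-\<gamma>)) ^ j = (2 powr (t - \<gamma>)) ^ j"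
        by (simp add: power_mult_distrib[symmetric] powr_add[symmetric])
      have k2: "R0 powr (-t) * R0 powr \<gamma> = R0 powr (\<gamma> - t)"
        by (simp add: powr_add[symmetric])
      have k3: "(R0 / 2 ^ Suc j) powr (-t) = R0 powr (-t) * (2 powr t * (2 powr t) ^ j)"
        unfolding e by simp
      show ?thesis
        unfolding k3 e k1[symmetric] k2[symmetric] by (simp only: power_Suc minus_minus mult_ac)
    qed
    finally show "ennreal (?b j) * emeasure M (?S j) \<le> ennreal (?K * (2 powr (t - \<gamma>)) ^ j)" .
  qed auto
  also have "\<dots> = ennreal (?K * (1 / (1 - 2 powr (t - \<gamma>))))"
  proof (rule suminf_ennreal_eq)
    show "(\<lambda>j. ?K * (2 powr (t - \<gamma>)) ^ j) sums
       (?K * (1 / (1 - 2 powr (t - \<gamma>))))"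
      using t by (intro sums_mult geometric_sums) (simp add: powr_less_one)
  qed (use C in simp)
  finally show ?thesis by (simp add: mult_ac)
qed

section \<open>The kernel distance and the Green function\<close>

text \<open>
  The modulus of the Szego kernel denominator. Up to constants it is the distance between
  \<open>z\<close> and \<open>w\<close> plus their distances to the circle, and it behaves like a metric on the disc
  except that \<open>kd z z > 0\<close>.
\<close>

definition kd :: "complex \<Rightarrow> complex \<Rightarrow> real" where
  "kd z w = cmod (1 - cnj z * w)"

lemma kd_nonneg [simp]: "0 \<le> kd z w" by (simp add: kd_def)

lemma kd_sym: "kd z w = kd w z"
proof -
  have "cnj (1 - cnj z * w) = 1 - cnj w * z" by simp
  then show ?thesis unfolding kd_def by (metis complex_mod_cnj)
qed

lemma kd_measurable [measurable]: "(\<lambda>z. kd w z) \<in> borel_measurable borel"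
  unfolding kd_def by measurable

lemma kd_square: "(kd z w)\<^sup>2 = (cmod (z - w))\<^sup>2 + (1 - (cmod z)\<^sup>2) * (1 - (cmod w)\<^sup>2)"
  unfolding kd_def cmod_power2 by (simp add: power2_eq_square algebra_simps)

lemma dist_le_kd:
  assumes "cmod z \<le> 1" "cmod w \<le> 1"
  shows "cmod (z - w) \<le> kd z w"
proof (rule power2_le_imp_le)
  show "(cmod (z - w))\<^sup>2 \<le> (kd z w)\<^sup>2"
    unfolding kd_square using assms by (simp add: power_le_one)
qed simp

lemma kd_ge:
  assumes "cmod z \<le> 1" "cmod w \<le> 1"
  shows "1 - cmod w \<le> kd z w"
proof -
  have "cmod z * cmod w \<le> 1 * cmod w" using assms by (intro mult_right_mono) auto
  then have "1 - cmod w \<le> cmod 1 - cmod (cnj z * w)" by (simp add: norm_mult)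
  also have "\<dots> \<le> kd z w" unfolding kd_def by (rule norm_triangle_ineq2)
  finally show ?thesis .
qed

lemma kd_pos: "z \<in> disc \<Longrightarrow> w \<in> disc \<Longrightarrow> 0 < kd z w"
  using kd_ge[of z w] by simp

text \<open>
  From \<open>1 - a\<^sup>*w = (1 - a\<^sup>*z) + a\<^sup>*(z - w)\<close>, where the last term is dominated by
  \<open>kd z w\<close>.
\<close>

lemma kd_triangle:
  assumes "cmod a \<le> 1" "cmod z \<le> 1" "cmod w \<le> 1"
  shows "kd a w \<le> kd a z + kd z w"
proof -
  have "1 - cnj a * w = (1 - cnj a * z) + cnj a * (z - w)" by (simp add: algebra_simps)
  then have "kd a w \<le> kd a z + cmod a * cmod (z - w)"
    unfolding kd_def by (metis complex_mod_cnj norm_mult norm_triangle_ineq)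
  also have "cmod a * cmod (z - w) \<le> 1 * cmod (z - w)" using assms by (intro mult_right_mono) auto
  also have "1 * cmod (z - w) \<le> kd z w" using dist_le_kd assms by simp
  finally show ?thesis by simp
qed

lemma kd_le:
  assumes "cmod z \<le> 1" "cmod w \<le> 1"
  shows "kd z w \<le> 2 * (1 - cmod z) + cmod (z - w)"
proof -
  have "1 - cnj z * w = (1 - cnj z * z) + cnj z * (z - w)" by (simp add: algebra_simps)
  then have "kd z w \<le> kd z z + cmod z * cmod (z - w)"
    unfolding kd_def by (metis complex_mod_cnj norm_mult norm_triangle_ineq)
  also have "cmod z * cmod (z - w) \<le> 1 * cmod (z - w)" using assms by (intro mult_right_mono) auto
  also have "kd z z = (1 - cmod z) * (1 + cmod z)"
  proof -
    have "(kd z z)\<^sup>2 = (1 - (cmod z)\<^sup>2)\<^sup>2" unfolding kd_square by (simp add: power2_eq_square)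
    moreover have "0 \<le> 1 - (cmod z)\<^sup>2" using assms by (simp add: power_le_one)
    ultimately have "kd z z = 1 - (cmod z)\<^sup>2" by (metis kd_nonneg power2_eq_iff_nonneg)
    then show ?thesis by (simp add: power2_eq_square algebra_simps)
  qed
  also have "\<dots> \<le> (1 - cmod z) * 2" using assms by (intro mult_left_mono) auto
  finally show ?thesis by simp
qed

text \<open>
  This is \<open>1 - |\<sigma>\<^sub>a(z)|\<^sup>2\<close> (see \<open>poi_involution\<close>), in the form in which it is integrated.
\<close>

definition poi :: "complex \<Rightarrow> complex \<Rightarrow> real" where
  "poi a z = (1 - (cmod a)\<^sup>2) * (1 - (cmod z)\<^sup>2) / (kd a z)\<^sup>2"

lemma poi_measurable [measurable]: "(\<lambda>z. poi a z) \<in> borel_measurable borel"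
  unfolding poi_def by measurable

lemma norm_involution: "cmod (disc_involution a z) = cmod (z - a) / kd a z"
  by (simp add: disc_involution_def kd_def norm_divide norm_minus_commute)

lemma poi_involution:
  assumes "a \<in> disc" "z \<in> disc"
  shows "poi a z = 1 - (cmod (disc_involution a z))\<^sup>2" "0 < poi a z" "poi a z \<le> 1"
proof -
  have k: "0 < kd a z" using kd_pos assms by blast
  have s: "(kd a z)\<^sup>2 = (cmod (z - a))\<^sup>2 + (1 - (cmod a)\<^sup>2) * (1 - (cmod z)\<^sup>2)"
    using kd_square[of a z] by (simp add: norm_minus_commute)
  show e: "poi a z = 1 - (cmod (disc_involution a z))\<^sup>2"
    unfolding norm_involution poi_def using k s by (simp add: field_simps power_divide)
  show "0 < poi a z" unfolding poi_def using k assms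
    by (intro divide_pos_pos mult_pos_pos) (auto simp: power_less_one_iff abs_square_less_1)
  show "poi a z \<le> 1" unfolding e by simp
qed

text \<open>
  From \<open>-ln t \<ge> 1 - t \<ge> (1 - t\<^sup>2) / 2\<close>.
\<close>

lemma green_lower:
  assumes "a \<in> disc" "z \<in> disc" "0 < p"
  shows "ennreal ((poi a z / 2) powr p) \<le> green_powr p z a"
proof (cases "z = a")
  case False
  define t where "t = cmod (disc_involution a z)"
  have k: "0 < kd a z" using kd_pos assms by blast
  have "t\<^sup>2 \<le> 1" using poi_involution[OF assms(1,2)] by (simp add: t_def)
  then have t1: "t \<le> 1" by (auto simp: t_def abs_square_le_1)
  have t: "0 < t" "t \<le> 1" using t1 False k by (simp_all add: t_def norm_involution)
  have "1 - t \<le> - ln t" using ln_le_minus_one[of t] t by simp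
  then have l: "1 - t \<le> ln (1 / t)" using t by (simp add: ln_div)
  have "poi a z = (1 - t) * (1 + t)" unfolding poi_involution(1)[OF assms(1,2)] t_def
    by (simp add: power2_eq_square algebra_simps)
  also have "\<dots> \<le> (1 - t) * 2" using t by (intro mult_left_mono) auto
  finally have "poi a z / 2 \<le> ln (1 / t)" using l by simp
  then have "(poi a z / 2) powr p \<le> ln (1 / t) powr p"
    using poi_involution(2)[OF assms(1,2)] assms by (intro powr_mono2) auto
  then show ?thesis using False by (simp add: green_powr_def t_def ennreal_leI)
qed (simp add: green_powr_def)

text \<open>
  Away from its pole the Green function is comparable to \<open>1 - |\<sigma>\<^sub>a|\<^sup>2\<close>, which is free of
  singularities.
\<close>

lemma green_upper_far:
  assumes "a \<in> disc" "z \<in> disc" "0 < p" "p \<le> 1" and far: "1/4 \<le> cmod (disc_involution a z)"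
  shows "green_powr p z a \<le> ennreal (4 * poi a z powr p)"
proof -
  define t where "t = cmod (disc_involution a z)"
  have za: "z \<noteq> a" using far by (auto simp: disc_involution_def)
  have "t\<^sup>2 \<le> 1" using poi_involution[OF assms(1,2)] by (simp add: t_def)
  then have t: "1/4 \<le> t" "t \<le> 1" using far by (auto simp: t_def abs_square_le_1)
  have "ln (1 / t) \<le> 1 / t - 1" using t ln_le_minus_one[of "1 / t"] by simp
  also have "\<dots> \<le> 4 * poi a z"
  proof -
    have "1 / t - 1 = (1 - t) * (1 / t)" using t by (simp add: field_simps)
    also have "\<dots> \<le> ((1 - t) * (1 + t)) * 4"
    proof -
      have "(1 - t) * (1 / t) \<le> (1 - t) * 4" using t by (intro mult_left_mono) (auto simp: field_simps)
      also have "\<dots> \<le> (1 - t) * ((1 + t) * 4)" using t by (intro mult_left_mono) auto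
      finally show ?thesis by (simp add: mult_ac)
    qed
    also have "(1 - t) * (1 + t) = poi a z" unfolding poi_involution(1)[OF assms(1,2)] t_def
      by (simp add: power2_eq_square algebra_simps)
    finally show ?thesis by simp
  qed
  finally have "ln (1 / t) powr p \<le> (4 * poi a z) powr p" using t assms by (intro powr_mono2) auto
  also have "\<dots> = 4 powr p * poi a z powr p" using poi_involution(2)[OF assms(1,2)] by (simp add: powr_mult)
  also have "\<dots> \<le> 4 powr 1 * poi a z powr p" using assms by (intro mult_right_mono powr_mono) auto
  finally show ?thesis using za by (simp add: green_powr_def t_def ennreal_leI)
qed

text \<open>
  Near its pole the Green function has a logarithmic singularity, and the cruder but integrable
  majorant \<open>1 / |\<sigma>\<^sub>a|\<close> is enough; as it is at least \<open>1\<close>, it also absorbs the power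
  \<open>p \<le> 1\<close>.
\<close>

lemma green_upper_near:
  assumes "a \<in> disc" "z \<in> disc" "0 < p" "p \<le> 1" "z \<noteq> a"
  shows "green_powr p z a \<le> ennreal (kd a z / cmod (z - a))"
proof -
  define t where "t = cmod (disc_involution a z)"
  have k: "0 < kd a z" using kd_pos assms by blast
  have "t\<^sup>2 \<le> 1" using poi_involution[OF assms(1,2)] by (simp add: t_def)
  then have t1: "t \<le> 1" by (auto simp: t_def abs_square_le_1)
  have t0: "0 < t" using k assms(5) by (simp add: t_def norm_involution)
  have one: "1 \<le> 1 / t" using t0 t1 by simp
  have "ln (1 / t) \<le> 1 / t" using t0 ln_le_minus_one[of "1 / t"] by simp
  then have "ln (1 / t) powr p \<le> (1 / t) powr p" using t0 t1 assms by (intro powr_mono2) auto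
  also have "\<dots> \<le> (1 / t) powr 1" using assms one by (intro powr_mono) auto
  also have "\<dots> = kd a z / cmod (z - a)" using t0 by (simp add: t_def norm_involution)
  finally show ?thesis using assms(5) by (simp add: green_powr_def t_def ennreal_leI)
qed

lemma Qp_energy_dsq: "Qp_energy p f = (SUP a\<in>disc. \<integral>\<^sup>+z. dsq f z * green_powr p z a \<partial>area)"
  unfolding Qp_energy_indicator dsq_def ..

text \<open>
  The submean value property of \<open>|f'|\<^sup>2\<close>: a pointwise bound by a local energy.
\<close>

lemma dsq_submean:
  assumes hol: "f holomorphic_on disc" and sub: "ball z R \<subseteq> disc" and r: "0 < r" "r < R"
  shows "dsq f z \<le> ennreal (1 / r\<^sup>2) * (\<integral>\<^sup>+w. dsq f w * indicator (ball z r) w \<partial>area)"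
proof -
  have "dsq f z \<le> jac f z" by (simp add: dsq_def split: split_indicator)
  also have "\<dots> = ennreal (1 / r\<^sup>2) * ennreal (r\<^sup>2 * (cmod (deriv f z))\<^sup>2)"
    using r by (subst ennreal_mult[symmetric]) auto
  also have "\<dots> \<le> ennreal (1 / r\<^sup>2) * (\<integral>\<^sup>+w. dsq f w * indicator (ball z r) w \<partial>area)"
    unfolding dsq_def by (intro mult_left_mono submean_area[OF holomorphic_deriv[OF hol open_ball] sub r]) simp
  finally show ?thesis .
qed

lemma nn_integral_inverse_dist:
  assumes "0 < R"
  shows "(\<integral>\<^sup>+z. ennreal (1 / cmod (z - a)) * indicator {z. cmod (z - a) \<le> R} z \<partial>area) \<le> ennreal (4 * R)"
proof -
  have "(\<integral>\<^sup>+z. ennreal (cmod (z - a) powr (-1)) * indicator {z\<in>space area. cmod (z - a) \<le> R} z \<partial>area)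
    \<le> ennreal (1 * (2 powr 1 / (1 - 2 powr (1 - 2))) * R powr (2 - 1))"
  proof (rule nn_integral_powr_growth_below)
    fix S :: real assume S: "0 < S" "S \<le> R"
    have "emeasure area {z\<in>space area. cmod (z - a) \<le> S} \<le> ennreal (S\<^sup>2)"
      using S by (intro emeasure_area_ball_le[of _ a]) (auto simp: dist_norm norm_minus_commute)
    then show "emeasure area {z\<in>space area. cmod (z - a) \<le> S} \<le> ennreal (1 * S powr 2)"
      using S by (simp add: powr_numeral)
  qed (use assms in auto)
  also have "1 * (2 powr 1 / (1 - 2 powr (1 - 2))) * R powr (2 - 1) = 4 * R"
    using assms by (simp add: powr_minus)
  finally show ?thesis by (simp add: powr_minus_divide)
qed

text \<open>
  In the definition of the energy the Green function may be replaced by the smooth weight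
  \<open>1 - |\<sigma>\<^sub>a|\<^sup>2\<close>. The part near the pole \<open>a\<close> is controlled by the submean value property: there
  \<open>|f'|\<^sup>2\<close> is at most the local energy over a disc \<open>B\<close> around \<open>a\<close> of radius comparable to
  \<open>\<delta> = 1 - |a|\<close>, divided by \<open>\<delta>\<^sup>2\<close>, the singularity \<open>\<delta> / |z - a|\<close> integrates to a
  multiple of \<open>\<delta>\<^sup>2\<close>, and on \<open>B\<close> the smooth weight is bounded below.
\<close>

lemma energy_le_poisson:
  assumes hol: "f holomorphic_on disc" and a: "a \<in> disc" and p: "0 < p" "p \<le> 1"
  shows "(\<integral>\<^sup>+z. dsq f z * green_powr p z a \<partial>area)
      \<le> ennreal 100000 * (\<integral>\<^sup>+z. dsq f z * ennreal (poi a z powr p) \<partial>area)"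
proof -
  note [measurable] = dsq_measurable[OF hol]
  let ?G = "\<lambda>z. dsq f z * green_powr p z a" and ?P = "\<lambda>z. dsq f z * ennreal (poi a z powr p)"
  define \<delta> where "\<delta> = 1 - cmod a"
  have d: "0 < \<delta>" "\<delta> \<le> 1" using a by (auto simp: \<delta>_def)
  define B where "B = ball a (5/6 * \<delta>)"
  define I where "I = (\<integral>\<^sup>+w. dsq f w * indicator B w \<partial>area)"
  have [measurable]: "B \<in> sets borel" by (simp add: B_def)
  \<comment> \<open>Balls of radius \<open>\<delta>/12\<close> around points with \<open>|z - a| \<le> 2\<delta>/3\<close> stay in \<open>B\<close>, and those of radius \<open>\<delta>/6\<close> in the disc.\<close>
  have near_dsq: "dsq f z \<le> ennreal (144 / \<delta>\<^sup>2) * I" if z: "cmod (z - a) \<le> 2/3 * \<delta>" for z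
  proof -
    have "cmod z \<le> cmod a + 2/3 * \<delta>" using z norm_triangle_sub[of z a] by linarith
    have "ball z (\<delta>/6) \<subseteq> disc"
    proof
      fix w assume "w \<in> ball z (\<delta>/6)"
      then have "cmod (w - z) < \<delta>/6" by (simp add: dist_norm norm_minus_commute)
      then have "cmod w < cmod a + 2/3 * \<delta> + \<delta>/6"
        using \<open>cmod z \<le> cmod a + 2/3 * \<delta>\<close> norm_triangle_sub[of w z] by linarith
      also have "\<dots> < cmod a + \<delta>" using d by simp
      finally have "cmod w < 1" by (simp add: \<delta>_def)
      then show "w \<in> disc" by simp
    qed
    then have "dsq f z \<le> ennreal (1 / (\<delta>/12)\<^sup>2) * (\<integral>\<^sup>+w. dsq f w * indicator (ball z (\<delta>/12)) w \<partial>area)"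
      using d by (intro dsq_submean[OF hol]) auto
    also have "\<dots> \<le> ennreal (1 / (\<delta>/12)\<^sup>2) * I" unfolding I_def
    proof (rule mult_left_mono[OF nn_integral_mono])
      fix w
      have "ball z (\<delta>/12) \<subseteq> B" unfolding B_def using z d
          by (intro ball_subset_ball_iff[THEN iffD2]) (auto simp: dist_norm)
      then show "dsq f w * indicator (ball z (\<delta>/12)) w \<le> dsq f w * indicator B w"
        by (auto split: split_indicator)
    qed simp
    also have "1 / (\<delta>/12)\<^sup>2 = 144 / \<delta>\<^sup>2" by (simp add: power_divide)
    finally show ?thesis .
  qed
  let ?N = "{z. cmod (z - a) \<le> 2/3 * \<delta>}"
  let ?c = "ennreal (144 / \<delta>\<^sup>2) * I * ennreal (3 * \<delta>)" and ?h = "\<lambda>z. ennreal (1 / cmod (z - a)) * indicator ?N z"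
  \<comment> \<open>If \<open>|\<sigma>\<^sub>a(z)| < 1/4\<close>, then \<open>|z - a| \<le> 2\<delta>/3\<close> and \<open>kd a z \<le> 3\<delta>\<close>.\<close>
  have far_near: "?G z \<le> ennreal 4 * ?P z +
     ?c * ?h z" if za: "z \<noteq> a" for z
  proof (cases "z \<in> disc \<and> cmod (disc_involution a z) < 1/4")
    case False
    have "?G z \<le> ennreal 4 * ?P z"
    proof (cases "z \<in> disc")
      case True
      then have "green_powr p z a \<le> ennreal 4 * ennreal (poi a z powr p)"
        using green_upper_far[OF a True p] False by (simp add: ennreal_mult)
      then have "?G z \<le> dsq f z * (ennreal 4 * ennreal (poi a z powr p))"
        by (rule mult_left_mono) simp
      then show ?thesis by (simp add: mult_ac)
    qed (simp add: dsq_def)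
    then show ?thesis by (rule order_trans) simp
  next
    case True
    then have z: "z \<in> disc" "cmod (z - a) < kd a z / 4"
      using kd_pos[OF a, of z] by (auto simp: norm_involution field_simps)
    have k: "kd a z \<le> 2 * \<delta> + cmod (z - a)" using kd_le[of a z] a z(1)
      by (simp add: \<delta>_def norm_minus_commute)
    then have N: "cmod (z - a) \<le> 2/3 * \<delta>" using z(2) by simp
    then have "kd a z \<le> 3 * \<delta>" using k d by simp
    then have "green_powr p z a \<le> ennreal (3 * \<delta> / cmod (z - a))"
      using za by (intro order_trans[OF green_upper_near[OF a z(1) p za]] ennreal_leI divide_right_mono) auto
    also have "\<dots> = ennreal (3 * \<delta>) * ennreal (1 / cmod (z - a))"
      using d by (subst ennreal_mult[symmetric]) auto
    finally have "?G z \<le> (ennreal (144 / \<delta>\<^sup>2) * I) * (ennreal (3 * \<delta>) * ennreal (1 / cmod (z - a)))"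
      by (intro mult_mono near_dsq N) auto
    then have "?G z \<le> ?c * ?h z"
      using N by (simp add: mult_ac)
    then show ?thesis by (rule order_trans) simp
  qed
  have AEa: "AE z in area. z \<noteq> a"
  proof -
    have "AE z in lborel. z \<notin> {a}" by (rule AE_lborel_notin_countable) simp
    then show ?thesis unfolding AE_area by eventually_elim auto
  qed
  have "(\<integral>\<^sup>+z. ?G z \<partial>area) \<le> (\<integral>\<^sup>+z. ennreal 4 * ?P z +
     ?c * ?h z \<partial>area)"
    by (rule nn_integral_mono_AE) (use AEa far_near in auto)
  also have "\<dots> = ennreal 4 * (\<integral>\<^sup>+z. ?P z \<partial>area) +
     ?c * (\<integral>\<^sup>+z. ?h z \<partial>area)"
    by (subst nn_integral_add) (auto simp: nn_integral_cmult)
  also have "?c * (\<integral>\<^sup>+z. ?h z \<partial>area)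
      \<le> ?c * ennreal (4 * (2/3 * \<delta>))"
    by (intro mult_left_mono nn_integral_inverse_dist) (use d in auto)
  also have "\<dots> = ennreal (144 / \<delta>\<^sup>2 * (3 * \<delta>) * (4 * (2/3 * \<delta>))) * I"
    using d by (subst ennreal_mult, simp, simp)+ (simp add: mult_ac)
  also have "144 / \<delta>\<^sup>2 * (3 * \<delta>) * (4 * (2/3 * \<delta>)) = 1152" using d by (simp add: field_simps power2_eq_square)
  \<comment> \<open>On \<open>B\<close> one has \<open>kd a z \<le> 3\<delta>\<close> and \<open>1 - |z| \<ge> \<delta>/6\<close>, hence \<open>poi a z \<ge> 1/54\<close>.\<close>
  also have "I \<le> ennreal 54 * (\<integral>\<^sup>+z. ?P z \<partial>area)"
    unfolding I_def
  proof (subst nn_integral_cmult[symmetric], measurable, rule nn_integral_mono)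
    fix z
    show "dsq f z * indicator B z \<le> ennreal 54 * ?P z"
    proof (cases "z \<in> B \<and> z \<in> disc")
      case True
      then have z: "cmod (z - a) < 5/6 * \<delta>" "z \<in> disc" by (auto simp: B_def dist_norm norm_minus_commute)
      have "kd a z \<le> 2 * \<delta> + cmod (z - a)" using kd_le[of a z] a z(2) by (simp add: \<delta>_def norm_minus_commute)
      then have k: "kd a z \<le> 3 * \<delta>" using z d by simp
      have "cmod z \<le> cmod a + cmod (z - a)" by (rule norm_triangle_sub)
      then have dz: "\<delta> / 6 \<le> 1 - cmod z" using z(1) unfolding \<delta>_def by simp
      have "1 / 54 = \<delta> * (\<delta> / 6) / (3 * \<delta>)\<^sup>2" using d by (simp add: power2_eq_square)
      also have "\<dots> \<le> poi a z" unfolding poi_def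
      proof (intro frac_le mult_mono power_mono)
        have "(cmod a)\<^sup>2 \<le> cmod a * 1" unfolding power2_eq_square using a by (intro mult_left_mono) auto
        then show "\<delta> \<le> 1 - (cmod a)\<^sup>2" by (simp add: \<delta>_def)
        have "(cmod z)\<^sup>2 \<le> cmod z * 1" unfolding power2_eq_square using z(2) by (intro mult_left_mono) auto
        then show "\<delta> / 6 \<le> 1 - (cmod z)\<^sup>2" using dz by simp
        show "0 < (kd a z)\<^sup>2" using kd_pos[OF a z(2)] by simp
      qed (use d k a z in \<open>auto simp: abs_square_le_1 power_le_one\<close>)
      also have "poi a z powr 1 \<le> poi a z powr p" using poi_involution[OF a z(2)] p
        by (intro powr_mono') auto
      then have "poi a z \<le> poi a z powr p" using poi_involution[OF a z(2)] by simp
      finally have "1 \<le> 54 * poi a z powr p" by simp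
      then have "dsq f z * 1 \<le> dsq f z * ennreal (54 * poi a z powr p)"
        by (intro mult_left_mono) (auto simp: ennreal_ge_1)
      then show ?thesis using True by (simp add: ennreal_mult mult_ac)
    qed (auto simp: dsq_def split: split_indicator)
  qed
  finally have "(\<integral>\<^sup>+z. ?G z \<partial>area) \<le>
     ennreal 4 * (\<integral>\<^sup>+z. ?P z \<partial>area) +
     ennreal 1152 * (ennreal 54 * (\<integral>\<^sup>+z. ?P z \<partial>area))"
    by (simp add: mult_left_mono)
  also have "\<dots> = ennreal (4 + 1152 * 54) * (\<integral>\<^sup>+z. ?P z \<partial>area)"
  proof -
    have e1: "ennreal 1152 * ennreal 54 = ennreal (1152 * 54)" by (subst ennreal_mult[symmetric]) auto
    have e2: "ennreal 4 + ennreal (1152 * 54) = ennreal (4 + 1152 * 54)" by (subst ennreal_plus[symmetric]) auto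
    show ?thesis unfolding e2[symmetric] e1[symmetric] by (simp only: distrib_right mult.assoc)
  qed
  also have "\<dots> \<le> ennreal 100000 * (\<integral>\<^sup>+z. ?P z \<partial>area)"
    by (intro mult_right_mono ennreal_leI) auto
  finally show ?thesis .
qed

section \<open>Arcs\<close>

lemma cis_inj_short:
  assumes "cis x = cis y" "\<bar>x - y\<bar> < 2 * pi"
  shows "x = y"
proof -
  have "sin x = sin y \<and> cos x = cos y" using assms(1) by (simp add: complex_eq_iff)
  then obtain n :: int where n: "x = y + 2 * pi * n" using sin_cos_eq_iff[of x y] by auto
  have "2 * pi * real_of_int n < 2 * pi * 1" "2 * pi * (-1) < 2 * pi * real_of_int n"
    using assms(2) n by linarith+
  then have "real_of_int n < 1" "-1 < real_of_int n"
    by (simp_all only: mult_less_cancel_left_pos pi_gt_zero mult_pos_pos zero_less_numeral)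
  then show "x = y" using n by simp
qed

lemma inj_on_cis_period: "inj_on cis {0..<2*pi}"
  by (auto intro!: inj_onI cis_inj_short)

text \<open>
  The parameter interval \<open>{0..<2 * pi}\<close> in the definition of \<open>arc_len\<close> cuts an arc that passes
  through \<open>1\<close>, so the part of \<open>X\<close> beyond \<open>2 * pi\<close> has to be moved back.
\<close>

lemma measure_cis_image:
  assumes X: "X \<subseteq> {0..<4 * pi}" "X \<in> sets borel" and inj: "inj_on cis X"
  shows "measure lborel {t\<in>{0..<2 * pi}. cis t \<in> cis ` X} = measure lborel X"
proof -
  let ?A = "X \<inter> {0..<2*pi}" and ?B = "X \<inter> {2*pi..<4*pi}"
  let ?B' = "(\<lambda>t. t - 2*pi) ` ?B"
  have sh: "?B' = (\<lambda>t. 2*pi + t) -` ?B" by force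
  have [measurable]: "?A \<in> sets borel" "?B \<in> sets borel" using X by auto
  have B'm [measurable]: "?B' \<in> sets borel" unfolding sh
    using measurable_sets[of "\<lambda>t::real. 2*pi + t" borel borel ?B] by simp
  have sub: "emeasure lborel S < \<infinity>" if "S \<subseteq> {0..4*pi}" "S \<in> sets borel" for S :: "real set"
    using emeasure_mono[OF that(1), of lborel] by (auto intro: le_less_trans)
  have mB: "emeasure lborel ?B' = emeasure lborel ?B"
  proof -
    have "emeasure lborel ?B = emeasure (distr lborel borel ((+) (2*pi))) ?B" by (simp add: lborel_distr_plus)
    also have "\<dots> = emeasure lborel ((+) (2*pi) -` ?B)" by (subst emeasure_distr) auto
    finally show ?thesis by (simp add: sh)
  qed
  have cis2: "cis (t - 2*pi) = cis t" for t
    using cis_divide[of t "2*pi"] by simp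
  have eq: "{t\<in>{0..<2 * pi}. cis t \<in> cis ` X} = ?A \<union> ?B'"
  proof (intro equalityI subsetI)
    fix t assume "t \<in> {t\<in>{0..<2 * pi}. cis t \<in> cis ` X}"
    then obtain x where t: "0 \<le> t" "t < 2*pi" "x \<in> X" "cis t = cis x" by auto
    show "t \<in> ?A \<union> ?B'"
    proof (cases "x < 2*pi")
      case True
      then have "t = x"
        using t X(1) by (intro inj_onD[OF inj_on_cis_period]) auto
      then show ?thesis using t by auto
    next
      case False
      then have "cis t = cis (x - 2*pi)" using t cis2 by simp
      then have "t = x - 2*pi"
        using t X(1) False by (intro inj_onD[OF inj_on_cis_period]) auto
      then show ?thesis using t False X(1) by auto
    qed
  next
    fix t assume "t \<in> ?A \<union> ?B'"
    then show "t \<in> {t\<in>{0..<2 * pi}. cis t \<in> cis ` X}" using cis2 by auto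
  qed
  have disj: "?A \<inter> ?B' = {}"
  proof (rule ccontr)
    assume "?A \<inter> ?B' \<noteq> {}"
    then obtain t where "t \<in> ?A" "t \<in> ?B'" by blast
    then have "t \<in> X" "t < 2*pi" "t + 2*pi \<in> X" by auto
    moreover have "cis (t + 2*pi) = cis t" using cis2[of "t + 2*pi"] by simp
    ultimately have "t + 2*pi = t" using inj by (auto dest: inj_onD)
    then show False by simp
  qed
  have XAB: "X = ?A \<union> ?B" using X by auto
  have "emeasure lborel (?A \<union> ?B') = emeasure lborel ?A + emeasure lborel ?B'"
    by (rule plus_emeasure[symmetric]) (use disj in auto)
  also have "\<dots> = emeasure lborel ?A + emeasure lborel ?B" by (simp add: mB)
  also have "\<dots> = emeasure lborel (?A \<union> ?B)"
    by (rule plus_emeasure) auto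
  finally show ?thesis unfolding eq using XAB by (simp add: measure_def)
qed

lemma cis_add_2pi_int: "cis (t - 2 * pi * of_int n) = cis t"
  using cis_divide[of t "2 * pi * of_int n"] by simp

lemma arc_len_cis_image:
  assumes X: "X = {a..<b} \<or> X = {a<..b}" and ab: "a < b" "b \<le> a + 2 * pi"
  shows "arc_len (cis ` X) = (b - a) / (2 * pi)"
proof -
  define n where "n = \<lfloor>a / (2 * pi)\<rfloor>"
  have n: "of_int n \<le> a / (2 * pi)" "a / (2 * pi) < of_int n + 1" by (auto simp: n_def)
  have a': "2 * pi * of_int n \<le> a" "a < 2 * pi * of_int n + 2 * pi"
    using n by (auto simp: field_simps)
  let ?s = "\<lambda>t. t - 2 * pi * of_int n"
  define Y where "Y = ?s ` X"
  have Y: "Y = {?s a..<?s b} \<or> Y = {?s a<..?s b}"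
  proof -
    have "Y = {t. t + 2 * pi * of_int n \<in> X}" unfolding Y_def by force
    then show ?thesis using X by auto
  qed
  have "cis ` X = cis ` Y" unfolding Y_def image_image cis_add_2pi_int ..
  moreover have "inj_on cis Y"
  proof (rule inj_onI)
    fix x y assume "x \<in> Y" "y \<in> Y" "cis x = cis y"
    then show "x = y" using Y ab by (intro cis_inj_short) auto
  qed
  moreover have "Y \<subseteq> {0..<4*pi}" using Y a' ab by auto
  moreover have "Y \<in> sets borel" using Y by auto
  ultimately have "measure lborel {t\<in>{0..<2 * pi}. cis t \<in> cis ` X} = measure lborel Y"
    using measure_cis_image[of Y] by simp
  also have "\<dots> = b - a" using Y ab by auto
  finally show ?thesis by (simp add: arc_len_def)
qed

lemma norm_cis_diff_le: "cmod (cis s - cis t) \<le> \<bar>s - t\<bar>"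
proof -
  have "(cmod (cis s - cis t))\<^sup>2 = (cos s - cos t)\<^sup>2 + (sin s - sin t)\<^sup>2" by (simp add: cmod_power2)
  also have "\<dots> = ((cos s)\<^sup>2 + (sin s)\<^sup>2) + ((cos t)\<^sup>2 + (sin t)\<^sup>2) - 2 * (cos s * cos t + sin s * sin t)"
    by (simp add: power2_eq_square algebra_simps)
  also have "\<dots> = 2 - 2 * cos (s - t)" by (simp add: cos_diff)
  also have "\<dots> = 4 * (sin ((s - t) / 2))\<^sup>2" using cos_double_sin[of "(s - t) / 2"]
      by (simp only: mult.assoc[symmetric] mult_2 field_sum_of_halves)
  also have "\<dots> \<le> 4 * ((s - t) / 2)\<^sup>2"
    by (intro mult_left_mono iffD1[OF abs_le_square_iff] abs_sin_x_le_abs_x) simp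
  also have "\<dots> = \<bar>s - t\<bar>\<^sup>2" by (simp add: power2_eq_square)
  finally show ?thesis by (rule power2_le_imp_le) simp
qed

text \<open>
  Midpoints are chosen by the two properties that matter, since for the full circle the endpoints
  are not determined by the set: rotating the midpoint by less than \<open>pi |I|\<close>, half the angular
  length, stays in the arc, and the arc lies within \<open>pi |I|\<close> of it.
\<close>

definition arc_mid :: "complex set \<Rightarrow> complex" where
  "arc_mid I = (SOME u. cmod u = 1 \<and> (\<forall>\<theta>. \<bar>\<theta>\<bar> < pi * arc_len I \<longrightarrow> u * cis \<theta> \<in> I) \<and>
     (\<forall>v\<in>I. cmod (v - u) \<le> pi * arc_len I))"

lemma arc_mid:
  assumes "half_open_arc I"
  shows "cmod (arc_mid I) = 1" "\<And>\<theta>. \<bar>\<theta>\<bar> < pi * arc_len I \<Longrightarrow> arc_mid I * cis \<theta> \<in> I"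
    "\<And>v. v \<in> I \<Longrightarrow> cmod (v - arc_mid I) \<le> pi * arc_len I"
proof -
  obtain a b X where X: "X = {a..<b} \<or> X = {a<..b}" and ab: "a < b" "b \<le> a + 2 * pi" and I: "I = cis ` X"
    using assms unfolding half_open_arc_def by blast
  have L: "pi * arc_len I = (b - a) / 2" using arc_len_cis_image[OF X ab] I by simp
  let ?P = "\<lambda>u. cmod u = 1 \<and> (\<forall>\<theta>. \<bar>\<theta>\<bar> < pi * arc_len I \<longrightarrow> u * cis \<theta> \<in> I) \<and>
     (\<forall>v\<in>I. cmod (v - u) \<le> pi * arc_len I)"
  have "?P (cis ((a + b) / 2))"
  proof (intro conjI allI impI ballI)
    fix \<theta> assume "\<bar>\<theta>\<bar> < pi * arc_len I"
    then have "(a + b) / 2 + \<theta> \<in> X" unfolding L using X by (auto simp: abs_less_iff field_simps)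
    then show "cis ((a + b) / 2) * cis \<theta> \<in> I" unfolding cis_mult I by (rule imageI)
  next
    fix v assume "v \<in> I"
    then obtain t where t: "t \<in> X" "v = cis t" using I by auto
    have "\<bar>t - (a + b) / 2\<bar> \<le> (b - a) / 2" using t X by (auto simp: abs_le_iff field_simps)
    then show "cmod (v - cis ((a + b) / 2)) \<le> pi * arc_len I"
      unfolding L t(2) by (rule order_trans[OF norm_cis_diff_le])
  qed simp
  then have "?P (arc_mid I)" unfolding arc_mid_def by (rule someI)
  then show "cmod (arc_mid I) = 1" "\<And>\<theta>. \<bar>\<theta>\<bar> < pi * arc_len I \<Longrightarrow> arc_mid I * cis \<theta> \<in> I"
    "\<And>v. v \<in> I \<Longrightarrow> cmod (v - arc_mid I) \<le> pi * arc_len I" by blast+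
qed

lemma half_open_arc_borel:
  assumes "half_open_arc I"
  shows "I \<in> sets borel"
proof -
  obtain a b where "I = cis ` {a..<b} \<or> I = cis ` {a<..b}"
    using assms unfolding half_open_arc_def by blast
  moreover have "cis ` {a..<b} = (\<Union>n. cis ` {a..b - 1 / real (Suc n)})"
  proof -
    have "{a..<b} = (\<Union>n. {a..b - 1 / real (Suc n)})"
    proof (intro equalityI subsetI)
      fix x assume x: "x \<in> {a..<b}"
      then obtain n :: nat where "1 / Suc n < b - x" using nat_approx_posE[of "b - x"] by auto
      then show "x \<in> (\<Union>n. {a..b - 1 / real (Suc n)})" using x by (intro UN_I[of n]) auto
    next
      fix x assume "x \<in> (\<Union>n. {a..b - 1 / real (Suc n)})"
      then obtain n :: nat where "a \<le> x" "x \<le> b - 1 / Suc n" by auto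
      moreover have "0 < 1 / real (Suc n)" by simp
      ultimately show "x \<in> {a..<b}" unfolding atLeastLessThan_iff by linarith
    qed
    then show ?thesis by (simp add: image_UN)
  qed
  moreover have "cis ` {a<..b} = (\<Union>n. cis ` {a + 1 / real (Suc n)..b})"
  proof -
    have "{a<..b} = (\<Union>n. {a + 1 / real (Suc n)..b})"
    proof (intro equalityI subsetI)
      fix x assume x: "x \<in> {a<..b}"
      then obtain n :: nat where "1 / Suc n < x - a" using nat_approx_posE[of "x - a"] by auto
      then show "x \<in> (\<Union>n. {a + 1 / real (Suc n)..b})" using x by (intro UN_I[of n]) auto
    next
      fix x assume "x \<in> (\<Union>n. {a + 1 / real (Suc n)..b})"
      then obtain n :: nat where "x \<le> b" "a + 1 / Suc n \<le> x" by auto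
      moreover have "0 < 1 / real (Suc n)" by simp
      ultimately show "x \<in> {a<..b}" unfolding greaterThanAtMost_iff by linarith
    qed
    then show ?thesis by (simp add: image_UN)
  qed
  moreover have "cis ` {c..d} \<in> sets borel" for c d
  proof -
    have "continuous_on {c..d} cis" unfolding cis_conv_exp by (intro continuous_intros)
    then have "compact (cis ` {c..d})" by (intro compact_continuous_image) auto
    then show ?thesis by (intro borel_closed compact_imp_closed)
  qed
  ultimately show ?thesis by (auto intro!: sets.countable_UN)
qed

section \<open>Dyadic systems\<close>

text \<open>
  The generations are recovered from the arc lengths, so the system itself carries all the
  information.
\<close>

definition dyadic_level :: "complex set set \<Rightarrow> nat \<Rightarrow> complex set set" where
  "dyadic_level \<D> k = {I\<in>\<D>. arc_len I = 1 / 2 ^ k}"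

lemma dyadic_system_levels:
  assumes "dyadic_system \<D>"
  shows "\<D> = (\<Union>k. dyadic_level \<D> k)" "dyadic_level \<D> 0 = {circle}" "partition_on circle (dyadic_level \<D> k)"
    "card (dyadic_level \<D> k) = 2 ^ k" "finite (dyadic_level \<D> k)"
    "\<And>I. I \<in> dyadic_level \<D> (Suc k) \<Longrightarrow> \<exists>J\<in>dyadic_level \<D> k. I \<subseteq> J"
    "\<And>I. I \<in> \<D> \<Longrightarrow> half_open_arc I"
proof -
  obtain D :: "nat \<Rightarrow> complex set set" where D': "\<D> = (\<Union>k. D k)" "D 0 = {circle}"
    "\<forall>k. partition_on circle (D k) \<and> card (D k) = 2 ^ k \<and>
        (\<forall>I\<in>D k. half_open_arc I \<and> arc_len I = 1 / 2 ^ k)"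
    "\<forall>k. \<forall>I\<in>D (Suc k). \<exists>J\<in>D k. I \<subseteq> J"
    using assms unfolding dyadic_system_def by (elim exE conjE) (rule that)
  have D: "\<D> = (\<Union>k. D k)" "D 0 = {circle}" "partition_on circle (D k)" "card (D k) = 2 ^ k"
    "I \<in> D k \<Longrightarrow> half_open_arc I \<and> arc_len I = 1 / 2 ^ k"
    "I \<in> D (Suc k) \<Longrightarrow> \<exists>J\<in>D k. I \<subseteq> J" for k I
    using D' by simp_all
  have lev: "dyadic_level \<D> k = D k" for k
  proof (intro equalityI subsetI)
    fix I assume "I \<in> dyadic_level \<D> k"
    then obtain j where j: "I \<in> D j" "arc_len I = 1 / 2 ^ k" unfolding dyadic_level_def D(1) by blast
    then have "(2::real) ^ j = 2 ^ k" using D(5)[OF j(1)] by simp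
    then show "I \<in> D k" using j by simp
  next
    fix I assume I: "I \<in> D k"
    then have "I \<in> \<D>" unfolding D(1) by blast
    then show "I \<in> dyadic_level \<D> k" using D(5)[OF I] by (simp add: dyadic_level_def)
  qed
  show "\<D> = (\<Union>k. dyadic_level \<D> k)" "dyadic_level \<D> 0 = {circle}" "partition_on circle (dyadic_level \<D> k)"
    "card (dyadic_level \<D> k) = 2 ^ k" "\<And>I. I \<in> dyadic_level \<D> (Suc k) \<Longrightarrow> \<exists>J\<in>dyadic_level \<D> k. I \<subseteq> J"
    unfolding lev using D(1-4,6) by auto
  show "finite (dyadic_level \<D> k)" unfolding lev using D(4)[of k] by (intro card_ge_0_finite) simp
  show "half_open_arc I" if "I \<in> \<D>" for I using that D(5) unfolding D(1) by blast
qed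

lemma dyadic_mem:
  assumes "dyadic_system \<D>" "I \<in> \<D>"
  obtains k where "I \<in> dyadic_level \<D> k" "arc_len I = 1 / 2 ^ k"
proof -
  obtain k where k: "I \<in> dyadic_level \<D> k" using dyadic_system_levels(1)[OF assms(1)] assms(2) by blast
  then have "arc_len I = 1 / 2 ^ k" by (simp add: dyadic_level_def)
  then show thesis using that k by blast
qed

lemma dyadic_arc:
  assumes D: "dyadic_system \<D>" and I: "I \<in> \<D>"
  shows "half_open_arc I" "I \<subseteq> circle" "I \<noteq> {}" "0 < arc_len I" "arc_len I \<le> 1"
proof -
  obtain k where k: "I \<in> dyadic_level \<D> k" "arc_len I = 1 / 2 ^ k" using dyadic_mem[OF D I] .
  show "half_open_arc I" using dyadic_system_levels(7)[OF D I] .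
  have "partition_on circle (dyadic_level \<D> k)" using dyadic_system_levels(3)[OF D] .
  then show "I \<subseteq> circle" "I \<noteq> {}" using k(1) unfolding partition_on_def by auto
  show "0 < arc_len I" "arc_len I \<le> 1" unfolding k(2) by auto
qed

lemma dyadic_ancestor:
  assumes D: "dyadic_system \<D>" and "I \<in> dyadic_level \<D> k" "j \<le> k"
  shows "\<exists>J\<in>dyadic_level \<D> j. I \<subseteq> J"
  using assms(3,2)
proof (induction arbitrary: I rule: dec_induct)
  case (step n)
  obtain J where J: "J \<in> dyadic_level \<D> n" "I \<subseteq> J" using dyadic_system_levels(6)[OF D step.prems] by auto
  then show ?case using step.IH[OF J(1)] by blast
qed auto

lemma dyadic_level_disjoint:
  assumes D: "dyadic_system \<D>" and "I \<in> dyadic_level \<D> k" "J \<in> dyadic_level \<D> k" "x \<in> I" "x \<in> J"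
  shows "I = J"
  using dyadic_system_levels(3)[OF D, of k] assms(2-) unfolding partition_on_def disjoint_def by blast

lemma dyadic_nested:
  assumes D: "dyadic_system \<D>" and I: "I \<in> dyadic_level \<D> k" and J: "J \<in> dyadic_level \<D> j"
    and x: "x \<in> I" "x \<in> J" and jk: "j \<le> k"
  shows "I \<subseteq> J"
proof -
  obtain J' where J': "J' \<in> dyadic_level \<D> j" "I \<subseteq> J'" using dyadic_ancestor[OF D I jk] by auto
  then have "J' = J" using dyadic_level_disjoint[OF D J'(1) J] x by auto
  then show ?thesis using J' by simp
qed

text \<open>
  Two arcs that meet are nested, since an arc is contained in an arc of every coarser
  generation.
\<close>

lemma dyadic_laminar:
  assumes D: "dyadic_system \<D>" and "I \<in> \<D>" "J \<in> \<D>"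
  shows "I \<inter> J = {} \<or> I \<subseteq> J \<or> J \<subseteq> I"
proof -
  obtain k where k: "I \<in> dyadic_level \<D> k" using dyadic_mem[OF D assms(2)] .
  obtain j where j: "J \<in> dyadic_level \<D> j" using dyadic_mem[OF D assms(3)] .
  show ?thesis using dyadic_nested[OF D k j] dyadic_nested[OF D j k] nat_le_linear by blast
qed

lemma dyadic_subset_level:
  assumes D: "dyadic_system \<D>" and I: "I \<in> dyadic_level \<D> k" and J: "J \<in> dyadic_level \<D> j" and sub: "I \<subseteq> J"
  shows "j \<le> k"
proof (rule ccontr)
  assume "\<not> j \<le> k"
  then have kj: "k \<le> j" "k \<noteq> j" by auto
  have "I \<in> \<D>" using I by (simp add: dyadic_level_def)
  then obtain x where x: "x \<in> I" using dyadic_arc(3)[OF D] by blast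
  then have "J \<subseteq> I" using dyadic_nested[OF D J I _ x kj(1)] sub by blast
  then have "I = J" using sub by blast
  then have "(2::real) ^ k = 2 ^ j" using I J by (simp add: dyadic_level_def)
  then show False using kj(2) by simp
qed

lemma dyadic_arc_len_mono:
  assumes D: "dyadic_system \<D>" and "I \<in> \<D>" "J \<in> \<D>" "I \<subseteq> J"
  shows "arc_len I \<le> arc_len J"
proof -
  obtain k where k: "I \<in> dyadic_level \<D> k" "arc_len I = 1 / 2 ^ k" using dyadic_mem[OF D assms(2)] .
  obtain j where j: "J \<in> dyadic_level \<D> j" "arc_len J = 1 / 2 ^ j" using dyadic_mem[OF D assms(3)] .
  have "j \<le> k" by (rule dyadic_subset_level[OF D k(1) j(1) assms(4)])
  then have "(2::real) ^ j \<le> 2 ^ k" by (intro power_increasing) auto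
  then show ?thesis unfolding k(2) j(2) by (intro divide_left_mono) auto
qed

abbreviation above :: "'a set set \<Rightarrow> 'a set \<Rightarrow> 'a set set" where
  "above \<D> I \<equiv> {J\<in>\<D>. I \<subseteq> J}"

abbreviation below :: "'a set set \<Rightarrow> 'a set \<Rightarrow> 'a set set" where
  "below E J \<equiv> {I\<in>E. I \<subseteq> J}"

lemma dyadic_finite_ancestors:
  assumes D: "dyadic_system \<D>" and I: "I \<in> \<D>"
  shows "finite (above \<D> I)"
proof -
  obtain k where k: "I \<in> dyadic_level \<D> k" using dyadic_mem[OF D I] .
  have "(above \<D> I) \<subseteq> (\<Union>j\<in>{..k}. dyadic_level \<D> j)"
  proof
    fix J assume J: "J \<in> (above \<D> I)"
    then have JD: "J \<in> \<D>" "I \<subseteq> J" by auto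
    obtain j where j: "J \<in> dyadic_level \<D> j" using dyadic_mem[OF D JD(1)] .
    show "J \<in> (\<Union>j\<in>{..k}. dyadic_level \<D> j)" using dyadic_subset_level[OF D k j JD(2)] j by auto
  qed
  then show ?thesis by (rule finite_subset) (use dyadic_system_levels(5)[OF D] in auto)
qed

lemma dyadic_countable:
  assumes D: "dyadic_system \<D>"
  shows "countable \<D>"
  using dyadic_system_levels(1,5)[OF D] by (metis countable_UN countable_finite countableI_type)

lemma dyadic_infinite:
  assumes D: "dyadic_system \<D>"
  shows "infinite \<D>"
proof
  assume fin: "finite \<D>"
  have "(\<lambda>k. 1 / (2::real) ^ k) ` UNIV \<subseteq> arc_len ` \<D>"
  proof
    fix y assume "y \<in> (\<lambda>k. 1 / (2::real) ^ k) ` UNIV"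
    then obtain k :: nat where k: "y = 1 / 2 ^ k" by auto
    have "card (dyadic_level \<D> k) \<noteq> 0" using dyadic_system_levels(4)[OF D, of k] by simp
    then obtain I where "I \<in> dyadic_level \<D> k" by fastforce
    then show "y \<in> arc_len ` \<D>" unfolding k dyadic_level_def by force
  qed
  then have "finite ((\<lambda>k::nat. 1 / (2::real) ^ k) ` UNIV)" using fin by (metis finite_imageI finite_subset)
  moreover have "inj (\<lambda>k::nat. 1 / (2::real) ^ k)" by (rule injI) simp
  ultimately show False using finite_imageD by blast
qed

lemma circle_eq_cis: "circle = cis ` {0..<2 * pi}"
proof (intro equalityI subsetI)
  fix z assume "z \<in> circle"
  then have "cmod z = 1" by simp
  then have "z = cis (Arg2pi z)" using Arg2pi[of z] by (simp add: cis_conv_exp is_Arg_def)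
  moreover have "Arg2pi z \<in> {0..<2*pi}" using Arg2pi[of z] by simp
  ultimately show "z \<in> cis ` {0..<2*pi}" by blast
qed auto

text \<open>
  The standard dyadic arcs. The smallness of the gauge is a statement about all dyadic systems, and
  the sufficiency argument needs one in which to apply it.
\<close>

lemma dyadic_system_exists: "\<exists>\<D>. dyadic_system \<D>"
proof -
  define I where "I k j = {2 * pi * real j / 2 ^ k ..< 2 * pi * real (Suc j) / 2 ^ k}" for k j :: nat
  define A where "A k j = cis ` I k j" for k j
  define D where "D k = A k ` {..<2 ^ k}" for k :: nat
  have mem: "t \<in> I k j \<longleftrightarrow> real j \<le> t * 2 ^ k / (2 * pi) \<and> t * 2 ^ k / (2 * pi) < real (Suc j)" for t k j
    unfolding I_def atLeastLessThan_iff by (simp add: field_simps)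
  have mem': "t \<in> I k j \<longleftrightarrow> \<lfloor>t * 2 ^ k / (2 * pi)\<rfloor> = int j" for t k j
    unfolding mem floor_eq_iff by (simp add: add.commute)
  have sub: "I k j \<subseteq> {0..<2*pi}" if "j < 2 ^ k" for k j
  proof
    fix t assume t: "t \<in> I k j"
    have "real (Suc j) \<le> 2 ^ k" using that by (metis Suc_leI of_nat_le_iff of_nat_numeral of_nat_power)
    then have b: "0 \<le> t * 2 ^ k / (2 * pi)" "t * 2 ^ k / (2 * pi) < 2 ^ k" using t mem[of t k j] by linarith+
    define c :: real where "c = 2 ^ k / (2 * pi)"
    have c: "0 < c" "t * 2 ^ k / (2 * pi) = t * c" "2 ^ k = 2 * pi * c" by (auto simp: c_def)
    have "0 \<le> t" using b(1) c(1) unfolding c(2) by (simp add: zero_le_mult_iff)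
    moreover have "t < 2 * pi" using b(2) c(1) unfolding c(2) unfolding c(3)
        by (simp only: mult_less_cancel_right_pos)
    ultimately show "t \<in> {0..<2*pi}" by simp
  qed
  have ne: "I k j \<noteq> {}" for k j
  proof -
    have "2 * pi * real j / 2 ^ k \<in> I k j" unfolding I_def by (simp add: divide_strict_right_mono)
    then show ?thesis by blast
  qed
  have disj: "i = j" if ij: "i < 2 ^ k" "j < 2 ^ k" "x \<in> A k i" "x \<in> A k j" for i j k x
  proof -
    obtain s t where st: "s \<in> I k i" "t \<in> I k j" "cis s = x" "cis t = x" using ij by (auto simp: A_def)
    have "s = t" by (rule inj_onD[OF inj_on_cis_period]) (use st sub[OF ij(1)] sub[OF ij(2)] in auto)
    then show ?thesis using st(1,2) unfolding mem' by simp
  qed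
  have union: "\<Union>(D k) = circle" for k
  proof (intro equalityI subsetI)
    fix x assume "x \<in> \<Union>(D k)"
    then show "x \<in> circle" by (auto simp: D_def A_def)
  next
    fix x assume "x \<in> circle"
    then obtain t where t: "0 \<le> t" "t < 2*pi" "x = cis t" unfolding circle_eq_cis by auto
    define j where "j = nat \<lfloor>t * 2 ^ k / (2 * pi)\<rfloor>"
    have pos: "0 \<le> t * 2 ^ k / (2 * pi)" using t by simp
    then have "t \<in> I k j" unfolding mem' j_def by simp
    moreover have "j < 2 ^ k"
    proof -
      have "t * 2 ^ k / (2 * pi) < 2 ^ k" using t by (simp add: field_simps)
      then have "\<lfloor>t * 2 ^ k / (2 * pi)\<rfloor> < 2 ^ k" by (simp add: floor_less_iff)
      then show ?thesis unfolding j_def by (simp add: nat_less_iff pos)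
    qed
    ultimately show "x \<in> \<Union>(D k)" using t(3) by (auto simp: D_def A_def)
  qed
  have part: "partition_on circle (D k)" for k
    unfolding partition_on_def disjoint_def union
  proof (intro conjI refl ballI impI)
    fix X Y assume "X \<in> D k" "Y \<in> D k" "X \<noteq> Y"
    then show "X \<inter> Y = {}" unfolding D_def using disj by blast
  next
    show "{} \<notin> D k" using ne by (auto simp: D_def A_def)
  qed
  have card: "card (D k) = 2 ^ k" for k
  proof -
    have "inj_on (A k) {..<2 ^ k}"
    proof (rule inj_onI)
      fix i j assume ij: "i \<in> {..<2 ^ k}" "j \<in> {..<2 ^ k}" "A k i = A k j"
      obtain x where "x \<in> A k i" using ne[of k i] by (auto simp: A_def)
      then show "i = j" using disj[of i k j x] ij by auto
    qed
    then show ?thesis by (simp add: D_def card_image)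
  qed
  have arc: "half_open_arc X \<and> arc_len X = 1 / 2 ^ k" if X: "X \<in> D k" for X k
  proof -
    obtain j where j: "X = A k j" using X by (auto simp: D_def)
    let ?a = "2 * pi * real j / 2 ^ k" and ?b = "2 * pi * real (Suc j) / 2 ^ k"
    have ba: "?b - ?a = 2 * pi / 2 ^ k" by (simp add: field_simps)
    have "1 \<le> (2::real) ^ k" by simp
    then have "2 * pi / 2 ^ k \<le> 2 * pi / 1" "0 < 2 * pi / 2 ^ k" by (intro divide_left_mono) auto
    then have ab: "?a < ?b" "?b \<le> ?a + 2 * pi" using ba by linarith+
    have "half_open_arc X" unfolding half_open_arc_def j A_def I_def using ab by blast
    moreover have "arc_len X = (?b - ?a) / (2 * pi)"
      unfolding j A_def I_def by (rule arc_len_cis_image) (use ab in auto)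
    ultimately show ?thesis unfolding ba by simp
  qed
  have nest: "\<exists>Y\<in>D k. X \<subseteq> Y" if X: "X \<in> D (Suc k)" for X k
  proof -
    obtain j where j: "X = A (Suc k) j" "j < 2 ^ Suc k" using X by (auto simp: D_def)
    have "I (Suc k) j \<subseteq> I k (j div 2)"
    proof
      fix t assume "t \<in> I (Suc k) j"
      moreover define q where "q = t * 2 ^ k / (2 * pi)"
      have q2: "t * 2 ^ Suc k / (2 * pi) = q * 2" by (simp add: q_def)
      ultimately have "real j \<le> q * 2" "q * 2 < real j + 1"
        unfolding mem q2 by simp_all
      moreover have "2 * real (j div 2) \<le> real j" "real j + 1 \<le> 2 * real (j div 2) + 2" by linarith+
      ultimately have "real (j div 2) \<le> q" "q < real (Suc (j div 2))" by linarith+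
      then show "t \<in> I k (j div 2)" unfolding mem q_def by simp
    qed
    then have "X \<subseteq> A k (j div 2)" unfolding j A_def by (rule image_mono)
    moreover have "A k (j div 2) \<in> D k" using j(2) by (auto simp: D_def)
    ultimately show ?thesis by blast
  qed
  have D0: "D 0 = {circle}"
    unfolding circle_eq_cis by (auto simp: D_def A_def I_def)
  have "dyadic_system (\<Union>k. D k)"
    unfolding dyadic_system_def
  proof (intro exI[of _ D] conjI allI ballI)
    show "D 0 = {circle}" by (rule D0)
    show "partition_on circle (D k)" for k by (rule part)
    show "card (D k) = 2 ^ k" for k by (rule card)
    show "half_open_arc X" "arc_len X = 1 / 2 ^ k" if "X \<in> D k" for X k using arc[OF that] by auto
    show "\<exists>Y\<in>D k. X \<subseteq> Y" if "X \<in> D (Suc k)" for X k by (rule nest[OF that])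
  qed simp
  then show ?thesis by blast
qed

section \<open>Upper halves of Carleson boxes\<close>

lemma Q_up_iff:
  assumes D: "dyadic_system \<D>" and I: "I \<in> \<D>"
  shows "z \<in> Q_up I \<longleftrightarrow> 1 - arc_len I \<le> cmod z \<and> cmod z < 1 - arc_len I / 2 \<and> (z = 0 \<or> sgn z \<in> I)"
proof
  assume "z \<in> Q_up I"
  then obtain r w where rw: "z = of_real r * w" "w \<in> I" "1 - arc_len I \<le> r" "r < 1 - arc_len I / 2"
    unfolding Q_up_def by blast
  have w: "cmod w = 1" using rw(2) dyadic_arc(2)[OF D I] by auto
  have "0 \<le> r" using rw dyadic_arc(5)[OF D I] by linarith
  then have "cmod z = r" "z \<noteq> 0 \<Longrightarrow> sgn z = w" using rw(1) w
      by (auto simp: norm_mult sgn_div_norm sgn_mult scaleR_conv_of_real)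
  then show "1 - arc_len I \<le> cmod z \<and> cmod z < 1 - arc_len I / 2 \<and> (z = 0 \<or> sgn z \<in> I)" using rw(2-4) by auto
next
  assume *: "1 - arc_len I \<le> cmod z \<and> cmod z < 1 - arc_len I / 2 \<and> (z = 0 \<or> sgn z \<in> I)"
  obtain v where v: "v \<in> I" using dyadic_arc(3)[OF D I] by blast
  show "z \<in> Q_up I"
  proof (cases "z = 0")
    case True
    then have "z = of_real 0 * v" by simp
    then show ?thesis unfolding Q_up_def using * v True by fastforce
  next
    case False
    then have "z = of_real (cmod z) * sgn z" by (simp add: sgn_div_norm scaleR_conv_of_real)
    then show ?thesis unfolding Q_up_def using * False by blast
  qed
qed

lemma Q_up_borel:
  assumes D: "dyadic_system \<D>" and I: "I \<in> \<D>"
  shows "Q_up I \<in> sets borel"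
proof -
  have [measurable]: "I \<in> sets borel" by (rule half_open_arc_borel[OF dyadic_arc(1)[OF D I]])
  have "(sgn :: complex \<Rightarrow> complex) \<in> borel_measurable borel"
    unfolding sgn_div_norm[abs_def] by measurable
  then have [measurable]: "sgn -` I \<in> sets (borel :: complex measure)"
    using measurable_sets[of "sgn :: complex \<Rightarrow> complex" borel borel I] by simp
  have "Q_up I = {z. 1 - arc_len I \<le> cmod z} \<inter> {z. cmod z < 1 - arc_len I / 2} \<inter> ({0} \<union> sgn -` I)"
    using Q_up_iff[OF D I] by auto
  then show ?thesis by simp
qed

lemma Q_up_disjoint:
  assumes D: "dyadic_system \<D>" and I: "I \<in> \<D>" and J: "J \<in> \<D>" and z: "z \<in> Q_up I" "z \<in> Q_up J"
  shows "I = J"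
proof -
  obtain k where k: "I \<in> dyadic_level \<D> k" "arc_len I = 1 / 2 ^ k" using dyadic_mem[OF D I] .
  obtain j where j: "J \<in> dyadic_level \<D> j" "arc_len J = 1 / 2 ^ j" using dyadic_mem[OF D J] .
  have le: "j \<le> k" if "1 / (2::real) ^ k / 2 < 1 / 2 ^ j" for j k :: nat
  proof -
    have "(2::real) ^ j < 2 ^ Suc k" using that by (simp add: field_simps)
    then have "j < Suc k" by (rule power_less_imp_less_exp[rotated]) simp
    then show ?thesis by simp
  qed
  have b: "1 - 1 / 2 ^ k \<le> cmod z" "cmod z < 1 - 1 / 2 ^ k / 2" "1 - 1 / 2 ^ j
      \<le> cmod z" "cmod z < 1 - 1 / 2 ^ j / 2"
    using z Q_up_iff[OF D I, of z] Q_up_iff[OF D J, of z] unfolding k(2) j(2) by auto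
  then have "1 / (2::real) ^ k / 2 < 1 / 2 ^ j" "1 / (2::real) ^ j / 2 < 1 / 2 ^ k" by linarith+
  then have "j \<le> k" "k \<le> j" by (auto intro: le)
  then have jk: "j = k" by simp
  show ?thesis
  proof (cases "z = 0")
    case True
    then have "1 - 1 / (2::real) ^ k \<le> 0" using b(1) by simp
    then have "(2::real) ^ k \<le> 1" by (simp add: field_simps)
    moreover have "1 < (2::real) ^ k" if "k \<noteq> 0" using that by (intro one_less_power) auto
    ultimately have "k = 0" by fastforce
    then show ?thesis using k j jk dyadic_system_levels(2)[OF D] by auto
  next
    case False
    then show ?thesis using dyadic_level_disjoint[OF D k(1) j(1)[unfolded jk], of "sgn z"] z Q_up_iff[OF D I]
        Q_up_iff[OF D J] by auto
  qed
qed

lemma Q_up_cover: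
  assumes D: "dyadic_system \<D>" and z: "z \<in> disc"
  shows "\<exists>I\<in>\<D>. z \<in> Q_up I"
proof -
  have z1: "0 < 1 - cmod z" using z by simp
  obtain k where k: "2 ^ k * (1 - cmod z) \<le> 1" "1 < 2 ^ Suc k * (1 - cmod z)"
    using dyadic_scale_above[OF z1, of 1] by auto
  have kb: "1 - 1 / 2 ^ k \<le> cmod z" "cmod z < 1 - 1 / 2 ^ k / 2" using k by (auto simp: field_simps)
  have part: "\<Union>(dyadic_level \<D> k) = circle" using dyadic_system_levels(3)[OF D, of k]
      by (simp add: partition_on_def)
  define v where "v = (if z = 0 then 1 else sgn z)"
  have "v \<in> circle" by (simp add: v_def norm_sgn)
  then obtain I where I: "I \<in> dyadic_level \<D> k" "v \<in> I" using part by blast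
  then have ID: "I \<in> \<D>" "arc_len I = 1 / 2 ^ k" by (auto simp: dyadic_level_def)
  then have "z \<in> Q_up I" unfolding Q_up_iff[OF D ID(1)] using kb I(2) unfolding v_def by (auto split: if_splits)
  then show ?thesis using ID by blast
qed

lemma abs_arctan_le: "\<bar>arctan x\<bar> \<le> \<bar>x\<bar>"
proof -
  have pos: "arctan x \<le> x" if "0 \<le> x" for x :: real
  proof -
    have "0 - arctan 0 \<le> x - arctan x"
    proof (rule DERIV_nonneg_imp_nondecreasing[OF that])
      fix y :: real
      have "((\<lambda>x. x - arctan x) has_real_derivative 1 - inverse (1 + y\<^sup>2)) (at y)"
        by (intro derivative_intros DERIV_arctan)
      moreover have "0 \<le> 1 - inverse (1 + y\<^sup>2)" by (simp add: inverse_le_1_iff)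
      ultimately show "\<exists>z. ((\<lambda>x. x - arctan x) has_real_derivative z) (at y) \<and> 0 \<le> z" by blast
    qed
    then show ?thesis by simp
  qed
  show ?thesis
  proof (cases "0 \<le> x")
    case False
    then show ?thesis using pos[of "-x"] by (simp add: arctan_minus)
  qed (use pos in simp)
qed

text \<open>
  The centre of \<open>Q_up I\<close>, at distance \<open>3|I|/4\<close> from the circle.
\<close>

definition arc_pt :: "complex set \<Rightarrow> complex" where
  "arc_pt I = of_real (1 - 3 * arc_len I / 4) * arc_mid I"

text \<open>
  The set \<open>Q_up I\<close> is a fat set of size \<open>|I|\<close>: it contains a ball of radius \<open>|I|/8\<close>
  around its centre and is contained in one of radius \<open>4|I|\<close>.
\<close>

lemma arc_pt:
  assumes D: "dyadic_system \<D>" and I: "I \<in> \<D>"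
  shows norm_arc_pt: "cmod (arc_pt I) = 1 - 3 * arc_len I / 4"
    and ball_arc_pt: "ball (arc_pt I) (arc_len I / 8) \<subseteq> Q_up I"
    and Q_up_near_arc_pt: "z \<in> Q_up I \<Longrightarrow> cmod (z - arc_pt I) \<le> 4 * arc_len I"
    and arc_pt_near_mid: "cmod (arc_pt I - arc_mid I) \<le> arc_len I"
    and arc_mid_in: "arc_mid I \<in> I"
proof -
  let ?L = "arc_len I"
  have L: "0 < ?L" "?L \<le> 1" using dyadic_arc[OF D I] by auto
  note mid = arc_mid[OF dyadic_arc(1)[OF D I]]
  show n: "cmod (arc_pt I) = 1 - 3 * ?L / 4" using L mid(1)
      by (simp add: arc_pt_def norm_mult abs_if del: of_real_diff)
  show "arc_mid I \<in> I" using mid(2)[of 0] L by simp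
  have d: "arc_pt I - arc_mid I = of_real (- (3 * ?L / 4)) * arc_mid I"
    by (simp add: arc_pt_def algebra_simps)
  show nm: "cmod (arc_pt I - arc_mid I) \<le> ?L"
    unfolding d norm_mult norm_of_real mid(1) using L by simp
  show "ball (arc_pt I) (?L / 8) \<subseteq> Q_up I"
  proof
    fix z assume z: "z \<in> ball (arc_pt I) (?L / 8)"
    \<comment> \<open>After rotating the midpoint to \<open>1\<close> the point \<open>y\<close> has real part above \<open>1/8\<close>, so its argument is an arctangent.\<close>
    define u where "u = arc_mid I"
    have u: "cmod u = 1" "u \<noteq> 0" using mid(1) by (auto simp: u_def)
    define y where "y = z / u"
    have zy: "z = u * y" using u by (simp add: y_def)
    have "cmod (u * y - u * of_real (1 - 3 * ?L / 4)) < ?L / 8"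
      using z zy by (simp add: dist_norm norm_minus_commute arc_pt_def u_def mult.commute)
    then have yb: "cmod (y - of_real (1 - 3 * ?L / 4)) < ?L / 8"
      unfolding right_diff_distrib[symmetric] norm_mult u by simp
    have "\<bar>Re y - (1 - 3 * ?L / 4)\<bar> < ?L / 8" "\<bar>Im y\<bar> < ?L / 8"
      using le_less_trans[OF abs_Re_le_cmod yb] le_less_trans[OF abs_Im_le_cmod yb] by simp_all
    then have re: "1/8 < Re y" and im: "\<bar>Im y\<bar> < ?L / 8" using L by linarith+
    have y0: "y \<noteq> 0" using re by auto
    have "\<bar>Arg y\<bar> = \<bar>arctan (Im y / Re y)\<bar>" using arg_conv_arctan[of y] re by simp
    also have "\<dots> \<le> \<bar>Im y / Re y\<bar>" by (rule abs_arctan_le)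
    also have "\<dots> = \<bar>Im y\<bar> / Re y" using re by simp
    also have "\<dots> \<le> (?L / 8) / (1/8)" using re im by (intro frac_le) auto
    also have "\<dots> < pi * ?L" using L pi_gt3 by simp
    finally have "u * cis (Arg y) \<in> I" unfolding u_def by (rule mid(2))
    moreover have "sgn z = u * cis (Arg y)"
      using y0 u by (simp add: zy sgn_mult cis_Arg sgn_div_norm scaleR_conv_of_real norm_mult)
    ultimately have "sgn z \<in> I" by simp
    moreover have "\<bar>cmod z - cmod (arc_pt I)\<bar> < ?L / 8"
      using z norm_triangle_ineq3[of z "arc_pt I"] by (simp add: dist_norm norm_minus_commute)
    then have "1 - ?L \<le> cmod z" "cmod z < 1 - ?L / 2" using L unfolding n abs_less_iff by linarith+
    ultimately show "z \<in> Q_up I" unfolding Q_up_iff[OF D I] by simp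
  qed
  show "cmod (z - arc_pt I) \<le> 4 * ?L" if z: "z \<in> Q_up I"
  proof -
    obtain r w where rw: "z = of_real r * w" "w \<in> I" "1 - ?L \<le> r" "r < 1 - ?L / 2"
      using z unfolding Q_up_def by blast
    have w: "cmod w = 1" using rw(2) dyadic_arc(2)[OF D I] by auto
    define s where "s = 1 - 3 * ?L / 4"
    have e: "z - arc_pt I = of_real (r - s) * w + of_real s * (w - arc_mid I)"
      unfolding rw(1) arc_pt_def s_def[symmetric] by (simp add: algebra_simps)
    have "cmod (z - arc_pt I) \<le> \<bar>r - s\<bar> * 1 + \<bar>s\<bar> * cmod (w - arc_mid I)"
      unfolding e by (rule order_trans[OF norm_triangle_ineq]) (simp add: norm_mult w del: of_real_diff)
    also have "\<dots> \<le> ?L / 4 * 1 + 1 * (pi * ?L)"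
    proof (intro add_mono mult_mono)
      show "\<bar>r - s\<bar> \<le> ?L / 4" unfolding s_def using rw(3,4) by (intro abs_leI) linarith+
      show "\<bar>s\<bar> \<le> 1" unfolding s_def using L by (intro abs_leI) linarith+
    qed (use L mid(3)[OF rw(2)] in auto)
    also have "\<dots> \<le> 4 * ?L"
    proof -
      have "pi \<le> 15 / 4" using pi_approx by simp
      then have "pi * ?L \<le> 15 / 4 * ?L" using L by (intro mult_right_mono) auto
      then show ?thesis by simp
    qed
    finally show ?thesis .
  qed
qed

text \<open>
  The balls of radius \<open>|I|/8\<close> around the points \<open>arc_pt I\<close> are disjoint because the sets
  \<open>Q_up I\<close> are, so the estimate compares areas.
\<close>

lemma dyadic_packing:
  assumes D: "dyadic_system \<D>" and E: "finite E" "E \<subseteq> \<D>"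
    and sub: "\<And>I. I \<in> E \<Longrightarrow> ball (arc_pt I) (arc_len I / 8) \<subseteq> ball b R" and R: "0 \<le> R"
  shows "(\<Sum>I\<in>E. (arc_len I)\<^sup>2) \<le> 64 * R\<^sup>2"
proof -
  let ?B = "\<lambda>I. ball (arc_pt I) (arc_len I / 8)"
  have dis: "disjoint_family_on ?B E" unfolding disjoint_family_on_def
  proof (intro ballI impI)
    fix I J assume IJ: "I \<in> E" "J \<in> E" "I \<noteq> J"
    have ID: "I \<in> \<D>" "J \<in> \<D>" using IJ E by auto
    show "?B I \<inter> ?B J = {}"
      using ball_arc_pt[OF D ID(1)] ball_arc_pt[OF D ID(2)] Q_up_disjoint[OF D ID] IJ(3) by blast
  qed
  have pos: "0 \<le> arc_len I" for I by (simp add: arc_len_def)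
  have "ennreal (\<Sum>I\<in>E. pi * (arc_len I / 8)\<^sup>2) = (\<Sum>I\<in>E. emeasure lborel (?B I))"
    using pos by (subst sum_ennreal[symmetric]) (auto simp: emeasure_ball_complex)
  also have "\<dots> = emeasure lborel (\<Union>I\<in>E. ?B I)"
    using dis E by (intro sum_emeasure) auto
  also have "\<dots> \<le> emeasure lborel (ball b R)" using sub by (intro emeasure_mono) auto
  also have "\<dots> = ennreal (pi * R\<^sup>2)" using R by (rule emeasure_ball_complex)
  finally have "(\<Sum>I\<in>E. pi * (arc_len I / 8)\<^sup>2) \<le> pi * R\<^sup>2" by simp
  also have "(\<Sum>I\<in>E. pi * (arc_len I / 8)\<^sup>2) = pi / 64 * (\<Sum>I\<in>E. (arc_len I)\<^sup>2)"
    by (simp add: sum_distrib_left power_divide)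
  finally have "pi * ((\<Sum>I\<in>E. (arc_len I)\<^sup>2) / 64) \<le> pi * R\<^sup>2" by simp
  then show ?thesis by (subst (asm) mult_le_cancel_left_pos) auto
qed

lemma sum_UNION_le:
  fixes x :: "'a \<Rightarrow> real"
  assumes "finite G" "\<And>J. J \<in> G \<Longrightarrow> finite (S J)" "\<And>I. 0 \<le> x I"
  shows "sum x (\<Union>J\<in>G. S J) \<le> (\<Sum>J\<in>G. sum x (S J))"
  using assms
proof (induction G rule: finite_induct)
  case (insert J G)
  have "sum x (S J \<union> (\<Union>J\<in>G. S J)) + sum x (S J \<inter> (\<Union>J\<in>G. S J)) = sum x (S J) + sum x (\<Union>J\<in>G. S J)"
    using insert by (intro sum.union_inter) auto
  moreover have "0 \<le> sum x (S J \<inter> (\<Union>J\<in>G. S J))" using insert.prems by (intro sum_nonneg) auto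
  moreover have "sum x (\<Union>J\<in>G. S J) \<le> (\<Sum>J\<in>G. sum x (S J))" using insert by auto
  ultimately show ?case using insert.hyps by simp
qed simp

section \<open>Duality on laminar families\<close>

text \<open>
  Linear programming duality between covering \<open>h\<close> by weights \<open>l\<close> at minimal cost and packing
  \<open>x\<close> below the capacities \<open>W\<close>. In a laminar family both optima are found greedily: the members of
  \<open>E\<close> are processed in order of decreasing \<open>h\<close>, and each \<open>x I\<close> is taken as large as the
  capacities of the sets above \<open>I\<close> allow. Then every \<open>I\<close> has a tight set \<open>J \<supseteq> I\<close>, that
  is, one whose capacity is exhausted. The induction removes the member \<open>I0\<close> with the
  smallest value \<open>m\<close>: the cover for \<open>h - m\<close> on the rest is increased by \<open>m\<close> on the
  maximal tight sets, which are disjoint, cover every member of \<open>E\<close>, and whose capacities add up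
  to the sum of all \<open>x I\<close>, so that the cost rises exactly as much as the dual value.
\<close>

lemma laminar_duality:
  fixes \<D> :: "'a set set" and W :: "'a set \<Rightarrow> real"
  assumes lam: "\<And>I J. I \<in> \<D> \<Longrightarrow> J \<in> \<D> \<Longrightarrow> I \<inter> J = {} \<or> I \<subseteq> J \<or> J \<subseteq> I"
    and ne: "{} \<notin> \<D>" and anc: "\<And>I. I \<in> \<D> \<Longrightarrow> finite (above \<D> I)"
    and W: "\<And>J. J \<in> \<D> \<Longrightarrow> 0 \<le> W J"
    and E: "finite E" "E \<subseteq> \<D>" and h: "\<And>I. I \<in> E \<Longrightarrow> 0 \<le> h I"
  shows "\<exists>x F l. (\<forall>I. 0 \<le> x I) \<and> (\<forall>J\<in>\<D>. (\<Sum>I\<in>below E J. x I) \<le> W J) \<and>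
    (\<forall>I\<in>E. \<exists>J\<in>\<D>. I \<subseteq> J \<and> (\<Sum>I\<in>below E J. x I) = W J) \<and>
    finite F \<and> F \<subseteq> \<D> \<and> (\<forall>J. 0 \<le> l J) \<and> (\<forall>J. J \<notin> F \<longrightarrow> l J = 0) \<and>
    (\<forall>I\<in>E. h I \<le> (\<Sum>J\<in>above \<D> I. l J)) \<and>
    (\<Sum>J\<in>F. l J * W J) \<le> (\<Sum>I\<in>E. h I * (x I :: real))"
  using E h
proof (induction "card E" arbitrary: E h)
  case 0
  then have "E = {}" by simp
  then show ?case using W
    by (intro exI[of _ "\<lambda>_. 0"] exI[of _ "{}"]) auto
next
  case (Suc n)
  note hpos = Suc.prems(3)
  have Ene: "E \<noteq> {}" using Suc.hyps(2) by auto
  obtain I0 where I0: "I0 \<in> E" "\<And>I. I \<in> E \<Longrightarrow> h I0 \<le> h I"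
  proof -
    have "Min (h ` E) \<in> h ` E" using Suc.prems(1) Ene by (intro Min_in) auto
    then obtain I0 where "I0 \<in> E" "h I0 = Min (h ` E)" by auto
    then show thesis using that[of I0] Suc.prems(1) by auto
  qed
  define E' where "E' = E - {I0}"
  define m where "m = h I0"
  have m0: "0 \<le> m" using hpos I0(1) by (simp add: m_def)
  have EE: "E = insert I0 E'" "I0 \<notin> E'" using I0 by (auto simp: E'_def)
  have finE': "finite E'" and finE: "finite E" using Suc.prems(1) by (auto simp: E'_def)
  have "n = card E'" using Suc.hyps(2) I0(1) Suc.prems(1) by (simp add: E'_def)
  from Suc.hyps(1)[OF this finE', of "\<lambda>I. h I - m"]
  have "\<exists>x F l. (\<forall>I. 0 \<le> x I) \<and> (\<forall>J\<in>\<D>. (\<Sum>I\<in>below E' J. x I) \<le> W J) \<and>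
    (\<forall>I\<in>E'. \<exists>J\<in>\<D>. I \<subseteq> J \<and> (\<Sum>I\<in>below E' J. x I) = W J) \<and>
    finite F \<and> F \<subseteq> \<D> \<and> (\<forall>J. 0 \<le> l J) \<and> (\<forall>J. J \<notin> F \<longrightarrow> l J = 0) \<and>
    (\<forall>I\<in>E'. h I - m \<le> (\<Sum>J\<in>above \<D> I. l J)) \<and>
    (\<Sum>J\<in>F. l J * W J) \<le> (\<Sum>I\<in>E'. (h I - m) * (x I :: real))"
    using Suc.prems(2) I0(2) EE by (simp add: m_def)
  then obtain x' F' l' where IHs: "\<forall>I. 0 \<le> x' I" "\<forall>J\<in>\<D>. (\<Sum>I\<in>below E' J. x' I) \<le> W J"
    "\<forall>I\<in>E'. \<exists>J\<in>\<D>. I \<subseteq> J \<and> (\<Sum>I\<in>below E' J. x' I) = W J"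
    "finite F'" "F' \<subseteq> \<D>" "\<forall>J. 0 \<le> l' J" "\<forall>J. J \<notin> F' \<longrightarrow> l' J = 0"
    "\<forall>I\<in>E'. h I - m \<le> (\<Sum>J\<in>above \<D> I. l' J)"
    "(\<Sum>J\<in>F'. l' J * W J) \<le> (\<Sum>I\<in>E'. (h I - m) * (x' I :: real))"
    by (elim exE conjE) (rule that)
  note IH = IHs[rule_format]
  define s' where "s' J = (\<Sum>I\<in>below E' J. x' I)" for J
  define A where "A = above \<D> I0"
  have I0D: "I0 \<in> \<D>" using I0 Suc.prems(2) by auto
  have A: "finite A" "I0 \<in> A" using anc[OF I0D] I0D by (auto simp: A_def)
  \<comment> \<open>The largest value of \<open>x I0\<close> that no set above \<open>I0\<close> forbids; it makes one of them tight.\<close>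
  define x0 where "x0 = Min ((\<lambda>J. W J - s' J) ` A)"
  have x0_le: "x0 \<le> W J - s' J" if "J \<in> A" for J using A that unfolding x0_def by (intro Min_le) auto
  have "x0 \<in> (\<lambda>J. W J - s' J) ` A" unfolding x0_def using A by (intro Min_in) auto
  then obtain J0 where J0: "J0 \<in> A" "x0 = W J0 - s' J0" by auto
  have x00: "0 \<le> x0" using J0 IH(2)[of J0] by (simp add: A_def s'_def)
  define x where "x = x'(I0 := x0)"
  define s where "s J = (\<Sum>I\<in>below E J. x I)" for J
  have s_eq: "s J = s' J + (if I0 \<subseteq> J then x0 else 0)" for J
  proof -
    have eq: "(below E J) = (if I0 \<subseteq> J then insert I0 (below E' J) else (below E' J))"
      using EE by auto
    have "(\<Sum>I\<in>below E' J. x I) = s' J" unfolding s'_def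
      by (rule sum.cong) (use EE in \<open>auto simp: x_def\<close>)
    then show ?thesis unfolding s_def eq using finE' EE(2) by (auto simp: x_def)
  qed
  have x_pos: "0 \<le> x I" for I using IH(1) x00 by (simp add: x_def)
  have feas: "s J \<le> W J" if "J \<in> \<D>" for J
    using x0_le[of J] IH(2)[OF that] that by (auto simp: s_eq A_def s'_def)
  have tight: "\<exists>J\<in>\<D>. I \<subseteq> J \<and> s J = W J" if "I \<in> E" for I
  proof (cases "I = I0")
    case True
    then show ?thesis using J0 by (intro bexI[of _ J0]) (auto simp: s_eq A_def)
  next
    case False
    then have "I \<in> E'" using that EE by simp
    then obtain J where J: "J \<in> \<D>" "I \<subseteq> J" "s' J = W J" using IH(3)[of I] unfolding s'_def by blast
    moreover have "s J = W J"
      using x0_le[of J] J x00 by (auto simp: s_eq A_def)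
    ultimately show ?thesis by auto
  qed
  \<comment> \<open>The maximal tight sets above members of \<open>E\<close>; they are disjoint by laminarity.\<close>
  define M where "M = {J\<in>\<D>. s J = W J \<and> (\<exists>I\<in>E. I \<subseteq> J) \<and> (\<forall>K\<in>\<D>. s K = W K \<longrightarrow> J \<subseteq> K \<longrightarrow> K = J)}"
  have cover: "\<exists>J\<in>M. I \<subseteq> J" if I: "I \<in> E" for I
  proof -
    let ?T = "{J\<in>\<D>. I \<subseteq> J \<and> s J = W J}"
    have "I \<in> \<D>" using I Suc.prems(2) by auto
    then have "finite ?T" using anc[of I] by (rule_tac finite_subset[of _ "above \<D> I"]) auto
    moreover have "?T \<noteq> {}" using tight[OF I] by auto
    ultimately obtain J where J: "J \<in> ?T" "\<forall>K\<in>?T. J \<le> K \<longrightarrow> J = K"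
      using finite_has_maximal[of ?T] by blast
    then have "J \<in> M" using I unfolding M_def by blast
    then show ?thesis using J by auto
  qed
  have uniq: "J = K" if "J \<in> M" "K \<in> M" "I \<in> E" "I \<subseteq> J" "I \<subseteq> K" for I J K
  proof -
    have "I \<noteq> {}" using that(3) Suc.prems(2) ne by auto
    then have "J \<inter> K \<noteq> {}" using that by auto
    then show ?thesis using lam[of J K] that(1,2) unfolding M_def by blast
  qed
  have finM: "finite M"
  proof (rule finite_subset)
    show "M \<subseteq> (\<Union>I\<in>E. above \<D> I)" by (auto simp: M_def)
    show "finite (\<Union>I\<in>E. above \<D> I)" using finE anc Suc.prems(2) by auto
  qed
  have MW: "(\<Sum>J\<in>M. W J) = (\<Sum>I\<in>E. x I)"
  proof -
    have "(\<Sum>J\<in>M. W J) = (\<Sum>J\<in>M. \<Sum>I\<in>below E J. x I)"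
      by (rule sum.cong) (auto simp: M_def s_def)
    also have "\<dots> = sum x (\<Union>J\<in>M. (below E J))"
      using finM finE uniq by (intro sum.UNION_disjoint[symmetric]) auto
    also have "(\<Union>J\<in>M. (below E J)) = E" using cover by auto
    finally show ?thesis .
  qed
  define l where "l J = l' J + (if J \<in> M then m else 0)" for J
  have MD: "M \<subseteq> \<D>" by (auto simp: M_def)
  have covl: "h I \<le> (\<Sum>J\<in>above \<D> I. l J)" if I: "I \<in> E" for I
  proof -
    have ID: "I \<in> \<D>" using I Suc.prems(2) by auto
    obtain J where J: "J \<in> M" "I \<subseteq> J" using cover[OF I] by auto
    have "(\<Sum>K\<in>{J}. if K \<in> M then m else 0) \<le> (\<Sum>K\<in>above \<D> I. if K \<in> M then m else 0)"
      using J MD anc[OF ID] m0 by (intro sum_mono2) auto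
    then have "m \<le> (\<Sum>K\<in>above \<D> I. if K \<in> M then m else 0)" using J by simp
    moreover have "h I - m \<le> (\<Sum>J\<in>above \<D> I. l' J)"
    proof (cases "I = I0")
      case True
      then show ?thesis using IH(6) by (simp add: m_def sum_nonneg)
    next
      case False then show ?thesis using IH(8)[of I] I EE by auto
    qed
    ultimately show ?thesis by (simp add: l_def sum.distrib)
  qed
  have cost: "(\<Sum>J\<in>F' \<union> M. l J * W J) \<le> (\<Sum>I\<in>E. h I * x I)"
  proof -
    have "(\<Sum>J\<in>F' \<union> M. l J * W J) = (\<Sum>J\<in>F' \<union> M. l' J * W J) + (\<Sum>J\<in>F' \<union> M. if J \<in> M then m * W J else 0)"
      unfolding sum.distrib[symmetric] by (rule sum.cong) (auto simp: l_def algebra_simps)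
    also have "(\<Sum>J\<in>F' \<union> M. l' J * W J) = (\<Sum>J\<in>F'. l' J * W J)"
      using IH(4,7) finM by (intro sum.mono_neutral_right) auto
    also have "(\<Sum>J\<in>F' \<union> M. if J \<in> M then m * W J else 0) = (\<Sum>J\<in>M. m * W J)"
      using IH(4) finM by (intro sum.mono_neutral_cong_right) auto
    also have "\<dots> = m * (\<Sum>I\<in>E. x I)" by (simp add: sum_distrib_left[symmetric] MW)
    also have "(\<Sum>J\<in>F'. l' J * W J) + m * (\<Sum>I\<in>E. x I) \<le> (\<Sum>I\<in>E'. (h I - m) * x' I) + m * (\<Sum>I\<in>E. x I)"
      using IH(9) by simp
    also have "(\<Sum>I\<in>E. x I) = x0 + (\<Sum>I\<in>E'. x' I)"
    proof -
      have "(\<Sum>I\<in>E'. x I) = (\<Sum>I\<in>E'. x' I)" by (rule sum.cong) (use EE in \<open>auto simp: x_def\<close>)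
      then show ?thesis using EE finE' by (simp add: x_def)
    qed
    also have "(\<Sum>I\<in>E'. (h I - m) * x' I) + m * (x0 + (\<Sum>I\<in>E'. x' I)) = m * x0 + (\<Sum>I\<in>E'. h I * x' I)"
      by (simp add: algebra_simps sum_subtractf sum_distrib_left)
    also have "\<dots> = (\<Sum>I\<in>E. h I * x I)"
    proof -
      have "(\<Sum>I\<in>E'. h I * x I) = (\<Sum>I\<in>E'. h I * x' I)" by (rule sum.cong) (use EE in \<open>auto simp: x_def\<close>)
      then show ?thesis using EE finE' by (simp add: x_def m_def)
    qed
    finally show ?thesis .
  qed
  have c1: "\<forall>I. 0 \<le> x I" using x_pos by blast
  have c2: "\<forall>J\<in>\<D>. (\<Sum>I\<in>below E J. x I) \<le> W J" using feas unfolding s_def by blast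
  have c3: "\<forall>I\<in>E. \<exists>J\<in>\<D>. I \<subseteq> J \<and> (\<Sum>I\<in>below E J. x I) = W J" using tight unfolding s_def by blast
  have c4: "finite (F' \<union> M)" using IH(4) finM by simp
  have c5: "F' \<union> M \<subseteq> \<D>" using IH(5) MD by simp
  have c6: "\<forall>J. 0 \<le> l J" using IH(6) m0 by (simp add: l_def)
  have c7: "\<forall>J. J \<notin> F' \<union> M \<longrightarrow> l J = 0" using IH(7) by (simp add: l_def)
  have c8: "\<forall>I\<in>E. h I \<le> (\<Sum>J\<in>above \<D> I. l J)" using covl by blast
  show ?case
    by (rule exI[of _ x], rule exI[of _ "F' \<union> M"], rule exI[of _ l]) (intro conjI c1 c2 c3 c4 c5 c6 c7 c8 cost)
qed

text \<open>
  The finite duality is applied to an exhaustion of \<open>\<D>\<close>. The numbers \<open>l J * W J\<close> stay in a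
  bounded interval, so a diagonal subsequence of the covers converges at every \<open>J\<close>. The covering
  condition at \<open>I\<close> involves only the finitely many sets above \<open>I\<close> and survives the limit.
\<close>

lemma laminar_gauge_le:
  fixes \<D> :: "'a set set" and W :: "'a set \<Rightarrow> real" and h :: "'a set \<Rightarrow> real"
  assumes lam: "\<And>I J. I \<in> \<D> \<Longrightarrow> J \<in> \<D> \<Longrightarrow> I \<inter> J = {} \<or> I \<subseteq> J \<or> J \<subseteq> I"
    and ne: "{} \<notin> \<D>" and anc: "\<And>I. I \<in> \<D> \<Longrightarrow> finite (above \<D> I)"
    and W: "\<And>J. J \<in> \<D> \<Longrightarrow> 0 < W J" and cD: "countable \<D>" "\<D> \<noteq> {}"
    and h: "\<And>I. I \<in> \<D> \<Longrightarrow> 0 \<le> h I"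
    and dual: "\<And>E x. finite E \<Longrightarrow> E \<subseteq> {I\<in>\<D>. h I \<noteq> 0} \<Longrightarrow> (\<And>I. 0 \<le> x I) \<Longrightarrow>
       (\<And>J. J \<in> \<D> \<Longrightarrow> (\<Sum>I\<in>below E J. x I) \<le> W J) \<Longrightarrow> (\<Sum>I\<in>E. h I * x I) \<le> \<epsilon>"
  shows "\<exists>w. (\<forall>J\<in>\<D>. 0 \<le> w J) \<and> (\<forall>I\<in>\<D>. h I \<le> (\<Sum>J\<in>above \<D> I. w J)) \<and>
     (\<forall>G. finite G \<longrightarrow> G \<subseteq> \<D> \<longrightarrow> (\<Sum>J\<in>G. w J * W J) \<le> \<epsilon>)"
proof -
  define E where "E n = from_nat_into \<D> ` {..n} \<inter> {I\<in>\<D>. h I \<noteq> 0}" for n :: nat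
  have ex: "\<exists>F l. finite F \<and> F \<subseteq> \<D> \<and> (\<forall>J. 0 \<le> l J) \<and> (\<forall>J. J \<notin> F \<longrightarrow> l J = 0) \<and>
    (\<forall>I\<in>E n. h I \<le> (\<Sum>J\<in>above \<D> I. l J)) \<and> (\<Sum>J\<in>F. l J * W J) \<le> \<epsilon>" for n
  proof -
    have En: "finite (E n)" "E n \<subseteq> \<D>" by (auto simp: E_def)
    have "\<And>I. I \<in> E n \<Longrightarrow> 0 \<le> h I" using h En(2) by blast
    then have "\<exists>x F l. (\<forall>I. 0 \<le> x I) \<and> (\<forall>J\<in>\<D>. (\<Sum>I\<in>below (E n) J. x I) \<le> W J) \<and>
    (\<forall>I\<in>E n. \<exists>J\<in>\<D>. I \<subseteq> J \<and> (\<Sum>I\<in>below (E n) J. x I) = W J) \<and>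
    finite F \<and> F \<subseteq> \<D> \<and> (\<forall>J. 0 \<le> l J) \<and> (\<forall>J. J \<notin> F \<longrightarrow> l J = 0) \<and>
    (\<forall>I\<in>E n. h I \<le> (\<Sum>J\<in>above \<D> I. l J)) \<and>
    (\<Sum>J\<in>F. l J * W J) \<le> (\<Sum>I\<in>E n. h I * (x I :: real))"
      by (intro laminar_duality lam ne anc less_imp_le[OF W] En)
    then obtain x F l where *: "(\<forall>I. 0 \<le> x I)" "(\<forall>J\<in>\<D>. (\<Sum>I\<in>below (E n) J. x I) \<le> W J)"
      "finite F" "F \<subseteq> \<D>" "(\<forall>J. 0 \<le> l J)" "(\<forall>J. J \<notin> F \<longrightarrow> l J = 0)"
      "(\<forall>I\<in>E n. h I \<le> (\<Sum>J\<in>above \<D> I. l J))"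
      "(\<Sum>J\<in>F. l J * W J) \<le> (\<Sum>I\<in>E n. h I * (x I :: real))"
      by (elim exE conjE) (rule that)
    have "(\<Sum>I\<in>E n. h I * x I) \<le> \<epsilon>"
      using * En by (intro dual) (auto simp: E_def)
    then show ?thesis using * by (intro exI[of _ F] exI[of _ l]) auto
  qed
  have ex2: "\<forall>n. \<exists>F l. finite F \<and> F \<subseteq> \<D> \<and> (\<forall>J. 0 \<le> l J) \<and> (\<forall>J. J \<notin> F \<longrightarrow> l J = 0) \<and>
    (\<forall>I\<in>E n. h I \<le> (\<Sum>J\<in>above \<D> I. l J)) \<and> (\<Sum>J\<in>F. l J * W J) \<le> \<epsilon>"
    using ex by (rule allI)
  from choice[OF ex2]
  obtain F where "\<forall>n. \<exists>l. finite (F n) \<and> F n \<subseteq> \<D> \<and> (\<forall>J. 0 \<le> l J) \<and> (\<forall>J. J \<notin> F n \<longrightarrow> l J = 0) \<and>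
    (\<forall>I\<in>E n. h I \<le> (\<Sum>J\<in>above \<D> I. l J)) \<and> (\<Sum>J\<in>F n. l J * W J) \<le> \<epsilon>"
    by (elim exE) (rule that)
  from choice[OF this]
  obtain l where "\<forall>n. finite (F n) \<and> F n \<subseteq> \<D> \<and> (\<forall>J. 0 \<le> l n J) \<and> (\<forall>J. J \<notin> F n \<longrightarrow> l n J = 0) \<and>
    (\<forall>I\<in>E n. h I \<le> (\<Sum>J\<in>above \<D> I. l n J)) \<and> (\<Sum>J\<in>F n. l n J * W J) \<le> \<epsilon>"
    by (elim exE) (rule that)
  then have l: "finite (F n)" "F n \<subseteq> \<D>" "0 \<le> l n J" "J \<notin> F n \<Longrightarrow> l n J = 0"
    "I \<in> E n \<Longrightarrow> h I \<le> (\<Sum>J\<in>above \<D> I. l n J)" "(\<Sum>J\<in>F n. l n J * W J) \<le> \<epsilon>" for n I J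
    by blast+
  have finsum: "(\<Sum>J\<in>G. l n J * W J) \<le> \<epsilon>" if "finite G" "G \<subseteq> \<D>" for G n
  proof -
    have "(\<Sum>J\<in>G. l n J * W J) = (\<Sum>J\<in>G \<inter> F n. l n J * W J)"
      using that l(4) by (intro sum.mono_neutral_right) auto
    also have "\<dots> \<le> (\<Sum>J\<in>F n. l n J * W J)"
    proof (rule sum_mono2)
      fix J assume "J \<in> F n - G \<inter> F n"
      then have "0 < W J" using l(2)[of n] W by blast
      then show "0 \<le> l n J * W J" using l(3)[of n J] by simp
    qed (use l(1) in auto)
    finally show ?thesis using l(6)[of n] by simp
  qed
  have bd: "norm (l n J * W J) \<le> \<epsilon>" if "J \<in> \<D>" for n J
    using finsum[of "{J}" n] that l(3)[of n J] W[OF that] by simp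
  obtain k :: "nat \<Rightarrow> nat" where k: "strict_mono k" "\<And>J. J \<in> \<D> \<Longrightarrow> \<exists>y. (\<lambda>n. l (k n) J * W J) \<longlonglongrightarrow> y"
    using function_convergent_subsequence[of \<D> "\<lambda>n J. l n J * W J" \<epsilon>, OF cD(1) bd] by blast
  then obtain y where y: "\<And>J. J \<in> \<D> \<Longrightarrow> (\<lambda>n. l (k n) J * W J) \<longlonglongrightarrow> y J" by metis
  have conv: "(\<lambda>n. l (k n) J) \<longlonglongrightarrow> y J / W J" if "J \<in> \<D>" for J
  proof -
    have "(\<lambda>n. (l (k n) J * W J) / W J) \<longlonglongrightarrow> y J / W J"
      using W[OF that] by (intro tendsto_divide y that tendsto_const) auto
    then show ?thesis using W[OF that] by simp
  qed
  show ?thesis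
  proof (intro exI[of _ "\<lambda>J. y J / W J"] conjI ballI allI impI)
    show "0 \<le> y J / W J" if "J \<in> \<D>" for J
      by (rule LIMSEQ_le_const[OF conv[OF that]]) (use l(3) in auto)
    show "h I \<le> (\<Sum>J\<in>above \<D> I. y J / W J)" if I: "I \<in> \<D>" for I
    proof (cases "h I = 0")
      case True
      then show ?thesis using \<open>\<And>J. J \<in> \<D> \<Longrightarrow> 0 \<le> y J / W J\<close> by (auto intro!: sum_nonneg)
    next
      case False
      obtain n0 where n0: "from_nat_into \<D> n0 = I" using from_nat_into_surj[OF cD(1) I] by auto
      have *: "(\<lambda>n. \<Sum>J\<in>above \<D> I. l (k n) J) \<longlonglongrightarrow> (\<Sum>J\<in>above \<D> I. y J / W J)"
        by (intro tendsto_sum conv) auto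
      have "h I \<le> (\<Sum>J\<in>above \<D> I. l (k n) J)" if "n \<ge> n0" for n
      proof (rule l(5))
        have "n0 \<le> k n" using that strict_mono_imp_increasing[OF k(1), of n] by simp
        then show "I \<in> E (k n)" using I False n0 by (auto simp: E_def)
      qed
      then show ?thesis by (intro LIMSEQ_le_const[OF *]) auto
    qed
    show "(\<Sum>J\<in>G. y J / W J * W J) \<le> \<epsilon>" if G: "finite G" "G \<subseteq> \<D>" for G
    proof -
      have "(\<lambda>n. \<Sum>J\<in>G. l (k n) J * W J) \<longlonglongrightarrow> (\<Sum>J\<in>G. y J)"
        using G by (intro tendsto_sum y) auto
      then have "(\<Sum>J\<in>G. y J) \<le> \<epsilon>"
        by (rule LIMSEQ_le_const2) (use finsum[OF G] in auto)
      also have "(\<Sum>J\<in>G. y J) = (\<Sum>J\<in>G. y J / W J * W J)"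
        using G W by (intro sum.cong) (auto simp: less_imp_neq[symmetric] dest!: subsetD)
      finally show ?thesis by simp
    qed
  qed
qed

text \<open>
  The feasible points of the dual problem for the capacity gauge: a \<open>p\<close>-Carleson condition for
  the measure that puts mass \<open>x I\<close> on the arcs \<open>I \<in> E\<close>.
\<close>

definition dyadic_carleson :: "real \<Rightarrow> complex set set \<Rightarrow> complex set set \<Rightarrow> (complex set \<Rightarrow> real) \<Rightarrow> bool" where
  "dyadic_carleson p \<D> E x \<longleftrightarrow> finite E \<and> E \<subseteq> \<D> \<and> (\<forall>I. 0 \<le> x I) \<and>
     (\<forall>J\<in>\<D>. (\<Sum>I\<in>below E J. x I) \<le> arc_len J powr p)"

text \<open>
  The half of the duality that is needed: a bound for all dual values produces a cover of that
  cost. Arcs where \<open>h\<close> vanishes may be ignored in the dual problem.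
\<close>

lemma gauge_le_dual:
  assumes D: "dyadic_system \<D>" and p: "0 < p"
    and fin: "\<And>I. I \<in> \<D> \<Longrightarrow> h I < \<infinity>" and \<epsilon>: "0 \<le> \<epsilon>"
    and dual: "\<And>E x. dyadic_carleson p \<D> E x \<Longrightarrow> E \<subseteq> {I\<in>\<D>. h I \<noteq> 0} \<Longrightarrow> (\<Sum>I\<in>E. h I * ennreal (x I)) \<le> ennreal \<epsilon>"
  shows "capacity_gauge p \<D> h \<le> ennreal \<epsilon>"
proof -
  define H where "H I = enn2real (h I)" for I
  have hH: "h I = ennreal (H I)" if "I \<in> \<D>" for I using fin[OF that] by (simp add: H_def)
  have H0: "0 \<le> H I" for I by (simp add: H_def)
  have "\<exists>w. (\<forall>J\<in>\<D>. 0 \<le> w J) \<and> (\<forall>I\<in>\<D>. H I \<le> (\<Sum>J\<in>above \<D> I. w J)) \<and>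
     (\<forall>G. finite G \<longrightarrow> G \<subseteq> \<D> \<longrightarrow> (\<Sum>J\<in>G. w J * arc_len J powr p) \<le> \<epsilon>)"
  proof (rule laminar_gauge_le)
    show "I \<inter> J = {} \<or> I \<subseteq> J \<or> J \<subseteq> I" if "I \<in> \<D>" "J \<in> \<D>" for I J by (rule dyadic_laminar[OF D that])
    show "{} \<notin> \<D>" using dyadic_arc(3)[OF D] by blast
    show "finite (above \<D> I)" if "I \<in> \<D>" for I by (rule dyadic_finite_ancestors[OF D that])
    show "0 < arc_len J powr p" if "J \<in> \<D>" for J using dyadic_arc(4)[OF D that] by simp
    show "countable \<D>" by (rule dyadic_countable[OF D])
    show "\<D> \<noteq> {}" using dyadic_infinite[OF D] by auto
    show "0 \<le> H I" for I by (rule H0)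
    fix E x assume E: "finite E" "E \<subseteq> {I\<in>\<D>. H I \<noteq> 0}" and x: "\<And>I. 0 \<le> x I"
      and car: "\<And>J. J \<in> \<D> \<Longrightarrow> (\<Sum>I\<in>below E J. x I) \<le> arc_len J powr p"
    have "dyadic_carleson p \<D> E x" unfolding dyadic_carleson_def using E x car by auto
    moreover have "E \<subseteq> {I\<in>\<D>. h I \<noteq> 0}" using E(2) by (auto simp: H_def)
    ultimately have "(\<Sum>I\<in>E. h I * ennreal (x I)) \<le> ennreal \<epsilon>" by (rule dual)
    also have "(\<Sum>I\<in>E. h I * ennreal (x I)) = (\<Sum>I\<in>E. ennreal (H I * x I))"
      using E(2) x H0 by (intro sum.cong refl) (auto simp: hH ennreal_mult)
    also have "\<dots> = ennreal (\<Sum>I\<in>E. H I * x I)" using x H0 by (intro sum_ennreal) auto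
    finally show "(\<Sum>I\<in>E. H I * x I) \<le> \<epsilon>" using \<epsilon> by (simp add: ennreal_le_iff)
  qed
  then obtain w where w: "\<forall>J\<in>\<D>. 0 \<le> w J" "\<forall>I\<in>\<D>. H I \<le> (\<Sum>J\<in>above \<D> I. w J)"
    "\<forall>G. finite G \<longrightarrow> G \<subseteq> \<D> \<longrightarrow> (\<Sum>J\<in>G. w J * arc_len J powr p) \<le> \<epsilon>" by (elim exE conjE) (rule that)
  have adm: "h I \<le> (\<Sum>\<^sub>\<infinity>J\<in>above \<D> I. ennreal (w J))" if I: "I \<in> \<D>" for I
  proof -
    have "h I \<le> ennreal (\<Sum>J\<in>above \<D> I. w J)" unfolding hH[OF I] using w(2) I by (intro ennreal_leI) auto
    also have "\<dots> = (\<Sum>J\<in>above \<D> I. ennreal (w J))" using w(1) by (intro sum_ennreal[symmetric]) auto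
    finally show ?thesis using dyadic_finite_ancestors[OF D I] by (simp add: infsum_finite)
  qed
  have "capacity_gauge p \<D> h \<le> (\<Sum>\<^sub>\<infinity>J\<in>\<D>. ennreal (w J * arc_len J powr p))"
    unfolding capacity_gauge_def using w(1) adm by (intro Inf_lower) blast
  also have "\<dots> \<le> ennreal \<epsilon>"
  proof (subst nonneg_infsum_complete)
    show "(SUP F\<in>{F. finite F \<and> F \<subseteq> \<D>}. \<Sum>J\<in>F. ennreal (w J * arc_len J powr p)) \<le> ennreal \<epsilon>"
    proof (rule SUP_least)
      fix F assume F: "F \<in> {F. finite F \<and> F \<subseteq> \<D>}"
      have "(\<Sum>J\<in>F. ennreal (w J * arc_len J powr p)) = ennreal (\<Sum>J\<in>F. w J * arc_len J powr p)"
        using F w(1) by (intro sum_ennreal) auto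
      also have "\<dots> \<le> ennreal \<epsilon>" using w(3) F by (intro ennreal_leI) auto
      finally show "(\<Sum>J\<in>F. ennreal (w J * arc_len J powr p)) \<le> ennreal \<epsilon>" .
    qed
  qed simp
  finally show ?thesis .
qed

section \<open>Kernel integrals and dyadic Carleson sequences\<close>

lemma ball_borel [measurable]: "ball (z :: complex) r \<in> sets borel" by simp

definition disc_weight :: "real \<Rightarrow> complex \<Rightarrow> ennreal" where
  "disc_weight s z = ennreal ((1 - cmod z) powr s) * indicator disc z"

lemma disc_weight_measurable [measurable]: "disc_weight s \<in> borel_measurable borel"
  unfolding disc_weight_def[abs_def] by measurable

text \<open>
  A set with \<open>kd b \<le> R\<close> has Euclidean radius at most \<open>R\<close> and lies within \<open>R\<close> of the
  circle, so its weighted area is at most \<open>R^s R\<^sup>2\<close>.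
\<close>

lemma disc_weight_growth:
  assumes b: "b \<in> disc" and s: "0 \<le> s" and R: "0 < R"
      and A: "A \<in> sets borel" "\<And>z. z \<in> A \<Longrightarrow> z \<in> disc \<Longrightarrow> kd b z \<le> R"
  shows "emeasure (density area (disc_weight s)) A \<le> ennreal (1 * R powr (s + 2))"
proof -
  have [measurable]: "A \<in> sets borel" by fact
  have "emeasure (density area (disc_weight s)) A = (\<integral>\<^sup>+z. disc_weight s z * indicator A z \<partial>area)"
    by (subst emeasure_density) auto
  also have "\<dots> \<le> (\<integral>\<^sup>+z. ennreal (R powr s) * indicator (A \<inter> disc) z \<partial>area)"
  proof (rule nn_integral_mono)
    fix z
    show "disc_weight s z * indicator A z \<le> ennreal (R powr s) * indicator (A \<inter> disc) z"
    proof (cases "z \<in> A \<and> z \<in> disc")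
      case True
      then have "1 - cmod z \<le> R" using kd_ge[of b z] b A(2)[of z] by simp
      then have "(1 - cmod z) powr s \<le> R powr s" using True s by (intro powr_mono2) auto
      then show ?thesis using True by (simp add: disc_weight_def ennreal_leI)
    qed (auto simp: disc_weight_def)
  qed
  also have "\<dots> = ennreal (R powr s) * emeasure area (A \<inter> disc)"
    by (subst nn_integral_cmult_indicator) auto
  also have "emeasure area (A \<inter> disc) \<le> ennreal (R\<^sup>2)"
  proof (rule emeasure_area_ball_le[of _ b])
    show "A \<inter> disc \<subseteq> cball b R"
    proof
      fix z assume z: "z \<in> A \<inter> disc"
      then have "cmod (b - z) \<le> kd b z" using b by (intro dist_le_kd) auto
      then show "z \<in> cball b R" using A(2)[of z] z by (auto simp: dist_norm)
    qed
  qed (use R in auto)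
  also have "ennreal (R powr s) * ennreal (R\<^sup>2) = ennreal (1 * R powr (s + 2))"
    using R by (simp add: ennreal_mult[symmetric] powr_add powr_numeral)
  finally show ?thesis by (simp add: mult_left_mono)
qed

text \<open>
  The constant produced by \<open>nn_integral_powr_growth_above\<close>.
\<close>

definition shell_const :: "real \<Rightarrow> real \<Rightarrow> real" where
  "shell_const \<gamma> r = 2 powr \<gamma> / (1 - 2 powr (\<gamma> - r))"

lemma shell_const_nonneg: "\<gamma> < r \<Longrightarrow> 0 \<le> shell_const \<gamma> r"
  unfolding shell_const_def using powr_less_one[of 2 "\<gamma> - r"] by (intro divide_nonneg_nonneg) auto

text \<open>
  The Forelli-Rudin estimate in the range of exponents where the integral is dominated by the
  points close to \<open>b / |b|\<close>.
\<close>

lemma kernel_integral: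
  assumes b: "b \<in> disc" and s: "0 \<le> s" and r: "s + 2 < r"
  shows "(\<integral>\<^sup>+z. disc_weight s z * ennreal (kd b z powr (-r)) \<partial>area)
    \<le> ennreal (shell_const (s + 2) r * (1 - cmod b) powr (s + 2 - r))"
proof -
  let ?M = "density area (disc_weight s)"
  define D where "D z = (if z \<in> disc then kd b z else 1)" for z
  have D [measurable]: "D \<in> borel_measurable borel"
    unfolding D_def[abs_def] by measurable
  have "(\<integral>\<^sup>+z. ennreal (D z powr (-r)) \<partial>?M)
      \<le> ennreal (1 * (2 powr (s + 2) / (1 - 2 powr (s + 2 - r))) * (1 - cmod b) powr (s + 2 - r))"
  proof (rule nn_integral_powr_growth_above)
    fix z
    show "1 - cmod b \<le> D z" using kd_ge[of z b] b by (simp add: D_def kd_sym)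
  next
    fix R assume R: "1 - cmod b \<le> R"
    have "0 < 1 - cmod b" using b by simp
    then show "emeasure ?M {z \<in> space ?M. D z \<le> R} \<le> ennreal (1 * R powr (s + 2))"
      using R by (intro disc_weight_growth[OF b s]) (auto simp: D_def)
  qed (use b s r in auto)
  moreover have "(\<integral>\<^sup>+z. ennreal (D z powr (-r)) \<partial>?M) = (\<integral>\<^sup>+z. disc_weight s z * ennreal (kd b z powr (-r)) \<partial>area)"
    by (subst nn_integral_density) (auto intro!: nn_integral_cong simp: D_def disc_weight_def)
  ultimately show ?thesis by (simp add: shell_const_def)
qed

lemma kernel_integral_near:
  assumes b: "b \<in> disc" and s: "0 \<le> s" and t: "0 \<le> t" "t < s + 2" and R0: "0 < R0"
  shows "(\<integral>\<^sup>+z. disc_weight s z * ennreal (kd b z powr (-t)) * indicator {z. kd b z \<le> R0} z \<partial>area)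
    \<le> ennreal (2 powr t / (1 - 2 powr (t - (s + 2))) * R0 powr (s + 2 - t))"
proof -
  let ?M = "density area (disc_weight s)"
  have "(\<integral>\<^sup>+z. ennreal (kd b z powr (-t)) * indicator {z\<in>space ?M. kd b z \<le> R0} z \<partial>?M)
     \<le> ennreal (1 * (2 powr t / (1 - 2 powr (t - (s + 2)))) * R0 powr (s + 2 - t))"
  proof (rule nn_integral_powr_growth_below)
    fix R assume R: "0 < R" "R \<le> R0"
    then show "emeasure ?M {z \<in> space ?M. kd b z \<le> R} \<le> ennreal (1 * R powr (s + 2))"
      by (intro disc_weight_growth[OF b s]) auto
  qed (use assms in auto)
  moreover have "(\<integral>\<^sup>+z. ennreal (kd b z powr (-t)) * indicator {z\<in>space ?M. kd b z \<le> R0} z \<partial>?M) =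
     (\<integral>\<^sup>+z. disc_weight s z * ennreal (kd b z powr (-t)) * indicator {z. kd b z \<le> R0} z \<partial>area)"
    by (subst nn_integral_density) (auto intro!: nn_integral_cong simp: mult.assoc)
  ultimately show ?thesis by simp
qed

definition kernel_const :: "real \<Rightarrow> real \<Rightarrow> real \<Rightarrow> real" where
  "kernel_const s r t = 2 powr t * shell_const (s + 2) r + 2 powr r * (2 powr t / (1 - 2 powr (t - (s + 2))))"

lemma kernel_const_nonneg: "s + 2 < r \<Longrightarrow> t < s + 2 \<Longrightarrow> 0 \<le> kernel_const s r t"
  unfolding kernel_const_def using shell_const_nonneg[of "s+2" r] powr_less_one[of 2 "t - (s+2)"]
  by (intro add_nonneg_nonneg mult_nonneg_nonneg divide_nonneg_nonneg) auto

text \<open>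
  The product of two kernels is dominated by the stronger one, the kernel with pole near \<open>w\<close>:
  the factor \<open>kd a z powr (-t)\<close> may be replaced by its value at \<open>z = w\<close>. Indeed either
  \<open>kd a z\<close> is at least half of \<open>kd a w\<close>, or by the triangle inequality \<open>kd w z\<close> is; in the
  second case the weaker kernel is integrable near its own pole.
\<close>

lemma two_kernel_integral:
  assumes a: "a \<in> disc" and w: "w \<in> disc" and s: "0 \<le> s" and r: "s + 2 < r" and t: "0 \<le> t" "t < s + 2"
  shows "(\<integral>\<^sup>+z. disc_weight s z * ennreal (kd w z powr (-r) * kd a z powr (-t)) \<partial>area)
    \<le> ennreal (kernel_const s r t * (1 - cmod w) powr (s + 2 - r) * kd a w powr (-t))"
proof -
  define \<kappa> where "\<kappa> = kd a w"
  have k: "0 < \<kappa>" using kd_pos[OF a w] by (simp add: \<kappa>_def)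
  have kw: "1 - cmod w \<le> \<kappa>" "0 < 1 - cmod w" using kd_ge[of a w] a w by (auto simp: \<kappa>_def)
  let ?A = "2 powr t * \<kappa> powr (-t)" and ?B = "2 powr r * \<kappa> powr (-r)"
  let ?S = "{z. kd a z \<le> \<kappa> / 2}"
  let ?W = "disc_weight s" and ?f = "\<lambda>z. kd w z powr (-r)" and ?g = "\<lambda>z. kd a z powr (-t)"
  have pt: "?W z * ennreal (?f z * ?g z) \<le>
     ennreal ?A * (?W z * ennreal (?f z)) +
     ennreal ?B * (?W z * ennreal (?g z) * indicator ?S z)" for z
  proof (cases "z \<in> disc")
    case z: True
    have half: "(\<kappa> / 2) powr (-q) = 2 powr q * \<kappa> powr (-q)" for q
      using k by (simp add: powr_divide powr_minus_divide)
    show ?thesis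
    proof (cases "kd a z \<le> \<kappa> / 2")
      case False
      then have "?g z \<le> (\<kappa> / 2) powr (-t)" using k t by (intro powr_mono2') auto
      then have "?f z * ?g z \<le> ?A * ?f z"
        unfolding half by (subst mult.commute) (rule mult_right_mono, auto)
      then have "ennreal (?f z * ?g z) \<le> ennreal ?A * ennreal (?f z)"
        by (simp add: ennreal_mult[symmetric] ennreal_leI)
      then have "?W z * ennreal (?f z * ?g z) \<le> ?W z * (ennreal ?A * ennreal (?f z))"
        by (rule mult_left_mono) simp
      then show ?thesis using False by (simp add: mult_ac)
    next
      case True
      have "\<kappa> \<le> kd a z + kd z w" unfolding \<kappa>_def using a z w by (intro kd_triangle) auto
      then have "\<kappa> / 2 \<le> kd w z" using True by (simp add: kd_sym)
      then have "?f z \<le> (\<kappa> / 2) powr (-r)" using k r s by (intro powr_mono2') auto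
      then have "?f z * ?g z \<le> ?B * ?g z"
        unfolding half by (rule mult_right_mono) auto
      then have "ennreal (?f z * ?g z) \<le> ennreal ?B * ennreal (?g z)"
        by (simp add: ennreal_mult[symmetric] ennreal_leI)
      then have "?W z * ennreal (?f z * ?g z) \<le> ?W z * (ennreal ?B * ennreal (?g z))"
        by (rule mult_left_mono) simp
      then have "?W z * ennreal (?f z * ?g z) \<le> ennreal ?B * (?W z * ennreal (?g z) * indicator ?S z)"
        using True by (simp add: mult_ac)
      then show ?thesis by (rule order_trans) simp
    qed
  qed (simp add: disc_weight_def)
  have "(\<integral>\<^sup>+z. ?W z * ennreal (?f z * ?g z) \<partial>area)
    \<le> (\<integral>\<^sup>+z. ennreal ?A * (?W z * ennreal (?f z)) +
     ennreal ?B * (?W z * ennreal (?g z) * indicator ?S z) \<partial>area)"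
    by (intro nn_integral_mono pt)
  also have "\<dots> = ennreal ?A * (\<integral>\<^sup>+z. ?W z * ennreal (?f z) \<partial>area) +
     ennreal ?B * (\<integral>\<^sup>+z. ?W z * ennreal (?g z) * indicator ?S z \<partial>area)"
    by (subst nn_integral_add) (auto simp: nn_integral_cmult)
  also have "\<dots> \<le> ennreal ?A * ennreal (shell_const (s + 2) r * (1 - cmod w) powr (s + 2 - r)) +
     ennreal ?B * ennreal (2 powr t / (1 - 2 powr (t - (s + 2))) * (\<kappa> / 2) powr (s + 2 - t))"
    using k by (intro add_mono mult_left_mono kernel_integral kernel_integral_near) (use assms in auto)
  also have "\<dots> = ennreal (?A * (shell_const (s + 2) r * (1 - cmod w) powr (s + 2 - r)) +
     ?B * (2 powr t / (1 - 2 powr (t - (s + 2))) * (\<kappa> / 2) powr (s + 2 - t)))"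
    using shell_const_nonneg[OF r] powr_less_one[of 2 "t - (s+2)"] t
    by (simp add: ennreal_mult[symmetric] ennreal_plus[symmetric] del: ennreal_plus)
  also have "\<dots> \<le> ennreal (kernel_const s r t * (1 - cmod w) powr (s + 2 - r) * kd a w powr (-t))"
  proof (rule ennreal_leI)
    define K where "K = 2 powr t / (1 - 2 powr (t - (s + 2)))"
    have K: "0 \<le> K" unfolding K_def using powr_less_one[of 2 "t - (s+2)"] t by (intro divide_nonneg_nonneg) auto
    have "\<kappa> powr (-r) * (\<kappa> / 2) powr (s + 2 - t) \<le> \<kappa> powr (-r) * \<kappa> powr (s + 2 - t)"
      using k t by (intro mult_left_mono powr_mono2) auto
    also have "\<dots> = \<kappa> powr (s + 2 - r) * \<kappa> powr (-t)"
      by (simp only: powr_add[symmetric]) (simp add: algebra_simps)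
    also have "\<dots> \<le> (1 - cmod w) powr (s + 2 - r) * \<kappa> powr (-t)"
      using kw r by (intro mult_right_mono powr_mono2') auto
    finally have "2 powr r * K * (\<kappa> powr (-r) * (\<kappa> / 2) powr (s + 2 - t))
        \<le> 2 powr r * K * ((1 - cmod w) powr (s + 2 - r) * \<kappa> powr (-t))"
      using K by (intro mult_left_mono) auto
    then show "?A * (shell_const (s + 2) r * (1 - cmod w) powr (s + 2 - r)) +
      ?B * (2 powr t / (1 - 2 powr (t - (s + 2))) * (\<kappa> / 2) powr (s + 2 - t)) \<le>
      kernel_const s r t * (1 - cmod w) powr (s + 2 - r) * kd a w powr (-t)"
      unfolding kernel_const_def \<kappa>_def[symmetric] K_def[symmetric] by (simp add: algebra_simps)
  qed
  finally show ?thesis .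
qed

text \<open>
  The shell estimate \<open>nn_integral_powr_growth_above\<close> for a point measure.
\<close>

lemma sum_powr_growth:
  fixes y :: "'i \<Rightarrow> real"
  assumes E: "finite E" and y: "\<And>I. I \<in> E \<Longrightarrow> 0 \<le> y I" and D: "\<And>I. I \<in> E \<Longrightarrow> \<delta> \<le> D I" and \<delta>: "0 < \<delta>"
    and r: "0 \<le> \<gamma>" "\<gamma> < r" and C: "0 \<le> C"
    and growth: "\<And>R. \<delta> \<le> R \<Longrightarrow> (\<Sum>I\<in>{I\<in>E. D I \<le> R}. y I) \<le> C * R powr \<gamma>"
  shows "(\<Sum>I\<in>E. y I * D I powr (-r)) \<le> C * shell_const \<gamma> r * \<delta> powr (\<gamma> - r)"
proof -
  let ?M = "point_measure E (\<lambda>I. ennreal (y I))"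
  have "(\<integral>\<^sup>+I. ennreal (D I powr (-r)) \<partial>?M) \<le> ennreal (C * (2 powr \<gamma> / (1 - 2 powr (\<gamma> - r))) * \<delta> powr (\<gamma> - r))"
  proof (rule nn_integral_powr_growth_above)
    show "D \<in> borel_measurable ?M" by simp
    fix R assume R: "\<delta> \<le> R"
    have "emeasure ?M {x \<in> space ?M. D x \<le> R} = (\<Sum>I\<in>{I\<in>E. D I \<le> R}. ennreal (y I))"
      using E by (subst emeasure_point_measure_finite) (auto simp: space_point_measure)
    also have "\<dots> = ennreal (\<Sum>I\<in>{I\<in>E. D I \<le> R}. y I)" using y by (intro sum_ennreal) auto
    also have "\<dots> \<le> ennreal (C * R powr \<gamma>)" by (intro ennreal_leI growth R)
    finally show "emeasure ?M {x \<in> space ?M. D x \<le> R} \<le> ennreal (C * R powr \<gamma>)" .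
  qed (use \<delta> D r C in \<open>auto simp: space_point_measure\<close>)
  also have "(\<integral>\<^sup>+I. ennreal (D I powr (-r)) \<partial>?M) = (\<Sum>I\<in>E. ennreal (y I * D I powr (-r)))"
    using E y by (subst nn_integral_point_measure_finite) (auto simp: ennreal_mult[symmetric] intro!: sum.cong)
  also have "\<dots> = ennreal (\<Sum>I\<in>E. y I * D I powr (-r))"
    using y by (intro sum_ennreal) auto
  finally have "ennreal (\<Sum>I\<in>E. y I * D I powr (-r)) \<le> ennreal (C * shell_const \<gamma> r * \<delta> powr (\<gamma> - r))"
    unfolding shell_const_def .
  moreover have "0 \<le> C * shell_const \<gamma> r * \<delta> powr (\<gamma> - r)"
    using C shell_const_nonneg[OF r(2)] by (intro mult_nonneg_nonneg) auto
  ultimately show ?thesis by (simp only: ennreal_le_iff)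
qed

text \<open>
  A discrete version of \<open>kernel_integral\<close>, with the packing estimate in place of area: the
  arcs with \<open>kd (arc_pt I) z \<le> R\<close> have their balls in a disc of radius \<open>2 R\<close>.
\<close>

lemma dyadic_area_sum:
  assumes D: "dyadic_system \<D>" and E: "finite E" "E \<subseteq> \<D>" and z: "z \<in> disc" and r: "2 < r"
  shows "(\<Sum>I\<in>E. (arc_len I)\<^sup>2 * kd (arc_pt I) z powr (-r)) \<le> 256 * shell_const 2 r * (1 - cmod z) powr (2 - r)"
proof (rule sum_powr_growth[OF E(1)])
  have pt: "cmod (arc_pt I) \<le> 1" "1 - cmod (arc_pt I) = 3 * arc_len I / 4" "0 < arc_len I" if "I \<in> E" for I
    using norm_arc_pt[OF D, of I] dyadic_arc[OF D, of I] that E(2) by auto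
  show "1 - cmod z \<le> kd (arc_pt I) z" if "I \<in> E" for I using kd_ge[of "arc_pt I" z] pt[OF that] z by simp
  fix R assume R: "1 - cmod z \<le> R"
  then have R0: "0 < R" using z by auto
  have "(\<Sum>I\<in>{I\<in>E. kd (arc_pt I) z \<le> R}. (arc_len I)\<^sup>2) \<le> 64 * (2 * R)\<^sup>2"
  proof (rule dyadic_packing[OF D])
    fix I assume "I \<in> {I\<in>E. kd (arc_pt I) z \<le> R}"
    then have I: "I \<in> E" "kd (arc_pt I) z \<le> R" by auto
    have "cmod (arc_pt I - z) \<le> R" using dist_le_kd[of "arc_pt I" z] pt[OF I(1)] I(2) z by simp
    moreover have "3 * arc_len I / 4 \<le> R" using kd_ge[of z "arc_pt I"] pt[OF I(1)] I(2) z by (simp add: kd_sym)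
    ultimately show "ball (arc_pt I) (arc_len I / 8) \<subseteq> ball z (2 * R)"
      using R0 pt(3)[OF I(1)] by (subst ball_subset_ball_iff) (auto simp: dist_norm)
  qed (use E R0 in auto)
  then show "(\<Sum>I\<in>{I\<in>E. kd (arc_pt I) z \<le> R}. (arc_len I)\<^sup>2) \<le> 256 * R powr 2"
    using R0 by (simp add: power_mult_distrib powr_numeral)
qed (use z r in auto)

text \<open>
  If \<open>kd (arc_pt I) a \<le> R\<close>, then \<open>I\<close> is contained in one of boundedly many arcs of length
  comparable to \<open>R\<close> near \<open>a\<close>, and the Carleson condition is applied to each of these. For large
  \<open>R\<close> the whole circle serves.
\<close>

lemma dyadic_carleson_growth:
  assumes D: "dyadic_system \<D>" and x: "dyadic_carleson p \<D> E x" and p: "0 < p" and a: "a \<in> disc" and R: "0 < R"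
  shows "(\<Sum>I\<in>{I\<in>E. kd (arc_pt I) a \<le> R}. x I) \<le> (2304 * 8 powr p) * R powr p"
proof -
  have E: "finite E" "E \<subseteq> \<D>" and x0: "\<And>I. 0 \<le> x I"
    and car: "\<And>J. J \<in> \<D> \<Longrightarrow> (\<Sum>I\<in>below E J. x I) \<le> arc_len J powr p"
    using x by (auto simp: dyadic_carleson_def)
  let ?S = "{I\<in>E. kd (arc_pt I) a \<le> R}"
  have finS: "finite ?S" using E by simp
  show ?thesis
  proof (cases "R < 1/8")
    case False
    have c0: "circle \<in> dyadic_level \<D> 0" using dyadic_system_levels(2)[OF D] by simp
    then have c: "circle \<in> \<D>" "arc_len circle = 1" by (auto simp: dyadic_level_def)
    have "(\<Sum>I\<in>?S. x I) \<le> (\<Sum>I\<in>{I\<in>E. I \<subseteq> circle}. x I)"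
      using E x0 dyadic_arc(2)[OF D] by (intro sum_mono2) auto
    also have "\<dots> \<le> 1" using car[OF c(1)] c(2) by simp
    also have "\<dots> \<le> 2304 * (8 * R) powr p" using ge_one_powr_ge_zero[of "8 * R" p] False p by simp
    finally show ?thesis using R by (simp add: powr_mult)
  next
    case True
    \<comment> \<open>Generation \<open>k\<close> has arc length \<open>q\<close> with \<open>2R \<le> q \<le> 4R\<close>, so the arcs \<open>I\<close> in question are not longer than \<open>q\<close>.\<close>
    obtain k where k: "2 ^ k * (2 * R) \<le> 1" "1 < 2 ^ Suc k * (2 * R)"
      using dyadic_scale_above[of "2 * R" 1] True R by auto
    define q where "q = 1 / (2::real) ^ k"
    have q: "0 < q" "2 * R \<le> q" "q \<le> 4 * R" using k by (auto simp: q_def field_simps)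
    \<comment> \<open>Packing bounds the number of candidates by \<open>64 * 6\<^sup>2 = 2304\<close>.\<close>
    define G where "G = {J\<in>dyadic_level \<D> k. ball (arc_pt J) (arc_len J / 8) \<subseteq> ball a (6 * q)}"
    have GD: "G \<subseteq> \<D>" "\<And>J. J \<in> G \<Longrightarrow> arc_len J = q" by (auto simp: G_def dyadic_level_def q_def)
    have finG: "finite G" unfolding G_def using dyadic_system_levels(5)[OF D] by simp
    have "(\<Sum>J\<in>G. (arc_len J)\<^sup>2) \<le> 64 * (6 * q)\<^sup>2"
      by (rule dyadic_packing[OF D finG GD(1)]) (use q in \<open>auto simp: G_def\<close>)
    then have "real (card G) * q\<^sup>2 \<le> 2304 * q\<^sup>2" using GD(2) by (simp add: power_mult_distrib)
    then have cardG: "real (card G) \<le> 2304" using q by simp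
    have cov: "\<exists>J\<in>G. I \<subseteq> J" if "I \<in> ?S" for I
    proof -
      have I: "I \<in> \<D>" "kd (arc_pt I) a \<le> R" using that E by auto
      have L: "0 < arc_len I" "arc_len I \<le> 1" "1 - cmod (arc_pt I) = 3 * arc_len I / 4"
          using dyadic_arc[OF D I(1)] norm_arc_pt[OF D I(1)] by auto
      have Lq: "3 * arc_len I / 4 \<le> R" using kd_ge[of a "arc_pt I"] I(2) L a by (simp add: kd_sym)
      obtain j where j: "I \<in> dyadic_level \<D> j" "arc_len I = 1 / 2 ^ j" using dyadic_mem[OF D I(1)] .
      have "1 / 2 ^ j \<le> 1 / (2::real) ^ k" using Lq q R unfolding j(2)[symmetric] q_def[symmetric] by linarith
      then have "(2::real) ^ k \<le> 2 ^ j" by (simp add: field_simps)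
      then have "k \<le> j" by (rule power_le_imp_le_exp[rotated]) simp
      then obtain J where J: "J \<in> dyadic_level \<D> k" "I \<subseteq> J" using dyadic_ancestor[OF D j(1)] by blast
      have JD: "J \<in> \<D>" "arc_len J = q" using J by (auto simp: dyadic_level_def q_def)
      have "arc_mid I \<in> J" using arc_mid_in[OF D I(1)] J(2) by auto
      then have "cmod (arc_mid I - arc_mid J) \<le> pi * q"
        using arc_mid(3)[OF dyadic_arc(1)[OF D JD(1)]] JD(2) by simp
      also have "\<dots> \<le> 7/2 * q" using pi_approx q by (intro mult_right_mono) auto
      finally have m: "cmod (arc_mid I - arc_mid J) \<le> 7/2 * q" .
      have "cmod (arc_pt J - arc_mid J) \<le> q" "cmod (arc_pt I - arc_mid I) \<le> arc_len I"
        using arc_pt_near_mid[OF D JD(1)] arc_pt_near_mid[OF D I(1)] JD(2) by auto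
      moreover have "cmod (arc_pt I - a) \<le> R" using dist_le_kd[of "arc_pt I" a] L I(2) a by simp
      moreover have "cmod (arc_pt J - a) \<le> cmod (arc_pt J - arc_mid J) + cmod (arc_mid I - arc_mid J)
          + cmod (arc_pt I - arc_mid I) + cmod (arc_pt I - a)"
      proof -
        show ?thesis
          using norm_triangle_ineq[of "arc_pt J - arc_mid J" "arc_mid J - a"]
            norm_triangle_ineq[of "arc_mid J - arc_mid I" "arc_mid I - a"]
            norm_triangle_ineq[of "arc_mid I - arc_pt I" "arc_pt I - a"]
          by (simp add: norm_minus_commute)
      qed
      ultimately have "cmod (arc_pt J - a) \<le> 23/4 * q" using m Lq q R by linarith
      then have "ball (arc_pt J) (arc_len J / 8) \<subseteq> ball a (6 * q)"
        using q JD(2) by (subst ball_subset_ball_iff) (auto simp: dist_norm)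
      then show ?thesis using J by (auto simp: G_def)
    qed
    have "(\<Sum>I\<in>?S. x I) \<le> (\<Sum>I\<in>(\<Union>J\<in>G. (below E J)). x I)"
      using cov finG E x0 by (intro sum_mono2) auto
    also have "\<dots> \<le> (\<Sum>J\<in>G. \<Sum>I\<in>below E J. x I)"
      using finG E x0 by (intro sum_UNION_le) auto
    also have "\<dots> \<le> (\<Sum>J\<in>G. q powr p)"
      using car GD by (intro sum_mono) force
    also have "\<dots> = real (card G) * q powr p" by simp
    also have "\<dots> \<le> 2304 * (8 * R) powr p"
      using cardG q p R by (intro mult_mono powr_mono2) auto
    finally show ?thesis using R by (simp add: powr_mult)
  qed
qed

lemma dyadic_carleson_sum:
  assumes D: "dyadic_system \<D>" and x: "dyadic_carleson p \<D> E x" and p: "0 < p" and a: "a \<in> disc"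
  shows "(\<Sum>I\<in>E. x I * kd (arc_pt I) a powr (-(2*p)))
      \<le> (2304 * 8 powr p) * shell_const p (2*p) * (1 - cmod a) powr (-p)"
proof -
  have E: "finite E" "E \<subseteq> \<D>" and x0: "\<And>I. 0 \<le> x I" using x by (auto simp: dyadic_carleson_def)
  have "(\<Sum>I\<in>E. x I * kd (arc_pt I) a powr (-(2*p)))
      \<le> (2304 * 8 powr p) * shell_const p (2*p) * (1 - cmod a) powr (p - 2*p)"
  proof (rule sum_powr_growth[OF E(1) x0])
    show "1 - cmod a \<le> kd (arc_pt I) a" if "I \<in> E" for I
      using kd_ge[of "arc_pt I" a] a that E norm_arc_pt[OF D, of I] dyadic_arc[OF D, of I] by auto
    fix R assume "1 - cmod a \<le> R"
    then have "0 < R" using a by auto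
    then show "(\<Sum>I\<in>{I\<in>E. kd (arc_pt I) a \<le> R}. x I) \<le> (2304 * 8 powr p) * R powr p"
      by (rule dyadic_carleson_growth[OF D x p a])
  qed (use a p in auto)
  then show ?thesis by simp
qed

section \<open>Test functions\<close>

text \<open>
  A normalized kernel: on \<open>Q_up I\<close> its derivative has modulus about \<open>c |I|^(-1-p/2)\<close>. The
  constant factor makes a single atom with \<open>c = |I|^(p/2)\<close> bounded.
\<close>

definition atom :: "real \<Rightarrow> complex set \<Rightarrow> real \<Rightarrow> complex \<Rightarrow> complex" where
  "atom p I c z = of_real (c * arc_len I powr (2 - p / 2)) / (1 - cnj (arc_pt I) * z)\<^sup>2"

definition atom_deriv :: "real \<Rightarrow> complex set \<Rightarrow> real \<Rightarrow> complex \<Rightarrow> complex" where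
  "atom_deriv p I c z = of_real (c * arc_len I powr (2 - p / 2)) * (2 * cnj (arc_pt I)) / (1 - cnj (arc_pt I)
      * z) ^ 3"

lemma atom_has_derivative:
  assumes D: "dyadic_system \<D>" "I \<in> \<D>" and z: "z \<in> disc"
  shows "(atom p I c has_field_derivative atom_deriv p I c z) (at z)"
proof -
  have "cmod (arc_pt I) < 1" using norm_arc_pt[OF D] dyadic_arc[OF D] by simp
  then have "0 < kd (arc_pt I) z" using z by (intro kd_pos) auto
  then have nz: "1 - cnj (arc_pt I) * z \<noteq> 0" by (auto simp: kd_def)
  define K :: complex where "K = of_real (c * arc_len I powr (2 - p / 2))"
  define w where "w = cnj (arc_pt I)"
  have g: "((\<lambda>z. (1 - w * z)\<^sup>2) has_field_derivative 2 * (1 - w * z) * (- w)) (at z)"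
    by (auto intro!: derivative_eq_intros)
  have "((\<lambda>z. K / (1 - w * z)\<^sup>2) has_field_derivative
      (0 * (1 - w * z)\<^sup>2 - K * (2 * (1 - w * z) * (- w))) / ((1 - w * z)\<^sup>2 * (1 - w * z)\<^sup>2)) (at z)"
    by (rule DERIV_divide[OF DERIV_const g]) (use nz in \<open>simp add: w_def\<close>)
  also have "(0 * (1 - w * z)\<^sup>2 - K * (2 * (1 - w * z) * (- w))) / ((1 - w * z)\<^sup>2 * (1 - w * z)\<^sup>2)
      = K * (2 * w) / (1 - w * z) ^ 3"
  proof -
    define q where "q = 1 - w * z"
    have "q \<noteq> 0" using nz by (simp add: q_def w_def)
    then show ?thesis unfolding q_def[symmetric] by (simp add: field_simps power2_eq_square power3_eq_cube)
  qed
  finally show ?thesis unfolding atom_def[abs_def] atom_deriv_def K_def w_def .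
qed

text \<open>
  Cut off outside the disc, as membership in \<open>Qp\<close> requires.
\<close>

definition test_fun :: "real \<Rightarrow> complex set set \<Rightarrow> (complex set \<Rightarrow> real) \<Rightarrow> complex \<Rightarrow> complex" where
  "test_fun p E c z = (if z \<in> disc then (\<Sum>I\<in>E. atom p I (c I) z) else 0)"

lemma test_fun_deriv:
  assumes D: "dyadic_system \<D>" "E \<subseteq> \<D>" and z: "z \<in> disc"
  shows "(test_fun p E c has_field_derivative (\<Sum>I\<in>E. atom_deriv p I (c I) z)) (at z)"
proof -
  have "((\<lambda>z. \<Sum>I\<in>E. atom p I (c I) z) has_field_derivative (\<Sum>I\<in>E. atom_deriv p I (c I) z)) (at z)"
    by (intro DERIV_sum atom_has_derivative[OF D(1) _ z]) (use D in auto)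
  then show ?thesis
    by (rule has_field_derivative_transform_within_open[where S = disc]) (use z in \<open>auto simp: test_fun_def\<close>)
qed

lemma test_fun_holomorphic:
  assumes D: "dyadic_system \<D>" "E \<subseteq> \<D>"
  shows "test_fun p E c holomorphic_on disc"
  unfolding holomorphic_on_open[OF open_ball] using test_fun_deriv[OF D] by blast

lemma test_fun_dsq:
  assumes D: "dyadic_system \<D>" "E \<subseteq> \<D>" and z: "z \<in> disc"
  shows "dsq (test_fun p E c) z = ennreal ((cmod (\<Sum>I\<in>E. atom_deriv p I (c I) z))\<^sup>2)"
  using DERIV_imp_deriv[OF test_fun_deriv[OF D z]] z by (simp add: dsq_def)

lemma norm_atom_deriv_le:
  assumes D: "dyadic_system \<D>" "I \<in> \<D>" and z: "z \<in> disc"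
  shows "cmod (atom_deriv p I c z) \<le> 2 * (\<bar>c\<bar> * arc_len I powr (2 - p / 2) * kd (arc_pt I) z powr (-3))"
proof -
  have w: "cmod (arc_pt I) < 1" using norm_arc_pt[OF D] dyadic_arc[OF D] by simp
  have k: "0 < kd (arc_pt I) z" using z w by (intro kd_pos) auto
  have k3: "kd (arc_pt I) z powr (-3) = 1 / kd (arc_pt I) z ^ 3"
    using k by (simp add: powr_minus_divide powr_numeral)
  have "cmod (atom_deriv p I c z) = (\<bar>c\<bar> * arc_len I powr (2 - p / 2) * kd (arc_pt I) z powr (-3)) * (2
      * cmod (arc_pt I))"
    unfolding atom_deriv_def k3 by (simp add: norm_mult norm_divide norm_power kd_def abs_mult)
  also have "\<dots> \<le> (\<bar>c\<bar> * arc_len I powr (2 - p / 2) * kd (arc_pt I) z powr (-3)) * 2"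
    using w by (intro mult_left_mono) auto
  finally show ?thesis by simp
qed

text \<open>
  For \<open>z \<in> Q_up I\<close> one has \<open>kd (arc_pt I) z \<le> 6 |I|\<close> and \<open>|arc_pt I| \<ge> 1/4\<close>; the cubed kernel
  costs the factor \<open>6\<^sup>3 = 216\<close>.
\<close>

lemma norm_atom_deriv_ge:
  assumes D: "dyadic_system \<D>" "I \<in> \<D>" and z: "z \<in> Q_up I"
  shows "(cmod (atom_deriv p I c z))\<^sup>2 \<ge> c\<^sup>2 * arc_len I powr (-2 - p) / 1000000"
proof -
  let ?L = "arc_len I"
  have L: "0 < ?L" "?L \<le> 1" using dyadic_arc[OF D] by auto
  have w: "cmod (arc_pt I) = 1 - 3 * ?L / 4" by (rule norm_arc_pt[OF D])
  have zd: "z \<in> disc" using z L unfolding Q_up_iff[OF D] by auto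
  have k: "0 < kd (arc_pt I) z" using zd w L by (intro kd_pos) auto
  have "kd (arc_pt I) z \<le> 2 * (1 - cmod (arc_pt I)) + cmod (arc_pt I - z)"
    using zd w L by (intro kd_le) auto
  also have "cmod (arc_pt I - z) \<le> 4 * ?L" using Q_up_near_arc_pt[OF D z] by (simp add: norm_minus_commute)
  finally have kL: "kd (arc_pt I) z \<le> 6 * ?L" using w L by simp
  have e: "cmod (atom_deriv p I c z) = \<bar>c\<bar> * ?L powr (2 - p / 2) * (2 * cmod (arc_pt I)) / kd (arc_pt I) z ^ 3"
    unfolding atom_deriv_def by (simp add: norm_mult norm_divide norm_power kd_def abs_mult)
  have "\<bar>c\<bar> * ?L powr (-1 - p / 2) / 1000 \<le> \<bar>c\<bar> * ?L powr (2 - p / 2) * (1/2) / (6 * ?L) ^ 3"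
  proof -
    have "?L powr (2 - p / 2) = ?L powr (-1 - p / 2 + 3)" by (simp add: algebra_simps)
    also have "\<dots> = ?L powr (-1 - p / 2) * ?L powr 3" by (rule powr_add)
    also have "?L powr 3 = ?L ^ 3" using L by (simp add: powr_numeral)
    finally have h: "?L powr (2 - p / 2) / (6 * ?L) ^ 3 = ?L powr (-1 - p / 2) / 216" using L
        by (simp add: power_mult_distrib)
    have "\<bar>c\<bar> * ?L powr (2 - p / 2) * (1/2) / (6 * ?L) ^ 3 = \<bar>c\<bar> * (?L powr (2 - p / 2) / (6 * ?L) ^ 3) * (1/2)"
      by (simp only: times_divide_eq_right times_divide_eq_left mult.commute mult.left_commute)
    also have "\<dots> = \<bar>c\<bar> * ?L powr (-1 - p / 2) / 432" unfolding h by simp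
    finally have "\<bar>c\<bar> * ?L powr (2 - p / 2) * (1/2) / (6 * ?L) ^ 3 = \<bar>c\<bar> * ?L powr (-1 - p / 2) / 432" .
    moreover have "0 \<le> \<bar>c\<bar> * ?L powr (-1 - p / 2)" by simp
    ultimately show ?thesis by linarith
  qed
  also have "\<dots> \<le> cmod (atom_deriv p I c z)" unfolding e
    using k kL w L by (intro frac_le mult_left_mono power_mono mult_nonneg_nonneg zero_less_power) auto
  finally have "(\<bar>c\<bar> * ?L powr (-1 - p / 2) / 1000)\<^sup>2 \<le> (cmod (atom_deriv p I c z))\<^sup>2"
    by (intro power_mono) auto
  also have "(\<bar>c\<bar> * ?L powr (-1 - p / 2) / 1000)\<^sup>2 = c\<^sup>2 * ?L powr (-2 - p) / 1000000"
  proof -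
    have "(?L powr (-1 - p / 2))\<^sup>2 = ?L powr (-1 - p / 2) * ?L powr (-1 - p / 2)" by (rule power2_eq_square)
    also have "\<dots> = ?L powr (-2 - p)" by (simp only: powr_add[symmetric]) simp
    finally show ?thesis by (simp add: power_mult_distrib power_divide)
  qed
  finally show ?thesis .
qed

lemma poi_powr_le:
  assumes a: "a \<in> disc" and z: "z \<in> disc" and p: "0 < p" "p \<le> 1"
  shows "poi a z powr p \<le> 4 * ((1 - cmod a) powr p * (1 - cmod z) powr p * kd a z powr (-(2*p)))"
proof -
  have k: "0 < kd a z" using kd_pos[OF a z] .
  let ?a = "1 - cmod a" and ?z = "1 - cmod z"
  have s: "1 - (cmod b)\<^sup>2 \<le> 2 * (1 - cmod b)" "0 \<le> 1 - (cmod b)\<^sup>2" if "b \<in> disc" for b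
  proof -
    have "1 - (cmod b)\<^sup>2 = (1 - cmod b) * (1 + cmod b)" by (simp add: power2_eq_square algebra_simps)
    also have "\<dots> \<le> (1 - cmod b) * 2" using that by (intro mult_left_mono) auto
    finally show "1 - (cmod b)\<^sup>2 \<le> 2 * (1 - cmod b)" by simp
    show "0 \<le> 1 - (cmod b)\<^sup>2" using that by (simp add: power_le_one)
  qed
  have "poi a z \<le> (2 * ?a) * (2 * ?z) / (kd a z)\<^sup>2"
    unfolding poi_def using s[OF a] s[OF z] a by (intro divide_right_mono mult_mono) auto
  then have "poi a z powr p \<le> ((2 * ?a) * (2 * ?z) / (kd a z)\<^sup>2) powr p"
    using poi_involution(2)[OF a z] p by (intro powr_mono2) auto
  also have "\<dots> = 4 powr p * (?a powr p * ?z powr p * kd a z powr (-(2*p)))"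
  proof -
    have "((kd a z)\<^sup>2) powr p = kd a z powr (2*p)" using k by (simp add: powr_powr[symmetric] powr_numeral)
    moreover have "2 powr p * 2 powr p = 4 powr p" by (simp add: powr_mult[symmetric])
    moreover have "((2 * ?a) * (2 * ?z) / (kd a z)\<^sup>2) powr p =
        (2 powr p * ?a powr p) * (2 powr p * ?z powr p) / ((kd a z)\<^sup>2) powr p"
      by (simp only: powr_divide powr_mult)
    moreover have "(2 powr p * ?a powr p) * (2 powr p * ?z powr p) / K
        = (2 powr p * 2 powr p) * (?a powr p * ?z powr p * (1 / K))" for K
      by simp
    ultimately show ?thesis by (simp only: powr_minus_divide)
  qed
  also have "\<dots> \<le> 4 powr 1 * (?a powr p * ?z powr p * kd a z powr (-(2*p)))"
    using p by (intro mult_right_mono powr_mono) auto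
  finally show ?thesis by simp
qed

text \<open>
  The product of the constants of \<open>dyadic_area_sum\<close>, \<open>two_kernel_integral\<close> and
  \<open>dyadic_carleson_sum\<close> at the exponents used for the test functions.
\<close>

definition test_const :: "real \<Rightarrow> real" where
  "test_const p = 16 * (256 * shell_const 2 (2 + p / 2)) * kernel_const (p / 2) (4 - p / 2) (2 * p) * 2
     * ((2304 * 8 powr p) * shell_const p (2*p))"

text \<open>
  Cauchy-Schwarz, with the exponent \<open>3\<close> of the kernel split as \<open>(2 - p/4) + (1 + p/4)\<close>. The
  second factor then sums by \<open>dyadic_area_sum\<close>, whose exponent \<open>2 + p/2\<close> has to exceed \<open>2\<close>,
  while the first keeps the exponent \<open>4 - p/2\<close> large enough for \<open>two_kernel_integral\<close>.
\<close>

lemma test_fun_pointwise: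
  assumes D: "dyadic_system \<D>" and x: "dyadic_carleson p \<D> E x" and p: "0 < p" "p \<le> 1"
    and c: "\<And>I. I \<in> E \<Longrightarrow> (c I)\<^sup>2 \<le> x I" and z: "z \<in> disc"
  shows "(cmod (\<Sum>I\<in>E. atom_deriv p I (c I) z))\<^sup>2 \<le> 4 * (256 * shell_const 2 (2 + p / 2)) *
     ((1 - cmod z) powr (-p/2) * (\<Sum>I\<in>E. x I * arc_len I powr (2 - p) * kd (arc_pt I) z powr (-(4 - p/2))))"
proof -
  have E: "finite E" "E \<subseteq> \<D>" and x0: "\<And>I. 0 \<le> x I" using x by (auto simp: dyadic_carleson_def)
  let ?k = "\<lambda>I q. kd (arc_pt I) z powr (-q)" and ?d = "\<lambda>I. atom_deriv p I (c I) z"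
  define u where "u I = \<bar>c I\<bar> * arc_len I powr (1 - p/2) * ?k I (2 - p/4)" for I
  define v where "v I = arc_len I * ?k I (1 + p/4)" for I
  have L: "0 < arc_len I" and k: "0 < kd (arc_pt I) z" if "I \<in> E" for I
  proof -
    have I: "I \<in> \<D>" using that E by auto
    show "0 < arc_len I" using dyadic_arc[OF D I] by simp
    then show "0 < kd (arc_pt I) z" using norm_arc_pt[OF D I] z dyadic_arc[OF D I] by (intro kd_pos) auto
  qed
  have "cmod (\<Sum>I\<in>E. ?d I) \<le> (\<Sum>I\<in>E. 2 * (u I * v I))"
  proof (rule sum_norm_le)
    fix I assume I: "I \<in> E"
    have "cmod (?d I) \<le> 2 * (\<bar>c I\<bar> * arc_len I powr (2 - p / 2) * kd (arc_pt I) z powr (-3))"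
      using norm_atom_deriv_le[OF D _ z] E I by auto
    also have "arc_len I powr (2 - p/2) = arc_len I powr (1 - p/2) * arc_len I"
    proof -
      have "arc_len I powr (2 - p/2) = arc_len I powr ((1 - p/2) + 1)" by simp
      also have "\<dots> = arc_len I powr (1 - p/2) * arc_len I powr 1" by (rule powr_add)
      finally show ?thesis using L[OF I] by simp
    qed
    also have "kd (arc_pt I) z powr (-3) = ?k I (2 - p/4) * ?k I (1 + p/4)"
      by (simp only: powr_add[symmetric]) simp
    finally show "cmod (?d I) \<le> 2 * (u I * v I)" by (simp add: u_def v_def mult_ac)
  qed
  then have "(cmod (\<Sum>I\<in>E. ?d I))\<^sup>2 \<le> (2 * (\<Sum>I\<in>E. u I * v I))\<^sup>2"
    by (intro power_mono) (auto simp: sum_distrib_left)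
  also have "\<dots> = 4 * (\<Sum>I\<in>E. u I * v I)\<^sup>2" by (simp add: power_mult_distrib)
  also have "\<dots> \<le> 4 * ((\<Sum>I\<in>E. (u I)\<^sup>2) * (\<Sum>I\<in>E. (v I)\<^sup>2))"
    by (intro mult_left_mono Cauchy_Schwarz_ineq_sum) auto
  also have "\<dots> \<le> 4 * ((\<Sum>I\<in>E. x I * arc_len I powr (2 - p) * ?k I (4 - p/2)) *
      (256 * shell_const 2 (2 + p / 2) * (1 - cmod z) powr (-p/2)))"
  proof (intro mult_left_mono mult_mono)
    have sq: "(t powr q)\<^sup>2 = t powr (2 * q)" for t q :: real
      by (simp add: power2_eq_square powr_add[symmetric])
    show "(\<Sum>I\<in>E. (u I)\<^sup>2) \<le> (\<Sum>I\<in>E. x I * arc_len I powr (2 - p) * ?k I (4 - p/2))"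
    proof (rule sum_mono)
      fix I assume I: "I \<in> E"
      have "(u I)\<^sup>2 = (c I)\<^sup>2 * (arc_len I powr (2 - p) * ?k I (4 - p/2))"
        unfolding u_def power_mult_distrib sq by (simp add: algebra_simps)
      also have "\<dots> \<le> x I * (arc_len I powr (2 - p) * ?k I (4 - p/2))"
        by (intro mult_right_mono c I) auto
      finally show "(u I)\<^sup>2 \<le> x I * arc_len I powr (2 - p) * ?k I (4 - p/2)" by (simp add: mult_ac)
    qed
    have "(\<Sum>I\<in>E. (v I)\<^sup>2) = (\<Sum>I\<in>E. (arc_len I)\<^sup>2 * ?k I (2 + p/2))"
      unfolding v_def power_mult_distrib sq by (simp add: algebra_simps)
    also have "\<dots> \<le> 256 * shell_const 2 (2 + p/2) * (1 - cmod z) powr (2 - (2 + p/2))"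
      by (rule dyadic_area_sum[OF D E z]) (use p in simp)
    finally show "(\<Sum>I\<in>E. (v I)\<^sup>2) \<le> 256 * shell_const 2 (2 + p / 2) * (1 - cmod z) powr (-p/2)" by simp
  qed (auto intro!: sum_nonneg mult_nonneg_nonneg x0)
  finally show ?thesis by (simp add: mult_ac)
qed

text \<open>
  After \<open>energy_le_poisson\<close> and the pointwise bound the energy at \<open>a\<close> is a sum over arcs of
  integrals of two kernels, with poles near \<open>arc_pt I\<close> and \<open>a\<close>. By \<open>two_kernel_integral\<close> the
  powers of \<open>|I|\<close> cancel and what remains is the sum of \<open>x I * kd (arc_pt I) a powr (-2p)\<close>,
  which the Carleson condition bounds by a multiple of \<open>(1 - |a|)^(-p)\<close>. The factor
  \<open>(1 - |a|)^p\<close> of the Poisson weight cancels this.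
\<close>

lemma test_fun_energy:
  assumes D: "dyadic_system \<D>" and x: "dyadic_carleson p \<D> E x" and p: "0 < p" "p \<le> 1"
    and c: "\<And>I. I \<in> E \<Longrightarrow> (c I)\<^sup>2 \<le> x I"
  shows "Qp_energy p (test_fun p E c) \<le> ennreal (100000 * test_const p)"
  unfolding Qp_energy_dsq
proof (rule SUP_least)
  fix a :: complex assume a: "a \<in> disc"
  have E: "finite E" "E \<subseteq> \<D>" and x0: "\<And>I. 0 \<le> x I" using x by (auto simp: dyadic_carleson_def)
  let ?B = "256 * shell_const 2 (2 + p / 2)" and ?T = "kernel_const (p / 2) (4 - p / 2) (2 * p)"
    and ?C = "(2304 * 8 powr p) * shell_const p (2*p)"
  let ?A = "16 * ?B * (1 - cmod a) powr p" and ?y = "\<lambda>I. x I * arc_len I powr (2 - p)"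
    and ?k = "\<lambda>I z. kd (arc_pt I) z powr (-(4 - p/2)) * kd a z powr (-(2*p))"
    and ?q = "\<lambda>I. ?T * (1 - cmod (arc_pt I)) powr (p/2 + 2 - (4 - p/2)) * kd a (arc_pt I) powr (-(2*p))"
  have B0: "0 \<le> ?B" using shell_const_nonneg[of 2 "2 + p/2"] p by simp
  have T0: "0 \<le> ?T" using p by (intro kernel_const_nonneg) auto
  have wD: "arc_pt I \<in> disc" "1 - cmod (arc_pt I) = 3/4 * arc_len I" "0 < arc_len I" if "I \<in> E" for I
    using that E norm_arc_pt[OF D, of I] dyadic_arc[OF D, of I] by auto
  have "(\<integral>\<^sup>+z. dsq (test_fun p E c) z * ennreal (poi a z powr p) \<partial>area)
     \<le> (\<integral>\<^sup>+z. ennreal ?A * (\<Sum>I\<in>E. ennreal (?y I) * (disc_weight (p/2) z * ennreal (?k I z))) \<partial>area)"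
  proof (rule nn_integral_mono)
    fix z
    show "dsq (test_fun p E c) z * ennreal (poi a z powr p)
        \<le> ennreal ?A * (\<Sum>I\<in>E. ennreal (?y I) * (disc_weight (p/2) z * ennreal (?k I z)))"
    proof (cases "z \<in> disc")
      case z: True
      let ?S = "\<Sum>I\<in>E. ?y I * kd (arc_pt I) z powr (-(4 - p/2))"
      have S0: "0 \<le> ?S" by (intro sum_nonneg mult_nonneg_nonneg x0) auto
      have "(cmod (\<Sum>I\<in>E. atom_deriv p I (c I) z))\<^sup>2 * poi a z powr p
        \<le> (4 * ?B * ((1 - cmod z) powr (-p/2) * ?S)) * (4 * ((1 - cmod a) powr p * (1 - cmod z) powr p
            * kd a z powr (-(2*p))))"
        using B0 S0 by (intro mult_mono test_fun_pointwise[OF D x p c z] poi_powr_le[OF a z p]) auto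
      also have "\<dots> = ?A * (((1 - cmod z) powr (-p/2) * (1 - cmod z) powr p) * (?S * kd a z powr (-(2*p))))"
        by (simp add: mult_ac)
      also have "(1 - cmod z) powr (-p/2) * (1 - cmod z) powr p = (1 - cmod z) powr (p/2)"
        by (simp add: powr_add[symmetric])
      also have "(1 - cmod z) powr (p/2) * (?S * kd a z powr (-(2*p)))
          = (\<Sum>I\<in>E. ?y I * ((1 - cmod z) powr (p/2) * (?k I z)))"
        unfolding sum_distrib_left sum_distrib_right by (intro sum.cong refl) (simp add: mult_ac)
      finally have "ennreal ((cmod (\<Sum>I\<in>E. atom_deriv p I (c I) z))\<^sup>2 * poi a z powr p)
          \<le> ennreal (?A * (\<Sum>I\<in>E. ?y I * ((1 - cmod z) powr (p/2) * (?k I z))))"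
        by (rule ennreal_leI)
      also have "\<dots> = ennreal ?A * ennreal (\<Sum>I\<in>E. ?y I * ((1 - cmod z) powr (p/2) * (?k I z)))"
        using B0 by (intro ennreal_mult mult_nonneg_nonneg sum_nonneg x0) auto
      also have "ennreal (\<Sum>I\<in>E. ?y I * ((1 - cmod z) powr (p/2) * (?k I z))) =
         (\<Sum>I\<in>E. ennreal (?y I) * (disc_weight (p/2) z * ennreal (?k I z)))"
        using z x0 by (subst sum_ennreal[symmetric]) (auto simp: disc_weight_def ennreal_mult intro!: sum.cong)
      finally show ?thesis
        using z unfolding test_fun_dsq[OF D E(2) z] by (simp add: ennreal_mult)
    qed (simp add: dsq_def)
  qed
  also have "\<dots> = ennreal ?A * (\<Sum>I\<in>E. ennreal (?y I) * (\<integral>\<^sup>+z. disc_weight (p/2) z * ennreal (?k I z) \<partial>area))"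
    by (simp add: nn_integral_cmult nn_integral_sum)
  also have "\<dots> \<le> ennreal ?A * (\<Sum>I\<in>E. ennreal (?y I) * ennreal (?q I))"
    using p by (intro mult_left_mono sum_mono two_kernel_integral a wD) auto
  also have "\<dots> = ennreal (?A * (\<Sum>I\<in>E. ?y I * ?q I))"
  proof -
    have "(\<Sum>I\<in>E. ennreal (?y I) * ennreal (?q I))
      = (\<Sum>I\<in>E. ennreal (?y I * ?q I))"
      using x0 T0 by (intro sum.cong refl ennreal_mult[symmetric] mult_nonneg_nonneg) auto
    also have "\<dots> = ennreal (\<Sum>I\<in>E. ?y I * ?q I)"
      using x0 T0 by (intro sum_ennreal mult_nonneg_nonneg) auto
    finally show ?thesis
      using B0 x0 T0 by (subst ennreal_mult) (auto intro!: mult_nonneg_nonneg sum_nonneg)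
  qed
  also have "\<dots> \<le> ennreal (test_const p)"
  proof (rule ennreal_leI)
    have "?y I * ?q I
        \<le> ?T * 2 * (x I * kd (arc_pt I) a powr (-(2*p)))" if I: "I \<in> E" for I
    proof -
      note w = wD[OF I]
      \<comment> \<open>The exponent is \<open>s + 2 - r\<close> with \<open>s = p/2\<close> and \<open>r = 4 - p/2\<close>, that is, \<open>p - 2\<close>.\<close>
      have "(1 - cmod (arc_pt I)) powr (p/2 + 2 - (4 - p/2)) = (3/4 * arc_len I) powr (p - 2)" unfolding w(2)
          by (simp add: algebra_simps)
      also have "\<dots> = (3/4) powr (p - 2) * arc_len I powr (p - 2)" using w by (intro powr_mult)
      also have "\<dots> \<le> 2 * arc_len I powr (p - 2)"
      proof (intro mult_right_mono)
        have "(3/4::real) powr (p - 2) \<le> (3/4) powr (-2)" using p by (intro powr_mono') auto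
        also have "\<dots> = 16/9" by (simp add: powr_minus_divide powr_numeral power_divide)
        finally show "(3/4::real) powr (p - 2) \<le> 2" by simp
      qed auto
      finally have 1: "(1 - cmod (arc_pt I)) powr (p/2 + 2 - (4 - p/2)) \<le> 2 * arc_len I powr (p - 2)" .
      have "?y I * ?q I
        \<le> ?y I * (?T * (2 * arc_len I powr (p - 2)) * kd a (arc_pt I) powr (-(2*p)))"
        using x0 T0 1 by (intro mult_left_mono mult_right_mono) auto
      also have "\<dots> = (arc_len I powr (2 - p) * arc_len I powr (p - 2)) * (?T * 2 * (x I
          * kd (arc_pt I) a powr (-(2*p))))"
        by (simp add: kd_sym mult_ac)
      also have "arc_len I powr (2 - p) * arc_len I powr (p - 2) = 1" using w by (simp add: powr_add[symmetric])
      finally show ?thesis by simp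
    qed
    then have "(\<Sum>I\<in>E. ?y I * ?q I)
      \<le> ?T * 2 * (\<Sum>I\<in>E. x I * kd (arc_pt I) a powr (-(2*p)))"
      unfolding sum_distrib_left by (rule sum_mono)
    also have "\<dots> \<le> ?T * 2 * (?C * (1 - cmod a) powr (-p))"
      using T0 by (intro mult_left_mono dyadic_carleson_sum[OF D x p(1) a]) auto
    finally have "?A * (\<Sum>I\<in>E. ?y I * ?q I)
      \<le> ?A * (?T * 2 * (?C * (1 - cmod a) powr (-p)))"
      using B0 by (intro mult_left_mono) auto
    also have "\<dots> = (16 * ?B * ?T * 2 * ?C) * ((1 - cmod a) powr p * (1 - cmod a) powr (-p))"
      by (simp add: mult_ac)
    also have "(1 - cmod a) powr p * (1 - cmod a) powr (-p) = 1" using a by (simp add: powr_add[symmetric])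
    finally show "?A * (\<Sum>I\<in>E. ?y I * ?q I) \<le> test_const p"
      by (simp add: test_const_def)
  qed
  finally have "(\<integral>\<^sup>+z. dsq (test_fun p E c) z * ennreal (poi a z powr p) \<partial>area) \<le> ennreal (test_const p)" .
  then have "ennreal 100000 * (\<integral>\<^sup>+z. dsq (test_fun p E c) z * ennreal (poi a z powr p) \<partial>area)
      \<le> ennreal 100000 * ennreal (test_const p)"
    by (rule mult_left_mono) simp
  with energy_le_poisson[OF test_fun_holomorphic[OF D E(2)] a p, of p c]
  have "(\<integral>\<^sup>+z. dsq (test_fun p E c) z * green_powr p z a \<partial>area) \<le> ennreal 100000 * ennreal (test_const p)"
    by (rule order_trans)
  also have "\<dots> = ennreal (100000 * test_const p)"
  proof (rule ennreal_mult[symmetric])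
    show "0 \<le> test_const p" unfolding test_const_def
      using shell_const_nonneg[of p "2*p"] shell_const_nonneg[of 2 "2 + p/2"] T0 p
          by (intro mult_nonneg_nonneg) auto
  qed simp
  finally show "(\<integral>\<^sup>+z. dsq (test_fun p E c) z * green_powr p z a \<partial>area) \<le> ennreal (100000 * test_const p)" .
qed

text \<open>
  Generation \<open>k\<close> contributes \<open>2^k\<close> arcs of squared length \<open>4^(-k)\<close>.
\<close>

lemma deep_arcs_sum:
  assumes D: "dyadic_system \<D>" and E: "finite E" "E \<subseteq> (\<Union>k\<in>{n..}. dyadic_level \<D> k)"
  shows "(\<Sum>I\<in>E. (arc_len I)\<^sup>2) \<le> 2 * (1 / 2) ^ n"
proof -
  have "\<forall>I\<in>E. \<exists>k. n \<le> k \<and> I \<in> dyadic_level \<D> k" using E(2) by auto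
  then obtain lev where lev: "\<And>I. I \<in> E \<Longrightarrow> n \<le> lev I \<and> I \<in> dyadic_level \<D> (lev I)" by metis
  obtain m where m: "lev ` E \<subseteq> {..<m}" using finite_nat_bounded[of "lev ` E"] E(1) by auto
  have sub: "E \<subseteq> (\<Union>k\<in>{n..<m}. dyadic_level \<D> k)"
  proof
    fix I assume I: "I \<in> E"
    then have "lev I < m" using m by auto
    then show "I \<in> (\<Union>k\<in>{n..<m}. dyadic_level \<D> k)" using lev[OF I] by auto
  qed
  have "(\<Sum>I\<in>E. (arc_len I)\<^sup>2) \<le> (\<Sum>I\<in>(\<Union>k\<in>{n..<m}. dyadic_level \<D> k). (arc_len I)\<^sup>2)"
    using sub dyadic_system_levels(5)[OF D] by (intro sum_mono2) auto
  also have "\<dots> \<le> (\<Sum>k\<in>{n..<m}. \<Sum>I\<in>dyadic_level \<D> k. (arc_len I)\<^sup>2)"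
    using dyadic_system_levels(5)[OF D] by (intro sum_UNION_le) auto
  also have "\<dots> = (\<Sum>k\<in>{n..<m}. (1 / 2) ^ k)"
  proof (rule sum.cong[OF refl])
    fix k
    have "(\<Sum>I\<in>dyadic_level \<D> k. (arc_len I)\<^sup>2) = (\<Sum>I\<in>dyadic_level \<D> k. (1 / 2 ^ k)\<^sup>2)"
      by (rule sum.cong) (auto simp: dyadic_level_def)
    also have "\<dots> = 2 ^ k * (1 / 2 ^ k)\<^sup>2" using dyadic_system_levels(4)[OF D, of k] by simp
    also have "\<dots> = (1 / 2) ^ k" by (simp add: power2_eq_square power_divide)
    finally show "(\<Sum>I\<in>dyadic_level \<D> k. (arc_len I)\<^sup>2) = (1 / 2) ^ k" .
  qed
  also have "\<dots> \<le> 2 * (1 / 2) ^ n"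
  proof (cases "n \<le> m")
    case True
    have "(\<Sum>k\<in>{n..<m}. (1 / 2) ^ k) = 2 * (1 / 2 :: real) ^ n - 2 * (1 / 2) ^ m"
      using True by (induction rule: dec_induct) auto
    then show ?thesis by simp
  qed simp
  finally show ?thesis .
qed

text \<open>
  The Carleson condition at \<open>J = I\<close> gives \<open>(c I)\<^sup>2 \<le> |I|^p\<close>, so each atom is at most
  \<open>|I|\<^sup>2 / (1 - |z|)\<^sup>2\<close>. Test functions built from short arcs are therefore small on
  compact sets.
\<close>

lemma test_fun_small:
  assumes D: "dyadic_system \<D>" and x: "dyadic_carleson p \<D> E x" and p: "0 < p"
    and c: "\<And>I. (c I)\<^sup>2 = x I" and E: "E \<subseteq> (\<Union>k\<in>{n..}. dyadic_level \<D> k)" and z: "z \<in> disc"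
  shows "cmod (test_fun p E c z) \<le> (1 / (1 - cmod z)\<^sup>2) * (2 * (1 / 2) ^ n)"
proof -
  have E': "finite E" "E \<subseteq> \<D>" and x0: "\<And>I. 0 \<le> x I"
    and car: "\<And>J. J \<in> \<D> \<Longrightarrow> (\<Sum>I\<in>below E J. x I) \<le> arc_len J powr p"
    using x by (auto simp: dyadic_carleson_def)
  have z1: "0 < 1 - cmod z" using z by simp
  have "cmod (test_fun p E c z) \<le> (\<Sum>I\<in>E. (1 / (1 - cmod z)\<^sup>2) * (arc_len I)\<^sup>2)"
    unfolding test_fun_def using z
  proof (simp, intro sum_norm_le)
    fix I assume I: "I \<in> E"
    then have ID: "I \<in> \<D>" using E' by auto
    have L: "0 < arc_len I" using dyadic_arc[OF D ID] by simp
    have "x I = (\<Sum>I\<in>{I}. x I)" by simp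
    also have "\<dots> \<le> (\<Sum>I'\<in>{I'\<in>E. I' \<subseteq> I}. x I')" using E' I x0 by (intro sum_mono2) auto
    also have "\<dots> \<le> arc_len I powr p" by (rule car[OF ID])
    also have "\<dots> = (arc_len I powr (p/2))\<^sup>2" by (simp add: power2_eq_square powr_add[symmetric])
    finally have "\<bar>c I\<bar>\<^sup>2 \<le> (arc_len I powr (p/2))\<^sup>2" using c by simp
    then have cI: "\<bar>c I\<bar> \<le> arc_len I powr (p/2)" by (rule power2_le_imp_le) simp
    have "1 - cmod z \<le> kd (arc_pt I) z"
      using kd_ge[of "arc_pt I" z] z norm_arc_pt[OF D ID] L by simp
    then have kI: "(1 - cmod z)\<^sup>2 \<le> (kd (arc_pt I) z)\<^sup>2" using z1 by (intro power_mono) auto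
    have "cmod (atom p I (c I) z) = (\<bar>c I\<bar> * arc_len I powr (2 - p/2)) / (kd (arc_pt I) z)\<^sup>2"
      by (simp add: atom_def norm_divide norm_mult norm_power kd_def abs_mult)
    also have "\<dots> \<le> (arc_len I powr (p/2) * arc_len I powr (2 - p/2)) / (1 - cmod z)\<^sup>2"
      using cI kI z1 by (intro frac_le mult_right_mono) auto
    also have "arc_len I powr (p/2) * arc_len I powr (2 - p/2) = (arc_len I)\<^sup>2"
      using L by (simp add: powr_add[symmetric] powr_numeral)
    finally show "cmod (atom p I (c I) z) \<le> (arc_len I)\<^sup>2 / (1 - cmod z)\<^sup>2" .
  qed
  also have "\<dots> = (1 / (1 - cmod z)\<^sup>2) * (\<Sum>I\<in>E. (arc_len I)\<^sup>2)" by (simp only: sum_distrib_left)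
  also have "\<dots> \<le> (1 / (1 - cmod z)\<^sup>2) * (2 * (1 / 2) ^ n)"
    by (intro mult_left_mono deep_arcs_sum[OF D E'(1) E]) simp
  finally show ?thesis .
qed

section \<open>Functions of bounded energy\<close>

lemma QpD:
  assumes "f \<in> Qp p"
  shows "f holomorphic_on disc" "\<And>z. z \<notin> disc \<Longrightarrow> f z = 0" "Qp_energy p f < \<infinity>"
  using assms by (auto simp: Qp_def)

lemma dsq_cmult:
  assumes "f holomorphic_on disc"
  shows "dsq (\<lambda>z. c * f z) z = ennreal ((cmod c)\<^sup>2) * dsq f z"
proof (cases "z \<in> disc")
  case True
  then have "f field_differentiable at z" using assms holomorphic_on_imp_differentiable_at[OF _ open_ball]
      by blast
  then have "deriv (\<lambda>z. c * f z) z = c * deriv f z" by (rule deriv_cmult)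
  then show ?thesis by (simp add: dsq_def norm_mult power_mult_distrib ennreal_mult mult.assoc)
qed (simp add: dsq_def)

lemma Qp_energy_cmult:
  assumes hol: "f holomorphic_on disc"
  shows "Qp_energy p (\<lambda>z. c * f z) = ennreal ((cmod c)\<^sup>2) * Qp_energy p f"
proof -
  note [measurable] = dsq_measurable[OF hol]
  have "(\<integral>\<^sup>+z. dsq (\<lambda>z. c * f z) z * green_powr p z a \<partial>area)
      = ennreal ((cmod c)\<^sup>2) * (\<integral>\<^sup>+z. dsq f z * green_powr p z a \<partial>area)" for a
    unfolding dsq_cmult[OF hol] mult.assoc by (rule nn_integral_cmult) measurable
  then show ?thesis unfolding Qp_energy_dsq by (simp add: SUP_mult_left_ennreal)
qed

lemma Qp_cmult:
  assumes "f \<in> Qp p"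
  shows "(\<lambda>z. c * f z) \<in> Qp p" "Qp_norm p (\<lambda>z. c * f z) = cmod c * Qp_norm p f"
proof -
  note f = QpD[OF assms]
  have "(\<lambda>z. c * f z) holomorphic_on disc" using f by (intro holomorphic_intros)
  then show "(\<lambda>z. c * f z) \<in> Qp p" using f Qp_energy_cmult[OF f(1), of p c]
    by (auto simp: Qp_def ennreal_mult_less_top)
  show "Qp_norm p (\<lambda>z. c * f z) = cmod c * Qp_norm p f"
    unfolding Qp_norm_def Qp_energy_cmult[OF f(1)]
    by (simp add: norm_mult enn2real_mult real_sqrt_mult algebra_simps)
qed

lemma Qp_diff:
  assumes "f \<in> Qp p" "h \<in> Qp p"
  shows "(\<lambda>z. f z - h z) \<in> Qp p" "Qp_norm p (\<lambda>z. f z - h z) \<le> Qp_norm p f + Qp_norm p h"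
proof -
  show "(\<lambda>z. f z - h z) \<in> Qp p" using Qp_diff_energy[OF assms] assms by (auto simp: Qp_def)
  have m: "(\<lambda>z. (-1) * h z) \<in> Qp p" "Qp_norm p (\<lambda>z. (-1) * h z) = cmod (-1) * Qp_norm p h"
    using Qp_cmult[OF assms(2), of "-1"] by auto
  have "Qp_norm p (\<lambda>z. f z + (-1) * h z) \<le> Qp_norm p f + Qp_norm p (\<lambda>z. (-1) * h z)"
    by (rule Qp_norm_triangle(2)) (use QpD[OF assms(1)] QpD[OF m(1)] in auto)
  then show "Qp_norm p (\<lambda>z. f z - h z) \<le> Qp_norm p f + Qp_norm p h" using m(2) by simp
qed

lemma Qp_norm_nonneg: "0 \<le> Qp_norm p f" by (simp add: Qp_norm_def)

lemma Qp_energy_le_norm: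
  assumes "f \<in> Qp p"
  shows "Qp_energy p f \<le> ennreal ((Qp_norm p f)\<^sup>2)"
proof -
  have "Qp_energy p f = ennreal (enn2real (Qp_energy p f))" using QpD(3)[OF assms] by simp
  also have "\<dots> = ennreal ((sqrt (enn2real (Qp_energy p f)))\<^sup>2)" by simp
  also have "\<dots> \<le> ennreal ((Qp_norm p f)\<^sup>2)"
    unfolding Qp_norm_def by (intro ennreal_leI power_mono) auto
  finally show ?thesis .
qed

lemma Qp_norm_le:
  assumes "Qp_energy p f \<le> ennreal (A\<^sup>2)" "0 \<le> A"
  shows "Qp_norm p f \<le> cmod (f 0) + A"
proof -
  have "enn2real (Qp_energy p f) \<le> A\<^sup>2" using assms by (intro enn2real_leI) auto
  then have "sqrt (enn2real (Qp_energy p f)) \<le> A" using assms by (intro real_le_lsqrt) auto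
  then show ?thesis by (simp add: Qp_norm_def)
qed

text \<open>
  On a compact subset of the disc the weight \<open>g(\<cdot>, 0)^p\<close> is bounded below, so the energy at
  \<open>a = 0\<close> controls local energies, and these control the derivative.
\<close>

lemma Qp_deriv_bound:
  assumes s: "0 \<le> s" "s < 1" and p: "0 < p"
  shows "\<exists>K\<ge>0. \<forall>f\<in>Qp p. \<forall>z\<in>cball (0::complex) s. cmod (deriv f z) \<le> K * Qp_norm p f"
proof -
  define r where "r = (1 - s) / 2"
  define \<kappa> where "\<kappa> = ((1 - s) / 4) powr p"
  have r: "0 < r" "r < 1 - s" using s by (auto simp: r_def)
  have k: "0 < \<kappa>" using s by (simp add: \<kappa>_def)
  have main: "(cmod (deriv f z))\<^sup>2 \<le> (1 / r\<^sup>2 * (1 / \<kappa>)) * (Qp_norm p f)\<^sup>2" if f: "f \<in> Qp p"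
      and z: "z \<in> cball (0::complex) s" for f z
  proof -
    note fD = QpD[OF f]
    note [measurable] = dsq_measurable[OF fD(1)]
    have zd: "z \<in> disc" using z s by auto
    have sub: "ball z (1 - s) \<subseteq> disc"
    proof
      fix w assume "w \<in> ball z (1 - s)"
      then have "cmod (w - z) < 1 - s" by (simp add: dist_norm norm_minus_commute)
      then show "w \<in> disc" using z norm_triangle_sub[of w z] by simp
    qed
    have "jac f z = dsq f z" using zd by (simp add: dsq_def)
    also have "\<dots> \<le> ennreal (1 / r\<^sup>2) * (\<integral>\<^sup>+w. dsq f w * indicator (ball z r) w \<partial>area)"
      by (rule dsq_submean[OF fD(1) sub r])
    also have "\<dots> \<le> ennreal (1 / r\<^sup>2) * (\<integral>\<^sup>+w. ennreal (1 / \<kappa>) * (dsq f w * green_powr p w 0) \<partial>area)"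
    proof (rule mult_left_mono[OF nn_integral_mono])
      fix w
      show "dsq f w * indicator (ball z r) w \<le> ennreal (1 / \<kappa>) * (dsq f w * green_powr p w 0)"
      proof (cases "w \<in> ball z r")
        case True
        then have "cmod (w - z) < r" by (simp add: dist_norm norm_minus_commute)
        then have wn: "cmod w \<le> 1 - (1 - s) / 2" using z norm_triangle_sub[of w z]
            by (simp add: r_def field_simps)
        then have "cmod w < 1" using s by argo
        then have wd: "w \<in> disc" by simp
        have "(cmod w)\<^sup>2 \<le> cmod w * 1" unfolding power2_eq_square using wd by (intro mult_left_mono) auto
        moreover have "poi 0 w = 1 - (cmod w)\<^sup>2" by (simp add: poi_def kd_def)
        ultimately have "(1 - s) / 2 \<le> poi 0 w" using wn by argo
        then have "\<kappa> \<le> (poi 0 w / 2) powr p" unfolding \<kappa>_def using s p by (intro powr_mono2) auto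
        then have "ennreal \<kappa> \<le> ennreal ((poi 0 w / 2) powr p)" by (rule ennreal_leI)
        also have "\<dots> \<le> green_powr p w 0" by (rule green_lower[OF _ wd p]) simp
        finally have "ennreal \<kappa> \<le> green_powr p w 0" .
        then have "ennreal (1 / \<kappa>) * ennreal \<kappa> \<le> ennreal (1 / \<kappa>) * green_powr p w 0"
            by (rule mult_left_mono) simp
        then have "1 \<le> ennreal (1 / \<kappa>) * green_powr p w 0" using k by (simp add: ennreal_mult[symmetric])
        then have "dsq f w * 1 \<le> dsq f w * (ennreal (1 / \<kappa>) * green_powr p w 0)" by (rule mult_left_mono) simp
        then show ?thesis using True by (simp add: mult_ac)
      qed simp
    qed simp
    also have "\<dots> = ennreal (1 / r\<^sup>2) * (ennreal (1 / \<kappa>) * (\<integral>\<^sup>+w. dsq f w * green_powr p w 0 \<partial>area))"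
      by (simp add: nn_integral_cmult)
    also have "\<dots> \<le> ennreal (1 / r\<^sup>2) * (ennreal (1 / \<kappa>) * ennreal ((Qp_norm p f)\<^sup>2))"
    proof -
      have "(\<integral>\<^sup>+w. dsq f w * green_powr p w 0 \<partial>area) \<le> Qp_energy p f"
        unfolding Qp_energy_dsq by (rule SUP_upper) simp
      also have "\<dots> \<le> ennreal ((Qp_norm p f)\<^sup>2)" by (rule Qp_energy_le_norm[OF f])
      finally show ?thesis by (intro mult_left_mono) auto
    qed
    also have "\<dots> = ennreal ((1 / r\<^sup>2 * (1 / \<kappa>)) * (Qp_norm p f)\<^sup>2)"
      using k by (simp add: ennreal_mult[symmetric] mult.assoc)
    finally show ?thesis using k by (subst (asm) ennreal_le_iff) auto
  qed
  show ?thesis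
  proof (intro exI[of _ "sqrt (1 / r\<^sup>2 * (1 / \<kappa>))"] conjI ballI)
    fix f z assume "f \<in> Qp p" "z \<in> cball (0::complex) s"
    then have "cmod (deriv f z) \<le> sqrt ((1 / r\<^sup>2 * (1 / \<kappa>)) * (Qp_norm p f)\<^sup>2)" using main
        by (intro real_le_rsqrt) auto
    then show "cmod (deriv f z) \<le> sqrt (1 / r\<^sup>2 * (1 / \<kappa>)) * Qp_norm p f"
      by (simp only: real_sqrt_mult real_sqrt_abs abs_of_nonneg[OF Qp_norm_nonneg])
  qed (use k in auto)
qed

lemma Qp_value_bound:
  assumes s: "0 \<le> s" "s < 1" and p: "0 < p"
  shows "\<exists>K\<ge>0. \<forall>f\<in>Qp p. \<forall>z\<in>cball (0::complex) s. cmod (f z) \<le> K * Qp_norm p f"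
proof -
  obtain K where K: "K \<ge> 0" "\<forall>f\<in>Qp p. \<forall>z\<in>cball (0::complex) s. cmod (deriv f z) \<le> K * Qp_norm p f"
    using Qp_deriv_bound[OF s p] by auto
  show ?thesis
  proof (intro exI[of _ "1 + K"] conjI ballI)
    fix f z assume f: "f \<in> Qp p" and z: "z \<in> cball (0::complex) s"
    have sub: "cball (0::complex) s \<subseteq> disc" using s by auto
    have "cmod (f z - f 0) \<le> (K * Qp_norm p f) * cmod (z - 0)"
    proof (rule field_differentiable_bound[of "cball (0::complex) s"])
      fix w assume w: "w \<in> cball (0::complex) s"
      show "(f has_field_derivative deriv f w) (at w within cball (0::complex) s)"
        using holomorphic_derivI[OF QpD(1)[OF f] open_ball] w sub by blast
      show "cmod (deriv f w) \<le> K * Qp_norm p f" using K f w by blast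
    qed (use z s in auto)
    also have "\<dots> \<le> (K * Qp_norm p f) * 1" using z s K(1) Qp_norm_nonneg
        by (intro mult_left_mono mult_nonneg_nonneg) auto
    finally have "cmod (f z) \<le> cmod (f 0) + K * Qp_norm p f" using norm_triangle_sub[of "f z" "f 0"] by simp
    also have "cmod (f 0) \<le> Qp_norm p f" by (simp add: Qp_norm_def)
    finally show "cmod (f z) \<le> (1 + K) * Qp_norm p f" by (simp add: algebra_simps)
  qed (use K in auto)
qed

text \<open>
  Montel's theorem gives a locally uniformly convergent subsequence. Its derivatives converge
  pointwise, so Fatou's lemma bounds the energy of the limit.
\<close>

lemma Qp_normal_family:
  assumes p: "0 < p" and f: "\<And>n. f n \<in> Qp p" and bd: "\<And>n. Qp_norm p (f n) \<le> B"
  shows "\<exists>g r. g \<in> Qp p \<and> strict_mono (r :: nat \<Rightarrow> nat) \<and> (\<forall>s<1. uniform_limit (cball 0 s) (f \<circ> r) g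
      sequentially)"
proof -
  have B0: "0 \<le> B" using bd[of 0] Qp_norm_nonneg[of p "f 0"] by linarith
  obtain g0 r where g0: "g0 holomorphic_on disc" "strict_mono (r :: nat \<Rightarrow> nat)"
    "\<And>x. x \<in> disc \<Longrightarrow> (\<lambda>n. f (r n) x) \<longlonglongrightarrow> g0 x"
    "\<And>K. compact K \<Longrightarrow> K \<subseteq> disc \<Longrightarrow> uniform_limit K (f \<circ> r) g0 sequentially"
  proof (rule Montel[of disc "range f" f])
    show "\<And>h. h \<in> range f \<Longrightarrow> h holomorphic_on disc" using QpD(1)[OF f] by blast
    show "\<exists>B. \<forall>h\<in>range f. \<forall>z\<in>K. cmod (h z) \<le> B" if K: "compact K" "K \<subseteq> disc" for K
    proof -
      have "\<exists>s. 0 \<le> s \<and> s < 1 \<and> K \<subseteq> cball 0 s"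
      proof (cases "K = {}")
        case True
        then show ?thesis by (intro exI[of _ 0]) auto
      next
        case False
        have "continuous_on K cmod" by (intro continuous_intros)
        then obtain z where z: "z \<in> K" "\<And>w. w \<in> K \<Longrightarrow> cmod w \<le> cmod z"
          using continuous_attains_sup[OF K(1) False] by blast
        then have "cmod z < 1" using K(2) by auto
        then show ?thesis using z by (intro exI[of _ "cmod z"]) auto
      qed
      then obtain s where s: "0 \<le> s" "s < 1" "K \<subseteq> cball 0 s" by blast
      obtain C where C: "0 \<le> C" "\<forall>f\<in>Qp p. \<forall>z\<in>cball 0 s. cmod (f z) \<le> C * Qp_norm p f"
        using Qp_value_bound[OF s(1,2) p] by blast
      have "cmod (f n z) \<le> C * B" if "z \<in> K" for n z
      proof -
        have "cmod (f n z) \<le> C * Qp_norm p (f n)" using C(2) f s(3) that by blast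
        also have "\<dots> \<le> C * B" using C(1) bd by (rule mult_left_mono[rotated])
        finally show ?thesis .
      qed
      then show ?thesis by blast
    qed
  qed auto
  define g where "g z = (if z \<in> disc then g0 z else 0)" for z
  have hol: "g holomorphic_on disc"
    by (rule holomorphic_transform[OF g0(1)]) (simp add: g_def)
  have ul: "uniform_limit K (f \<circ> r) g sequentially" if "compact K" "K \<subseteq> disc" for K
    using g0(4)[OF that] by (rule uniform_limit_cong'[THEN iffD1, rotated 2]) (use that in \<open>auto simp: g_def\<close>)
  have dconv: "(\<lambda>n. deriv (f (r n)) z) \<longlonglongrightarrow> deriv g z" if z: "z \<in> disc" for z
  proof -
    have "\<exists>g'. \<forall>x\<in>disc. (g has_field_derivative g' x) (at x) \<and> (\<lambda>n. deriv (f (r n)) x) \<longlonglongrightarrow> g' x"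
    proof (rule has_complex_derivative_uniform_sequence[OF open_ball])
      show "((\<lambda>z. f (r n) z) has_field_derivative deriv (f (r n)) x) (at x)" if "x \<in> disc" for n x
        using holomorphic_derivI[OF QpD(1)[OF f] open_ball that] by simp
      show "\<exists>d>0. cball x d \<subseteq> disc \<and> uniform_limit (cball x d) (\<lambda>n. f (r n)) g sequentially"
          if xd: "x \<in> disc" for x
      proof -
        obtain d where d: "d > 0" "cball x d \<subseteq> disc" using open_contains_cball[THEN iffD1, OF open_ball] xd
            by blast
        have "uniform_limit (cball x d) (\<lambda>n. f (r n)) g sequentially"
          using ul[OF compact_cball d(2)] unfolding o_def .
        then show ?thesis using d by blast
      qed
    qed
    then obtain g' where g': "\<forall>x\<in>disc. (g has_field_derivative g' x) (at x) \<and> (\<lambda>n. deriv (f (r n)) x) \<longlonglongrightarrow> g' x"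
      by (rule exE)
    have "deriv g z = g' z" by (rule DERIV_imp_deriv) (rule conjunct1[OF bspec[OF g' z]])
    then show ?thesis using conjunct2[OF bspec[OF g' z]] by simp
  qed
  have "Qp_energy p g \<le> ennreal (B\<^sup>2)" unfolding Qp_energy_dsq
  proof (rule SUP_least)
    fix a :: complex assume a: "a \<in> disc"
    have dl: "(\<lambda>n. dsq (f (r n)) z) \<longlonglongrightarrow> dsq g z" for z
    proof (cases "z \<in> disc")
      case True
      have "(\<lambda>n. ennreal ((cmod (deriv (f (r n)) z))\<^sup>2)) \<longlonglongrightarrow> jac g z"
        by (intro tendsto_ennrealI tendsto_intros dconv True)
      then show ?thesis using True by (simp add: dsq_def)
    qed (simp add: dsq_def)
    have li: "dsq g z * green_powr p z a \<le> liminf (\<lambda>n. dsq (f (r n)) z * green_powr p z a)" if "z \<noteq> a" for z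
    proof -
      have "green_powr p z a \<noteq> top" using that by (simp add: green_powr_def)
      then have "(\<lambda>n. dsq (f (r n)) z * green_powr p z a) \<longlonglongrightarrow> dsq g z * green_powr p z a"
        using dl[of z] by (intro tendsto_mult_ennreal tendsto_const) (auto simp: dsq_def ennreal_mult_eq_top_iff
            split: split_indicator)
      then show ?thesis by (simp add: lim_imp_Liminf)
    qed
    have AEa: "AE z in area. z \<noteq> a"
    proof -
      have "AE z in lborel. z \<notin> {a}" by (rule AE_lborel_notin_countable) simp
      then show ?thesis unfolding AE_area by eventually_elim auto
    qed
    have "(\<integral>\<^sup>+z. dsq g z * green_powr p z a \<partial>area)
        \<le> (\<integral>\<^sup>+z. liminf (\<lambda>n. dsq (f (r n)) z * green_powr p z a) \<partial>area)"
      by (rule nn_integral_mono_AE) (use AEa li in auto)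
    also have "\<dots> \<le> liminf (\<lambda>n. \<integral>\<^sup>+z. dsq (f (r n)) z * green_powr p z a \<partial>area)"
    proof (rule nn_integral_liminf)
      fix n
      show "(\<lambda>z. dsq (f (r n)) z * green_powr p z a) \<in> borel_measurable area"
        using dsq_measurable[OF QpD(1)[OF f]] by measurable
    qed
    also have "\<dots> \<le> ennreal (B\<^sup>2)"
    proof -
      have "(\<integral>\<^sup>+z. dsq (f (r n)) z * green_powr p z a \<partial>area) \<le> ennreal (B\<^sup>2)" for n
      proof -
        have "(\<integral>\<^sup>+z. dsq (f (r n)) z * green_powr p z a \<partial>area) \<le> Qp_energy p (f (r n))"
          unfolding Qp_energy_dsq by (rule SUP_upper[OF a])
        also have "\<dots> \<le> ennreal ((Qp_norm p (f (r n)))\<^sup>2)" by (rule Qp_energy_le_norm[OF f])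
        also have "\<dots> \<le> ennreal (B\<^sup>2)" by (intro ennreal_leI power_mono bd Qp_norm_nonneg)
        finally show ?thesis .
      qed
      then have "liminf (\<lambda>n. \<integral>\<^sup>+z. dsq (f (r n)) z * green_powr p z a \<partial>area) \<le> liminf (\<lambda>n::nat. ennreal (B\<^sup>2))"
        by (intro Liminf_mono always_eventually) auto
      then show ?thesis by (simp add: Liminf_const)
    qed
    finally show "(\<integral>\<^sup>+z. dsq g z * green_powr p z a \<partial>area) \<le> ennreal (B\<^sup>2)" .
  qed
  then have "Qp_energy p g < \<infinity>" by (rule le_less_trans) simp
  then have gQ: "g \<in> Qp p" unfolding Qp_def using hol by (auto simp: g_def)
  show ?thesis
  proof (intro exI[of _ g] exI[of _ r] conjI gQ g0(2) allI impI)
    fix s :: real assume "s < 1"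
    then show "uniform_limit (cball 0 s) (f \<circ> r) g sequentially" by (intro ul) auto
  qed
qed

text \<open>
  The identity map as an element of \<open>Qp\<close>; as a test function it detects the total mass of the
  push-forward measures.
\<close>

definition disc_id :: "complex \<Rightarrow> complex" where
  "disc_id z = (if z \<in> disc then z else 0)"

lemma disc_id_has_derivative:
  assumes z: "z \<in> disc"
  shows "(disc_id has_field_derivative 1) (at z)"
  by (rule has_field_derivative_transform_within_open[where S = disc and f
      = "\<lambda>z. z"]) (use z in \<open>auto simp: disc_id_def\<close>)

lemma dsq_disc_id: "dsq disc_id z = indicator disc z"
  using DERIV_imp_deriv[OF disc_id_has_derivative, of z] by (simp add: dsq_def split: split_indicator)

lemma disc_id_Qp:
  assumes p: "0 < p" "p \<le> 1"
  shows "disc_id \<in> Qp p" (is "?f \<in> _")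
proof -
  have hol: "?f holomorphic_on disc" unfolding holomorphic_on_open[OF open_ball] using disc_id_has_derivative
      by blast
  note ds = dsq_disc_id
  have "Qp_energy p ?f \<le> ennreal 100000 * 1" unfolding Qp_energy_dsq
  proof (rule SUP_least)
    fix a :: complex assume a: "a \<in> disc"
    have "(\<integral>\<^sup>+z. dsq ?f z * green_powr p z a \<partial>area)
        \<le> ennreal 100000 * (\<integral>\<^sup>+z. dsq ?f z * ennreal (poi a z powr p) \<partial>area)"
      by (rule energy_le_poisson[OF hol a p])
    also have "(\<integral>\<^sup>+z. dsq ?f z * ennreal (poi a z powr p) \<partial>area) \<le> (\<integral>\<^sup>+z. indicator (ball 0 1) z \<partial>area)"
    proof (rule nn_integral_mono)
      fix z
      show "dsq ?f z * ennreal (poi a z powr p) \<le> indicator (ball 0 1) z"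
      proof (cases "z \<in> disc")
        case True
        then have "poi a z powr p \<le> 1 powr p" using poi_involution[OF a True] p by (intro powr_mono2) auto
        then show ?thesis using True by (simp add: ds)
      qed (simp add: ds)
    qed
    also have "\<dots> = emeasure area (ball 0 1)" by simp
    also have "\<dots> \<le> ennreal (1\<^sup>2)" by (rule emeasure_area_ball_le[of _ 0]) auto
    finally show "(\<integral>\<^sup>+z. dsq ?f z * green_powr p z a \<partial>area) \<le> ennreal 100000 * 1" by (simp add: mult_left_mono)
  qed
  also have "\<dots> < \<infinity>" by simp
  finally show ?thesis unfolding Qp_def using hol by (auto simp: disc_id_def)
qed

lemma Qp_zero:
  assumes "0 < p" "p \<le> 1"
  shows "(\<lambda>_. 0) \<in> Qp p"
  using Qp_cmult(1)[OF disc_id_Qp[OF assms], of 0] by simp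

lemma Qp_dist_zero_right: "Qp_dist p f (\<lambda>_. 0) = Qp_norm p f"
  by (simp add: Qp_dist_def)

lemma Qp_mbounded_iff:
  assumes p: "0 < p" "p \<le> 1" and S: "S \<subseteq> Qp p"
  shows "Metric_space.mbounded (Qp p) (Qp_dist p) S \<longleftrightarrow> (\<exists>B. \<forall>f\<in>S. Qp_norm p f \<le> B)"
proof -
  interpret Q: Metric_space "Qp p" "Qp_dist p" by (rule Metric_space_Qp)
  note z = Qp_zero[OF p]
  show ?thesis
  proof
    assume "Q.mbounded S"
    then obtain x B where xB: "S \<subseteq> Q.mcball x B" unfolding Q.mbounded_def by blast
    show "\<exists>B. \<forall>f\<in>S. Qp_norm p f \<le> B"
    proof (intro exI ballI)
      fix f assume f: "f \<in> S"
      then have fx: "x \<in> Qp p" "f \<in> Qp p" "Qp_dist p x f \<le> B" using xB by auto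
      have "Qp_dist p f (\<lambda>_. 0) \<le> Qp_dist p f x + Qp_dist p x (\<lambda>_. 0)" by (rule Q.triangle[OF fx(2,1) z])
      then show "Qp_norm p f \<le> B + Qp_norm p x" using fx(3) by (simp add: Qp_dist_zero_right Q.commute)
    qed
  next
    assume "\<exists>B. \<forall>f\<in>S. Qp_norm p f \<le> B"
    then obtain B where B: "\<forall>f\<in>S. Qp_norm p f \<le> B" by blast
    have "S \<subseteq> Q.mcball (\<lambda>_. 0) B"
    proof
      fix f assume f: "f \<in> S"
      then have "Qp_dist p (\<lambda>_. 0) f \<le> B" using B Q.commute[of "\<lambda>_. 0" f] by (simp add: Qp_dist_zero_right)
      then show "f \<in> Q.mcball (\<lambda>_. 0) B" using f S z by auto
    qed
    then show "Q.mbounded S" unfolding Q.mbounded_def by blast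
  qed
qed

section \<open>The push-forward measure\<close>

text \<open>
  The factor \<open>indicator disc\<close> only makes \<open>\<phi>\<close> Borel measurable on the whole plane.
\<close>

definition pull_measure :: "real \<Rightarrow> (complex \<Rightarrow> complex) \<Rightarrow> complex \<Rightarrow> complex measure" where
  "pull_measure p \<phi> a = distr (density area (\<lambda>z. dsq \<phi> z
      * green_powr p z a)) borel (\<lambda>z. indicator disc z *\<^sub>R \<phi> z)"

lemma sets_pull_measure [simp, measurable_cong]: "sets (pull_measure p \<phi> a) = sets borel"
  by (simp add: pull_measure_def)

lemma space_pull_measure [simp]: "space (pull_measure p \<phi> a) = UNIV"
  by (simp add: pull_measure_def)

lemma disc_extension_measurable:
  assumes "\<phi> holomorphic_on disc"
  shows "(\<lambda>z. indicator disc z *\<^sub>R \<phi> z) \<in> borel_measurable borel"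
  by (intro borel_measurable_continuous_on_indicator holomorphic_on_imp_continuous_on assms) auto

lemma nn_integral_pull_measure:
  assumes hol: "\<phi> holomorphic_on disc" and F [measurable]: "F \<in> borel_measurable borel"
  shows "(\<integral>\<^sup>+\<zeta>. F \<zeta> \<partial>pull_measure p \<phi> a) = (\<integral>\<^sup>+z. dsq \<phi> z * green_powr p z a * F (\<phi> z) \<partial>area)"
proof -
  note [measurable] = disc_extension_measurable[OF hol] dsq_measurable[OF hol]
  have "(\<integral>\<^sup>+\<zeta>. F \<zeta> \<partial>pull_measure p \<phi> a) = (\<integral>\<^sup>+z. dsq \<phi> z * green_powr p z a * F (indicator disc z *\<^sub>R \<phi> z) \<partial>area)"
    unfolding pull_measure_def by (subst nn_integral_distr) (auto simp: nn_integral_density)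
  also have "\<dots> = (\<integral>\<^sup>+z. dsq \<phi> z * green_powr p z a * F (\<phi> z) \<partial>area)"
    by (intro nn_integral_cong) (auto simp: dsq_def split: split_indicator)
  finally show ?thesis .
qed

text \<open>
  The push-forward measure has the counting function as its density. The
  integral on the right is meaningful because the counting function agrees almost everywhere with
  a countable sum of Borel functions.
\<close>

lemma emeasure_pull_measure:
  assumes hol: "\<phi> holomorphic_on disc" and maps: "\<phi> ` disc \<subseteq> disc" and B [measurable]: "B \<in> sets borel"
  shows "emeasure (pull_measure p \<phi> a) B = (\<integral>\<^sup>+\<zeta>. counting p \<phi> a \<zeta> * indicator B \<zeta> \<partial>area)"
proof -
  have "emeasure (pull_measure p \<phi> a) B = (\<integral>\<^sup>+\<zeta>. indicator B \<zeta> \<partial>pull_measure p \<phi> a)" by simp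
  also have "\<dots> = (\<integral>\<^sup>+z. dsq \<phi> z * green_powr p z a * indicator B (\<phi> z) \<partial>area)"
    by (rule nn_integral_pull_measure[OF hol]) measurable
  also have "\<dots> = (\<integral>\<^sup>+\<zeta>. counting p \<phi> a \<zeta> * indicator B \<zeta> \<partial>area)"
    unfolding nn_integral_counting[OF hol maps B]
    by (intro nn_integral_cong) (auto simp: dsq_def split: split_indicator)
  finally show ?thesis .
qed

lemma AE_pull_measure_disc:
  assumes hol: "\<phi> holomorphic_on disc" and maps: "\<phi> ` disc \<subseteq> disc"
  shows "AE \<zeta> in pull_measure p \<phi> a. \<zeta> \<in> disc"
proof -
  have "(\<integral>\<^sup>+\<zeta>. indicator (- disc) \<zeta> \<partial>pull_measure p \<phi> a)
      = (\<integral>\<^sup>+z. dsq \<phi> z * green_powr p z a * indicator (- disc) (\<phi> z) \<partial>area)"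
    by (rule nn_integral_pull_measure[OF hol]) auto
  also have "\<dots> = (\<integral>\<^sup>+z. 0 \<partial>area)"
  proof (rule nn_integral_cong)
    fix z
    have "\<phi> z \<in> disc" if "z \<in> disc" using maps that by blast
    then show "dsq \<phi> z * green_powr p z a * indicator (- disc) (\<phi> z) = 0"
      by (cases "z \<in> disc") (auto simp: dsq_def)
  qed
  finally have "emeasure (pull_measure p \<phi> a) (- disc) = 0" by simp
  then have "- disc \<in> null_sets (pull_measure p \<phi> a)" by (intro null_setsI) auto
  then show ?thesis using AE_not_in by fastforce
qed

lemma comp_operator_has_derivative:
  assumes hol: "\<phi> holomorphic_on disc" and maps: "\<phi> ` disc \<subseteq> disc" and f: "f holomorphic_on disc"
      and z: "z \<in> disc"
  shows "(comp_operator \<phi> f has_field_derivative deriv f (\<phi> z) * deriv \<phi> z) (at z)"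
proof -
  have "\<phi> z \<in> disc" using maps z by blast
  then have "(f \<circ> \<phi> has_field_derivative deriv f (\<phi> z) * deriv \<phi> z) (at z)"
    by (intro DERIV_chain holomorphic_derivI[OF f open_ball] holomorphic_derivI[OF hol open_ball]) (use z in
        auto)
  then show ?thesis
    by (rule has_field_derivative_transform_within_open[where S
        = disc]) (use z in \<open>auto simp: comp_operator_def\<close>)
qed

text \<open>
  The chain rule, \<open>|(f \<circ> \<phi>)'|\<^sup>2 = |f' \<circ> \<phi>|\<^sup>2 |\<phi>'|\<^sup>2\<close>.
\<close>

lemma comp_operator_energy:
  assumes hol: "\<phi> holomorphic_on disc" and maps: "\<phi> ` disc \<subseteq> disc" and f: "f holomorphic_on disc"
  shows "Qp_energy p (comp_operator \<phi> f) = (SUP a\<in>disc. \<integral>\<^sup>+\<zeta>. dsq f \<zeta> \<partial>pull_measure p \<phi> a)"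
  unfolding Qp_energy_dsq
proof (rule SUP_cong[OF refl])
  fix a
  have "(\<integral>\<^sup>+\<zeta>. dsq f \<zeta> \<partial>pull_measure p \<phi> a) = (\<integral>\<^sup>+z. dsq \<phi> z * green_powr p z a * dsq f (\<phi> z) \<partial>area)"
    by (rule nn_integral_pull_measure[OF hol dsq_measurable[OF f]])
  also have "\<dots> = (\<integral>\<^sup>+z. dsq (comp_operator \<phi> f) z * green_powr p z a \<partial>area)"
  proof (rule nn_integral_cong)
    fix z
    show "dsq \<phi> z * green_powr p z a * dsq f (\<phi> z) = dsq (comp_operator \<phi> f) z * green_powr p z a"
    proof (cases "z \<in> disc")
      case True
      then have "\<phi> z \<in> disc" using maps by blast
      then have "dsq (comp_operator \<phi> f) z = dsq f (\<phi> z) * dsq \<phi> z"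
        using DERIV_imp_deriv[OF comp_operator_has_derivative[OF hol maps f True]] True
        by (simp add: dsq_def norm_mult power_mult_distrib ennreal_mult)
      then show ?thesis by (simp add: mult_ac)
    qed (simp add: dsq_def)
  qed
  finally show "(\<integral>\<^sup>+z. dsq (comp_operator \<phi> f) z * green_powr p z a \<partial>area)
      = (\<integral>\<^sup>+\<zeta>. dsq f \<zeta> \<partial>pull_measure p \<phi> a)" ..
qed

lemma comp_operator_diff: "comp_operator \<phi> (\<lambda>z. f z - g z) = (\<lambda>z. comp_operator \<phi> f z - comp_operator \<phi> g z)"
  by (auto simp: comp_operator_def)

lemma pull_measure_total:
  assumes p: "0 < p" "p \<le> 1" and hol: "\<phi> holomorphic_on disc" and maps: "\<phi> ` disc \<subseteq> disc"
    and im: "comp_operator \<phi> ` Qp p \<subseteq> Qp p"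
  shows "\<exists>K. K < \<infinity> \<and> (\<forall>a\<in>disc. emeasure (pull_measure p \<phi> a) UNIV \<le> K)"
proof -
  let ?f = disc_id
  have f: "?f \<in> Qp p" by (rule disc_id_Qp[OF p])
  have fin: "Qp_energy p (comp_operator \<phi> ?f) < \<infinity>" using f im QpD(3)[of "comp_operator \<phi> ?f" p] by blast
  have "emeasure (pull_measure p \<phi> a) UNIV \<le> Qp_energy p (comp_operator \<phi> ?f)" if a: "a \<in> disc" for a
  proof -
    have "emeasure (pull_measure p \<phi> a) UNIV = (\<integral>\<^sup>+\<zeta>. 1 \<partial>pull_measure p \<phi> a)" by simp
    also have "\<dots> = (\<integral>\<^sup>+\<zeta>. dsq ?f \<zeta> \<partial>pull_measure p \<phi> a)"
      by (rule nn_integral_cong_AE) (use AE_pull_measure_disc[OF hol maps, of p a] in \<open>eventually_elim, simp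
          add: dsq_disc_id\<close>)
    also have "\<dots> \<le> Qp_energy p (comp_operator \<phi> ?f)"
      unfolding comp_operator_energy[OF hol maps QpD(1)[OF f]] by (rule SUP_upper[OF a])
    finally show ?thesis .
  qed
  then show ?thesis using fin by blast
qed

lemma H_avg_eq:
  assumes D: "dyadic_system \<D>" and I: "I \<in> \<D>" and hol: "\<phi> holomorphic_on disc" and maps: "\<phi> ` disc \<subseteq> disc"
  shows "H_avg p \<phi> a \<rho> I = emeasure (pull_measure p \<phi> a) (Q_up I \<inter> {\<zeta>. \<rho> < cmod \<zeta> \<and> cmod \<zeta> < 1}) / ennreal
      (arc_len I powr (p + 2))"
proof -
  have [measurable]: "Q_up I \<in> sets borel" by (rule Q_up_borel[OF D I])
  have "{\<zeta>. \<rho> < cmod \<zeta> \<and> cmod \<zeta> < 1} = {\<zeta>::complex. \<rho> < cmod \<zeta>} \<inter> {\<zeta>. cmod \<zeta> < 1}" by auto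
  also have "\<dots> \<in> sets borel" by measurable
  finally have [measurable]: "{\<zeta>::complex. \<rho> < cmod \<zeta> \<and> cmod \<zeta> < 1} \<in> sets borel" .
  show ?thesis unfolding H_avg_def by (subst emeasure_pull_measure[OF hol maps]) auto
qed

text \<open>
  The set \<open>Q_up I\<close> lies in the disc of radius \<open>1 - |I|/2\<close>.
\<close>

lemma H_avg_coarse_eq_0:
  assumes D: "dyadic_system \<D>" and I: "I \<in> dyadic_level \<D> k" and hol: "\<phi> holomorphic_on disc"
      and maps: "\<phi> ` disc \<subseteq> disc"
    and k: "k < n" and \<rho>: "1 - 1 / 2 ^ n \<le> \<rho>"
  shows "H_avg p \<phi> a \<rho> I = 0"
proof -
  have ID: "I \<in> \<D>" "arc_len I = 1 / 2 ^ k" using I by (auto simp: dyadic_level_def)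
  have "(2::real) ^ Suc k \<le> 2 ^ n" using k by (intro power_increasing) auto
  then have "1 / (2::real) ^ n \<le> 1 / 2 ^ k / 2" by (simp add: field_simps)
  then have "Q_up I \<inter> {\<zeta>. \<rho> < cmod \<zeta> \<and> cmod \<zeta> < 1} = {}"
    using Q_up_iff[OF D ID(1)] \<rho> unfolding ID(2) by fastforce
  then show ?thesis unfolding H_avg_eq[OF D ID(1) hol maps] by simp
qed

lemma ennreal_avg_le:
  fixes A B S :: ennreal
  assumes "2 * S \<le> A + B"
  shows "S \<le> A \<or> S \<le> B"
proof (rule ccontr)
  assume "\<not> (S \<le> A \<or> S \<le> B)"
  then have lt: "A < S" "B < S" by auto
  define m where "m = max A B"
  have m: "m < S" using lt by (simp add: m_def)
  then have mfin: "m \<noteq> top" using top.not_eq_extremum by fastforce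
  have "A + B \<le> m + m" by (intro add_mono) (auto simp: m_def)
  also have "\<dots> < m + S" using m mfin by (simp add: ennreal_add_left_cancel_less)
  also have "\<dots> \<le> S + S" using m by (intro add_mono) auto
  finally show False using assms by (simp add: mult_2)
qed

text \<open>
  The terms are added one at a time. By the parallelogram law the squared norms of \<open>v + u\<close> and
  \<open>v - u\<close> average to the sum of the squared norms, so one of the two signs does not lose.
\<close>

lemma choose_signs:
  fixes u :: "'i \<Rightarrow> 'a \<Rightarrow> complex"
  assumes E: "finite E" and u: "\<And>I. I \<in> E \<Longrightarrow> u I \<in> borel_measurable M"
  shows "\<exists>\<sigma>. (\<forall>I. \<sigma> I = 1 \<or> \<sigma> I = (-1::real)) \<and>
    (\<Sum>I\<in>E. \<integral>\<^sup>+z. ennreal ((cmod (u I z))\<^sup>2) \<partial>M) \<le> (\<integral>\<^sup>+z. ennreal ((cmod (\<Sum>I\<in>E. of_real (\<sigma> I) * u I z))\<^sup>2) \<partial>M)"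
  using assms
proof (induction E rule: finite_induct)
  case empty
  then show ?case by (intro exI[of _ "\<lambda>_. 1"]) auto
next
  case (insert J E)
  obtain \<sigma> where \<sigma>: "\<forall>I. \<sigma> I = 1 \<or> \<sigma> I = (-1::real)"
    "(\<Sum>I\<in>E. \<integral>\<^sup>+z. ennreal ((cmod (u I z))\<^sup>2) \<partial>M) \<le> (\<integral>\<^sup>+z. ennreal ((cmod (\<Sum>I\<in>E. of_real (\<sigma> I) * u I z))\<^sup>2) \<partial>M)"
    using insert.IH insert.prems by auto
  define v where "v = (\<lambda>z. \<Sum>I\<in>E. of_real (\<sigma> I) * u I z)"
  have [measurable]: "u J \<in> borel_measurable M" using insert.prems by simp
  have [measurable]: "v \<in> borel_measurable M" unfolding v_def using insert.prems
      by (intro borel_measurable_sum) auto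
  define N where "N h = (\<integral>\<^sup>+z. ennreal ((cmod (h z))\<^sup>2) \<partial>M)" for h
  have "N (\<lambda>z. v z + u J z) + N (\<lambda>z. v z - u J z)
      = (\<integral>\<^sup>+z. 2 * ennreal ((cmod (v z))\<^sup>2) + 2 * ennreal ((cmod (u J z))\<^sup>2) \<partial>M)"
    unfolding N_def
  proof (subst nn_integral_add[symmetric], measurable, rule nn_integral_cong)
    fix z
    have "(cmod (v z + u J z))\<^sup>2 + (cmod (v z - u J z))\<^sup>2 = 2 * (cmod (v z))\<^sup>2 + 2 * (cmod (u J z))\<^sup>2"
      unfolding cmod_power2 by (simp add: power2_eq_square algebra_simps)
    then have "ennreal ((cmod (v z + u J z))\<^sup>2 + (cmod (v z - u J z))\<^sup>2)
        = ennreal (2 * (cmod (v z))\<^sup>2 + 2 * (cmod (u J z))\<^sup>2)" by simp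
    then show "ennreal ((cmod (v z + u J z))\<^sup>2) + ennreal ((cmod (v z - u J z))\<^sup>2)
        = 2 * ennreal ((cmod (v z))\<^sup>2) + 2 * ennreal ((cmod (u J z))\<^sup>2)"
      by (simp add: ennreal_mult)
  qed
  also have "\<dots> = 2 * (N v + N (u J))"
    unfolding N_def by (simp add: nn_integral_add nn_integral_cmult distrib_left)
  finally have "N v + N (u J) \<le> N (\<lambda>z. v z + u J z) \<or> N v + N (u J) \<le> N (\<lambda>z. v z - u J z)"
    by (intro ennreal_avg_le) simp
  then obtain s :: real where s: "s = 1 \<or> s = -1" "N v + N (u J) \<le> N (\<lambda>z. of_real s * u J z + v z)"
  proof
    assume "N v + N (u J) \<le> N (\<lambda>z. v z + u J z)"
    then show ?thesis by (intro that[of 1]) (auto simp: add.commute)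
  next
    assume "N v + N (u J) \<le> N (\<lambda>z. v z - u J z)"
    then show ?thesis by (intro that[of "-1"]) auto
  qed
  define \<sigma>' where "\<sigma>' = \<sigma>(J := s)"
  have sum_eq: "(\<Sum>I\<in>insert J E. of_real (\<sigma>' I) * u I z) = of_real s * u J z + v z" for z
  proof -
    have "(\<Sum>I\<in>E. of_real (\<sigma>' I) * u I z) = v z" unfolding v_def
      by (rule sum.cong) (use insert.hyps in \<open>auto simp: \<sigma>'_def\<close>)
    then show ?thesis using insert.hyps by (simp add: \<sigma>'_def)
  qed
  have "(\<Sum>I\<in>insert J E. \<integral>\<^sup>+z. ennreal ((cmod (u I z))\<^sup>2) \<partial>M) \<le> N v + N (u J)"
    using \<sigma>(2) insert.hyps by (simp add: N_def v_def add.commute add_right_mono)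
  also have "\<dots> \<le> N (\<lambda>z. of_real s * u J z + v z)" by (rule s(2))
  finally show ?case unfolding N_def sum_eq[symmetric]
    by (intro exI[of _ \<sigma>'] conjI) (use \<sigma>(1) s(1) in \<open>auto simp: \<sigma>'_def\<close>)
qed

text \<open>
  For a suitable choice of signs the image of the test function has energy at least the dual
  value of \<open>x\<close>, up to the constant of \<open>norm_atom_deriv_ge\<close>.
\<close>

lemma test_fun_image_energy_ge:
  assumes D: "dyadic_system \<D>" and x: "dyadic_carleson p \<D> E x"
    and hol: "\<phi> holomorphic_on disc" and maps: "\<phi> ` disc \<subseteq> disc"
  shows "\<exists>c. (\<forall>I. (c I)\<^sup>2 = x I) \<and>
    (\<Sum>I\<in>E. ennreal (x I * arc_len I powr (-2 - p) / 1000000) * emeasure (pull_measure p \<phi> a) (Q_up I))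
      \<le> (\<integral>\<^sup>+\<zeta>. dsq (test_fun p E c) \<zeta> \<partial>pull_measure p \<phi> a)"
proof -
  have E: "finite E" "E \<subseteq> \<D>" and x0: "\<And>I. 0 \<le> x I" using x by (auto simp: dyadic_carleson_def)
  let ?M = "pull_measure p \<phi> a"
  let ?u = "\<lambda>I. atom_deriv p I (sqrt (x I))"
  let ?y = "\<lambda>I. ennreal (x I * arc_len I powr (-2 - p) / 1000000)" and ?n = "\<lambda>I z. ennreal ((cmod (?u I z))\<^sup>2)"
  have m [measurable]: "?u I \<in> borel_measurable borel" for I
    unfolding atom_deriv_def[abs_def] by measurable
  obtain \<sigma> where \<sigma>: "\<forall>I. \<sigma> I = 1 \<or> \<sigma> I = (-1::real)"
    "(\<Sum>I\<in>E. \<integral>\<^sup>+z. ?n I z \<partial>?M) \<le> (\<integral>\<^sup>+z. ennreal ((cmod (\<Sum>I\<in>E. of_real (\<sigma> I) * ?u I z))\<^sup>2) \<partial>?M)"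
    using choose_signs[OF E(1), of ?u ?M] m by auto
  define c where "c I = \<sigma> I * sqrt (x I)" for I
  have c2: "(c I)\<^sup>2 = x I" for I using \<sigma>(1) x0[of I] by (auto simp: c_def power_mult_distrib power2_eq_1_iff)
  have lin: "of_real (\<sigma> I) * ?u I z = atom_deriv p I (c I) z" for I z
    by (simp add: atom_deriv_def c_def)
  have "(\<Sum>I\<in>E. ?y I * emeasure ?M (Q_up I)) \<le> (\<Sum>I\<in>E. \<integral>\<^sup>+z. ?n I z \<partial>?M)"
  proof (rule sum_mono)
    fix I assume I: "I \<in> E"
    then have ID: "I \<in> \<D>" using E by auto
    have "?y I * emeasure ?M (Q_up I)
       = (\<integral>\<^sup>+z. ?y I * indicator (Q_up I) z \<partial>?M)"
      using Q_up_borel[OF D ID] by (subst nn_integral_cmult_indicator) auto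
    also have "\<dots> \<le> (\<integral>\<^sup>+z. ?n I z \<partial>?M)"
    proof (rule nn_integral_mono)
      fix z
      show "?y I * indicator (Q_up I) z \<le> ?n I z"
      proof (cases "z \<in> Q_up I")
        case True
        then show ?thesis using norm_atom_deriv_ge[OF D ID True, of "sqrt (x I)" p] x0[of I]
            by (simp add: ennreal_leI)
      qed simp
    qed
    finally show "?y I * emeasure ?M (Q_up I) \<le> (\<integral>\<^sup>+z. ?n I z \<partial>?M)" .
  qed
  also note \<sigma>(2)
  also have "(\<integral>\<^sup>+z. ennreal ((cmod (\<Sum>I\<in>E. of_real (\<sigma> I) * ?u I z))\<^sup>2) \<partial>?M) = (\<integral>\<^sup>+\<zeta>. dsq (test_fun p E c) \<zeta> \<partial>?M)"
  proof (rule nn_integral_cong_AE)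
    show "AE z in ?M. ennreal ((cmod (\<Sum>I\<in>E. of_real (\<sigma> I) * ?u I z))\<^sup>2) = dsq (test_fun p E c) z"
      using AE_pull_measure_disc[OF hol maps] by eventually_elim (simp only: lin test_fun_dsq[OF D E(2)])
  qed
  finally show ?thesis using c2 by blast
qed

section \<open>The discrete Carleson embedding\<close>

text \<open>
  A neighbourhood of \<open>Q_up I\<close> that contains the balls of radius \<open>|I|/4\<close> around its points.
\<close>

definition arc_box :: "complex set \<Rightarrow> complex set" where
  "arc_box I = {\<zeta>\<in>disc. cmod (\<zeta> - arc_pt I) \<le> 5 * arc_len I \<and> arc_len I / 4 \<le> 1 - cmod \<zeta> \<and> 1 - cmod \<zeta>
      \<le> 5 * arc_len I / 4}"

lemma arc_box_borel [measurable]: "arc_box I \<in> sets borel"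
proof -
  have "arc_box I = disc \<inter> ({\<zeta>. cmod (\<zeta> - arc_pt I) \<le> 5 * arc_len I} \<inter> ({\<zeta>. arc_len I / 4
      \<le> 1 - cmod \<zeta>} \<inter> {\<zeta>. 1 - cmod \<zeta> \<le> 5 * arc_len I / 4}))"
    by (auto simp: arc_box_def)
  also have "\<dots> \<in> sets borel" by measurable
  finally show ?thesis .
qed

lemma dsq_le_arc_box:
  assumes D: "dyadic_system \<D>" and I: "I \<in> \<D>" and g: "g holomorphic_on disc" and z: "z \<in> Q_up I"
  shows "ennreal ((arc_len I)\<^sup>2) * dsq g z \<le> ennreal 16 * (\<integral>\<^sup>+\<zeta>. dsq g \<zeta> * indicator (arc_box I) \<zeta> \<partial>area)"
proof -
  let ?L = "arc_len I"
  have L: "0 < ?L" "?L \<le> 1" using dyadic_arc[OF D I] by auto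
  have zb: "1 - ?L \<le> cmod z" "cmod z < 1 - ?L / 2" using z Q_up_iff[OF D I] by auto
  have tri: "cmod w \<le> cmod z + cmod (w - z)" "cmod z \<le> cmod w + cmod (w - z)" for w
    using norm_triangle_sub[of w z] norm_triangle_sub[of z w] by (auto simp: norm_minus_commute)
  have sub: "ball z (?L / 2) \<subseteq> disc"
  proof
    fix w assume "w \<in> ball z (?L / 2)"
    then have "cmod (w - z) < ?L / 2" by (simp add: dist_norm norm_minus_commute)
    then have "cmod w < 1" using tri(1)[of w] zb(2) by linarith
    then show "w \<in> disc" by simp
  qed
  have box: "ball z (?L / 4) \<subseteq> arc_box I"
  proof
    fix w assume "w \<in> ball z (?L / 4)"
    then have wz: "cmod (w - z) < ?L / 4" by (simp add: dist_norm norm_minus_commute)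
    have "cmod (w - arc_pt I) \<le> cmod (w - z) + cmod (z - arc_pt I)"
      using norm_triangle_ineq[of "w - z" "z - arc_pt I"] by simp
    then have 1: "cmod (w - arc_pt I) \<le> 5 * ?L" using wz Q_up_near_arc_pt[OF D I z] L by linarith
    have 2: "cmod w < 1" "?L / 4 \<le> 1 - cmod w" "1 - cmod w \<le> 5 * ?L / 4"
      using tri(1)[of w] tri(2)[of w] zb wz L by linarith+
    show "w \<in> arc_box I" unfolding arc_box_def using 1 2 by simp
  qed
  have "ennreal (?L\<^sup>2) * dsq g z \<le> ennreal (?L\<^sup>2) * (ennreal (1 / (?L / 4)\<^sup>2) * (\<integral>\<^sup>+w. dsq g w
      * indicator (ball z (?L / 4)) w \<partial>area))"
    using L by (intro mult_left_mono dsq_submean[OF g sub]) auto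
  also have "\<dots> = ennreal 16 * (\<integral>\<^sup>+w. dsq g w * indicator (ball z (?L / 4)) w \<partial>area)"
    using L by (simp add: mult.assoc[symmetric] ennreal_mult[symmetric] power_divide)
  also have "\<dots> \<le> ennreal 16 * (\<integral>\<^sup>+\<zeta>. dsq g \<zeta> * indicator (arc_box I) \<zeta> \<partial>area)"
    using box by (intro mult_left_mono nn_integral_mono) (auto split: split_indicator)
  finally show ?thesis .
qed

text \<open>
  The arcs in question have length comparable to \<open>1 - |\<zeta>|\<close> and centres within a multiple of
  that from \<open>\<zeta>\<close>, so the packing estimate bounds their number.
\<close>

lemma arc_box_overlap:
  assumes D: "dyadic_system \<D>" and E: "finite E" "E \<subseteq> \<D>" and z: "\<zeta> \<in> disc"
  shows "real (card {I\<in>E. \<zeta> \<in> arc_box I}) \<le> 44100"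
proof -
  define \<delta> where "\<delta> = 1 - cmod \<zeta>"
  have d: "0 < \<delta>" using z by (simp add: \<delta>_def)
  let ?S = "{I\<in>E. \<zeta> \<in> arc_box I}"
  have L: "4 * \<delta> / 5 \<le> arc_len I" "arc_len I \<le> 4 * \<delta>" "cmod (\<zeta> - arc_pt I) \<le> 5 * arc_len I" "0 < arc_len I"
      if "I \<in> ?S" for I
    using that dyadic_arc[OF D, of I] E(2) by (auto simp: arc_box_def \<delta>_def)
  have "(\<Sum>I\<in>?S. (arc_len I)\<^sup>2) \<le> 64 * (21 * \<delta>)\<^sup>2"
  proof (rule dyadic_packing[OF D])
    fix I assume I: "I \<in> ?S"
    show "ball (arc_pt I) (arc_len I / 8) \<subseteq> ball \<zeta> (21 * \<delta>)"
      using L[OF I] d by (subst ball_subset_ball_iff) (auto simp: dist_norm norm_minus_commute)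
  qed (use E d in auto)
  moreover have "(\<Sum>I\<in>?S. (4 * \<delta> / 5)\<^sup>2) \<le> (\<Sum>I\<in>?S. (arc_len I)\<^sup>2)"
    using L(1) d by (intro sum_mono power_mono) auto
  ultimately have "real (card ?S) * (4 * \<delta> / 5)\<^sup>2 \<le> 64 * (21 * \<delta>)\<^sup>2" by simp
  then have "(real (card ?S) * (16 / 25)) * \<delta>\<^sup>2 \<le> (64 * 441) * \<delta>\<^sup>2"
    by (simp add: power_mult_distrib power_divide)
  then have "real (card ?S) * (16 / 25) \<le> 64 * 441" using d by (subst (asm) mult_le_cancel_right_pos) auto
  then show ?thesis by simp
qed

text \<open>
  Seen from the centre of \<open>Q_up J\<close>, a point at height \<open>|I|\<close> above \<open>J\<close> has
  \<open>1 - |\<sigma>|\<^sup>2\<close> at least a multiple of \<open>|I| / |J|\<close>.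
\<close>

lemma arc_box_green:
  assumes D: "dyadic_system \<D>" and I: "I \<in> \<D>" and J: "J \<in> \<D>" and IJ: "I \<subseteq> J" and p: "0 < p" "p \<le> 1"
    and z: "\<zeta> \<in> arc_box I"
  shows "ennreal (arc_len I powr p) \<le> ennreal (1808 * arc_len J powr p) * green_powr p \<zeta> (arc_pt J)"
proof -
  let ?L = "arc_len J" and ?w = "arc_pt J"
  have LI: "0 < arc_len I" "arc_len I \<le> ?L" and L: "0 < ?L" "?L \<le> 1"
    using dyadic_arc[OF D I] dyadic_arc[OF D J] dyadic_arc_len_mono[OF D I J IJ] by auto
  have zd: "\<zeta> \<in> disc" "cmod (\<zeta> - arc_pt I) \<le> 5 * arc_len I" "arc_len I / 4 \<le> 1 - cmod \<zeta>"
    using z by (auto simp: arc_box_def)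
  have nw: "cmod ?w = 1 - 3 * ?L / 4" by (rule norm_arc_pt[OF D J])
  then have wd: "?w \<in> disc" using L by simp
  have "arc_mid I \<in> J" using arc_mid_in[OF D I] IJ by blast
  then have "cmod (arc_mid I - arc_mid J) \<le> pi * ?L" by (rule arc_mid(3)[OF dyadic_arc(1)[OF D J]])
  also have "\<dots> \<le> 4 * ?L" using pi_less_4 L by (intro mult_right_mono) auto
  finally have m: "cmod (arc_mid I - arc_mid J) \<le> 4 * ?L" .
  have "cmod (\<zeta> - ?w) \<le> cmod (\<zeta> - arc_pt I) + cmod (arc_pt I - arc_mid I) + cmod (arc_mid I - arc_mid J)
      + cmod (?w - arc_mid J)"
    using norm_triangle_ineq[of "\<zeta> - arc_pt I" "arc_pt I - ?w"]
      norm_triangle_ineq[of "arc_pt I - arc_mid I" "arc_mid I - ?w"]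
      norm_triangle_ineq[of "arc_mid I - arc_mid J" "arc_mid J - ?w"]
    by (simp add: norm_minus_commute)
  also have "\<dots> \<le> 11 * ?L"
    using zd(2) arc_pt_near_mid[OF D I] arc_pt_near_mid[OF D J] m LI L by linarith
  finally have dz: "cmod (\<zeta> - ?w) \<le> 11 * ?L" .
  have k: "0 < kd ?w \<zeta>" by (rule kd_pos[OF wd zd(1)])
  have "kd ?w \<zeta> \<le> 2 * (1 - cmod ?w) + cmod (?w - \<zeta>)" using wd zd(1) by (intro kd_le) auto
  then have k13: "kd ?w \<zeta> \<le> 13 * ?L" using dz nw L by (simp add: norm_minus_commute)
  \<comment> \<open>Here \<open>13\<^sup>2 * 4/3 \<le> 226\<close>, and \<open>1808 = 4 * 226 * 2\<close> includes the factor \<open>1/2\<close> of \<open>green_lower\<close>.\<close>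
  have "(arc_len I / 4) / (226 * ?L) \<le> (3/4 * ?L * (arc_len I / 4)) / (13 * ?L)\<^sup>2"
    using L LI by (simp add: field_simps power2_eq_square)
  also have "\<dots> \<le> poi ?w \<zeta>" unfolding poi_def
  proof (intro frac_le mult_mono power_mono)
    have "(cmod ?w)\<^sup>2 \<le> cmod ?w * 1" unfolding power2_eq_square using wd by (intro mult_left_mono) auto
    then show "3/4 * ?L \<le> 1 - (cmod ?w)\<^sup>2" using nw by simp
    have "(cmod \<zeta>)\<^sup>2 \<le> cmod \<zeta> * 1" unfolding power2_eq_square using zd(1) by (intro mult_left_mono) auto
    then show "arc_len I / 4 \<le> 1 - (cmod \<zeta>)\<^sup>2" using zd(3) by linarith
    show "0 < (kd ?w \<zeta>)\<^sup>2" using k by simp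
    show "0 \<le> 1 - (cmod ?w)\<^sup>2" using wd by (simp add: power_le_one)
    show "0 \<le> (1 - (cmod ?w)\<^sup>2) * (1 - (cmod \<zeta>)\<^sup>2)" using wd zd(1)
        by (intro mult_nonneg_nonneg) (auto simp: power_le_one)
  qed (use L LI k13 k in auto)
  finally have "arc_len I \<le> 1808 * ?L * (poi ?w \<zeta> / 2)" using L by (simp add: field_simps)
  then have "arc_len I powr p \<le> (1808 * ?L * (poi ?w \<zeta> / 2)) powr p" using LI p by (intro powr_mono2) auto
  also have "\<dots> = (1808 powr p * ?L powr p) * (poi ?w \<zeta> / 2) powr p" by (simp only: powr_mult)
  also have "\<dots> \<le> (1808 powr 1 * ?L powr p) * (poi ?w \<zeta> / 2) powr p"
    using p by (intro mult_right_mono powr_mono) auto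
  finally have "ennreal (arc_len I powr p) \<le> ennreal (1808 * ?L powr p) * ennreal ((poi ?w \<zeta> / 2) powr p)"
    by (simp add: ennreal_mult[symmetric] ennreal_leI)
  also have "\<dots> \<le> ennreal (1808 * ?L powr p) * green_powr p \<zeta> ?w"
    by (intro mult_left_mono green_lower[OF wd zd(1) p(1)]) auto
  finally show ?thesis .
qed

text \<open>
  The submean value property (constant 16) replaces \<open>S(I) |I|\<^sup>2\<close> by the energy over the box of
  \<open>I\<close>, the factor \<open>|I|^p\<close> is dominated by \<open>1808 |J|^p g(\<cdot>, w\<^sub>J)^p\<close> there with
  \<open>w\<^sub>J = arc_pt J\<close>, and each point lies in at most 44100 boxes. So the sum is at most a constant
  times \<open>|J|^p\<close> times the energy integral at \<open>a = w\<^sub>J\<close>.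
\<close>

lemma carleson_embedding:
  assumes D: "dyadic_system \<D>" and E: "finite E" "E \<subseteq> \<D>" and J: "J \<in> \<D>" and p: "0 < p" "p \<le> 1"
    and g: "g holomorphic_on disc"
  shows "(\<Sum>I\<in>below E J. (SUP z\<in>Q_up I. dsq g z) * ennreal (arc_len I powr (p + 2)))
    \<le> ennreal (16 * 44100 * 1808) * ennreal (arc_len J powr p) * Qp_energy p g"
proof -
  note [measurable] = dsq_measurable[OF g]
  let ?S = "below E J"
  have finS: "finite ?S" using E by simp
  let ?a = "\<lambda>I. ennreal (arc_len I powr p)" and ?C = "ennreal (16 * 44100 * 1808)"
  let ?U = "\<lambda>I. SUP z\<in>Q_up I. dsq g z" and ?e = "\<lambda>I. \<integral>\<^sup>+\<zeta>. dsq g \<zeta> * indicator (arc_box I) \<zeta> \<partial>area"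
    and ?g = "\<lambda>\<zeta>. dsq g \<zeta> * green_powr p \<zeta> (arc_pt J)"
  have wJ: "arc_pt J \<in> disc" using norm_arc_pt[OF D J] dyadic_arc[OF D J] by simp
  have "(\<Sum>I\<in>?S. ?U I * ennreal (arc_len I powr (p + 2)))
     \<le> (\<Sum>I\<in>?S. ?a I * (ennreal 16 * ?e I))"
  proof (rule sum_mono)
    fix I assume "I \<in> ?S"
    then have I: "I \<in> \<D>" using E by auto
    have L: "0 < arc_len I" using dyadic_arc[OF D I] by simp
    have "?U I * ennreal (arc_len I powr (p + 2)) = ?a I * (ennreal ((arc_len I)\<^sup>2) * ?U I)"
      using L by (simp add: powr_add powr_numeral ennreal_mult mult_ac)
    also have "ennreal ((arc_len I)\<^sup>2) * ?U I = (SUP z\<in>Q_up I. ennreal ((arc_len I)\<^sup>2) * dsq g z)"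
      by (rule SUP_mult_left_ennreal)
    also have "\<dots> \<le> ennreal 16 * ?e I"
      by (rule SUP_least) (rule dsq_le_arc_box[OF D I g])
    finally show "?U I * ennreal (arc_len I powr (p + 2)) \<le> ?a I * (ennreal 16 * ?e I)"
      by (simp add: mult_left_mono)
  qed
  also have "\<dots> = (\<integral>\<^sup>+\<zeta>. (\<Sum>I\<in>?S. ennreal 16 * (dsq g \<zeta> * (?a I * indicator (arc_box I) \<zeta>))) \<partial>area)"
  proof -
    have "?a I * (ennreal 16 * ?e I)
      = (\<integral>\<^sup>+\<zeta>. ennreal 16 * (dsq g \<zeta> * (?a I * indicator (arc_box I) \<zeta>)) \<partial>area)" for I
    proof -
      have "(\<integral>\<^sup>+\<zeta>. (?a I * ennreal 16) * (dsq g \<zeta> * indicator (arc_box I) \<zeta>) \<partial>area)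
        = (?a I * ennreal 16) * ?e I"
        by (rule nn_integral_cmult) measurable
      then show ?thesis by (simp only: mult_ac)
    qed
    then show ?thesis by (subst nn_integral_sum) auto
  qed
  also have "\<dots> \<le> (\<integral>\<^sup>+\<zeta>. ?C * ?a J * ?g \<zeta> \<partial>area)"
  proof (rule nn_integral_mono)
    fix \<zeta>
    let ?G = "ennreal (1808 * arc_len J powr p) * green_powr p \<zeta> (arc_pt J)"
    show "(\<Sum>I\<in>?S. ennreal 16 * (dsq g \<zeta> * (?a I * indicator (arc_box I) \<zeta>)))
      \<le> ?C * ?a J * ?g \<zeta>"
    proof (cases "\<zeta> \<in> disc")
      case True
      have "(\<Sum>I\<in>?S. ?a I * indicator (arc_box I) \<zeta>) \<le> (\<Sum>I\<in>?S. ?G * indicator (arc_box I) \<zeta>)"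
      proof (rule sum_mono)
        fix I assume "I \<in> ?S"
        then have I: "I \<in> \<D>" "I \<subseteq> J" using E by auto
        show "?a I * indicator (arc_box I) \<zeta> \<le> ?G * indicator (arc_box I) \<zeta>"
          using arc_box_green[OF D I(1) J I(2) p] by (cases "\<zeta> \<in> arc_box I") auto
      qed
      also have "\<dots> = ?G * of_nat (card {I\<in>?S. \<zeta> \<in> arc_box I})"
      proof -
        have "(\<Sum>I\<in>?S. indicator (arc_box I) \<zeta>) = (\<Sum>I\<in>{I\<in>?S. \<zeta> \<in> arc_box I}. (1::ennreal))"
          using finS by (intro sum.mono_neutral_cong_right) (auto split: split_indicator)
        then show ?thesis by (simp add: sum_distrib_left[symmetric])
      qed
      also have "of_nat (card {I\<in>?S. \<zeta> \<in> arc_box I}) \<le> ennreal 44100"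
      proof -
        have "real (card {I\<in>?S. \<zeta> \<in> arc_box I}) \<le> 44100"
          by (rule arc_box_overlap[OF D finS _ True]) (use E in auto)
        then show ?thesis unfolding ennreal_of_nat_eq_real_of_nat by (rule ennreal_leI)
      qed
      finally have "(\<Sum>I\<in>?S. ?a I * indicator (arc_box I) \<zeta>) \<le> ?G * ennreal 44100"
        by (simp add: mult_left_mono)
      then have "ennreal 16 * (dsq g \<zeta> * (\<Sum>I\<in>?S. ?a I * indicator (arc_box I) \<zeta>))
          \<le> ennreal 16 * (dsq g \<zeta> * (?G * ennreal 44100))"
        by (intro mult_left_mono) auto
      also have "\<dots> = (ennreal 16 * ennreal 44100 * ennreal 1808) * ?a J * ?g \<zeta>"
        by (subst ennreal_mult) (auto simp: mult_ac)
      also have "ennreal 16 * ennreal 44100 * ennreal 1808 = ?C"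
        by (simp only: ennreal_mult[symmetric]) (subst ennreal_mult[symmetric]; simp)?
      finally show ?thesis by (simp add: sum_distrib_left)
    qed (simp add: dsq_def)
  qed
  also have "\<dots> = ?C * ?a J * (\<integral>\<^sup>+\<zeta>. ?g \<zeta> \<partial>area)"
    by (rule nn_integral_cmult) measurable
  also have "\<dots> \<le> ?C * ?a J * Qp_energy p g"
    unfolding Qp_energy_dsq by (intro mult_left_mono SUP_upper wJ) auto
  finally show ?thesis .
qed

section \<open>A small gauge forces compactness\<close>

text \<open>
  The quantity whose limit as \<open>\<rho> \<rightarrow> 1\<close> decides about compactness.
\<close>

abbreviation worst_gauge :: "real \<Rightarrow> (complex \<Rightarrow> complex) \<Rightarrow> real \<Rightarrow> ennreal" where
  "worst_gauge p \<phi> \<rho> \<equiv> SUP a\<in>disc. SUP \<D>\<in>{\<D>. dyadic_system \<D>}. capacity_gauge p \<D> (H_avg p \<phi> a \<rho>)"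

text \<open>
  Bound \<open>|g'|\<^sup>2\<close> on \<open>Q_up I\<close> by its supremum \<open>S(I)\<close>. The mass of \<open>Q_up I\<close> beyond
  \<open>\<rho>\<close> is \<open>|I|^(p+2) H\<^sub>a(I)\<close>, hence at most \<open>|I|^(p+2)\<close> times the sum of \<open>w J\<close> over
  \<open>J \<supseteq> I\<close>. Interchanging the sums, \<open>w J\<close> is multiplied by the sum over \<open>I \<subseteq> J\<close> that
  \<open>carleson_embedding\<close> bounds.
\<close>

lemma tail_estimate:
  assumes D: "dyadic_system \<D>" and p: "0 < p" "p \<le> 1"
    and hol: "\<phi> holomorphic_on disc" and maps: "\<phi> ` disc \<subseteq> disc" and g: "g holomorphic_on disc"
    and w: "\<forall>J\<in>\<D>. 0 \<le> w J" "\<forall>I\<in>\<D>. H_avg p \<phi> a \<rho> I \<le> (\<Sum>\<^sub>\<infinity>J\<in>above \<D> I. ennreal (w J))"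
    and cost: "(\<Sum>\<^sub>\<infinity>J\<in>\<D>. ennreal (w J * arc_len J powr p)) \<le> \<epsilon>"
  shows "(\<integral>\<^sup>+\<zeta>. dsq g \<zeta> * indicator {\<zeta>. \<rho> < cmod \<zeta>} \<zeta> \<partial>pull_measure p \<phi> a)
      \<le> ennreal (16 * 44100 * 1808) * \<epsilon> * Qp_energy p g"
proof -
  let ?M = "pull_measure p \<phi> a"
  let ?C = "ennreal (16 * 44100 * 1808)"
  define A where "A = {\<zeta>. \<rho> < cmod \<zeta>}"
  have [measurable]: "A \<in> sets borel" unfolding A_def by measurable
  define S where "S I = (SUP z\<in>Q_up I. dsq g z)" for I
  \<comment> \<open>The integral of the countable sum is taken along an enumeration of \<open>\<D>\<close>.\<close>
  define e where "e = from_nat_into \<D>"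
  let ?Q = "\<lambda>I. Q_up I \<inter> (A \<inter> disc)" and ?L = "\<lambda>I. ennreal (arc_len I powr (p + 2))"
  let ?m = "\<lambda>I. emeasure ?M (?Q I)" and ?t = "\<lambda>I J. ennreal (w J) * (S I * ?L I)"
    and ?c = "\<lambda>J. ennreal (w J * arc_len J powr p)"
  have bij: "bij_betw e UNIV \<D>" unfolding e_def
    using dyadic_countable[OF D] dyadic_infinite[OF D] by (rule bij_betw_from_nat_into)
  have eD: "e n \<in> \<D>" for n using bij by (auto simp: bij_betw_def)
  have Qm [measurable]: "Q_up (e n) \<in> sets borel" for n by (rule Q_up_borel[OF D eD])
  have A2: "A \<inter> disc = {\<zeta>. \<rho> < cmod \<zeta> \<and> cmod \<zeta> < 1}" by (auto simp: A_def)
  have mass: "?m I \<le> ?L I * (\<Sum>J\<in>above \<D> I. ennreal (w J))" if I: "I \<in> \<D>" for I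
  proof -
    have L: "0 < arc_len I" using dyadic_arc[OF D I] by simp
    have [measurable]: "Q_up I \<in> sets borel" by (rule Q_up_borel[OF D I])
    have "H_avg p \<phi> a \<rho> I = ?m I / ?L I"
      unfolding H_avg_def A2[symmetric] by (subst emeasure_pull_measure[OF hol maps]) auto
    moreover have "?L I * (X / ?L I) = X" for X
    proof -
      have "?L I * (X / ?L I) = X * ?L I / ?L I"
        by (simp add: ennreal_times_divide mult.commute)
      also have "\<dots> = X" by (rule ennreal_mult_divide_eq) (use L in auto)
      finally show ?thesis .
    qed
    ultimately have "?m I = ?L I * H_avg p \<phi> a \<rho> I"
      by simp
    also have "H_avg p \<phi> a \<rho> I \<le> (\<Sum>J\<in>above \<D> I. ennreal (w J))"
      using w(2) I dyadic_finite_ancestors[OF D I] by (auto simp: infsum_finite)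
    finally show ?thesis by (simp add: mult_left_mono)
  qed
  have "(\<integral>\<^sup>+\<zeta>. dsq g \<zeta> * indicator A \<zeta> \<partial>?M) \<le> (\<integral>\<^sup>+\<zeta>. (\<Sum>n. S (e n) * indicator (?Q (e n)) \<zeta>) \<partial>?M)"
  proof (rule nn_integral_mono)
    fix \<zeta>
    show "dsq g \<zeta> * indicator A \<zeta> \<le> (\<Sum>n. S (e n) * indicator (?Q (e n)) \<zeta>)"
    proof (cases "\<zeta> \<in> A \<and> \<zeta> \<in> disc")
      case True
      then obtain I where I: "I \<in> \<D>" "\<zeta> \<in> Q_up I" using Q_up_cover[OF D, of \<zeta>] by blast
      then obtain n where n: "I = e n" using bij by (auto simp: bij_betw_def)
      have "dsq g \<zeta> \<le> S (e n)" unfolding S_def using I n by (intro SUP_upper) auto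
      then have "dsq g \<zeta> * indicator A \<zeta> \<le> (\<Sum>m\<in>{n}. S (e m) * indicator (?Q (e m)) \<zeta>)"
        using True I n by simp
      also have "\<dots> \<le> (\<Sum>n. S (e n) * indicator (?Q (e n)) \<zeta>)" by (rule sum_le_suminf) auto
      finally show ?thesis .
    qed (auto simp: dsq_def)
  qed
  also have "\<dots> = (\<Sum>n. S (e n) * ?m (e n))"
    by (simp add: nn_integral_suminf nn_integral_cmult_indicator)
  also have "\<dots> \<le> ?C * \<epsilon> * Qp_energy p g"
    unfolding suminf_eq_SUP
  proof (rule SUP_least)
    fix N
    define E where "E = e ` {..<N}"
    have E: "finite E" "E \<subseteq> \<D>" using eD by (auto simp: E_def)
    have inj: "inj_on e {..<N}" using bij by (auto simp: bij_betw_def intro: inj_on_subset)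
    define F where "F = (\<Union>I\<in>E. above \<D> I)"
    have F: "finite F" "F \<subseteq> \<D>" unfolding F_def using E dyadic_finite_ancestors[OF D] by auto
    have "(\<Sum>n<N. S (e n) * ?m (e n)) = (\<Sum>I\<in>E. S I * ?m I)"
      unfolding E_def by (simp add: sum.reindex[OF inj])
    also have "\<dots> \<le> (\<Sum>I\<in>E. S I * (?L I * (\<Sum>J\<in>above \<D> I. ennreal (w J))))"
      using E by (intro sum_mono mult_left_mono mass) auto
    also have "\<dots> = (\<Sum>I\<in>E. \<Sum>J\<in>F. (if I \<subseteq> J then ?t I J else 0))"
    proof (rule sum.cong[OF refl])
      fix I assume I: "I \<in> E"
      have "(\<Sum>J\<in>F. (if I \<subseteq> J then ?t I J else 0)) = (\<Sum>J\<in>above \<D> I. ?t I J)"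
        using F I by (intro sum.mono_neutral_cong_right) (auto simp: F_def)
      then show "S I * (?L I * (\<Sum>J\<in>above \<D> I. ennreal (w J))) = (\<Sum>J\<in>F. (if I \<subseteq> J then ?t I J else 0))"
        by (simp add: sum_distrib_left mult_ac)
    qed
    also have "\<dots> = (\<Sum>J\<in>F. \<Sum>I\<in>E. (if I \<subseteq> J then ?t I J else 0))"
      by (rule sum.swap)
    also have "\<dots> = (\<Sum>J\<in>F. ennreal (w J) * (\<Sum>I\<in>below E J. S I * ?L I))"
    proof (rule sum.cong[OF refl])
      fix J
      have "(\<Sum>I\<in>E. (if I \<subseteq> J then ?t I J else 0)) = (\<Sum>I\<in>below E J. ?t I J)"
        using E by (intro sum.mono_neutral_cong_right) auto
      then show "(\<Sum>I\<in>E. (if I \<subseteq> J then ?t I J else 0)) = ennreal (w J) * (\<Sum>I\<in>below E J. S I * ?L I)"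
        by (simp add: sum_distrib_left)
    qed
    also have "\<dots> \<le> (\<Sum>J\<in>F. ennreal (w J) * (?C * ennreal (arc_len J powr p) * Qp_energy p g))"
      unfolding S_def using F by (intro sum_mono mult_left_mono carleson_embedding[OF D E _ p g]) auto
    also have "\<dots> = ?C * (\<Sum>J\<in>F. ?c J) * Qp_energy p g"
    proof -
      have "ennreal (w J) * (?C * ennreal (arc_len J powr p) * Qp_energy p g) = ?C * ?c J * Qp_energy p g"
          if "J \<in> F" for J
        using w(1) F that by (subst ennreal_mult) (auto simp: mult_ac)
      then show ?thesis by (simp add: sum_distrib_left sum_distrib_right)
    qed
    also have "(\<Sum>J\<in>F. ?c J) \<le> \<epsilon>"
    proof -
      have "(\<Sum>J\<in>F. ?c J) \<le> (\<Sum>\<^sub>\<infinity>J\<in>\<D>. ?c J)"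
        by (subst nonneg_infsum_complete) (use F in \<open>auto intro!: SUP_upper\<close>)
      then show ?thesis using cost by (rule order_trans)
    qed
    finally show "(\<Sum>n<N. S (e n) * ?m (e n)) \<le> ?C * \<epsilon> * Qp_energy p g"
      by (simp add: mult_left_mono mult_right_mono)
  qed
  finally show ?thesis unfolding A_def .
qed

text \<open>
  Cauchy's estimate on discs of radius \<open>(1 - \<rho>) / 2\<close>.
\<close>

lemma dsq_le_of_sup_bound:
  assumes hol: "h holomorphic_on disc" and \<rho>: "0 \<le> \<rho>" "\<rho> < 1" and \<eta>: "0 \<le> \<eta>"
    and bd: "\<And>z. z \<in> cball 0 ((1 + \<rho>) / 2) \<Longrightarrow> cmod (h z) \<le> \<eta>" and z: "cmod z \<le> \<rho>"
  shows "dsq h z \<le> ennreal ((2 * \<eta> / (1 - \<rho>))\<^sup>2)"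
proof -
  let ?r = "(1 - \<rho>) / 2"
  have sub: "cball z ?r \<subseteq> cball 0 ((1 + \<rho>) / 2)"
  proof
    fix w assume "w \<in> cball z ?r"
    then have "cmod (w - z) \<le> ?r" by (simp add: dist_norm norm_minus_commute)
    then have "cmod w \<le> (1 + \<rho>) / 2" using norm_triangle_sub[of w z] z by argo
    then show "w \<in> cball 0 ((1 + \<rho>) / 2)" by simp
  qed
  have subd: "cball z ?r \<subseteq> disc"
  proof -
    have "cball (0::complex) ((1 + \<rho>) / 2) \<subseteq> disc" using \<rho> by auto
    then show ?thesis using sub by blast
  qed
  have "norm ((deriv ^^ 1) h z) \<le> fact 1 * \<eta> / ?r ^ 1"
  proof (rule Cauchy_inequality)
    show "h holomorphic_on ball z ?r" using hol subd ball_subset_cball by (blast intro: holomorphic_on_subset)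
    show "continuous_on (cball z ?r) h" using holomorphic_on_imp_continuous_on[OF hol] subd continuous_on_subset
        by blast
    show "0 < ?r" using \<rho> by simp
    fix x assume "norm (z - x) = ?r"
    then have "x \<in> cball z ?r" by (simp add: dist_norm)
    then show "norm (h x) \<le> \<eta>" using sub bd by blast
  qed
  then have "cmod (deriv h z) \<le> 2 * \<eta> / (1 - \<rho>)" by (simp add: mult.commute)
  then have "(cmod (deriv h z))\<^sup>2 \<le> (2 * \<eta> / (1 - \<rho>))\<^sup>2" by (intro power_mono) auto
  then show ?thesis by (simp add: dsq_def ennreal_leI split: split_indicator)
qed

text \<open>
  Fix \<open>\<rho>\<close> with small gauge. Over \<open>|\<zeta>| \<le> \<rho>\<close> the derivatives tend to zero uniformly and
  the measures have bounded mass; over \<open>|\<zeta>| > \<rho>\<close> the tail estimate applies to all functions of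
  norm at most \<open>B\<close> at once.
\<close>

lemma gauge_small_imp_norm_small:
  assumes p: "0 < p" "p \<le> 1" and hol: "\<phi> holomorphic_on disc" and maps: "\<phi> ` disc \<subseteq> disc"
    and im: "comp_operator \<phi> ` Qp p \<subseteq> Qp p"
    and lim: "((\<lambda>\<rho>. worst_gauge p \<phi> \<rho>) \<longlongrightarrow> 0) (at_left 1)"
    and h: "\<And>n. h n \<in> Qp p" "\<And>n. Qp_norm p (h n) \<le> B"
    and ul: "\<And>s. s < 1 \<Longrightarrow> uniform_limit (cball 0 s) h (\<lambda>_. 0) sequentially"
  shows "(\<lambda>n. Qp_norm p (comp_operator \<phi> (h n))) \<longlonglongrightarrow> 0"
proof (rule LIMSEQ_I)
  fix \<epsilon> :: real assume \<epsilon>: "0 < \<epsilon>"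
  have B0: "0 \<le> B" using h(2)[of 0] Qp_norm_nonneg[of p "h 0"] by linarith
  obtain K where K: "K < \<infinity>" "\<forall>a\<in>disc. emeasure (pull_measure p \<phi> a) UNIV \<le> K"
    using pull_measure_total[OF p hol maps im] by blast
  define k where "k = enn2real K"
  have k: "K = ennreal k" "0 \<le> k" using K(1) by (auto simp: k_def)
  define C :: real where "C = 16 * 44100 * 1808"
  \<comment> \<open>Chosen so that the tail contributes at most \<open>(\<epsilon>/4)\<^sup>2\<close>; \<open>+ 1\<close> allows \<open>B = 0\<close>.\<close>
  define \<delta> where "\<delta> = (\<epsilon> / 4)\<^sup>2 / (C * (B\<^sup>2 + 1))"
  have d: "0 < \<delta>" using \<epsilon> by (auto simp: \<delta>_def C_def add_nonneg_pos intro!: divide_pos_pos mult_pos_pos)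
  have "eventually (\<lambda>\<rho>. worst_gauge p \<phi> \<rho> < ennreal \<delta>) (at_left 1)"
    using order_tendstoD(2)[OF lim, of "ennreal \<delta>"] d by simp
  moreover have "eventually (\<lambda>\<rho>. \<rho> \<in> {0<..<1::real}) (at_left 1)" by (rule eventually_at_left_real) simp
  ultimately have "eventually (\<lambda>\<rho>. \<rho> \<in> {0<..<1} \<and> worst_gauge p \<phi> \<rho> < ennreal \<delta>) (at_left (1::real))"
    by eventually_elim simp
  then obtain \<rho> where \<rho>: "0 < \<rho>" "\<rho> < 1" and g: "worst_gauge p \<phi> \<rho> < ennreal \<delta>"
    using eventually_happens'[of "at_left (1::real)"] by (auto simp: trivial_limit_at_left_real)
  obtain \<D> where D: "dyadic_system \<D>" using dyadic_system_exists by blast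
  \<comment> \<open>Chosen so that Cauchy's estimate makes the inner part at most \<open>(\<epsilon>/4)\<^sup>2\<close> in total.\<close>
  define \<eta> where "\<eta> = (1 - \<rho>) / 2 * ((\<epsilon> / 4) / sqrt (k + 1))"
  have e: "0 < \<eta>" using \<rho> \<epsilon> k by (auto simp: \<eta>_def)
  have "eventually (\<lambda>n. \<forall>z\<in>cball 0 ((1 + \<rho>) / 2). dist (h n z) 0 < \<eta>) sequentially"
    using ul[of "(1 + \<rho>) / 2"] \<rho> e unfolding uniform_limit_iff by auto
  moreover have "eventually (\<lambda>n. cmod (h n (\<phi> 0)) < \<epsilon> / 4) sequentially"
  proof -
    have p0: "cmod (\<phi> 0) < 1" using maps by (auto simp: image_subset_iff)
    have "eventually (\<lambda>n. \<forall>z\<in>cball 0 (cmod (\<phi> 0)). dist (h n z) 0 < \<epsilon> / 4) sequentially"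
      by (rule uniform_limitD[OF ul[OF p0]]) (use \<epsilon> in simp)
    then show ?thesis by eventually_elim auto
  qed
  ultimately have "eventually (\<lambda>n. Qp_norm p (comp_operator \<phi> (h n)) < \<epsilon>) sequentially"
  proof eventually_elim
    case (elim n)
    let ?h = "h n"
    have hh: "?h holomorphic_on disc" by (rule QpD(1)[OF h(1)])
    note [measurable] = dsq_measurable[OF hh]
    have [measurable]: "{\<zeta>::complex. \<rho> < cmod \<zeta>} \<in> sets borel" by measurable
    have hE: "Qp_energy p ?h \<le> ennreal (B\<^sup>2)"
      using Qp_energy_le_norm[OF h(1)[of n]] h(2)[of n] Qp_norm_nonneg
          by (elim order_trans) (intro ennreal_leI power_mono)
    have "Qp_energy p (comp_operator \<phi> ?h) \<le> ennreal ((\<epsilon> / 2)\<^sup>2)"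
      unfolding comp_operator_energy[OF hol maps hh]
    proof (rule SUP_least)
      fix a :: complex assume a: "a \<in> disc"
      let ?M = "pull_measure p \<phi> a"
      have "capacity_gauge p \<D> (H_avg p \<phi> a \<rho>)
          \<le> (SUP \<D>\<in>{\<D>. dyadic_system \<D>}. capacity_gauge p \<D> (H_avg p \<phi> a \<rho>))"
        using D by (intro SUP_upper) auto
      also have "\<dots> \<le> worst_gauge p \<phi> \<rho>"
        using a by (rule SUP_upper)
      finally have "capacity_gauge p \<D> (H_avg p \<phi> a \<rho>) < ennreal \<delta>" using g by (rule le_less_trans)
      then obtain w where w: "\<forall>J\<in>\<D>. 0 \<le> w J" "\<forall>I\<in>\<D>. H_avg p \<phi> a \<rho> I \<le> (\<Sum>\<^sub>\<infinity>J\<in>above \<D> I. ennreal (w J))"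
        "(\<Sum>\<^sub>\<infinity>J\<in>\<D>. ennreal (w J * arc_len J powr p)) < ennreal \<delta>"
        unfolding capacity_gauge_def Inf_less_iff by blast
      have "(\<integral>\<^sup>+\<zeta>. dsq ?h \<zeta> \<partial>?M) \<le> (\<integral>\<^sup>+\<zeta>. ennreal ((2 * \<eta> / (1 - \<rho>))\<^sup>2)
          + dsq ?h \<zeta> * indicator {\<zeta>. \<rho> < cmod \<zeta>} \<zeta> \<partial>?M)"
      proof (rule nn_integral_mono)
        fix \<zeta>
        show "dsq ?h \<zeta> \<le> ennreal ((2 * \<eta> / (1 - \<rho>))\<^sup>2) + dsq ?h \<zeta> * indicator {\<zeta>. \<rho> < cmod \<zeta>} \<zeta>"
        proof (cases "\<rho> < cmod \<zeta>")
          case False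
          have "dsq ?h \<zeta> \<le> ennreal ((2 * \<eta> / (1 - \<rho>))\<^sup>2)"
          proof (rule dsq_le_of_sup_bound[OF hh])
            show "cmod (h n z) \<le> \<eta>" if "z \<in> cball 0 ((1 + \<rho>) / 2)" for z
              using elim(1) that by (force simp: dist_norm)
          qed (use \<rho> e False in auto)
          then show ?thesis using False by simp
        qed simp
      qed
      also have "\<dots> = ennreal ((2 * \<eta> / (1 - \<rho>))\<^sup>2) * emeasure ?M UNIV
          + (\<integral>\<^sup>+\<zeta>. dsq ?h \<zeta> * indicator {\<zeta>. \<rho> < cmod \<zeta>} \<zeta> \<partial>?M)"
        by (subst nn_integral_add) auto
      also have "\<dots> \<le> ennreal ((2 * \<eta> / (1 - \<rho>))\<^sup>2) * ennreal k + ennreal C * ennreal \<delta> * ennreal (B\<^sup>2)"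
      proof (intro add_mono mult_left_mono)
        show "emeasure ?M UNIV \<le> ennreal k" using K(2) a k by simp
        have "(\<integral>\<^sup>+\<zeta>. dsq ?h \<zeta> * indicator {\<zeta>. \<rho> < cmod \<zeta>} \<zeta> \<partial>?M) \<le> ennreal C * ennreal \<delta> * Qp_energy p ?h"
          unfolding C_def by (rule tail_estimate[OF D p hol maps hh w(1,2) less_imp_le[OF w(3)]])
        also have "\<dots> \<le> ennreal C * ennreal \<delta> * ennreal (B\<^sup>2)" by (intro mult_left_mono hE) auto
        finally show "(\<integral>\<^sup>+\<zeta>. dsq ?h \<zeta> * indicator {\<zeta>. \<rho> < cmod \<zeta>} \<zeta> \<partial>?M)
            \<le> ennreal C * ennreal \<delta> * ennreal (B\<^sup>2)" .
      qed simp
      also have "\<dots> = ennreal ((2 * \<eta> / (1 - \<rho>))\<^sup>2 * k + C * \<delta> * B\<^sup>2)"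
        using k d by (simp add: ennreal_mult ennreal_plus C_def)
      also have "\<dots> \<le> ennreal ((\<epsilon> / 2)\<^sup>2)"
      proof (rule ennreal_leI)
        have "2 * \<eta> / (1 - \<rho>) = (\<epsilon> / 4) / sqrt (k + 1)" using \<rho> by (simp add: \<eta>_def)
        then have "(2 * \<eta> / (1 - \<rho>))\<^sup>2 * k = (\<epsilon> / 4)\<^sup>2 * (k / (k + 1))" using k by (simp add: power_divide)
        also have "\<dots> \<le> (\<epsilon> / 4)\<^sup>2 * 1" using k by (intro mult_left_mono) auto
        finally have 1: "(2 * \<eta> / (1 - \<rho>))\<^sup>2 * k \<le> (\<epsilon> / 4)\<^sup>2" by simp
        have Bp: "0 < B\<^sup>2 + 1" by (simp add: add_nonneg_pos)
        have "C * \<delta> * B\<^sup>2 = (\<epsilon> / 4)\<^sup>2 * (B\<^sup>2 / (B\<^sup>2 + 1))"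
        proof -
          have "C \<noteq> 0" by (simp add: C_def)
          then show ?thesis unfolding \<delta>_def by simp
        qed
        also have "\<dots> \<le> (\<epsilon> / 4)\<^sup>2 * 1" using Bp by (intro mult_left_mono) auto
        finally have 2: "C * \<delta> * B\<^sup>2 \<le> (\<epsilon> / 4)\<^sup>2" by simp
        have "(\<epsilon> / 4)\<^sup>2 + (\<epsilon> / 4)\<^sup>2 \<le> (\<epsilon> / 2)\<^sup>2" by (simp add: power_divide)
        then show "(2 * \<eta> / (1 - \<rho>))\<^sup>2 * k + C * \<delta> * B\<^sup>2 \<le> (\<epsilon> / 2)\<^sup>2" using 1 2 by linarith
      qed
      finally show "(\<integral>\<^sup>+\<zeta>. dsq ?h \<zeta> \<partial>?M) \<le> ennreal ((\<epsilon> / 2)\<^sup>2)" .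
    qed
    then have "Qp_norm p (comp_operator \<phi> ?h) \<le> cmod (comp_operator \<phi> ?h 0) + \<epsilon> / 2"
      using \<epsilon> by (intro Qp_norm_le) auto
    also have "comp_operator \<phi> ?h 0 = ?h (\<phi> 0)" by (simp add: comp_operator_def)
    finally show ?case using elim(2) \<epsilon> by linarith
  qed
  then show "\<exists>no. \<forall>n\<ge>no. norm (Qp_norm p (comp_operator \<phi> (h n)) - 0) < \<epsilon>"
    by (simp add: eventually_sequentially abs_of_nonneg Qp_norm_nonneg)
qed

text \<open>
  By the Bolzano-Weierstrass property it suffices that an infinite set of images of bounded
  functions has a limit point. A normal family argument extracts a limit \<open>g\<close> of preimages, and
  the hypothesis is applied to the differences with \<open>g\<close>.
\<close>

lemma null_sequence_imp_compact:
  assumes p: "0 < p" "p \<le> 1" and im: "comp_operator \<phi> ` Qp p \<subseteq> Qp p"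
    and null: "\<And>h B. (\<And>n. h n \<in> Qp p) \<Longrightarrow> (\<And>n. Qp_norm p (h n) \<le> B) \<Longrightarrow>
      (\<And>s. s < 1 \<Longrightarrow> uniform_limit (cball 0 s) h (\<lambda>_. 0) sequentially) \<Longrightarrow>
      (\<lambda>n::nat. Qp_norm p (comp_operator \<phi> (h n))) \<longlonglongrightarrow> 0"
  shows "Qp_compact_operator p (comp_operator \<phi>)"
proof -
  interpret Q: Metric_space "Qp p" "Qp_dist p" by (rule Metric_space_Qp)
  let ?T = "comp_operator \<phi>"
  have "compactin Q.mtopology (Q.mtopology closure_of (?T ` S))" if S: "S \<subseteq> Qp p" and bS: "Q.mbounded S" for S
    unfolding Q.compact_closure_of_eq_Bolzano_Weierstrass
  proof (intro allI impI)
    fix U assume U: "infinite U \<and> U \<subseteq> ?T ` S \<and> U \<subseteq> Qp p"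
    obtain B where B: "\<forall>f\<in>S. Qp_norm p f \<le> B" using bS unfolding Qp_mbounded_iff[OF p S] by blast
    obtain y :: "nat \<Rightarrow> complex \<Rightarrow> complex" where y: "inj y" "range y \<subseteq> U"
      using U infinite_countable_subset by blast
    have "\<forall>n. \<exists>f. f \<in> S \<and> y n = ?T f" using y(2) U by blast
    then obtain f where f: "\<And>n. f n \<in> S" "\<And>n. y n = ?T (f n)" by metis
    obtain g r where gr: "g \<in> Qp p" "strict_mono (r :: nat \<Rightarrow> nat)" "\<forall>s<1. uniform_limit (cball 0 s) (f \<circ> r) g
        sequentially"
      using Qp_normal_family[OF p(1), of f B] f(1) S B by blast
    define h where "h n z = f (r n) z - g z" for n z
    have fQ: "f n \<in> Qp p" for n using f(1) S by blast
    have "(\<lambda>n. Qp_norm p (?T (h n))) \<longlonglongrightarrow> 0"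
    proof (rule null)
      show "h n \<in> Qp p" for n unfolding h_def by (rule Qp_diff(1)[OF fQ gr(1)])
      show "Qp_norm p (h n) \<le> B + Qp_norm p g" for n
      proof -
        have "Qp_norm p (h n) \<le> Qp_norm p (f (r n)) + Qp_norm p g" unfolding h_def
            by (rule Qp_diff(2)[OF fQ gr(1)])
        then show ?thesis using B f(1)[of "r n"] by fastforce
      qed
      show "uniform_limit (cball 0 s) h (\<lambda>_. 0) sequentially" if "s < 1" for s
        using gr(3) that unfolding uniform_limit_iff h_def by (simp add: dist_norm)
    qed
    moreover have "Qp_norm p (?T (h n)) = Qp_dist p (y (r n)) (?T g)" for n
      unfolding h_def comp_operator_diff Qp_dist_def f(2) ..
    ultimately have conv: "(\<lambda>n. Qp_dist p (y (r n)) (?T g)) \<longlonglongrightarrow> 0" by simp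
    have "?T g \<in> Q.mtopology derived_set_of U"
      unfolding Q.metric_derived_set_of
    proof (intro CollectI conjI allI impI)
      show "?T g \<in> Qp p" using im gr(1) by blast
      fix \<epsilon> :: real assume "0 < \<epsilon>"
      then obtain N where N: "\<And>n. n \<ge> N \<Longrightarrow> Qp_dist p (y (r n)) (?T g) < \<epsilon>"
        using LIMSEQ_D[OF conv] by (fastforce simp: abs_of_nonneg)
      \<comment> \<open>The \<open>y n\<close> are distinct, so one of two consecutive ones differs from the limit.\<close>
      have "r N \<noteq> r (Suc N)" using strict_monoD[OF gr(2), of N "Suc N"] by simp
      then have "y (r N) \<noteq> y (r (Suc N))" using y(1) by (auto dest: injD)
      then obtain n where n: "n \<ge> N" "y (r n) \<noteq> ?T g" by (metis le_refl le_SucI)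
      have "y (r n) \<in> U" using y(2) by blast
      moreover have "y (r n) \<in> Q.mball (?T g) \<epsilon>"
        using N[OF n(1)] \<open>?T g \<in> Qp p\<close> U \<open>y (r n) \<in> U\<close> Q.commute[of "?T g" "y (r n)"] by auto
      ultimately show "\<exists>u\<in>U. u \<noteq> ?T g \<and> u \<in> Q.mball (?T g) \<epsilon>" using n(2) by blast
    qed
    then show "Q.mtopology derived_set_of U \<noteq> {}" by blast
  qed
  then show ?thesis unfolding Qp_compact_operator_def using im by blast
qed

section \<open>Compactness forces a small gauge\<close>

lemma compact_imp_bounded_operator:
  assumes p: "0 < p" "p \<le> 1" and T: "Qp_compact_operator p (comp_operator \<phi>)"
  shows "Qp_bounded_operator p (comp_operator \<phi>)"
proof -
  interpret Q: Metric_space "Qp p" "Qp_dist p" by (rule Metric_space_Qp)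
  let ?T = "comp_operator \<phi>"
  have im: "?T ` Qp p \<subseteq> Qp p" using T by (simp add: Qp_compact_operator_def)
  define S where "S = {f\<in>Qp p. Qp_norm p f \<le> 1}"
  have S: "S \<subseteq> Qp p" by (auto simp: S_def)
  have "Q.mbounded S" unfolding Qp_mbounded_iff[OF p S] by (auto simp: S_def)
  then have "compactin Q.mtopology (Q.mtopology closure_of (?T ` S))"
    using T S by (simp add: Qp_compact_operator_def)
  then have "Q.mbounded (Q.mtopology closure_of (?T ` S))" by (rule Q.compactin_imp_mbounded)
  moreover have TS: "?T ` S \<subseteq> Qp p" using im S by blast
  then have "?T ` S \<subseteq> Q.mtopology closure_of (?T ` S)" by (simp add: closure_of_subset)
  ultimately have "Q.mbounded (?T ` S)" by (rule Q.mbounded_subset)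
  then obtain B where B: "\<forall>f\<in>?T ` S. Qp_norm p f \<le> B" unfolding Qp_mbounded_iff[OF p TS] by blast
  have "Qp_norm p (?T f) \<le> B * Qp_norm p f" if f: "f \<in> Qp p" for f
  proof (cases "Qp_norm p f = 0")
    case True
    have "f z = 0" for z
      using Qp_norm_eq_0[OF QpD(1,3)[OF f] True] QpD(2)[OF f] by (cases "z \<in> disc") auto
    then have "?T f = (\<lambda>_. 0)" by (auto simp: comp_operator_def)
    moreover have "Qp_norm p (\<lambda>_. 0) = 0" using Qp_cmult(2)[OF f, of 0] by simp
    ultimately show ?thesis using True by simp
  next
    case False
    define t where "t = Qp_norm p f"
    have t: "0 < t" using False Qp_norm_nonneg[of p f] by (simp add: t_def)
    define c :: complex where "c = of_real (1 / t)"
    have nc: "cmod c = 1 / t" using t by (simp add: c_def norm_divide)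
    have "(\<lambda>z. c * f z) \<in> S" unfolding S_def using Qp_cmult[OF f, of c] t nc by (simp add: t_def[symmetric])
    then have "Qp_norm p (?T (\<lambda>z. c * f z)) \<le> B" using B by blast
    moreover have "?T (\<lambda>z. c * f z) = (\<lambda>z. c * ?T f z)" by (auto simp: comp_operator_def)
    moreover have "?T f \<in> Qp p" using im f by blast
    ultimately have "Qp_norm p (?T f) / t \<le> B" using Qp_cmult(2)[of "?T f" p c] nc by simp
    then show ?thesis using t by (simp add: t_def[symmetric] field_simps)
  qed
  then show ?thesis unfolding Qp_bounded_operator_def using im by blast
qed

text \<open>
  Otherwise a subsequence of images stays away from zero but, by compactness, accumulates at some
  \<open>l\<close>. Convergence in \<open>Qp\<close> implies pointwise convergence, so \<open>l = 0\<close>.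
\<close>

lemma compact_imp_null_sequence:
  assumes p: "0 < p" "p \<le> 1" and T: "Qp_compact_operator p (comp_operator \<phi>)" and maps: "\<phi> ` disc \<subseteq> disc"
    and h: "\<And>n. h n \<in> Qp p" "\<And>n. Qp_norm p (h n) \<le> B"
    and ptw: "\<And>z. z \<in> disc \<Longrightarrow> (\<lambda>n. h n z) \<longlonglongrightarrow> 0"
  shows "(\<lambda>n. Qp_norm p (comp_operator \<phi> (h n))) \<longlonglongrightarrow> 0"
proof (rule ccontr)
  interpret Q: Metric_space "Qp p" "Qp_dist p" by (rule Metric_space_Qp)
  let ?T = "comp_operator \<phi>"
  have im: "?T ` Qp p \<subseteq> Qp p" using T by (simp add: Qp_compact_operator_def)
  assume "\<not> (\<lambda>n. Qp_norm p (?T (h n))) \<longlonglongrightarrow> 0"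
  then obtain \<delta> where \<delta>: "0 < \<delta>" "\<And>N. \<exists>n\<ge>N. \<delta> \<le> Qp_norm p (?T (h n))"
    unfolding LIMSEQ_iff by (auto simp: abs_of_nonneg Qp_norm_nonneg not_less)
  define A where "A = {n. \<delta> \<le> Qp_norm p (?T (h n))}"
  have infA: "infinite A" unfolding infinite_nat_iff_unbounded_le A_def using \<delta>(2) by auto
  define r where "r = enumerate A"
  have r: "strict_mono r" "\<And>n. r n \<in> A" using infA by (auto simp: r_def strict_mono_enumerate enumerate_in_set)
  define S where "S = range h"
  have S: "S \<subseteq> Qp p" using h(1) by (auto simp: S_def)
  have "Q.mbounded S" unfolding Qp_mbounded_iff[OF p S] using h(2) by (auto simp: S_def)
  then have "compactin Q.mtopology (Q.mtopology closure_of (?T ` S))"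
    using T S by (simp add: Qp_compact_operator_def)
  moreover have TS: "?T ` S \<subseteq> Qp p" using im S by blast
  then have "?T ` S \<subseteq> Q.mtopology closure_of (?T ` S)" by (simp add: closure_of_subset)
  then have "range (\<lambda>n. ?T (h (r n))) \<subseteq> Q.mtopology closure_of (?T ` S)" by (auto simp: S_def)
  ultimately obtain l q where lq: "strict_mono (q :: nat \<Rightarrow> nat)" "limitin Q.mtopology ((\<lambda>n. ?T (h (r n))) \<circ> q) l
      sequentially"
    unfolding Q.compactin_sequentially by blast
  then have l: "l \<in> Qp p" and conv: "(\<lambda>n. Qp_dist p (?T (h (r (q n)))) l) \<longlonglongrightarrow> 0"
    unfolding Q.limitin_metric_dist_null by (auto simp: o_def)
  have Th: "?T (h n) \<in> Qp p" for n using im h(1) by blast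
  have sub: "strict_mono (r \<circ> q)" using r(1) lq(1) by (rule strict_mono_o)
  have l0: "l z = 0" if z: "z \<in> disc" for z
  proof -
    have zs: "0 \<le> cmod z" "cmod z < 1" using z by auto
    obtain K where K: "K \<ge> 0" "\<forall>f\<in>Qp p. \<forall>w\<in>cball 0 (cmod z). cmod (f w) \<le> K * Qp_norm p f"
      using Qp_value_bound[OF zs p(1)] by blast
    have "(\<lambda>n. K * Qp_dist p (?T (h (r (q n)))) l) \<longlonglongrightarrow> K * 0" by (intro tendsto_intros conv)
    then have 1: "(\<lambda>n. K * Qp_dist p (?T (h (r (q n)))) l) \<longlonglongrightarrow> 0" by simp
    have "(\<lambda>n. ?T (h (r (q n))) z - l z) \<longlonglongrightarrow> 0"
    proof (rule Lim_null_comparison[OF _ 1], rule always_eventually, rule allI)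
      fix n
      have "(\<lambda>z. ?T (h (r (q n))) z - l z) \<in> Qp p" by (rule Qp_diff(1)[OF Th l])
      then show "norm (?T (h (r (q n))) z - l z) \<le> K * Qp_dist p (?T (h (r (q n)))) l"
        using K(2) unfolding Qp_dist_def by (auto dest!: bspec)
    qed
    moreover have "(\<lambda>n. ?T (h (r (q n))) z) \<longlonglongrightarrow> 0"
    proof -
      have "\<phi> z \<in> disc" using maps z by blast
      then have "(\<lambda>n. h n (\<phi> z)) \<longlonglongrightarrow> 0" by (rule ptw)
      then have "((\<lambda>n. h n (\<phi> z)) \<circ> (r \<circ> q)) \<longlonglongrightarrow> 0" by (rule LIMSEQ_subseq_LIMSEQ[OF _ sub])
      then show ?thesis using z by (simp add: comp_operator_def o_def)
    qed
    ultimately have "(\<lambda>n. ?T (h (r (q n))) z - (?T (h (r (q n))) z - l z)) \<longlonglongrightarrow> 0 - 0"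
        by (rule tendsto_diff[rotated])
    then have "(\<lambda>n::nat. l z) \<longlonglongrightarrow> 0" by simp
    then show ?thesis by (simp add: LIMSEQ_const_iff)
  qed
  then have "l z = 0" for z using QpD(2)[OF l] by (cases "z \<in> disc") auto
  then have "l = (\<lambda>_. 0)" by auto
  then have "(\<lambda>n. Qp_norm p (?T (h (r (q n))))) \<longlonglongrightarrow> 0" using conv by (simp add: Qp_dist_zero_right)
  moreover have "\<delta> \<le> Qp_norm p (?T (h (r (q n))))" for n using r(2)[of "q n"] by (simp add: A_def)
  ultimately have "\<delta> \<le> 0" by (intro LIMSEQ_le_const) auto
  then show False using \<delta>(1) by simp
qed

text \<open>
  If the dual values for arcs of generation at least \<open>n\<close> did not tend to zero uniformly, the
  corresponding test functions would be bounded, tend to zero pointwise, and have images of energy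
  bounded below.
\<close>

lemma compact_imp_dual_small:
  assumes p: "0 < p" "p \<le> 1" and T: "Qp_compact_operator p (comp_operator \<phi>)"
    and hol: "\<phi> holomorphic_on disc" and maps: "\<phi> ` disc \<subseteq> disc" and \<epsilon>: "0 < \<epsilon>"
  shows "\<exists>n. \<forall>a\<in>disc. \<forall>\<D> E x. dyadic_system \<D> \<longrightarrow> dyadic_carleson p \<D> E x \<longrightarrow> E \<subseteq> (\<Union>k\<in>{n..}. dyadic_level \<D> k) \<longrightarrow>
    (\<Sum>I\<in>E. ennreal (x I * arc_len I powr (-2 - p)) * emeasure (pull_measure p \<phi> a) (Q_up I)) \<le> ennreal \<epsilon>"
proof (rule ccontr)
  let ?T = "comp_operator \<phi>"
  let ?B = "2 + sqrt (100000 * test_const p)" and ?b = "\<lambda>n z. (1 / (1 - cmod z)\<^sup>2) * (2 * (1 / 2) ^ n)"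
  have im: "?T ` Qp p \<subseteq> Qp p" using T by (simp add: Qp_compact_operator_def)
  let ?S = "\<lambda>a E x. (\<Sum>I\<in>E. ennreal (x I * arc_len I powr (-2 - p)) * emeasure (pull_measure p \<phi> a) (Q_up I))"
  assume contra: "\<not> ?thesis"
  have bad: "\<exists>a \<D> E x. a \<in> disc \<and> dyadic_system \<D> \<and> dyadic_carleson p \<D> E x \<and> E \<subseteq> (\<Union>k\<in>{n..}. dyadic_level \<D> k) \<and>
      ennreal \<epsilon> < ?S a E x" for n
    unfolding not_le[symmetric] using contra by blast
  have "\<exists>f. f \<in> Qp p \<and> Qp_norm p f \<le> ?B \<and> ennreal (\<epsilon> / 1000000) < Qp_energy p (?T f) \<and>
     (\<forall>z\<in>disc. cmod (f z) \<le> ?b n z)" for n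
  proof -
    obtain a \<D> E x where *: "a \<in> disc" "dyadic_system \<D>" "dyadic_carleson p \<D> E x" "E \<subseteq> (\<Union>k\<in>{n..}. dyadic_level
        \<D> k)" "ennreal \<epsilon> < ?S a E x"
      using bad[of n]
      by (elim exE conjE) (rule that)
    have E: "E \<subseteq> \<D>" and x0: "\<And>I. 0 \<le> x I" using *(3) by (auto simp: dyadic_carleson_def)
    obtain c where c: "\<forall>I. (c I)\<^sup>2 = x I"
      "(\<Sum>I\<in>E. ennreal (x I * arc_len I powr (-2 - p) / 1000000) * emeasure (pull_measure p \<phi> a) (Q_up I))
        \<le> (\<integral>\<^sup>+\<zeta>. dsq (test_fun p E c) \<zeta> \<partial>pull_measure p \<phi> a)"
      using test_fun_image_energy_ge[OF *(2,3) hol maps, of a] by blast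
    let ?f = "test_fun p E c"
    have fh: "?f holomorphic_on disc" by (rule test_fun_holomorphic[OF *(2) E])
    have en: "Qp_energy p ?f \<le> ennreal (100000 * test_const p)"
      by (rule test_fun_energy[OF *(2,3) p]) (use c(1) in simp)
    then have "Qp_energy p ?f < \<infinity>" by (rule le_less_trans) simp
    then have fQ: "?f \<in> Qp p" unfolding Qp_def using fh by (auto simp: test_fun_def)
    have small: "cmod (?f z) \<le> ?b n z" if "z \<in> disc" for z
      using test_fun_small[OF *(2,3) p(1) _ *(4) that] c(1) by blast
    have "(1 / 2 :: real) ^ n \<le> 1" by (simp add: power_le_one)
    then have f0: "cmod (?f 0) \<le> 2" using small[of 0] by simp
    have tc: "0 \<le> test_const p"
    proof (rule ccontr)
      assume "\<not> 0 \<le> test_const p"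
      then show False
        unfolding test_const_def
        using shell_const_nonneg[of p "2*p"] shell_const_nonneg[of 2 "2
            + p/2"] kernel_const_nonneg[of "p/2" "4 - p/2" "2*p"] p
        by (auto simp: not_le mult_less_0_iff)
    qed
    have "Qp_norm p ?f \<le> cmod (?f 0) + sqrt (100000 * test_const p)"
      using en tc by (intro Qp_norm_le) auto
    then have nf: "Qp_norm p ?f \<le> ?B" using f0 by simp
    have "ennreal (\<epsilon> / 1000000) = ennreal (1 / 1000000) * ennreal \<epsilon>"
      using \<epsilon> by (subst ennreal_mult[symmetric]) auto
    also have "\<dots> < ennreal (1 / 1000000) * ?S a E x"
      using *(5) by (intro ennreal_mult_strict_left_mono) auto
    also have "\<dots> = (\<Sum>I\<in>E. ennreal (x I * arc_len I powr (-2 - p) / 1000000)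
        * emeasure (pull_measure p \<phi> a) (Q_up I))"
      unfolding sum_distrib_left mult.assoc[symmetric]
      using x0 by (intro sum.cong refl) (simp add: ennreal_mult[symmetric])
    also note c(2)
    also have "(\<integral>\<^sup>+\<zeta>. dsq ?f \<zeta> \<partial>pull_measure p \<phi> a) \<le> Qp_energy p (?T ?f)"
      unfolding comp_operator_energy[OF hol maps fh] by (rule SUP_upper[OF *(1)])
    finally show ?thesis using fQ nf small by blast
  qed
  then obtain f where f: "\<And>n. f n \<in> Qp p" "\<And>n. Qp_norm p (f n) \<le> ?B"
    "\<And>n. ennreal (\<epsilon> / 1000000) < Qp_energy p (?T (f n))"
    "\<And>n z. z \<in> disc \<Longrightarrow> cmod (f n z) \<le> ?b n z"
    by metis
  have "(\<lambda>n. Qp_norm p (?T (f n))) \<longlonglongrightarrow> 0"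
  proof (rule compact_imp_null_sequence[OF p T maps f(1,2)])
    fix z :: complex assume z: "z \<in> disc"
    have "(\<lambda>n. ?b n z) \<longlonglongrightarrow> (1 / (1 - cmod z)\<^sup>2) * (2 * 0)"
      by (intro tendsto_intros LIMSEQ_power_zero) simp
    then have "(\<lambda>n. ?b n z) \<longlonglongrightarrow> 0" by simp
    then show "(\<lambda>n. f n z) \<longlonglongrightarrow> 0"
      by (rule Lim_null_comparison[rotated]) (use f(4)[OF z] in auto)
  qed
  then have "(\<lambda>n. (Qp_norm p (?T (f n)))\<^sup>2) \<longlonglongrightarrow> 0\<^sup>2" by (intro tendsto_intros)
  then have "eventually (\<lambda>n. (Qp_norm p (?T (f n)))\<^sup>2 < \<epsilon> / 1000000) sequentially"
    by (rule order_tendstoD) (use \<epsilon> in simp)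
  then obtain n where n: "(Qp_norm p (?T (f n)))\<^sup>2 < \<epsilon> / 1000000" by (auto simp: eventually_sequentially)
  have "?T (f n) \<in> Qp p" using im f(1) by blast
  then have "Qp_energy p (?T (f n)) \<le> ennreal ((Qp_norm p (?T (f n)))\<^sup>2)" by (rule Qp_energy_le_norm)
  also have "\<dots> \<le> ennreal (\<epsilon> / 1000000)" using n by (intro ennreal_leI) simp
  finally show False using f(3)[of n] by simp
qed

text \<open>
  For \<open>\<rho> \<ge> 1 - 2^(-n)\<close> only arcs of generation at least \<open>n\<close> carry a nonzero \<open>H_avg\<close>, so
  the gauge is bounded by dual values of the kind estimated in \<open>compact_imp_dual_small\<close>.
\<close>

lemma compact_imp_gauge_small:
  assumes p: "0 < p" "p \<le> 1" and T: "Qp_compact_operator p (comp_operator \<phi>)"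
    and hol: "\<phi> holomorphic_on disc" and maps: "\<phi> ` disc \<subseteq> disc"
  shows "((\<lambda>\<rho>. worst_gauge p \<phi> \<rho>) \<longlongrightarrow> 0) (at_left 1)"
proof (rule order_tendstoI)
  have im: "comp_operator \<phi> ` Qp p \<subseteq> Qp p" using T by (simp add: Qp_compact_operator_def)
  obtain K where K: "K < \<infinity>" "\<forall>a\<in>disc. emeasure (pull_measure p \<phi> a) UNIV \<le> K"
    using pull_measure_total[OF p hol maps im] by blast
  fix e :: ennreal assume "0 < e"
  then obtain e' where e': "0 < e'" "e' < e" using dense by blast
  then obtain \<epsilon> where \<epsilon>: "e' = ennreal \<epsilon>" "0 \<le> \<epsilon>" by (cases e') auto
  then have \<epsilon>0: "0 < \<epsilon>" using e' by (simp add: less_le)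
  obtain n where n: "\<forall>a\<in>disc. \<forall>\<D> E x. dyadic_system \<D> \<longrightarrow> dyadic_carleson p \<D> E x
      \<longrightarrow> E \<subseteq> (\<Union>k\<in>{n..}. dyadic_level \<D> k) \<longrightarrow>
    (\<Sum>I\<in>E. ennreal (x I * arc_len I powr (-2 - p)) * emeasure (pull_measure p \<phi> a) (Q_up I)) \<le> ennreal \<epsilon>"
    using compact_imp_dual_small[OF p T hol maps \<epsilon>0] by blast
  have main: "capacity_gauge p \<D> (H_avg p \<phi> a \<rho>) \<le> ennreal \<epsilon>"
    if \<rho>: "1 - 1 / 2 ^ n \<le> \<rho>" and a: "a \<in> disc" and D: "dyadic_system \<D>" for \<rho> a \<D>
  proof (rule gauge_le_dual[OF D p(1) _ \<epsilon>(2)])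
    let ?M = "pull_measure p \<phi> a"
    have le: "H_avg p \<phi> a \<rho> I \<le> ennreal (arc_len I powr (-2 - p)) * emeasure ?M (Q_up I)" if I: "I \<in> \<D>" for I
    proof -
      have L: "0 < arc_len I" using dyadic_arc[OF D I] by simp
      have "H_avg p \<phi> a \<rho> I \<le> emeasure ?M (Q_up I) / ennreal (arc_len I powr (p + 2))"
        unfolding H_avg_eq[OF D I hol maps]
            by (intro divide_right_mono_ennreal emeasure_mono) (use Q_up_borel[OF D I] in auto)
      also have "\<dots> = inverse (ennreal (arc_len I powr (p + 2))) * emeasure ?M (Q_up I)"
        by (simp add: divide_ennreal_def mult.commute)
      also have "inverse (ennreal (arc_len I powr (p + 2))) = ennreal (arc_len I powr (-2 - p))"
      proof -
        have "inverse (ennreal (arc_len I powr (p + 2))) = ennreal (inverse (arc_len I powr (p + 2)))"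
          using L by (intro inverse_ennreal) simp
        also have "inverse (arc_len I powr (p + 2)) = arc_len I powr (- (p + 2))"
            by (rule powr_minus[symmetric])
        also have "- (p + 2) = -2 - p" by simp
        finally show ?thesis .
      qed
      finally show ?thesis .
    qed
    show "H_avg p \<phi> a \<rho> I < \<infinity>" if I: "I \<in> \<D>" for I
    proof -
      have "emeasure ?M (Q_up I) \<le> emeasure ?M UNIV" by (intro emeasure_mono) auto
      also have "\<dots> \<le> K" using K(2) a by blast
      finally have "emeasure ?M (Q_up I) < \<infinity>" using K(1) by (rule le_less_trans)
      then have "ennreal (arc_len I powr (-2 - p)) * emeasure ?M (Q_up I) < \<infinity>"
          by (simp add: ennreal_mult_less_top)
      then show ?thesis using le[OF I] by (rule le_less_trans[rotated])
    qed
    fix E x assume x: "dyadic_carleson p \<D> E x" and E: "E \<subseteq> {I\<in>\<D>. H_avg p \<phi> a \<rho> I \<noteq> 0}"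
    have x0: "\<And>I. 0 \<le> x I" using x by (auto simp: dyadic_carleson_def)
    have deep: "E \<subseteq> (\<Union>k\<in>{n..}. dyadic_level \<D> k)"
    proof
      fix I assume "I \<in> E"
      then have I: "I \<in> \<D>" "H_avg p \<phi> a \<rho> I \<noteq> 0" using E by auto
      obtain k where k: "I \<in> dyadic_level \<D> k" using dyadic_mem[OF D I(1)] .
      have "n \<le> k" using H_avg_coarse_eq_0[OF D k hol maps _ \<rho>] I(2) by (meson not_le)
      then show "I \<in> (\<Union>k\<in>{n..}. dyadic_level \<D> k)" using k by auto
    qed
    have "(\<Sum>I\<in>E. H_avg p \<phi> a \<rho> I * ennreal (x I))
        \<le> (\<Sum>I\<in>E. ennreal (x I * arc_len I powr (-2 - p)) * emeasure ?M (Q_up I))"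
    proof (rule sum_mono)
      fix I assume "I \<in> E"
      then have I: "I \<in> \<D>" using E by auto
      have "H_avg p \<phi> a \<rho> I * ennreal (x I)
          \<le> (ennreal (arc_len I powr (-2 - p)) * emeasure ?M (Q_up I)) * ennreal (x I)"
        by (rule mult_right_mono[OF le[OF I]]) simp
      also have "\<dots> = ennreal (x I * arc_len I powr (-2 - p)) * emeasure ?M (Q_up I)"
        using x0 by (simp add: ennreal_mult mult_ac)
      finally show "H_avg p \<phi> a \<rho> I * ennreal (x I)
          \<le> ennreal (x I * arc_len I powr (-2 - p)) * emeasure ?M (Q_up I)" .
    qed
    also have "\<dots> \<le> ennreal \<epsilon>" using n a D x deep by blast
    finally show "(\<Sum>I\<in>E. H_avg p \<phi> a \<rho> I * ennreal (x I)) \<le> ennreal \<epsilon>" .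
  qed
  have "eventually (\<lambda>\<rho>. \<rho> \<in> {1 - 1 / 2 ^ n<..<1::real}) (at_left 1)" by (rule eventually_at_left_real) simp
  then show "eventually (\<lambda>\<rho>. worst_gauge p \<phi> \<rho> < e) (at_left 1)"
  proof eventually_elim
    case (elim \<rho>)
    have "worst_gauge p \<phi> \<rho> \<le> ennreal \<epsilon>"
      by (intro SUP_least main) (use elim in auto)
    then show ?case using e'(2) \<epsilon>(1) by (simp add: le_less_trans)
  qed
qed (simp add: not_less_zero)

section \<open>Characterization of compactness\<close>

theorem theorem1p7:
  fixes p :: real and \<phi> :: "complex \<Rightarrow> complex"
  assumes "0 < p" and "p \<le> 1"
    and "\<phi> holomorphic_on disc" and "\<phi> ` disc \<subseteq> disc"
  shows "Qp_compact_operator p (comp_operator \<phi>) \<longleftrightarrow>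
    Qp_bounded_operator p (comp_operator \<phi>) \<and>
    ((\<lambda>\<rho>. SUP a\<in>disc. SUP \<D>\<in>{\<D>. dyadic_system \<D>}. capacity_gauge p \<D> (H_avg p \<phi> a \<rho>))
      \<longlongrightarrow> 0) (at_left 1)"
proof (intro iffI conjI)
  assume T: "Qp_compact_operator p (comp_operator \<phi>)"
  show "Qp_bounded_operator p (comp_operator \<phi>)"
    by (rule compact_imp_bounded_operator[OF assms(1,2) T])
  show "((\<lambda>\<rho>. worst_gauge p \<phi> \<rho>) \<longlongrightarrow> 0) (at_left 1)"
    by (rule compact_imp_gauge_small[OF assms(1,2) T assms(3,4)])
next
  assume *: "Qp_bounded_operator p (comp_operator \<phi>) \<and> ((\<lambda>\<rho>. worst_gauge p \<phi> \<rho>) \<longlongrightarrow> 0) (at_left 1)"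
  then have im: "comp_operator \<phi> ` Qp p \<subseteq> Qp p" by (simp add: Qp_bounded_operator_def)
  show "Qp_compact_operator p (comp_operator \<phi>)"
    by (rule null_sequence_imp_compact[OF assms(1,2) im])
      (rule gauge_small_imp_norm_small[OF assms im conjunct2[OF *]])
qed

end
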